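(* Let $H$, $Q$, $(e_j)$, $(q_j)$, $W$, $(\mathcal{F}_t)$, $\|\cdot\|_Q$, $K_R(a)$ and $\mathcal{V}_\infty(H)$ be as in the context. Let $F\colon H\to H$ be a function, $A$ a linear (possibly unbounded) operator in $H$ with domain $D(A)$, $\eta$ an $H$-valued random variable, and $T>0$. Consider the stochastic equation $$dX_t=dW_t+(AX_t+F(X_t))\,dt,\qquad X_0=\eta,$$ and the Cauchy problem $$\partial_t\mu_t=\tfrac12\sum_i q_i\,\partial^2_{e_ie_i}\mu_t-\sum_i\partial_{e_i}(b^i\mu_t),\qquad \mu_0=\mathrm{Law}(\eta),\qquad b^i=\langle B,e_i\rangle,\quad B(x)=Ax+F(x).$$ Assume: (i) $\eta$ is independent of $(W_t)_{t\ge0}$ and $\eta\in\mathcal{V}_\infty(H)$; (ii) $F$ is bounded: $\sup_{x\in H}\|F(x)\|<+\infty$; (iii') the Cauchy problem has a unique probability solution, and the stochastic equation has a variational solution $(X_t)_{t\in[0,T]}$ with $\mathbb{E}\sup_{t\in[0,T]}\|X_t\|^2<+\infty$; (iv) $D(A)$ is dense in $H$, and $A$ is self-adjoint and negative, i.e. $\langle Ax,x\rangle\le-\varepsilon\|x\|^2$ for some $\varepsilon>0$ and all $x\in D(A)$. Then, for any initial condition $\eta\in\mathcal{V}_\infty(H)$ and for every $t\in(0,T]$, the solution of the Cauchy problem is strictly positive on each ellipsoid $K_R(a)$ ($a\in H$, $R>0$): $$\mu_t(K_R(a))>0,\quad\text{or, equivalently,}\quad \mathbb{P}(X_t\in K_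R(a))>0.$$
   Context: $H$ is a separable real Hilbert space with inner product $\langle\cdot,\cdot\rangle$, norm $\|\cdot\|$ and Borel $\sigma$-field $\mathcal{B}(H)$. $Q\colon H\to H$ is a positive self-adjoint operator with finite trace, with orthonormal eigenvectors $(e_j)_{j\ge1}$ and eigenvalues $1=q_1\ge q_2\ge\dots>0$, $\mathrm{tr}\,Q=\sum_{j\ge1}q_j<\infty$. $(W_t)_{t\ge0}$ is an $H$-valued Wiener process with covariance operator $Q$ on a probability space $(\Omega,\mathcal{F},\mathbb{P})$, i.e. $W_t=\sum_{j\ge1}\sqrt{q_j}\,\beta^j_t e_j$ with independent standard real Wiener processes $\beta^j$; $(\mathcal{F}_t)_{t\ge0}$ is the filtration generated by $W$. The weighted norm is $\|x\|_Q=\langle Qx,x\rangle^{1/2}=\bigl(\sum_j q_j\langle x,e_j\rangle^2\bigr)^{1/2}$, and the ellipsoid is $K_R(a)=\{x\in H:\|x-a\|_Q\le R\}$. $\mathcal{V}_\infty(H)$ is the set of $H$-valued random variables with finite moments of all orders. $\mathcal{FC}_0^\infty(H)$ is the class of functions $\phi(x)=\phi_0(x_1,\dots,x_m)$, $x_j=\langle x,e_j\rangle$, with some $m\in\mathbb{N}$ and $\phi_0$ infinitely smooth with compact support in $\mathbb{R}^m$. Variational solution: let $V=D((-A)^{1/2})$ with the graph norm of $(-A)^{1/2}$ and let $V^*$ be its dual, so that $V\subset H\subset V^*$ is a Gelfand triple (continuous dense embeddings). $A$ also denotes its Friedrichs extension $A\colon V\to V^*$, and $B(\cdot)=A+F(\cdot)\colon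 V\to V^*$. A continuous $H$-valued $\mathcal{F}_t$-adapted process $(X_t)_{t\in[0,T]}$ is a variational solution if its $dt\times\mathbb{P}$-equivalence class $\hat X$ belongs to $L^2([0,T]\times\Omega,dt\times\mathbb{P};V)\cap L^2([0,T]\times\Omega,dt\times\mathbb{P};H)$ and $\mathbb{P}$-a.s. $X_t=\eta+W_t+\int_0^tB(\bar X_s)\,ds$ for $t\in[0,T]$, where $\bar X$ is any $\mathcal{F}_t$-adapted $V$-valued $dt\times\mathbb{P}$-version of $\hat X$. A (probability) solution of the Cauchy problem with $\mu_0=\nu$ is a family $(\mu_t)_{t\ge0}$ of probability measures on $(H,\mathcal{B}(H))$ such that for all $t\ge0$ and all $\phi\in\mathcal{FC}_0^\infty(H)$, $\int\phi\,d\mu_t-\int\phi\,d\nu=\int_0^t\int\mathcal{L}\phi\,d\mu_s\,ds$, where $\mathcal{L}\phi=\sum_{i\ge1}\tfrac12q_i\,\partial^2_{e_ie_i}\phi+\sum_{i\ge1}b^i\,\partial_{e_i}\phi$. The distributions $\mathrm{Law}(X_t)$ of the process solve this Cauchy problem with $\nu=\mathrm{Law}(\eta)$, so $\mu_t=\mathrm{Law}(X_t)$.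
   Formalization: The Cauchy problem and the uniqueness of its solution are taken on the time interval [0,T] of the process rather than for all t ≥ 0, because Law(X_t) is undefined for t > T and so cannot be a solution on [0,∞). *)

theory Defs
  imports "HOL-Probability.Probability"
begin

section \<open>Unbounded operators\<close>

text \<open>
  An unbounded operator is a pair of a domain \<open>D\<close> and a function \<open>A\<close>, whose values outside \<open>D\<close>
  are irrelevant.
\<close>

definition linear_operator :: "'a::real_inner set \<Rightarrow> ('a \<Rightarrow> 'a) \<Rightarrow> bool" where
  "linear_operator D A \<longleftrightarrow> subspace D \<and>
     (\<forall>x\<in>D. \<forall>y\<in>D. A (x + y) = A x + A y) \<and> (\<forall>c. \<forall>x\<in>D. A (c *\<^sub>R x) = c *\<^sub>R A x)"

definition adjoint_domain :: "'a::real_inner set \<Rightarrow> ('a \<Rightarrow> 'a) \<Rightarrow> 'a set" where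
  "adjoint_domain D A = {y. \<exists>z. \<forall>x\<in>D. A x \<bullet> y = x \<bullet> z}"

definition selfadjoint_operator :: "'a::real_inner set \<Rightarrow> ('a \<Rightarrow> 'a) \<Rightarrow> bool" where
  "selfadjoint_operator D A \<longleftrightarrow> linear_operator D A \<and> closure D = UNIV \<and>
     adjoint_domain D A = D \<and> (\<forall>x\<in>D. \<forall>y\<in>D. A x \<bullet> y = x \<bullet> A y)"

text \<open>
  \<open>(V, S)\<close> is the operator $(-A)^{1/2}$ with its domain: the (unique) nonnegative self-adjoint
  operator with $S^2 = -A$, including equality of the domains.
\<close>

definition sqrt_of_minus :: "'a::real_inner set \<Rightarrow> ('a \<Rightarrow> 'a) \<Rightarrow> 'a set \<Rightarrow> ('a \<Rightarrow> 'a) \<Rightarrow> bool" where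
  "sqrt_of_minus D A V S \<longleftrightarrow> selfadjoint_operator V S \<and> (\<forall>x\<in>V. 0 \<le> S x \<bullet> x) \<and>
     D = {x \<in> V. S x \<in> V} \<and> (\<forall>x\<in>D. S (S x) = - A x)"

section \<open>The covariance operator\<close>

definition covariance_operator ::
  "('a::real_inner \<Rightarrow> 'a) \<Rightarrow> (nat \<Rightarrow> 'a) \<Rightarrow> (nat \<Rightarrow> real) \<Rightarrow> bool" where
  "covariance_operator Q e q \<longleftrightarrow>
     bounded_linear Q \<and> (\<forall>x y. Q x \<bullet> y = x \<bullet> Q y) \<and> (\<forall>x. x \<noteq> 0 \<longrightarrow> 0 < Q x \<bullet> x) \<and>
     (\<forall>i j. e i \<bullet> e j = (if i = j then 1 else 0)) \<and> closure (span (range e)) = UNIV \<and>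
     (\<forall>j. Q (e j) = q j *\<^sub>R e j) \<and> q 0 = 1 \<and> decseq q \<and> (\<forall>j. 0 < q j) \<and> summable q"

definition Q_norm :: "('a::real_inner \<Rightarrow> 'a) \<Rightarrow> 'a \<Rightarrow> real" where
  "Q_norm Q x = sqrt (Q x \<bullet> x)"

definition ellipsoid :: "('a::real_inner \<Rightarrow> 'a) \<Rightarrow> 'a \<Rightarrow> real \<Rightarrow> 'a set" where
  "ellipsoid Q a R = {x. Q_norm Q (x - a) \<le> R}"

section \<open>Wiener processes\<close>

definition standard_wiener_process :: "'w measure \<Rightarrow> (real \<Rightarrow> 'w \<Rightarrow> real) \<Rightarrow> bool" where
  "standard_wiener_process M \<beta> \<longleftrightarrow>
     (\<forall>t\<ge>0. \<beta> t \<in> borel_measurable M) \<and>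
     (AE \<omega> in M. \<beta> 0 \<omega> = 0) \<and>
     (AE \<omega> in M. continuous_on {0..} (\<lambda>t. \<beta> t \<omega>)) \<and>
     (\<forall>s\<ge>0. \<forall>t>s. distributed M lborel (\<lambda>\<omega>. \<beta> t \<omega> - \<beta> s \<omega>) (normal_density 0 (sqrt (t - s)))) \<and>
     (\<forall>n. \<forall>\<tau> :: nat \<Rightarrow> real. 0 \<le> \<tau> 0 \<and> mono \<tau> \<longrightarrow>
        prob_space.indep_vars M (\<lambda>_. borel) (\<lambda>i \<omega>. \<beta> (\<tau> (Suc i)) \<omega> - \<beta> (\<tau> i) \<omega>) {..<n})"

text \<open>The random element of the path space with index set \<open>{0..}\<close> that is given by a process.\<close>

definition trajectory :: "(real \<Rightarrow> 'w \<Rightarrow> 'b) \<Rightarrow> 'w \<Rightarrow> real \<Rightarrow> 'b" where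
  "trajectory Z \<omega> = restrict (\<lambda>t. Z t \<omega>) {0..}"

abbreviation trajectory_space :: "(real \<Rightarrow> 'b::topological_space) measure" where
  "trajectory_space \<equiv> PiM {0..} (\<lambda>_. borel)"

definition wiener_process ::
  "'w measure \<Rightarrow> (nat \<Rightarrow> 'a) \<Rightarrow> (nat \<Rightarrow> real) \<Rightarrow>
   (real \<Rightarrow> 'w \<Rightarrow> 'a::{real_inner, banach, second_countable_topology}) \<Rightarrow> bool" where
  "wiener_process M e q W \<longleftrightarrow>
     (\<forall>t\<ge>0. W t \<in> borel_measurable M) \<and>
     (AE \<omega> in M. continuous_on {0..} (\<lambda>t. W t \<omega>)) \<and>
     (\<exists>\<beta> :: nat \<Rightarrow> real \<Rightarrow> 'w \<Rightarrow> real.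
        (\<forall>j. standard_wiener_process M (\<beta> j)) \<and>
        prob_space.indep_vars M (\<lambda>_. trajectory_space) (\<lambda>j. trajectory (\<beta> j)) UNIV \<and>
        (\<forall>t\<ge>0. AE \<omega> in M. (\<lambda>j. (sqrt (q j) * \<beta> j t \<omega>) *\<^sub>R e j) sums W t \<omega>))"

text \<open>
  The filtration is generated by \<open>W\<close> together with the initial value \<open>\<eta>\<close> and the null events.
  Without \<open>\<eta>\<close>, adaptedness at time 0 together with independence of \<open>\<eta>\<close> and \<open>W\<close> would force
  \<open>\<eta>\<close> to be almost surely constant. Processes adapted to the filtration of \<open>W\<close> alone are adapted.
\<close>

definition filtration ::
  "'w measure \<Rightarrow> ('w \<Rightarrow> 'a::topological_space) \<Rightarrow> (real \<Rightarrow> 'w \<Rightarrow> 'a) \<Rightarrow> real \<Rightarrow> 'w measure" where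
  "filtration M \<eta> W t = sigma (space M)
     ({\<eta> -` U \<inter> space M | U. U \<in> sets borel} \<union>
      {W s -` U \<inter> space M | s U. 0 \<le> s \<and> s \<le> t \<and> U \<in> sets borel} \<union> null_sets M)"

definition finite_moments :: "'w measure \<Rightarrow> ('w \<Rightarrow> 'a::real_normed_vector) \<Rightarrow> bool" where
  "finite_moments M \<eta> \<longleftrightarrow> \<eta> \<in> borel_measurable M \<and> (\<forall>p::nat. integrable M (\<lambda>\<omega>. norm (\<eta> \<omega>) ^ p))"

section \<open>Variational solutions\<close>

text \<open>
  For \<open>S\<close> the square root of $-A$ and \<open>V\<close> its domain, elements of $V^*$ are represented by their
  values on \<open>V\<close>; an element \<open>h\<close> of \<open>H\<close> is embedded as \<open>\<lambda>v. h \<bullet> v\<close>. The extension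
  $A \colon V \to V^*$ is $\langle Ax, v\rangle = -\langle Sx, Sv\rangle$, and \<open>drift S F x\<close> is the
  element $B(x) = Ax + F(x)$ of $V^*$, for \<open>x\<close> in \<open>V\<close>.
\<close>

definition drift :: "('a::real_inner \<Rightarrow> 'a) \<Rightarrow> ('a \<Rightarrow> 'a) \<Rightarrow> 'a \<Rightarrow> 'a \<Rightarrow> real" where
  "drift S F x v = - (S x \<bullet> S v) + F x \<bullet> v"

text \<open>
  \<open>Y\<close> is an adapted \<open>V\<close>-valued version of \<open>X\<close>. The graph norm makes \<open>x \<mapsto> (x, S x)\<close> an isometric
  embedding of \<open>V\<close> into $H \times H$, so measurability in \<open>V\<close> is measurability of \<open>Y\<close> and \<open>S Y\<close>.
\<close>

definition V_version ::
  "'w measure \<Rightarrow> (real \<Rightarrow> 'w measure) \<Rightarrow> 'a set \<Rightarrow> ('a \<Rightarrow> 'a) \<Rightarrow> real \<Rightarrow>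
   (real \<Rightarrow> 'w \<Rightarrow> 'a) \<Rightarrow> (real \<Rightarrow> 'w \<Rightarrow> 'a::{real_inner, banach, second_countable_topology}) \<Rightarrow> bool" where
  "V_version M \<F> V S T X Y \<longleftrightarrow>
     (\<forall>t\<in>{0..T}. \<forall>\<omega>\<in>space M. Y t \<omega> \<in> V) \<and>
     (\<forall>t\<in>{0..T}. Y t \<in> borel_measurable (\<F> t) \<and> (\<lambda>\<omega>. S (Y t \<omega>)) \<in> borel_measurable (\<F> t)) \<and>
     (\<lambda>(t, \<omega>). Y t \<omega>) \<in> borel_measurable (restrict_space lborel {0..T} \<Otimes>\<^sub>M M) \<and>
     (\<lambda>(t, \<omega>). S (Y t \<omega>)) \<in> borel_measurable (restrict_space lborel {0..T} \<Otimes>\<^sub>M M) \<and>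
     (AE (t, \<omega>) in restrict_space lborel {0..T} \<Otimes>\<^sub>M M. Y t \<omega> = X t \<omega>)"

text \<open>
  The integrability condition is square integrability of the graph norm; it contains square
  integrability in \<open>H\<close>. The equation, an identity in $V^*$, is tested against every \<open>v\<close> in \<open>V\<close>;
  this determines the $V^*$-valued integral, since \<open>V\<close> is a separable Hilbert space. Two versions
  \<open>Y\<close> agree \<open>ds\<close>-almost everywhere for almost every \<open>\<omega>\<close>, so the choice of \<open>Y\<close> does not matter.
\<close>

definition variational_solution ::
  "'w measure \<Rightarrow> ('w \<Rightarrow> 'a) \<Rightarrow> (real \<Rightarrow> 'w \<Rightarrow> 'a) \<Rightarrow> 'a set \<Rightarrow> ('a \<Rightarrow> 'a) \<Rightarrow> ('a \<Rightarrow> 'a) \<Rightarrow> real \<Rightarrow>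
   (real \<Rightarrow> 'w \<Rightarrow> 'a::{real_inner, banach, second_countable_topology}) \<Rightarrow> bool" where
  "variational_solution M \<eta> W V S F T X \<longleftrightarrow>
     (\<forall>\<omega>\<in>space M. continuous_on {0..T} (\<lambda>t. X t \<omega>)) \<and>
     (\<forall>t\<in>{0..T}. X t \<in> borel_measurable (filtration M \<eta> W t)) \<and>
     (\<exists>Y. V_version M (filtration M \<eta> W) V S T X Y \<and>
        integrable (restrict_space lborel {0..T} \<Otimes>\<^sub>M M)
          (\<lambda>(t, \<omega>). (norm (Y t \<omega>))\<^sup>2 + (norm (S (Y t \<omega>)))\<^sup>2) \<and>
        (AE \<omega> in M. \<forall>t\<in>{0..T}. \<forall>v\<in>V.
           set_integrable lborel {0..t} (\<lambda>s. drift S F (Y s \<omega>) v) \<and>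
           X t \<omega> \<bullet> v = \<eta> \<omega> \<bullet> v + W t \<omega> \<bullet> v + (LINT s:{0..t}|lborel. drift S F (Y s \<omega>) v)))"

section \<open>Smooth cylindrical functions and the Cauchy problem\<close>

text \<open>
  A function on $\mathbb{R}^m$ is represented by a function of a sequence that depends only on the
  entries with index below \<open>m\<close>; sequences carry the product topology.
\<close>

definition partial :: "nat \<Rightarrow> ((nat \<Rightarrow> real) \<Rightarrow> real) \<Rightarrow> (nat \<Rightarrow> real) \<Rightarrow> real" where
  "partial i f x = deriv (\<lambda>t. f (x(i := t))) (x i)"

definition smooth_compact_support :: "nat \<Rightarrow> ((nat \<Rightarrow> real) \<Rightarrow> real) \<Rightarrow> bool" where
  "smooth_compact_support m f \<longleftrightarrow>
     (\<forall>x y. (\<forall>i<m. x i = y i) \<longrightarrow> f x = f y) \<and>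
     (\<exists>r. \<forall>x. (\<exists>i<m. \<bar>x i\<bar> > r) \<longrightarrow> f x = 0) \<and>
     (\<forall>is \<in> lists {..<m}. continuous_on UNIV (foldr partial is f) \<and>
        (\<forall>i<m. \<forall>x. (\<lambda>t. foldr partial is f (x(i := t))) differentiable (at (x i))))"

definition FC0_infinity :: "(nat \<Rightarrow> 'a::real_inner) \<Rightarrow> ('a \<Rightarrow> real) set" where
  "FC0_infinity e =
     {\<phi>. \<exists>m \<phi>0. 0 < m \<and> smooth_compact_support m \<phi>0 \<and> \<phi> = (\<lambda>x. \<phi>0 (\<lambda>j. x \<bullet> e j))}"

definition dir_deriv :: "'a::real_vector \<Rightarrow> ('a \<Rightarrow> real) \<Rightarrow> 'a \<Rightarrow> real" where
  "dir_deriv v \<phi> x = deriv (\<lambda>t. \<phi> (x + t *\<^sub>R v)) 0"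

text \<open>
  Here $b^i(x) = \langle B(x), e_i\rangle$ is \<open>drift S F x (e i)\<close>. On \<open>FC0_infinity e\<close> both sums have
  only finitely many nonzero terms.
\<close>

definition generator ::
  "(nat \<Rightarrow> 'a::real_inner) \<Rightarrow> (nat \<Rightarrow> real) \<Rightarrow> ('a \<Rightarrow> 'a) \<Rightarrow> ('a \<Rightarrow> 'a) \<Rightarrow> ('a \<Rightarrow> real) \<Rightarrow> 'a \<Rightarrow> real" where
  "generator e q S F \<phi> x =
     (\<Sum>i. 1/2 * q i * dir_deriv (e i) (dir_deriv (e i) \<phi>) x) +
     (\<Sum>i. drift S F x (e i) * dir_deriv (e i) \<phi> x)"

text \<open>
  Solutions on a time interval \<open>I\<close> starting at 0. With \<open>I = {0..}\<close> this is the notion for all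
  $t \ge 0$; with \<open>I = {0..T}\<close> the problem has the same horizon as the process $(X_t)_{t \in [0,T]}$,
  so that its uniqueness identifies \<open>\<mu> t\<close> with the law of $X_t$. As \<open>B\<close> maps \<open>V\<close> to $V^*$, the coefficients
  $b^i(x)$ are defined only for \<open>x\<close> in \<open>V\<close> and $e_i$ in \<open>V\<close>, so the equation is meaningful
  only if all $e_i$ are in \<open>V\<close> and \<open>\<mu> s\<close> is concentrated on \<open>V\<close> for almost every \<open>s\<close>.
\<close>

definition cauchy_solution ::
  "(nat \<Rightarrow> 'a) \<Rightarrow> (nat \<Rightarrow> real) \<Rightarrow> 'a set \<Rightarrow> ('a \<Rightarrow> 'a) \<Rightarrow> ('a \<Rightarrow> 'a) \<Rightarrow> real set \<Rightarrow>
   'a measure \<Rightarrow> (real \<Rightarrow> 'a::{real_inner, banach, second_countable_topology} measure) \<Rightarrow> bool" where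
  "cauchy_solution e q V S F I \<nu> \<mu> \<longleftrightarrow>
     (\<forall>t\<in>I. prob_space (\<mu> t) \<and> sets (\<mu> t) = sets borel) \<and>
     (\<forall>i. e i \<in> V) \<and> (AE s in lborel. s \<in> I \<longrightarrow> (AE x in \<mu> s. x \<in> V)) \<and>
     (\<forall>t\<in>I. \<forall>\<phi>\<in>FC0_infinity e.
        (AE s in lborel. s \<in> {0..t} \<longrightarrow> set_integrable (\<mu> s) V (generator e q S F \<phi>)) \<and>
        set_integrable lborel {0..t} (\<lambda>s. LINT x:V|\<mu> s. generator e q S F \<phi> x) \<and>
        (LINT x|\<mu> t. \<phi> x) - (LINT x|\<nu>. \<phi> x) =
          (LINT s:{0..t}|lborel. (LINT x:V|\<mu> s. generator e q S F \<phi> x)))"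

definition unique_cauchy_solution ::
  "(nat \<Rightarrow> 'a) \<Rightarrow> (nat \<Rightarrow> real) \<Rightarrow> 'a set \<Rightarrow> ('a \<Rightarrow> 'a) \<Rightarrow> ('a \<Rightarrow> 'a) \<Rightarrow> real set \<Rightarrow>
   'a measure \<Rightarrow> (real \<Rightarrow> 'a::{real_inner, banach, second_countable_topology} measure) \<Rightarrow> bool" where
  "unique_cauchy_solution e q V S F I \<nu> \<mu> \<longleftrightarrow> cauchy_solution e q V S F I \<nu> \<mu> \<and>
     (\<forall>\<mu>'. cauchy_solution e q V S F I \<nu> \<mu>' \<longrightarrow> (\<forall>t\<in>I. \<mu>' t = \<mu> t))"

end

theory Submission
  imports Defs
begin

text \<open>
  The law of $X_t$ solves the Cauchy problem, so by uniqueness it is \<open>\<mu> t\<close>; since all $q_j \le 1$,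
  an ellipsoid contains a ball of the same radius, and it remains to show that $X_t$ lies in every ball with
  positive probability.

  The support of the law of $X_t$ is closed and nonempty, and it suffices that it is invariant under
  $x \mapsto x + c\,e_j$, because the span of the $e_j$ is dense. If $x$ is in the support, then by continuity
  of paths $X_{t-\delta}$ is close to $x$ with positive probability for small $\delta$. On $[t-\delta, t]$
  weight the probability by $\exp(\kappa g - \kappa^2\delta/2)$, where $g$ is the increment of the
  $j$-th standard coordinate of $W$; under the weighted probability the Wiener process gains the drift
  $\sqrt{q_j}\,\kappa\,e_j$, which carries $X$ to $x + c\,e_j$ in time $\delta$ when $\sqrt{q_j}\,\kappa\,\delta = c$.
  Comparing $X$ with a straight segment $y + (r - (t-\delta))\,z$ in \<open>DA\<close>, where $y$ and $\delta z$ approximate $x$ and $c\,e_j$,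
  the energy grows by $O(\delta)$ only, as \<open>A\<close> is dissipative and \<open>F\<close> bounded. No stochastic
  calculus is needed: the truncated energy of the resolvent-regularised process has increments bounded by
  $k h + O(h^{3/2})$ on intervals of length $h$, and the errors disappear under subdivision.
  The Cauchy problem for the law of $X_t$ is obtained in the same way from one-step expansions.
\<close>

section \<open>Self-adjoint operators and orthonormal bases\<close>

text \<open>\<open>X t\<close> need not lie in \<open>DA\<close>, and the equation holds only
  against vectors of \<open>V\<close>, so the energy of \<open>X t - y\<close> cannot be expanded
  directly. With the resolvent \<open>J = (I - l A)^(-1)\<close> and \<open>G = J^2\<close> the
  needed test vectors lie in \<open>DA\<close>; one \<open>J\<close> makes \<open>A\<close> bounded
  by \<open>2 / l\<close>, the other makes increments of \<open>X\<close> over time \<open>h\<close>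
  of order \<open>sqrt h\<close> in mean. The resulting constants blow up as \<open>l\<close> tends
  to 0, but they multiply \<open>h^(3/2)\<close> only and vanish under subdivision for fixed
  \<open>l\<close>; afterwards \<open>l\<close> is sent to 0. The energy is truncated at 1 because
  the second moments of the weight and of \<open>X\<close>, which are all that is known, do not
  control a weighted second moment of \<open>X\<close>. The event of closeness may have tiny
  probability, so the linear part of every bound has to carry that probability as a factor. For the
  Cauchy problem the obstacle is that the drift is only square integrable in time: errors are
  measured by the increments of an integral \<open>Psi\<close> instead of by \<open>h\<close>.
  Moreover \<open>F\<close> comes without measurability; that of the generator is read off the given
  solution.\<close>

lemma closed_subspace_orthogonal_vector:
  fixes R :: "'a::{real_inner, banach} set"
  assumes R: "subspace R" "closed R" and p: "p \<notin> R"
  obtains y where "y \<noteq> 0" "\<And>x. x \<in> R \<Longrightarrow> x \<bullet> y = 0"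
proof -
  have ne: "R \<noteq> {}" using R subspace_0 by auto
  define d where "d = infdist p R"
  have d0: "d \<ge> 0" by (simp add: d_def infdist_nonneg)
  have dle: "d \<le> norm (p - x)" if "x \<in> R" for x
    unfolding d_def using infdist_le[OF that] by (simp add: dist_norm)
  \<comment> \<open>A minimising sequence for the distance; the excess is measured on squared
    distances so that the parallelogram law applies directly.\<close>
  have "\<exists>x\<in>R. (norm (p - x))\<^sup>2 < d\<^sup>2 + 1 / real (Suc n)" for n
  proof -
    have "d < sqrt (d\<^sup>2 + 1 / real (Suc n))" using d0
      by (intro real_less_rsqrt) simp
    then obtain x where x: "x \<in> R" "dist p x < sqrt (d\<^sup>2 + 1 / real (Suc n))"
      using ne unfolding d_def infdist_notempty[OF ne] by (auto simp: cINF_less_iff)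
    have "(norm (p - x))\<^sup>2 < (sqrt (d\<^sup>2 + 1 / real (Suc n)))\<^sup>2"
      using x by (intro power_strict_mono) (auto simp: dist_norm)
    then show ?thesis using x by (auto simp: add_nonneg_nonneg)
  qed
  then obtain x where x: "\<And>n. x n \<in> R" "\<And>n. (norm (p - x n))\<^sup>2 < d\<^sup>2 + 1 / real (Suc n)"
    by metis
  \<comment> \<open>The parallelogram law for \<open>p - x n\<close> and \<open>p - x m\<close>: the
    midpoint lies in \<open>R\<close>, so its distance to \<open>p\<close> is at least
    \<open>d\<close>.\<close>
  have par: "(norm (x n - x m))\<^sup>2 \<le> 2 / real (Suc n) + 2 / real (Suc m)" for n m
  proof -
    have "(1/2) *\<^sub>R (x n + x m) \<in> R" using R x by (intro subspace_scale subspace_add)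
    from dle[OF this] have "d\<^sup>2 \<le> (norm (p - (1/2) *\<^sub>R (x n + x m)))\<^sup>2" using d0 by (intro power_mono)
    moreover have "(norm (x n - x m))\<^sup>2 = 2 * (norm (p - x n))\<^sup>2 + 2 * (norm (p - x m))\<^sup>2
        - 4 * (norm (p - (1/2) *\<^sub>R (x n + x m)))\<^sup>2"
      unfolding power2_norm_eq_inner
      by (simp add: inner_diff_left inner_diff_right inner_add_left inner_add_right inner_commute algebra_simps)
    ultimately show ?thesis using x(2)[of n] x(2)[of m] by auto
  qed
  have "Cauchy x"
  proof (rule metric_CauchyI)
    fix r :: real assume r: "r > 0"
    obtain N where N: "4 / r\<^sup>2 < real (Suc N)" by (meson less_SucI reals_Archimedean2 of_nat_less_iff order.strict_trans lessI)
    show "\<exists>N. \<forall>m\<ge>N. \<forall>n\<ge>N. dist (x m) (x n) < r"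
    proof (intro exI allI impI)
      fix m n assume mn: "m \<ge> N" "n \<ge> N"
      have "(norm (x m - x n))\<^sup>2 \<le> 2 / real (Suc N) + 2 / real (Suc N)"
        using par[of m n] mn by (intro order.trans[OF par] add_mono divide_left_mono) auto
      also have "\<dots> = 4 / real (Suc N)" by simp
      also have "\<dots> < r\<^sup>2" using N r by (simp add: field_simps)
      finally show "dist (x m) (x n) < r" using r by (simp add: dist_norm power2_less_imp_less)
    qed
  qed
  then obtain l where l: "x \<longlonglongrightarrow> l" using Cauchy_convergent convergent_def by blast
  have lR: "l \<in> R" using closed_sequentially[OF R(2)] x(1) l by blast
  have "(\<lambda>n. (norm (p - x n))\<^sup>2) \<longlonglongrightarrow> (norm (p - l))\<^sup>2" by (intro tendsto_intros l)
  moreover have "(\<lambda>n. d\<^sup>2 + 1 / real (Suc n)) \<longlonglongrightarrow> d\<^sup>2 + 0"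
    by (intro tendsto_intros LIMSEQ_Suc[OF lim_1_over_n])
  ultimately have le: "(norm (p - l))\<^sup>2 \<le> d\<^sup>2"
    using x(2) by (intro LIMSEQ_le[where X = "\<lambda>n. (norm (p - x n))\<^sup>2" and Y = "\<lambda>n. d\<^sup>2 + 1 / real (Suc n)"]) (auto intro: less_imp_le)
  have "v \<bullet> (p - l) = 0" if v: "v \<in> R" for v
  proof (cases "v = 0")
    case False
    \<comment> \<open>The coefficient of the projection of \<open>p - l\<close> onto
      \<open>v\<close>. Moving \<open>l\<close> by this multiple of \<open>v\<close> would lower the
      squared distance by \<open>(v \<bullet> (p - l))\<^sup>2 / (v \<bullet> v)\<close>, which
      minimality forbids unless it is 0.\<close>
    define c where "c = (v \<bullet> (p - l)) / (v \<bullet> v)"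
    have "l + c *\<^sub>R v \<in> R" using R lR v by (intro subspace_add subspace_scale)
    from dle[OF this] have "d\<^sup>2 \<le> (norm ((p - l) - c *\<^sub>R v))\<^sup>2" using d0
      by (intro power_mono) (auto simp: algebra_simps)
    also have "\<dots> = (norm (p - l))\<^sup>2 - 2 * c * (v \<bullet> (p - l)) + c\<^sup>2 * (v \<bullet> v)"
      unfolding power2_norm_eq_inner
      by (simp add: inner_diff_left inner_diff_right inner_commute power2_eq_square algebra_simps)
    also have "\<dots> = (norm (p - l))\<^sup>2 - (v \<bullet> (p - l))\<^sup>2 / (v \<bullet> v)"
      using False by (simp add: c_def power2_eq_square field_simps)
    finally have "(v \<bullet> (p - l))\<^sup>2 / (v \<bullet> v) \<le> 0" using le by linarith
    then show ?thesis using False by (simp add: divide_le_0_iff not_less)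
      (metis inner_ge_zero inner_eq_zero_iff order_antisym power2_eq_square power_eq_0_iff zero_le_power2 pos2)
  qed simp
  moreover have "p - l \<noteq> 0" using p lR by auto
  ultimately show thesis using that by blast
qed

text \<open>Since \<open>A\<close> is dissipative, pairing \<open>x - l A x\<close> with
  \<open>x\<close> shows that norms do not decrease, so convergent images have Cauchy preimages.
  That the limit of the preimages stays in \<open>D\<close> is the closedness of an adjoint
  operator.\<close>

lemma selfadjoint_range_closed:
  fixes A :: "'a::{real_inner, banach} \<Rightarrow> 'a"
  assumes sa: "selfadjoint_operator D A" and neg: "\<And>x. x \<in> D \<Longrightarrow> A x \<bullet> x \<le> 0" and l: "l > 0"
  shows "closed ((\<lambda>x. x - l *\<^sub>R A x) ` D)" and "x \<in> D \<Longrightarrow> norm x \<le> norm (x - l *\<^sub>R A x)"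
proof -
  have sub: "subspace D" and lin: "\<And>x y. x \<in> D \<Longrightarrow> y \<in> D \<Longrightarrow> A (x + y) = A x + A y"
    "\<And>c x. x \<in> D \<Longrightarrow> A (c *\<^sub>R x) = c *\<^sub>R A x" and dense: "closure D = UNIV"
    and adj: "adjoint_domain D A = D" and sym: "\<And>x y. x \<in> D \<Longrightarrow> y \<in> D \<Longrightarrow> A x \<bullet> y = x \<bullet> A y"
    using sa unfolding selfadjoint_operator_def linear_operator_def by auto
  have diff: "A (x - y) = A x - A y" if "x \<in> D" "y \<in> D" for x y
    using lin(1)[OF that(1), of "(-1) *\<^sub>R y"] lin(2)[OF that(2), of "-1"] that sub by (simp add: subspace_neg)
  have bd: "norm x \<le> norm (x - l *\<^sub>R A x)" if x: "x \<in> D" for x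
  proof (cases "x = 0")
    case False
    have "(norm x)\<^sup>2 \<le> (x - l *\<^sub>R A x) \<bullet> x" using neg[OF x] l
      by (simp add: power2_norm_eq_inner inner_diff_left mult_nonneg_nonpos)
    also have "\<dots> \<le> norm (x - l *\<^sub>R A x) * norm x" by (rule norm_cauchy_schwarz)
    finally show ?thesis using False by (simp add: power2_eq_square)
  qed simp
  then show "x \<in> D \<Longrightarrow> norm x \<le> norm (x - l *\<^sub>R A x)" .
  show "closed ((\<lambda>x. x - l *\<^sub>R A x) ` D)"
    unfolding closed_sequential_limits
  proof (intro allI impI, elim conjE)
    fix y yl assume "\<forall>n. y n \<in> (\<lambda>x. x - l *\<^sub>R A x) ` D" and yl: "y \<longlonglongrightarrow> yl"
    then obtain x where x: "\<And>n. x n \<in> D" "\<And>n. y n = x n - l *\<^sub>R A (x n)"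
      unfolding image_iff by metis
    have "Cauchy x"
    proof (rule metric_CauchyI)
      fix r :: real assume "r > 0"
      then obtain N where N: "\<forall>m\<ge>N. \<forall>n\<ge>N. dist (y m) (y n) < r"
        using LIMSEQ_imp_Cauchy[OF yl] metric_CauchyD by blast
      have "dist (x m) (x n) \<le> dist (y m) (y n)" for m n
      proof -
        have "(x m - x n) - l *\<^sub>R A (x m - x n) = y m - y n"
          unfolding diff[OF x(1) x(1)] x(2) by (simp add: scaleR_diff_right)
        then show ?thesis using bd[of "x m - x n"] x(1) sub by (simp add: dist_norm subspace_diff)
      qed
      then show "\<exists>N. \<forall>m\<ge>N. \<forall>n\<ge>N. dist (x m) (x n) < r" using N
        by (meson order.strict_trans1)
    qed
    then obtain xl where xl: "x \<longlonglongrightarrow> xl" using Cauchy_convergent convergent_def by blast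
    have Ax: "(\<lambda>n. A (x n)) \<longlonglongrightarrow> (1/l) *\<^sub>R (xl - yl)"
    proof -
      have "(\<lambda>n. (1/l) *\<^sub>R (x n - y n)) \<longlonglongrightarrow> (1/l) *\<^sub>R (xl - yl)" by (intro tendsto_intros xl yl)
      then show ?thesis using x(2) l by simp
    qed
    \<comment> \<open>Symmetry and the limit of \<open>A (x n)\<close> exhibit \<open>xl\<close> as
      an element of the adjoint domain, which is \<open>D\<close>.\<close>
    have eq: "A u \<bullet> xl = u \<bullet> ((1/l) *\<^sub>R (xl - yl))" if u: "u \<in> D" for u
    proof -
      have "(\<lambda>n. A u \<bullet> x n) \<longlonglongrightarrow> A u \<bullet> xl" by (intro tendsto_intros xl)
      moreover have "(\<lambda>n. u \<bullet> A (x n)) \<longlonglongrightarrow> u \<bullet> ((1/l) *\<^sub>R (xl - yl))" by (intro tendsto_intros Ax)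
      ultimately show ?thesis using sym[OF u x(1)] by (simp add: LIMSEQ_unique)
    qed
    then have xD: "xl \<in> D" using adj unfolding adjoint_domain_def by blast
    \<comment> \<open>The difference of the two candidates for \<open>A xl\<close> is orthogonal to
      the dense set \<open>D\<close>, hence 0.\<close>
    have "u \<bullet> (A xl - (1/l) *\<^sub>R (xl - yl)) = 0" if u: "u \<in> D" for u
      using eq[OF u] sym[OF u xD] by (simp add: inner_diff_right)
    moreover have "A xl - (1/l) *\<^sub>R (xl - yl) \<in> closure D" using dense by simp
    then obtain w where w: "\<And>n. w n \<in> D" "w \<longlonglongrightarrow> A xl - (1/l) *\<^sub>R (xl - yl)"
      unfolding closure_sequential by blast
    moreover have "(\<lambda>n. w n \<bullet> (A xl - (1/l) *\<^sub>R (xl - yl))) \<longlonglongrightarrow> (A xl - (1/l) *\<^sub>R (xl - yl)) \<bullet> (A xl - (1/l) *\<^sub>R (xl - yl))"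
      by (intro tendsto_intros w)
    ultimately have "(\<lambda>n::nat. 0) \<longlonglongrightarrow> (A xl - (1/l) *\<^sub>R (xl - yl)) \<bullet> (A xl - (1/l) *\<^sub>R (xl - yl))" by simp
    then have "A xl = (1/l) *\<^sub>R (xl - yl)" by (simp add: LIMSEQ_const_iff)
    then have "yl = xl - l *\<^sub>R A xl" using l by simp
    then show "yl \<in> (\<lambda>x. x - l *\<^sub>R A x) ` D" using xD by blast
  qed
qed

text \<open>Surjectivity of \<open>I - l A\<close> is the point: the range is closed, and a vector
  orthogonal to it would lie in the adjoint domain \<open>D\<close> and be an eigenvector of
  \<open>A\<close> with the eigenvalue \<open>1 / l > 0\<close>, against dissipativity.
  \<open>J\<close> is the inverse and inherits linearity, contractivity and symmetry.\<close>

lemma selfadjoint_resolvent: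
  fixes A :: "'a::{real_inner, banach} \<Rightarrow> 'a"
  assumes sa: "selfadjoint_operator D A" and neg: "\<And>x. x \<in> D \<Longrightarrow> A x \<bullet> x \<le> 0" and l: "l > 0"
  obtains J where "linear J" "\<And>x. J x \<in> D" "\<And>x. J x - l *\<^sub>R A (J x) = x"
    "\<And>x. x \<in> D \<Longrightarrow> J (x - l *\<^sub>R A x) = x" "\<And>x. norm (J x) \<le> norm x" "\<And>x y. J x \<bullet> y = x \<bullet> J y"
proof -
  have sub: "subspace D" and lin: "\<And>x y. x \<in> D \<Longrightarrow> y \<in> D \<Longrightarrow> A (x + y) = A x + A y"
    "\<And>c x. x \<in> D \<Longrightarrow> A (c *\<^sub>R x) = c *\<^sub>R A x"
    and adj: "adjoint_domain D A = D" and sym: "\<And>x y. x \<in> D \<Longrightarrow> y \<in> D \<Longrightarrow> A x \<bullet> y = x \<bullet> A y"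
    using sa unfolding selfadjoint_operator_def linear_operator_def by auto
  define R where "R = (\<lambda>x. x - l *\<^sub>R A x) ` D"
  note cl = selfadjoint_range_closed[OF sa neg l]
  have subR: "subspace R" unfolding subspace_def
  proof (intro conjI ballI allI)
    have "A 0 = 0" using lin(2)[of 0 0] sub by (simp add: subspace_0)
    then show "0 \<in> R" unfolding R_def using sub by (intro image_eqI[where x = 0]) (auto simp: subspace_0)
    show "x + y \<in> R" if "x \<in> R" "y \<in> R" for x y
    proof -
      obtain a b where ab: "a \<in> D" "b \<in> D" "x = a - l *\<^sub>R A a" "y = b - l *\<^sub>R A b" using \<open>x \<in> R\<close> \<open>y \<in> R\<close> unfolding R_def by blast
      then show ?thesis unfolding R_def using sub lin(1)[of a b]
        by (intro image_eqI[where x = "a + b"]) (auto simp: subspace_add scaleR_add_right)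
    qed
    show "c *\<^sub>R x \<in> R" if "x \<in> R" for c x
    proof -
      obtain a where ab: "a \<in> D" "x = a - l *\<^sub>R A a" using \<open>x \<in> R\<close> unfolding R_def by blast
      then show ?thesis unfolding R_def using sub lin(2)[of a c]
        by (intro image_eqI[where x = "c *\<^sub>R a"]) (auto simp: subspace_scale scaleR_diff_right mult.commute)
    qed
  qed
  have surj: "R = UNIV"
  proof (rule ccontr)
    assume "R \<noteq> UNIV"
    then obtain p where "p \<notin> R" by blast
    then obtain y where y: "y \<noteq> 0" "\<And>x. x \<in> R \<Longrightarrow> x \<bullet> y = 0"
      using closed_subspace_orthogonal_vector[OF subR] cl(1) unfolding R_def by metis
    have *: "A u \<bullet> y = u \<bullet> ((1/l) *\<^sub>R y)" if u: "u \<in> D" for u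
      using y(2)[of "u - l *\<^sub>R A u"] u l unfolding R_def by (simp add: inner_diff_left field_simps)
    then have yD: "y \<in> D" using adj unfolding adjoint_domain_def by blast
    have "A y \<bullet> y = (1/l) * (y \<bullet> y)" using *[OF yD] by simp
    then have "(1/l) * (y \<bullet> y) \<le> 0" using neg[OF yD] by simp
    then show False using l y(1) by (simp add: mult_le_0_iff divide_le_0_iff flip: inner_gt_zero_iff)
  qed
  define J where "J x = (SOME y. y \<in> D \<and> y - l *\<^sub>R A y = x)" for x
  have JD: "J x \<in> D \<and> J x - l *\<^sub>R A (J x) = x" for x
  proof -
    have "x \<in> R" using surj by simp
    then have "\<exists>y. y \<in> D \<and> y - l *\<^sub>R A y = x" unfolding R_def by auto
    then show ?thesis unfolding J_def by (rule someI_ex)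
  qed
  note JD1 = conjunct1[OF JD] and JD2 = conjunct2[OF JD]
  have inj: "x = y" if "x \<in> D" "y \<in> D" "x - l *\<^sub>R A x = y - l *\<^sub>R A y" for x y
  proof -
    have "A (x - y) = A x - A y"
      using lin(1)[OF that(1), of "(-1) *\<^sub>R y"] lin(2)[OF that(2), of "-1"] that sub by (simp add: subspace_neg)
    then have "(x - y) - l *\<^sub>R A (x - y) = (x - l *\<^sub>R A x) - (y - l *\<^sub>R A y)" by (simp only: scaleR_diff_right) simp
    then have "(x - y) - l *\<^sub>R A (x - y) = 0" using that(3) by simp
    moreover have "norm (x - y) \<le> norm ((x - y) - l *\<^sub>R A (x - y))"
      using that sub by (intro cl(2)) (auto simp: subspace_diff)
    ultimately have "norm (x - y) \<le> 0" by (simp only: norm_zero)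
    then show ?thesis by simp
  qed
  show thesis
  proof (rule that)
    show "linear J"
    proof (rule linearI)
      show "J (x + y) = J x + J y" for x y
      proof (rule inj)
        have "J x + J y - l *\<^sub>R A (J x + J y) = (J x - l *\<^sub>R A (J x)) + (J y - l *\<^sub>R A (J y))"
          unfolding lin(1)[OF conjunct1[OF JD] conjunct1[OF JD]] scaleR_add_right by simp
        also have "\<dots> = J (x + y) - l *\<^sub>R A (J (x + y))" by (simp only: JD2)
        finally show "J (x + y) - l *\<^sub>R A (J (x + y)) = J x + J y - l *\<^sub>R A (J x + J y)" by simp
      qed (use JD1 sub in \<open>auto simp: subspace_add\<close>)
      show "J (c *\<^sub>R x) = c *\<^sub>R J x" for c x
      proof (rule inj)
        have "c *\<^sub>R J x - l *\<^sub>R A (c *\<^sub>R J x) = c *\<^sub>R (J x - l *\<^sub>R A (J x))"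
          unfolding lin(2)[OF conjunct1[OF JD]] scaleR_diff_right by simp
        also have "\<dots> = J (c *\<^sub>R x) - l *\<^sub>R A (J (c *\<^sub>R x))" by (simp only: JD2)
        finally show "J (c *\<^sub>R x) - l *\<^sub>R A (J (c *\<^sub>R x)) = c *\<^sub>R J x - l *\<^sub>R A (c *\<^sub>R J x)" by simp
      qed (use JD1 sub in \<open>auto simp: subspace_scale\<close>)
    qed
    show "J x \<in> D" "J x - l *\<^sub>R A (J x) = x" for x by (fact JD1, fact JD2)
    show "J (x - l *\<^sub>R A x) = x" if "x \<in> D" for x by (rule inj[OF JD1 that JD2])
    show "norm (J x) \<le> norm x" for x 
    proof -
      have "norm (J x) \<le> norm (J x - l *\<^sub>R A (J x))" by (rule cl(2)) (auto simp: JD1)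
      then show ?thesis by (simp only: JD2)
    qed
    show "J x \<bullet> y = x \<bullet> J y" for x y
    proof -
      have "J x \<bullet> y = J x \<bullet> (J y - l *\<^sub>R A (J y))" by (simp only: JD2)
      also have "\<dots> = (J x - l *\<^sub>R A (J x)) \<bullet> J y" using sym[OF JD1[of x] JD1[of y]]
        by (simp add: inner_diff_left inner_diff_right)
      also have "\<dots> = x \<bullet> J y" by (simp only: JD2)
      finally show ?thesis .
    qed
  qed
qed

text \<open>On \<open>D\<close> the error is \<open>J d - d = l J (A d)\<close>, hence of order
  \<open>l\<close>; uniform contractivity carries the convergence over to the closure of
  \<open>D\<close>, which is the whole space.\<close>

lemma selfadjoint_resolvent_convergence:
  fixes A :: "'a::{real_inner, banach} \<Rightarrow> 'a"
  assumes dense: "closure D = UNIV"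
    and lin: "\<And>n. linear (J n)" and inv: "\<And>n x. J n x - l n *\<^sub>R A (J n x) = x"
    and inv': "\<And>n x. x \<in> D \<Longrightarrow> J n (x - l n *\<^sub>R A x) = x"
    and contr: "\<And>n x. norm (J n x) \<le> norm x" and l: "\<And>n. l n > 0" "l \<longlonglongrightarrow> 0"
  shows "(\<lambda>n. J n x) \<longlonglongrightarrow> x"
proof -
  have D: "norm (J n d - d) \<le> l n * norm (A d)" if d: "d \<in> D" for n d
  proof -
    have "J n d - d = l n *\<^sub>R J n (A d)"
      using arg_cong[OF inv'[OF d, of n], of "\<lambda>v. J n d - v"] unfolding linear_diff[OF lin] linear_scale[OF lin]
      by simp
    then show ?thesis using contr[of n "A d"] l(1)[of n] by (simp add: mult_left_mono)
  qed
  show ?thesis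
  proof (rule metric_LIMSEQ_I)
    fix r :: real assume r: "r > 0"
    have "x \<in> closure D" using dense by simp
    then obtain d where d: "d \<in> D" "dist d x < r / 3" using r unfolding closure_approachable
      by (metis divide_pos_pos zero_less_numeral)
    have "(\<lambda>n. l n * norm (A d)) \<longlonglongrightarrow> 0 * norm (A d)" by (intro tendsto_intros l)
    then have "\<forall>\<^sub>F n in sequentially. l n * norm (A d) < r / 3"
      using r by (intro order_tendstoD) auto
    then obtain N where N: "\<And>n. n \<ge> N \<Longrightarrow> l n * norm (A d) < r / 3" unfolding eventually_sequentially by blast
    have "dist (J n x) x < r" if "n \<ge> N" for n
    proof -
      have "J n x - x = J n (x - d) + (J n d - d) + (d - x)" unfolding linear_diff[OF lin] by simp
      then have "norm (J n x - x) \<le> norm (J n (x - d)) + norm (J n d - d) + norm (d - x)"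
        using norm_triangle_ineq[of "J n (x - d) + (J n d - d)" "d - x"] norm_triangle_ineq[of "J n (x - d)" "J n d - d"]
        by simp
      also have "\<dots> \<le> norm (x - d) + l n * norm (A d) + norm (d - x)"
        using contr[of n "x - d"] D[OF d(1), of n] by linarith
      also have "\<dots> < r" using d(2) N[OF that] by (simp add: dist_norm norm_minus_commute)
      finally show ?thesis by (simp add: dist_norm)
    qed
    then show "\<exists>no. \<forall>n\<ge>no. dist (J n x) x < r" by blast
  qed
qed

section \<open>Orthonormal expansions and the measurability of the form domain\<close>

locale orthonormal_basis =
  fixes e :: "nat \<Rightarrow> 'a::{real_inner, banach, second_countable_topology}"
  assumes orthonormal: "e i \<bullet> e j = (if i = j then 1 else 0)"
    and complete_span: "closure (span (range e)) = UNIV"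
begin

lemma norm_e [simp]: "norm (e i) = 1"
  by (simp add: norm_eq_sqrt_inner orthonormal)

lemma inner_partial_sum: "(\<Sum>i<n. c i *\<^sub>R e i) \<bullet> e j = (if j < n then c j else 0)"
proof -
  have "(\<Sum>i<n. c i *\<^sub>R e i) \<bullet> e j = (\<Sum>i<n. if i = j then c i else 0)"
    by (unfold inner_sum_left, intro sum.cong) (auto simp: orthonormal)
  then show ?thesis by (simp add: sum.delta)
qed

lemma norm_partial_sum: "(norm (\<Sum>i<n. c i *\<^sub>R e i))\<^sup>2 = (\<Sum>i<n. (c i)\<^sup>2)"
proof -
  have "(norm (\<Sum>i<n. c i *\<^sub>R e i))\<^sup>2 = (\<Sum>j<n. c j * ((\<Sum>i<n. c i *\<^sub>R e i) \<bullet> e j))"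
    unfolding power2_norm_eq_inner by (subst inner_sum_right) simp
  also have "\<dots> = (\<Sum>j<n. (c j)\<^sup>2)"
    by (intro sum.cong) (auto simp: inner_partial_sum power2_eq_square)
  finally show ?thesis .
qed

text \<open>Partial sums of the expansion are best approximations: once \<open>n\<close> exceeds the
  indices that occur in a good approximant \<open>s\<close> from the span, the remainder is
  orthogonal to the partial sum minus \<open>s\<close>, so it is no longer than
  \<open>x - s\<close>.\<close>

lemma sums_expansion: "(\<lambda>i. (x \<bullet> e i) *\<^sub>R e i) sums x"
  unfolding sums_def
proof (rule metric_LIMSEQ_I)
  fix r :: real assume r: "r > 0"
  have "x \<in> closure (span (range e))" using complete_span by simp
  then obtain s where s: "s \<in> span (range e)" "dist s x < r" using r unfolding closure_approachable by blast
  obtain T c where T: "finite T" "T \<subseteq> range e" "s = (\<Sum>a\<in>T. c a *\<^sub>R a)"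
    using s(1) unfolding span_explicit by blast
  obtain I where I: "finite I" "T = e ` I" using T finite_subset_image by metis
  obtain N where N: "I \<subseteq> {..<N}" using I(1) finite_nat_iff_bounded by blast
  have "dist (\<Sum>i<n. (x \<bullet> e i) *\<^sub>R e i) x < r" if n: "n \<ge> N" for n
  proof -
    define y where "y = x - (\<Sum>i<n. (x \<bullet> e i) *\<^sub>R e i)"
    define z where "z = (\<Sum>i<n. (x \<bullet> e i) *\<^sub>R e i) - s"
    have "y \<bullet> e i = 0" if "i < n" for i using that by (simp add: y_def inner_diff_left inner_partial_sum)
    then have "y \<bullet> z = 0" using I N n unfolding z_def T(3)
      by (auto simp: inner_diff_right inner_sum_right intro!: sum.neutral)
    then have "(norm (x - s))\<^sup>2 = (norm y)\<^sup>2 + (norm z)\<^sup>2"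
      unfolding power2_norm_eq_inner by (simp add: y_def z_def inner_diff_left inner_diff_right inner_commute)
    then have "(norm y)\<^sup>2 \<le> (norm (x - s))\<^sup>2" by simp
    then have "norm y \<le> norm (x - s)" by (rule power2_le_imp_le) simp
    then show ?thesis using s(2) by (simp add: y_def dist_norm norm_minus_commute)
  qed
  then show "\<exists>no. \<forall>n\<ge>no. dist (\<Sum>i<n. (x \<bullet> e i) *\<^sub>R e i) x < r" by blast
qed

lemma parseval: "(\<lambda>i. (x \<bullet> e i)\<^sup>2) sums (norm x)\<^sup>2"
proof -
  have "(\<lambda>n. (norm (\<Sum>i<n. (x \<bullet> e i) *\<^sub>R e i))\<^sup>2) \<longlonglongrightarrow> (norm x)\<^sup>2"
    using sums_expansion[of x] unfolding sums_def by (intro tendsto_intros)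
  then show ?thesis unfolding sums_def by (simp add: norm_partial_sum)
qed

lemma eq_if_coordinates_eq: "(\<And>i. x \<bullet> e i = y \<bullet> e i) \<Longrightarrow> x = y"
  using sums_unique2[OF sums_expansion[of x]] sums_expansion[of y] by simp

text \<open>\<open>S\<close> equals its adjoint, and a vector is in the domain of the adjoint when
  \<open>v \<mapsto> x \<bullet> S v\<close> is bounded. The vector that represents this functional
  is built from its coordinates \<open>x \<bullet> S (e i)\<close>. The bound is a natural number so
  that it can be used in a countable union.\<close>

lemma selfadjoint_domain_iff_bound:
  assumes sa: "selfadjoint_operator V S" and eV: "\<And>i. e i \<in> V"
  shows "x \<in> V \<longleftrightarrow> (\<exists>n::nat. \<forall>v\<in>V. \<bar>x \<bullet> S v\<bar> \<le> real n * norm v)"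
proof
  have sym: "\<And>x y. x \<in> V \<Longrightarrow> y \<in> V \<Longrightarrow> S x \<bullet> y = x \<bullet> S y" and adj: "adjoint_domain V S = V"
    and sub: "subspace V" and add: "\<And>x y. x \<in> V \<Longrightarrow> y \<in> V \<Longrightarrow> S (x + y) = S x + S y"
    and scale: "\<And>c x. x \<in> V \<Longrightarrow> S (c *\<^sub>R x) = c *\<^sub>R S x"
    using sa unfolding selfadjoint_operator_def linear_operator_def by auto
  show "\<exists>n::nat. \<forall>v\<in>V. \<bar>x \<bullet> S v\<bar> \<le> real n * norm v" if x: "x \<in> V"
  proof -
    obtain n :: nat where "norm (S x) \<le> real n" using real_arch_simple by blast
    then have "\<bar>x \<bullet> S v\<bar> \<le> real n * norm v" if "v \<in> V" for v
      using sym[OF x that] Cauchy_Schwarz_ineq2[of "S x" v] mult_right_mono[of "norm (S x)" "real n" "norm v"]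
      by simp
    then show ?thesis by blast
  qed
  assume "\<exists>n::nat. \<forall>v\<in>V. \<bar>x \<bullet> S v\<bar> \<le> real n * norm v"
  then obtain B where B: "\<And>v. v \<in> V \<Longrightarrow> \<bar>x \<bullet> S v\<bar> \<le> B * norm v" "B \<ge> 0" by (metis of_nat_0_le_iff)
  define c where "c i = x \<bullet> S (e i)" for i
  have S0: "S 0 = 0" using scale[of 0 0] sub by (simp add: subspace_0)
  have sumV: "(\<Sum>i\<in>I. d i *\<^sub>R e i) \<in> V \<and> x \<bullet> S (\<Sum>i\<in>I. d i *\<^sub>R e i) = (\<Sum>i\<in>I. d i * c i)" if "finite I" for I d
    using that
  proof induction
    case (insert i I)
    have iV: "d i *\<^sub>R e i \<in> V" using sub eV by (intro subspace_scale)
    have IV: "(\<Sum>i\<in>I. d i *\<^sub>R e i) \<in> V" using insert.IH by simp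
    have "x \<bullet> S (d i *\<^sub>R e i + (\<Sum>i\<in>I. d i *\<^sub>R e i)) = d i * c i + (\<Sum>i\<in>I. d i * c i)"
      using insert.IH by (simp add: add[OF iV IV] scale[OF eV] inner_add_right c_def)
    then show ?case using subspace_add[OF sub iV IV] insert.hyps by simp
  next
    case empty
    show ?case using subspace_0[OF sub] S0 by simp
  qed
  \<comment> \<open>The bound is tested on the truncated representing vector \<open>z\<close>, which
    gives \<open>(norm z)\<^sup>2 \<le> B * norm z\<close>.\<close>
  have bessel: "(\<Sum>i<n. (c i)\<^sup>2) \<le> B\<^sup>2" for n
  proof -
    define z where "z = (\<Sum>i<n. c i *\<^sub>R e i)"
    have "(norm z)\<^sup>2 = (\<Sum>i<n. c i * c i)" unfolding z_def norm_partial_sum by (simp add: power2_eq_square)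
    also have "\<dots> = x \<bullet> S z" using sumV[of "{..<n}" c] by (simp add: z_def)
    also have "\<dots> \<le> B * norm z" using B(1)[of z] sumV[of "{..<n}" c] by (auto simp: z_def)
    finally have "norm z * norm z \<le> B * norm z" by (simp add: power2_eq_square)
    then have "norm z \<le> B" using B(2) by (cases "z = 0") auto
    then have "(norm z)\<^sup>2 \<le> B\<^sup>2" by (intro power_mono) auto
    then show ?thesis by (simp add: z_def norm_partial_sum)
  qed
  have summ: "summable (\<lambda>i. (c i)\<^sup>2)"
    by (rule summableI_nonneg_bounded[of _ "B\<^sup>2"]) (use bessel in \<open>auto\<close>)
  have "Cauchy (\<lambda>n. \<Sum>i<n. c i *\<^sub>R e i)"
  proof (rule metric_CauchyI)
    fix r :: real assume r: "r > 0"
    have "Cauchy (\<lambda>n. \<Sum>i<n. (c i)\<^sup>2)" using summ summable_iff_convergent convergent_Cauchy by blast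
    then obtain N where N: "\<And>m n. m \<ge> N \<Longrightarrow> n \<ge> N \<Longrightarrow> dist (\<Sum>i<m. (c i)\<^sup>2) (\<Sum>i<n. (c i)\<^sup>2) < r\<^sup>2"
      using r metric_CauchyD[of "\<lambda>n. \<Sum>i<n. (c i)\<^sup>2" "r\<^sup>2"] by auto
    have *: "dist (\<Sum>i<m. c i *\<^sub>R e i) (\<Sum>i<n. c i *\<^sub>R e i) < r" if "N \<le> m" "m \<le> n" for m n
    proof -
      have "(\<Sum>i<m. c i *\<^sub>R e i) = (\<Sum>i<n. (if i < m then c i else 0) *\<^sub>R e i)"
        using that by (intro sum.mono_neutral_cong_left) auto
      then have "(\<Sum>i<n. c i *\<^sub>R e i) - (\<Sum>i<m. c i *\<^sub>R e i) = (\<Sum>i<n. (if i < m then 0 else c i) *\<^sub>R e i)"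
        by (simp only: sum_subtractf[symmetric]) (intro sum.cong, auto)
      then have "(norm ((\<Sum>i<n. c i *\<^sub>R e i) - (\<Sum>i<m. c i *\<^sub>R e i)))\<^sup>2 = (\<Sum>i<n. if i < m then 0 else (c i)\<^sup>2)"
        unfolding norm_partial_sum by (auto simp: norm_partial_sum intro!: sum.cong)
      also have "\<dots> = (\<Sum>i<n. (c i)\<^sup>2) - (\<Sum>i<m. (c i)\<^sup>2)"
      proof -
        have "(\<Sum>i<m. (c i)\<^sup>2) = (\<Sum>i<n. if i < m then (c i)\<^sup>2 else 0)"
          using that by (intro sum.mono_neutral_cong_left) auto
        then show ?thesis by (simp only: sum_subtractf[symmetric]) (intro sum.cong, auto)
      qed
      also have "\<dots> < r\<^sup>2" using N[of n m] that by (simp add: dist_real_def)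
      finally have "norm ((\<Sum>i<n. c i *\<^sub>R e i) - (\<Sum>i<m. c i *\<^sub>R e i)) < r" using r by (auto intro: power2_less_imp_less)
      then show ?thesis by (simp add: dist_norm norm_minus_commute)
    qed
    show "\<exists>M. \<forall>m\<ge>M. \<forall>n\<ge>M. dist (\<Sum>i<m. c i *\<^sub>R e i) (\<Sum>i<n. c i *\<^sub>R e i) < r"
    proof (intro exI[of _ N] allI impI)
      fix m n assume "m \<ge> N" "n \<ge> N"
      then show "dist (\<Sum>i<m. c i *\<^sub>R e i) (\<Sum>i<n. c i *\<^sub>R e i) < r"
        using *[of m n] *[of n m] by (cases "m \<le> n") (auto simp: dist_commute)
    qed
  qed
  then obtain z where z: "(\<lambda>n. \<Sum>i<n. c i *\<^sub>R e i) \<longlonglongrightarrow> z" using Cauchy_convergent convergent_def by blast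
  have ze: "z \<bullet> e j = c j" for j
  proof -
    have "(\<lambda>n. (\<Sum>i<n. c i *\<^sub>R e i) \<bullet> e j) \<longlonglongrightarrow> z \<bullet> e j" by (intro tendsto_intros z)
    moreover have "(\<lambda>n. (\<Sum>i<n. c i *\<^sub>R e i) \<bullet> e j) \<longlonglongrightarrow> c j"
      by (rule tendsto_eventually, rule eventually_sequentiallyI[of "Suc j"]) (simp add: inner_partial_sum)
    ultimately show ?thesis by (rule LIMSEQ_unique)
  qed
  have "S v \<bullet> x = v \<bullet> z" if v: "v \<in> V" for v
  proof -
    \<comment> \<open>The finite expansions of \<open>v\<close> lie in \<open>V\<close>, and the
      identity is known for them. The bound on \<open>x \<bullet> S (v - p n)\<close> passes it to
      the limit although \<open>S\<close> is unbounded.\<close>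
    define p where "p n = (\<Sum>i<n. (v \<bullet> e i) *\<^sub>R e i)" for n
    have p: "p \<longlonglongrightarrow> v" using sums_expansion[of v] unfolding sums_def p_def .
    have pV: "p n \<in> V" "x \<bullet> S (p n) = p n \<bullet> z" for n
      using sumV[of "{..<n}" "\<lambda>i. v \<bullet> e i"] unfolding p_def inner_sum_left
      by (simp_all add: ze[symmetric] inner_commute[of z])
    have "S (v - p n) = S v - S (p n)" for n
      using add[OF v, of "(-1) *\<^sub>R p n"] scale[OF pV(1), of "-1"] pV(1) sub by (simp add: subspace_neg)
    then have bd: "\<bar>x \<bullet> S v - p n \<bullet> z\<bar> \<le> B * norm (v - p n)" for n
      using B(1)[of "v - p n"] pV v sub by (simp add: inner_diff_right subspace_diff)
    have "(\<lambda>n. B * norm (v - p n)) \<longlonglongrightarrow> B * norm (v - v)" by (intro tendsto_intros p)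
    then have "(\<lambda>n. x \<bullet> S v - p n \<bullet> z) \<longlonglongrightarrow> 0"
      by (intro Lim_null_comparison[OF _ \<open>(\<lambda>n. B * norm (v - p n)) \<longlonglongrightarrow> _\<close>[simplified]] always_eventually) (use bd in auto)
    moreover have "(\<lambda>n. x \<bullet> S v - p n \<bullet> z) \<longlonglongrightarrow> x \<bullet> S v - v \<bullet> z" by (intro tendsto_intros p)
    ultimately have "0 = x \<bullet> S v - v \<bullet> z" by (rule LIMSEQ_unique)
    then show ?thesis by (simp add: inner_commute)
  qed
  then show "x \<in> V" using adj unfolding adjoint_domain_def by blast
qed

text \<open>For a fixed bound \<open>n\<close> the condition is an intersection of closed
  conditions, which is closed for any number of vectors \<open>v\<close>; only the union over
  \<open>n\<close> has to be countable.\<close>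

lemma selfadjoint_domain_borel:
  assumes sa: "selfadjoint_operator V S" and eV: "\<And>i. e i \<in> V"
  shows "V \<in> sets borel"
proof -
  have eq: "V = (\<Union>n::nat. \<Inter>v\<in>V. {x. \<bar>x \<bullet> S v\<bar> \<le> real n * norm v})"
    by (rule set_eqI, subst selfadjoint_domain_iff_bound[OF sa eV]) auto
  have "closed (\<Inter>v\<in>V. {x. \<bar>x \<bullet> S v\<bar> \<le> real n * norm v})" for n :: nat
    by (intro closed_INT ballI closed_Collect_le continuous_intros)
  then have "(\<Union>n::nat. \<Inter>v\<in>V. {x. \<bar>x \<bullet> S v\<bar> \<le> real n * norm v}) \<in> sets borel"
    by (intro sets.countable_UN image_subsetI borel_closed)
  then show ?thesis by (fold eq)
qed

end

section \<open>Independence of the Wiener increments and the filtration\<close>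

text \<open>The sets that agree almost everywhere with a member of a given sigma-algebra form a
  sigma-algebra. This bridges two gaps: \<open>W\<close> and the processes \<open>\<beta> j\<close>
  determine each other only almost surely, and the filtration contains the null events.\<close>

lemma sigma_sets_AE_eq:
  assumes gen: "\<And>A. A \<in> G \<Longrightarrow> \<exists>B\<in>sigma_sets (space M) H. AE \<omega> in M. \<omega> \<in> A \<longleftrightarrow> \<omega> \<in> B"
    and A: "A \<in> sigma_sets (space M) G"
  shows "\<exists>B\<in>sigma_sets (space M) H. AE \<omega> in M. \<omega> \<in> A \<longleftrightarrow> \<omega> \<in> B"
  using A
proof induction
  case (Basic a)
  then show ?case by (rule gen)
next
  case Empty
  then show ?case by (intro bexI[of _ "{}"]) (auto intro: sigma_sets.Empty)
next
  case (Compl a)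
  then obtain B where "B \<in> sigma_sets (space M) H" "AE \<omega> in M. \<omega> \<in> a \<longleftrightarrow> \<omega> \<in> B" by blast
  then show ?case by (intro bexI[of _ "space M - B"]) (auto intro: sigma_sets.Compl)
next
  case (Union a)
  then obtain B where B: "\<And>i. B i \<in> sigma_sets (space M) H" "\<And>i. AE \<omega> in M. \<omega> \<in> a i \<longleftrightarrow> \<omega> \<in> B i" by metis
  have "AE \<omega> in M. \<forall>i. \<omega> \<in> a i \<longleftrightarrow> \<omega> \<in> B i" using B(2) by (simp add: AE_all_countable)
  then show ?case using B(1) by (intro bexI[of _ "\<Union>i. B i"]) (auto intro: sigma_sets.Union)
qed

lemma vimage_factor:
  assumes X: "X \<in> measurable M N" and g: "g \<in> measurable N K" and Y: "\<forall>\<omega>. Y \<omega> = g (X \<omega>)" and A: "A \<in> sets K"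
  shows "\<exists>B\<in>sets N. Y -` A \<inter> space M = X -` B \<inter> space M"
proof (intro bexI[of _ "g -` A \<inter> space N"])
  show "Y -` A \<inter> space M = X -` (g -` A \<inter> space N) \<inter> space M"
    using measurable_space[OF X] Y by (simp add: set_eq_iff) blast
qed (rule measurable_sets[OF g A])

context prob_space
begin

lemma indep_set_AE_eq:
  assumes indep: "indep_set A B" and A': "A' \<subseteq> events" and B': "B' \<subseteq> events"
    and AE_A: "\<And>a. a \<in> A' \<Longrightarrow> \<exists>b\<in>A. AE \<omega> in M. \<omega> \<in> a \<longleftrightarrow> \<omega> \<in> b"
    and AE_B: "\<And>a. a \<in> B' \<Longrightarrow> \<exists>b\<in>B. AE \<omega> in M. \<omega> \<in> a \<longleftrightarrow> \<omega> \<in> b"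
  shows "indep_set A' B'"
  unfolding indep_sets2_eq
proof (intro conjI ballI A' B')
  have sub: "A \<subseteq> events" "B \<subseteq> events" using indep by (auto simp: indep_sets2_eq)
  fix a b assume ab: "a \<in> A'" "b \<in> B'"
  obtain a1 where a1: "a1 \<in> A" "AE \<omega> in M. \<omega> \<in> a \<longleftrightarrow> \<omega> \<in> a1" using AE_A[OF ab(1)] by blast
  obtain b1 where b1: "b1 \<in> B" "AE \<omega> in M. \<omega> \<in> b \<longleftrightarrow> \<omega> \<in> b1" using AE_B[OF ab(2)] by blast
  have ev: "a \<in> events" "b \<in> events" "a1 \<in> events" "b1 \<in> events" using ab a1 b1 A' B' sub by auto
  have "prob (a \<inter> b) = prob (a1 \<inter> b1)" using a1(2) b1(2) ev by (intro finite_measure_eq_AE) auto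
  also have "\<dots> = prob a1 * prob b1" using indep a1 b1 by (auto simp: indep_sets2_eq)
  also have "prob a1 = prob a" using a1(2) ev by (intro finite_measure_eq_AE) auto
  also have "prob b1 = prob b" using b1(2) ev by (intro finite_measure_eq_AE) auto
  finally show "prob (a \<inter> b) = prob a * prob b" .
qed

text \<open>The definition of a Wiener process speaks of increments along an increasing sequence of
  times only. The finitely many past times are therefore sorted together with 0, and
  \<open>s\<close> and \<open>r\<close> are appended; \<open>\<beta> u - \<beta> 0\<close> then is a
  partial sum of increments before the last one.\<close>

lemma wiener_past_future_indep_finite:
  assumes w: "standard_wiener_process M \<beta>" and sr: "0 \<le> s" "s \<le> r"
    and J: "finite J" "J \<subseteq> {0..s}" and E: "\<And>u. u \<in> J \<Longrightarrow> E u \<in> sets borel" and B: "B \<in> sets borel"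
  shows "prob ({\<omega> \<in> space M. \<forall>u\<in>J. \<beta> u \<omega> - \<beta> 0 \<omega> \<in> E u} \<inter> {\<omega> \<in> space M. \<beta> r \<omega> - \<beta> s \<omega> \<in> B}) =
    prob {\<omega> \<in> space M. \<forall>u\<in>J. \<beta> u \<omega> - \<beta> 0 \<omega> \<in> E u} * prob {\<omega> \<in> space M. \<beta> r \<omega> - \<beta> s \<omega> \<in> B}"
proof -
  define ts where "ts = sorted_list_of_set (insert 0 J)"
  define n where "n = length ts"
  have ts: "set ts = insert 0 J" "sorted ts" using J by (simp_all add: ts_def del: sorted_list_of_set_insert_remove)
  have n0: "n > 0" using ts(1) by (cases ts) (auto simp: n_def)
  have nth: "ts ! i \<in> {0..s}" if "i < n" for i using that ts(1) J(2) sr(1) nth_mem[of i ts] by (auto simp: n_def)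
  have ts0: "ts ! 0 = 0"
  proof -
    obtain k where "k < n" "ts ! k = 0" using ts(1) by (metis in_set_conv_nth insertI1 n_def)
    then show ?thesis using sorted_nth_mono[OF ts(2), of 0 k] nth[of 0] n0 by (auto simp: n_def)
  qed
  \<comment> \<open>The increments with number below \<open>n\<close> end at time
    \<open>\<tau> n = s\<close>, the increment number \<open>n\<close> leads from \<open>s\<close>
    to \<open>r\<close>, and the sequence stays at \<open>r\<close> afterwards so as to be monotone
    on all of \<open>nat\<close>.\<close>
  define \<tau> where "\<tau> i = (if i < n then ts ! i else if i = n then s else r)" for i
  have mono: "mono \<tau>"
  proof (rule monoI)
    fix x y :: nat assume "x \<le> y"
    then show "\<tau> x \<le> \<tau> y" using sr nth[of x] sorted_nth_mono[OF ts(2), of x y] by (auto simp: \<tau>_def n_def)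
  qed
  have \<tau>0: "0 \<le> \<tau> 0" using n0 ts0 by (simp add: \<tau>_def)
  define D where "D i \<omega> = \<beta> (\<tau> (Suc i)) \<omega> - \<beta> (\<tau> i) \<omega>" for i \<omega>
  have "indep_vars (\<lambda>_. borel) D {..<Suc n}"
    using w mono \<tau>0 unfolding standard_wiener_process_def D_def by blast
  \<comment> \<open>\<open>True\<close> stands for the future increment alone, \<open>False\<close>
    for the block of the \<open>n\<close> past ones.\<close>
  then have ind: "indep_vars (\<lambda>b. PiM (if b then {n} else {..<n}) (\<lambda>_. borel)) (\<lambda>b \<omega>. restrict (\<lambda>i. D i \<omega>) (if b then {n} else {..<n})) (UNIV :: bool set)"
    by (rule indep_vars_restrict) (auto simp: disjoint_family_on_def)
  have partial: "(\<Sum>i<k. D i \<omega>) = \<beta> (\<tau> k) \<omega> - \<beta> 0 \<omega>" for k \<omega>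
    using sum_lessThan_telescope[of "\<lambda>i. \<beta> (\<tau> i) \<omega>" k] n0 ts0 by (simp add: D_def \<tau>_def)
  have "\<exists>k. k < n \<and> ts ! k = u" if "u \<in> J" for u
    using that ts(1) by (metis in_set_conv_nth insertI2 n_def)
  then obtain k where k: "\<And>u. u \<in> J \<Longrightarrow> k u < n \<and> ts ! (k u) = u" by metis
  define S1 where "S1 = {x \<in> space (PiM {..<n} (\<lambda>_. borel :: real measure)). \<forall>u\<in>J. (\<Sum>i<k u. x i) \<in> E u}"
  define S2 where "S2 = {x \<in> space (PiM {n} (\<lambda>_. borel :: real measure)). x n \<in> B}"
  have S1m: "S1 \<in> sets (PiM {..<n} (\<lambda>_. borel))"
    unfolding S1_def
  proof (intro sets.sets_Collect_finite_All J(1))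
    fix u assume u: "u \<in> J"
    have "(\<lambda>x. \<Sum>i<k u. x i) \<in> borel_measurable (PiM {..<n} (\<lambda>_. borel :: real measure))"
      using k[OF u] by (intro borel_measurable_sum measurable_component_singleton) auto
    from measurable_sets_Collect[OF this, of "\<lambda>y. y \<in> E u"] E[OF u]
    show "{x \<in> space (PiM {..<n} (\<lambda>_. borel :: real measure)). (\<Sum>i<k u. x i) \<in> E u} \<in> sets (PiM {..<n} (\<lambda>_. borel))"
      by simp
  qed
  have S2m: "S2 \<in> sets (PiM {n} (\<lambda>_. borel))"
  proof -
    have "(\<lambda>x. x n) \<in> borel_measurable (PiM {n} (\<lambda>_. borel :: real measure))"
      by (intro measurable_component_singleton) auto
    from measurable_sets_Collect[OF this, of "\<lambda>y. y \<in> B"] B show ?thesis by (simp add: S2_def)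
  qed
  have 1: "restrict (\<lambda>i. D i \<omega>) {..<n} \<in> S1 \<longleftrightarrow> (\<forall>u\<in>J. \<beta> u \<omega> - \<beta> 0 \<omega> \<in> E u)" for \<omega>
  proof -
    have "(\<Sum>i<k u. restrict (\<lambda>i. D i \<omega>) {..<n} i) = \<beta> u \<omega> - \<beta> 0 \<omega>" if "u \<in> J" for u
    proof -
      have "(\<Sum>i<k u. restrict (\<lambda>i. D i \<omega>) {..<n} i) = (\<Sum>i<k u. D i \<omega>)" using k[OF that] by (intro sum.cong) auto
      then show ?thesis using k[OF that] by (simp add: partial \<tau>_def)
    qed
    then show ?thesis by (simp add: S1_def space_PiM PiE_def)
  qed
  have 2: "restrict (\<lambda>i. D i \<omega>) {n} \<in> S2 \<longleftrightarrow> \<beta> r \<omega> - \<beta> s \<omega> \<in> B" for \<omega>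
    by (simp add: S2_def space_PiM PiE_def D_def \<tau>_def)
  have "prob (\<Inter>b\<in>UNIV. (\<lambda>\<omega>. restrict (\<lambda>i. D i \<omega>) (if b then {n} else {..<n})) -` (if b then S2 else S1) \<inter> space M)
     = (\<Prod>b\<in>UNIV. prob ((\<lambda>\<omega>. restrict (\<lambda>i. D i \<omega>) (if b then {n} else {..<n})) -` (if b then S2 else S1) \<inter> space M))"
    by (rule indep_varsD[OF ind]) (use S1m S2m in auto)
  moreover have "(\<lambda>\<omega>. restrict (\<lambda>i. D i \<omega>) {..<n}) -` S1 \<inter> space M = {\<omega> \<in> space M. \<forall>u\<in>J. \<beta> u \<omega> - \<beta> 0 \<omega> \<in> E u}"
    using 1 by auto
  moreover have "(\<lambda>\<omega>. restrict (\<lambda>i. D i \<omega>) {n}) -` S2 \<inter> space M = {\<omega> \<in> space M. \<beta> r \<omega> - \<beta> s \<omega> \<in> B}"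
    using 2 by auto
  ultimately show ?thesis by (simp add: UNIV_bool Int_commute mult.commute)
qed

text \<open>Cylinder sets are an intersection-stable generator of the product sigma-algebra, so the
  factorisation for finitely many times extends to the whole past.\<close>

lemma wiener_past_future_indep:
  assumes w: "standard_wiener_process M \<beta>" and sr: "0 \<le> s" "s \<le> r"
  shows "indep_set {(\<lambda>\<omega>. restrict (\<lambda>u. \<beta> u \<omega> - \<beta> 0 \<omega>) {0..s}) -` A \<inter> space M | A. A \<in> sets (PiM {0..s} (\<lambda>_. borel))}
    {(\<lambda>\<omega>. \<beta> r \<omega> - \<beta> s \<omega>) -` A \<inter> space M | A. A \<in> sets borel}"
proof -
  define P where "P \<omega> = restrict (\<lambda>u. \<beta> u \<omega> - \<beta> 0 \<omega>) {0..s}" for \<omega>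
  define Q where "Q \<omega> = \<beta> r \<omega> - \<beta> s \<omega>" for \<omega>
  have m: "\<beta> u \<in> borel_measurable M" if "u \<ge> 0" for u using w that by (auto simp: standard_wiener_process_def)
  have Pm: "P \<in> measurable M (PiM {0..s} (\<lambda>_. borel))"
    unfolding P_def by (intro measurable_restrict borel_measurable_diff m) auto
  have Qm: "Q \<in> borel_measurable M" unfolding Q_def using sr by (intro borel_measurable_diff m) auto
  let ?G = "{P -` A \<inter> space M | A. A \<in> prod_algebra {0..s} (\<lambda>_. borel :: real measure)}"
  let ?H = "{Q -` A \<inter> space M | A. A \<in> sets borel}"
  have "indep_set ?G ?H"
    unfolding indep_sets2_eq
  proof (intro conjI ballI)
    show "?G \<subseteq> events" using measurable_sets[OF Pm] unfolding sets_PiM by auto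
    show "?H \<subseteq> events" using measurable_sets[OF Qm] by auto
    fix a b assume "a \<in> ?G" "b \<in> ?H"
    then obtain A B where AB: "A \<in> prod_algebra {0..s} (\<lambda>_. borel :: real measure)" "B \<in> sets borel"
      "a = P -` A \<inter> space M" "b = Q -` B \<inter> space M" by blast
    obtain J E where JE: "A = prod_emb {0..s} (\<lambda>_. borel :: real measure) J (\<Pi>\<^sub>E j\<in>J. E j)" "finite J" "J \<subseteq> {0..s}"
       "\<And>i. i \<in> J \<Longrightarrow> E i \<in> sets borel"
      using prod_algebraE[OF AB(1)] by metis
    have a: "a = {\<omega> \<in> space M. \<forall>u\<in>J. \<beta> u \<omega> - \<beta> 0 \<omega> \<in> E u}"
      using JE(3) unfolding AB(3) JE(1) by (auto simp: prod_emb_def P_def PiE_iff subset_iff)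
    have b: "b = {\<omega> \<in> space M. \<beta> r \<omega> - \<beta> s \<omega> \<in> B}" unfolding AB(4) Q_def by auto
    show "prob (a \<inter> b) = prob a * prob b"
      unfolding a b by (rule wiener_past_future_indep_finite[OF w sr JE(2,3,4) AB(2)])
  qed
  moreover have "Int_stable ?G" unfolding Int_stable_def
  proof (intro ballI)
    fix a b assume "a \<in> ?G" "b \<in> ?G"
    then obtain A B where "A \<in> prod_algebra {0..s} (\<lambda>_. borel :: real measure)" "B \<in> prod_algebra {0..s} (\<lambda>_. borel :: real measure)"
      "a = P -` A \<inter> space M" "b = P -` B \<inter> space M" by blast
    then show "a \<inter> b \<in> ?G"
      using Int_stable_prod_algebra[of "{0..s}" "\<lambda>_. borel :: real measure"] unfolding Int_stable_def
      by (intro CollectI exI[of _ "A \<inter> B"]) auto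
  qed
  moreover have "Int_stable ?H" unfolding Int_stable_def
  proof (intro ballI)
    fix a b assume "a \<in> ?H" "b \<in> ?H"
    then obtain A B where "A \<in> sets borel" "B \<in> sets borel"
      "a = Q -` A \<inter> space M" "b = Q -` B \<inter> space M" by blast
    then show "a \<inter> b \<in> ?H" by (intro CollectI exI[of _ "A \<inter> B"]) auto
  qed
  ultimately have ind: "indep_set (sigma_sets (space M) ?G) (sigma_sets (space M) ?H)" by (rule indep_set_sigma_sets)
  have "P \<in> space M \<rightarrow> (\<Pi>\<^sub>E i\<in>{0..s}. space (borel :: real measure))"
    by (auto simp: P_def)
  from sigma_sets_vimage_commute[OF this, of "prod_algebra {0..s} (\<lambda>_. borel)"]
  have "sigma_sets (space M) ?G = {P -` A \<inter> space M | A. A \<in> sets (PiM {0..s} (\<lambda>_. borel))}"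
    unfolding sets_PiM by simp
  moreover have "?H \<subseteq> sigma_sets (space M) ?H" by (rule sigma_sets_superset_generator)
  ultimately show ?thesis using ind unfolding indep_sets2_eq P_def[symmetric] Q_def[symmetric] by blast
qed

end

section \<open>Past and future of the Hilbert-valued Wiener process\<close>

locale hilbert_wiener = prob_space M + orthonormal_basis e
  for M :: "'w measure" and e :: "nat \<Rightarrow> 'a::{real_inner, banach, second_countable_topology}" +
  fixes q :: "nat \<Rightarrow> real" and W :: "real \<Rightarrow> 'w \<Rightarrow> 'a" and \<beta> :: "nat \<Rightarrow> real \<Rightarrow> 'w \<Rightarrow> real"
  assumes q_pos: "0 < q j" and q_summable: "summable q"
    and W_measurable: "0 \<le> t \<Longrightarrow> W t \<in> borel_measurable M"
    and \<beta>_wiener: "standard_wiener_process M (\<beta> j)"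
    and \<beta>_indep: "indep_vars (\<lambda>_. trajectory_space) (\<lambda>j. trajectory (\<beta> j)) UNIV"
    and W_sums: "0 \<le> t \<Longrightarrow> AE \<omega> in M. (\<lambda>j. (sqrt (q j) * \<beta> j t \<omega>) *\<^sub>R e j) sums W t \<omega>"
begin

lemma \<beta>_measurable: "0 \<le> t \<Longrightarrow> \<beta> j t \<in> borel_measurable M"
  using \<beta>_wiener[of j] by (auto simp: standard_wiener_process_def)

lemma W_coordinate: "0 \<le> t \<Longrightarrow> AE \<omega> in M. \<forall>j. W t \<omega> \<bullet> e j = sqrt (q j) * \<beta> j t \<omega>"
  apply (drule W_sums)
proof (elim AE_mp, intro AE_I2 impI)
  fix \<omega> assume elim: "(\<lambda>j. (sqrt (q j) * \<beta> j t \<omega>) *\<^sub>R e j) sums W t \<omega>"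
  show "\<forall>j. W t \<omega> \<bullet> e j = sqrt (q j) * \<beta> j t \<omega>"
  proof
    fix j
    have "(\<lambda>n. (\<Sum>i<n. (sqrt (q i) * \<beta> i t \<omega>) *\<^sub>R e i) \<bullet> e j) \<longlonglongrightarrow> W t \<omega> \<bullet> e j"
      using elim unfolding sums_def by (intro tendsto_intros)
    moreover have "(\<lambda>n. (\<Sum>i<n. (sqrt (q i) * \<beta> i t \<omega>) *\<^sub>R e i) \<bullet> e j) \<longlonglongrightarrow> sqrt (q j) * \<beta> j t \<omega>"
      by (rule tendsto_eventually, rule eventually_sequentiallyI[of "Suc j"]) (simp add: inner_partial_sum)
    ultimately show "W t \<omega> \<bullet> e j = sqrt (q j) * \<beta> j t \<omega>" by (rule LIMSEQ_unique)
  qed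
qed

text \<open>Increments from time 0 stand in for values, with which they agree almost surely only.
  The sigma-algebra is not completed; the exceptional events are handled by lemmas on equality
  almost everywhere.\<close>

definition past :: "real \<Rightarrow> 'w set set" where
  "past s = sigma_sets (space M) (\<Union>j. {(\<lambda>\<omega>. \<beta> j u \<omega> - \<beta> j 0 \<omega>) -` B \<inter> space M | u B. u \<in> {0..s} \<and> B \<in> sets borel})"

definition future :: "real \<Rightarrow> real \<Rightarrow> 'w set set" where
  "future s r = sigma_sets (space M) (\<Union>j. {(\<lambda>\<omega>. \<beta> j r \<omega> - \<beta> j s \<omega>) -` B \<inter> space M | B. B \<in> sets borel})"

text \<open>Two kinds of independence are combined: the trajectories are independent for different
  \<open>j\<close>, and for each \<open>j\<close> the past is independent of the future increment.
  Hence the doubly indexed family \<open>E (j, b)\<close> is independent, where \<open>b\<close>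
  separates past from future, and regrouping it by \<open>b\<close> gives the claim for all
  coordinates together.\<close>

lemma past_future_indep:
  assumes sr: "0 \<le> s" "s \<le> r"
  shows "indep_set (past s) (future s r)"
proof -
  define P where "P j \<omega> = restrict (\<lambda>u. \<beta> j u \<omega> - \<beta> j 0 \<omega>) {0..s}" for j \<omega>
  define Q where "Q j \<omega> = \<beta> j r \<omega> - \<beta> j s \<omega>" for j \<omega>
  define E where "E = (\<lambda>(j, b). if b then {P j -` A \<inter> space M | A. A \<in> sets (PiM {0..s} (\<lambda>_. borel))}
     else {Q j -` A \<inter> space M | A. A \<in> sets borel})"
  define Tr where "Tr j = {trajectory (\<beta> j) -` A \<inter> space M | A. A \<in> sets trajectory_space}" for j
  have Trm: "trajectory (\<beta> j) \<in> measurable M trajectory_space" for j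
    unfolding trajectory_def[abs_def] by (intro measurable_restrict \<beta>_measurable) auto
  have PTr: "\<exists>g\<in>measurable trajectory_space (PiM {0..s} (\<lambda>_. borel)). \<forall>\<omega>. P j \<omega> = g (trajectory (\<beta> j) \<omega>)" for j
  proof (intro bexI allI)
    show "P j \<omega> = (\<lambda>x. restrict (\<lambda>u. x u - x 0) {0..s}) (trajectory (\<beta> j) \<omega>)" for \<omega>
      by (auto simp: P_def trajectory_def restrict_def)
    show "(\<lambda>x. restrict (\<lambda>u. x u - x 0) {0..s}) \<in> measurable trajectory_space (PiM {0..s} (\<lambda>_. borel :: real measure))"
      by (intro measurable_restrict borel_measurable_diff measurable_component_singleton) auto
  qed
  have QTr: "\<exists>g\<in>measurable trajectory_space borel. \<forall>\<omega>. Q j \<omega> = g (trajectory (\<beta> j) \<omega>)" for j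
  proof (intro bexI allI)
    show "Q j \<omega> = (\<lambda>x. x r - x s) (trajectory (\<beta> j) \<omega>)" for \<omega>
      using sr by (auto simp: Q_def trajectory_def restrict_def)
    show "(\<lambda>x. x r - x s) \<in> measurable trajectory_space (borel :: real measure)"
      using sr by (intro borel_measurable_diff measurable_component_singleton) auto
  qed
  have E_True: "E (j, True) = {P j -` A \<inter> space M | A. A \<in> sets (PiM {0..s} (\<lambda>_. borel))}"
    and E_False: "E (j, False) = {Q j -` A \<inter> space M | A. A \<in> sets borel}" for j
    by (simp_all add: E_def)
  have E_Tr_True: "E (j, True) \<subseteq> Tr j" for j
  proof
    fix x assume "x \<in> E (j, True)"
    then obtain A where A: "A \<in> sets (PiM {0..s} (\<lambda>_. borel))" "x = P j -` A \<inter> space M" unfolding E_True by blast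
    obtain g where g: "g \<in> measurable trajectory_space (PiM {0..s} (\<lambda>_. borel :: real measure))" "\<forall>\<omega>. P j \<omega> = g (trajectory (\<beta> j) \<omega>)"
      using PTr[of j] by blast
    have "\<exists>B\<in>sets trajectory_space. P j -` A \<inter> space M = trajectory (\<beta> j) -` B \<inter> space M"
      by (rule vimage_factor[where X = "trajectory (\<beta> j)" and g = g, OF Trm g A(1)])
    then show "x \<in> Tr j" unfolding A(2) Tr_def by blast
  qed
  have E_Tr_False: "E (j, False) \<subseteq> Tr j" for j
  proof
    fix x assume "x \<in> E (j, False)"
    then obtain A where A: "A \<in> sets borel" "x = Q j -` A \<inter> space M" unfolding E_False by blast
    obtain g where g: "g \<in> measurable trajectory_space (borel :: real measure)" "\<forall>\<omega>. Q j \<omega> = g (trajectory (\<beta> j) \<omega>)"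
      using QTr[of j] by blast
    have "\<exists>B\<in>sets trajectory_space. Q j -` A \<inter> space M = trajectory (\<beta> j) -` B \<inter> space M"
      by (rule vimage_factor[where X = "trajectory (\<beta> j)" and g = g, OF Trm g A(1)])
    then show "x \<in> Tr j" unfolding A(2) Tr_def by blast
  qed
  have E_Tr: "E (j, b) \<subseteq> Tr j" for j b using E_Tr_True E_Tr_False by (cases b) auto
  have Tr_ev: "Tr j \<subseteq> events" for j using measurable_sets[OF Trm] by (auto simp: Tr_def)
  have Tr_indep: "indep_sets Tr UNIV"
    using \<beta>_indep unfolding indep_vars_def2 Tr_def by simp
  have ind_j: "indep_set (E (j, True)) (E (j, False))" for j
    unfolding E_True E_False P_def[abs_def] Q_def[abs_def] by (rule wiener_past_future_indep[OF \<beta>_wiener sr])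
  have E_indep1: "prob (a \<inter> b) = prob a * prob b" if "a \<in> E (j, True)" "b \<in> E (j, False)" for a b j
    by (rule indep_setD[OF ind_j that])
  have Int: "a \<inter> b \<in> Tr j" if "a \<in> Tr j" "b \<in> Tr j" for a b j
  proof -
    have "\<exists>A. a = trajectory (\<beta> j) -` A \<inter> space M \<and> A \<in> sets trajectory_space"
      using that(1) by (simp only: Tr_def mem_Collect_eq)
    then obtain A where A: "a = trajectory (\<beta> j) -` A \<inter> space M" "A \<in> sets trajectory_space" by (elim exE conjE)
    have "\<exists>A. b = trajectory (\<beta> j) -` A \<inter> space M \<and> A \<in> sets trajectory_space"
      using that(2) by (simp only: Tr_def mem_Collect_eq)
    then obtain B where B: "b = trajectory (\<beta> j) -` B \<inter> space M" "B \<in> sets trajectory_space" by (elim exE conjE)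
    have "a \<inter> b = trajectory (\<beta> j) -` (A \<inter> B) \<inter> space M" unfolding A(1) B(1) by blast
    then show ?thesis unfolding Tr_def using sets.Int[OF A(2) B(2)] by (intro CollectI exI conjI)
  qed
  have space_E: "space M \<in> E (j, b)" for j b
  proof (cases b)
    case True
    have "P j -` space (PiM {0..s} (\<lambda>_. borel)) \<inter> space M = space M" by (auto simp: P_def space_PiM)
    then have "space M = P j -` space (PiM {0..s} (\<lambda>_. borel)) \<inter> space M" by simp
    then have "space M \<in> E (j, True)" unfolding E_True by blast
    then show ?thesis using True by simp
  next
    case False
    have "space M = Q j -` UNIV \<inter> space M \<and> UNIV \<in> sets borel" by simp
    then have "space M \<in> E (j, False)" unfolding E_False by (intro CollectI exI)
    then show ?thesis using False by simp
  qed
  have E_indep: "indep_sets E UNIV"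
  proof (rule indep_setsI)
    show E_ev: "E i \<subseteq> events" for i
      using subset_trans[OF E_Tr[of "fst i" "snd i"] Tr_ev[of "fst i"]] by simp
    fix A J assume J: "J \<noteq> {}" "J \<subseteq> (UNIV :: (nat \<times> bool) set)" "finite J" "\<forall>j\<in>J. A j \<in> E j"
    \<comment> \<open>Indices outside \<open>J\<close> are filled with the whole space, so that past
      and future events come in complete pairs for every coordinate that occurs.\<close>
    define A' where "A' i = (if i \<in> J then A i else space M)" for i
    define K where "K = fst ` J"
    have K: "finite K" "K \<noteq> {}" using J by (auto simp: K_def)
    have A'E: "A' i \<in> E i" for i using J(4) space_E[of "fst i" "snd i"] by (simp add: A'_def)
    have "(\<Inter>j\<in>J. A j) = (\<Inter>k\<in>K. A' (k, True) \<inter> A' (k, False))" (is "?L = ?R")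
    proof (intro equalityI subsetI)
      fix x assume x: "x \<in> ?L"
      obtain i where "i \<in> J" using J by auto
      then have "A i \<subseteq> space M" using J(4) E_ev[of i] by (intro sets.sets_into_space) blast
      then have "x \<in> space M" using x \<open>i \<in> J\<close> by blast
      then show "x \<in> ?R" using x by (auto simp: A'_def)
    next
      fix x assume x: "x \<in> ?R"
      show "x \<in> ?L"
      proof
        fix j assume j: "j \<in> J"
        then have "fst j \<in> K" by (auto simp: K_def)
        then have "x \<in> A' (fst j, snd j)" using x by (cases "snd j") auto
        then show "x \<in> A j" using j by (simp add: A'_def)
      qed
    qed
    then have "prob (\<Inter>j\<in>J. A j) = prob (\<Inter>k\<in>K. A' (k, True) \<inter> A' (k, False))" by simp
    also have "\<dots> = (\<Prod>k\<in>K. prob (A' (k, True) \<inter> A' (k, False)))"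
    proof (rule indep_setsD[OF Tr_indep _ K(2,1)])
      show "\<forall>k\<in>K. A' (k, True) \<inter> A' (k, False) \<in> Tr k"
      proof
        fix k
        show "A' (k, True) \<inter> A' (k, False) \<in> Tr k"
          by (rule Int[OF subsetD[OF E_Tr_True[of k] A'E] subsetD[OF E_Tr_False[of k] A'E]])
      qed
    qed simp
    also have "\<dots> = (\<Prod>k\<in>K. prob (A' (k, True)) * prob (A' (k, False)))"
    proof (rule prod.cong[OF refl])
      show "prob (A' (k, True) \<inter> A' (k, False)) = prob (A' (k, True)) * prob (A' (k, False))" for k
        by (rule indep_setD[OF ind_j[of k] A'E A'E])
    qed
    also have "\<dots> = (\<Prod>k\<in>K. \<Prod>b\<in>UNIV. prob (A' (k, b)))" by (simp add: UNIV_bool mult.commute)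
    also have "\<dots> = (\<Prod>i\<in>K \<times> UNIV. prob (A' i))" by (subst prod.cartesian_product) simp
    also have "\<dots> = (\<Prod>i\<in>J. prob (A' i))"
    proof (rule prod.mono_neutral_right)
      show "finite (K \<times> (UNIV :: bool set))" using K by simp
      show "J \<subseteq> K \<times> UNIV" by (force simp: K_def)
    qed (auto simp: A'_def prob_space)
    also have "\<dots> = (\<Prod>j\<in>J. prob (A j))" by (simp add: A'_def)
    finally show "prob (\<Inter>j\<in>J. A j) = (\<Prod>j\<in>J. prob (A j))" .
  qed
  have grouped: "indep_sets (\<lambda>b. sigma_sets (space M) (\<Union>i\<in>UNIV \<times> {b}. E i)) (UNIV :: bool set)"
  proof (rule indep_sets_collect_sigma)
    show "indep_sets E (\<Union>b\<in>UNIV. UNIV \<times> {b})" by (rule indep_sets_mono_index[OF _ E_indep]) simp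
    show "Int_stable (E i)" for i
    proof (cases i)
      case (Pair j b)
      show ?thesis unfolding Int_stable_def
      proof (intro ballI)
        fix x y assume xy: "x \<in> E i" "y \<in> E i"
        show "x \<inter> y \<in> E i"
        proof (cases b)
          case True
          then have True_b: "b = True" by simp
          have "\<exists>A. x = P j -` A \<inter> space M \<and> A \<in> sets (PiM {0..s} (\<lambda>_. borel))" "\<exists>A. y = P j -` A \<inter> space M \<and> A \<in> sets (PiM {0..s} (\<lambda>_. borel))"
            using xy by (simp_all only: Pair True_b E_True mem_Collect_eq)
          then obtain A B where AB: "x = P j -` A \<inter> space M" "A \<in> sets (PiM {0..s} (\<lambda>_. borel))" "y = P j -` B \<inter> space M" "B \<in> sets (PiM {0..s} (\<lambda>_. borel))"
            by (elim exE conjE)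
          have "x \<inter> y = P j -` (A \<inter> B) \<inter> space M" unfolding AB(1,3) by blast
          then have "x \<inter> y \<in> E (j, True)" unfolding E_True using sets.Int[OF AB(2,4)] by (intro CollectI exI conjI)
          then show ?thesis using True Pair by simp
        next
          case False
          then have False_b: "b = False" by simp
          have "\<exists>A. x = Q j -` A \<inter> space M \<and> A \<in> sets borel" "\<exists>A. y = Q j -` A \<inter> space M \<and> A \<in> sets borel"
            using xy by (simp_all only: Pair False_b E_False mem_Collect_eq)
          then obtain A B where AB: "x = Q j -` A \<inter> space M" "A \<in> sets borel" "y = Q j -` B \<inter> space M" "B \<in> sets borel"
            by (elim exE conjE)
          have "x \<inter> y = Q j -` (A \<inter> B) \<inter> space M" unfolding AB(1,3) by blast
          then have "x \<inter> y \<in> E (j, False)" unfolding E_False using sets.Int[OF AB(2,4)] by (intro CollectI exI conjI)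
          then show ?thesis using False Pair by simp
        qed
      qed
    qed
    show "disjoint_family_on (\<lambda>b. UNIV \<times> {b}) (UNIV :: bool set)" by (auto simp: disjoint_family_on_def)
  qed
  have "past s \<subseteq> sigma_sets (space M) (\<Union>i\<in>UNIV \<times> {True}. E i)"
    unfolding past_def
  proof (intro sigma_sets_mono subsetI)
    fix x assume "x \<in> (\<Union>j. {(\<lambda>\<omega>. \<beta> j u \<omega> - \<beta> j 0 \<omega>) -` B \<inter> space M | u B. u \<in> {0..s} \<and> B \<in> sets borel})"
    then obtain j u B where B: "u \<in> {0..s}" "B \<in> sets borel" "x = (\<lambda>\<omega>. \<beta> j u \<omega> - \<beta> j 0 \<omega>) -` B \<inter> space M" by blast
    have "{f \<in> space (PiM {0..s} (\<lambda>_. borel :: real measure)). f u \<in> B} \<in> sets (PiM {0..s} (\<lambda>_. borel))"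
      using B measurable_sets_Collect[OF measurable_component_singleton[OF B(1), of "\<lambda>_. borel"], of "\<lambda>y. y \<in> B"] by simp
    moreover have "x = P j -` {f \<in> space (PiM {0..s} (\<lambda>_. borel :: real measure)). f u \<in> B} \<inter> space M"
      using B by (auto simp: P_def space_PiM)
    ultimately have "x \<in> E (j, True)" unfolding E_True by blast
    then show "x \<in> sigma_sets (space M) (\<Union>i\<in>UNIV \<times> {True}. E i)" by (intro sigma_sets.Basic) auto
  qed
  moreover have "future s r \<subseteq> sigma_sets (space M) (\<Union>i\<in>UNIV \<times> {False}. E i)"
    unfolding future_def
  proof (intro sigma_sets_mono subsetI)
    fix x assume "x \<in> (\<Union>j. {(\<lambda>\<omega>. \<beta> j r \<omega> - \<beta> j s \<omega>) -` B \<inter> space M | B. B \<in> sets borel})"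
    then obtain j where "x \<in> E (j, False)" unfolding E_False Q_def by blast
    then have "x \<in> (\<Union>i\<in>UNIV \<times> {False}. E i)" by auto
    then show "x \<in> sigma_sets (space M) (\<Union>i\<in>UNIV \<times> {False}. E i)" by (intro sigma_sets.Basic)
  qed
  ultimately have sub: "case_bool (past s) (future s r) b \<subseteq> sigma_sets (space M) (\<Union>i\<in>UNIV \<times> {b}. E i)" for b
    by (cases b) simp_all
  have "indep_sets (case_bool (past s) (future s r)) UNIV"
    by (rule indep_sets_mono_sets[OF grouped sub])
  then show ?thesis unfolding indep_set_def .
qed


lemma W_increment_coordinate:
  assumes "0 \<le> s" "0 \<le> r"
  shows "AE \<omega> in M. \<forall>j. (W r \<omega> - W s \<omega>) \<bullet> e j = sqrt (q j) * (\<beta> j r \<omega> - \<beta> j s \<omega>)"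
  using W_coordinate[OF assms(1)] W_coordinate[OF assms(2)]
proof eventually_elim
  case (elim \<omega>)
  show ?case unfolding inner_diff_left right_diff_distrib using elim by simp
qed

lemma W_increment_measurable: "0 \<le> s \<Longrightarrow> s \<le> r \<Longrightarrow> (\<lambda>\<omega>. W r \<omega> - W s \<omega>) \<in> borel_measurable M"
  by (intro borel_measurable_diff W_measurable) auto

lemma W_0: "AE \<omega> in M. W 0 \<omega> = 0"
proof -
  have "AE \<omega> in M. \<forall>j. \<beta> j 0 \<omega> = 0"
    using \<beta>_wiener unfolding standard_wiener_process_def AE_all_countable by blast
  then show ?thesis using W_coordinate[OF order_refl]
    by eventually_elim (rule eq_if_coordinates_eq, simp)
qed

text \<open>The increment of \<open>W\<close> is almost surely the sum of the series with
  coefficients \<open>sqrt (q j)\<close> times the increments of \<open>\<beta> j\<close>, and this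
  sum is measurable with respect to those increments.\<close>

lemma future_AE:
  assumes sr: "0 \<le> s" "s \<le> r" and B: "B \<in> sets borel"
  shows "\<exists>A\<in>future s r. AE \<omega> in M. \<omega> \<in> (\<lambda>\<omega>. W r \<omega> - W s \<omega>) -` B \<inter> space M \<longleftrightarrow> \<omega> \<in> A"
proof -
  define G where "G = (\<Union>j. {(\<lambda>\<omega>. \<beta> j r \<omega> - \<beta> j s \<omega>) -` B \<inter> space M | B. B \<in> sets borel})"
  define N where "N = sigma (space M) G"
  have G: "G \<subseteq> Pow (space M)" by (auto simp: G_def)
  have N: "space N = space M" "sets N = future s r"
    unfolding N_def future_def G_def[symmetric] by (rule space_measure_of[OF G], rule sets_measure_of[OF G])
  have m: "(\<lambda>\<omega>. \<beta> j r \<omega> - \<beta> j s \<omega>) \<in> borel_measurable N" for j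
  proof (rule measurableI)
    fix A :: "real set" assume "A \<in> sets borel"
    then have "(\<lambda>\<omega>. \<beta> j r \<omega> - \<beta> j s \<omega>) -` A \<inter> space M \<in> G" unfolding G_def by blast
    then show "(\<lambda>\<omega>. \<beta> j r \<omega> - \<beta> j s \<omega>) -` A \<inter> space N \<in> sets N"
      unfolding N(1) unfolding N(2) future_def G_def[symmetric] by (rule sigma_sets.Basic)
  qed simp
  define g where "g \<omega> = (\<Sum>j. (sqrt (q j) * (\<beta> j r \<omega> - \<beta> j s \<omega>)) *\<^sub>R e j)" for \<omega>
  have "g \<in> borel_measurable N" unfolding g_def using m by measurable
  then have "g -` B \<inter> space M \<in> future s r" using measurable_sets[of g N borel B] B N by simp
  moreover have "AE \<omega> in M. g \<omega> = W r \<omega> - W s \<omega>"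
  proof -
    have "AE \<omega> in M. \<forall>j. (W r \<omega> - W s \<omega>) \<bullet> e j = sqrt (q j) * (\<beta> j r \<omega> - \<beta> j s \<omega>)"
      using sr by (intro W_increment_coordinate) auto
    then show ?thesis
    proof (elim AE_mp, intro AE_I2 impI)
    fix \<omega> assume "\<forall>j. (W r \<omega> - W s \<omega>) \<bullet> e j = sqrt (q j) * (\<beta> j r \<omega> - \<beta> j s \<omega>)"
    then show "g \<omega> = W r \<omega> - W s \<omega>"
      using sums_unique[OF sums_expansion[of "W r \<omega> - W s \<omega>"]] by (simp add: g_def)
  qed
  qed
  then have "AE \<omega> in M. \<omega> \<in> (\<lambda>\<omega>. W r \<omega> - W s \<omega>) -` B \<inter> space M \<longleftrightarrow> \<omega> \<in> g -` B \<inter> space M"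
    by eventually_elim simp
  ultimately show ?thesis by blast
qed

lemma past_AE:
  assumes u: "0 \<le> u" "u \<le> s" and B: "B \<in> sets borel"
  shows "\<exists>A\<in>past s. AE \<omega> in M. \<omega> \<in> W u -` B \<inter> space M \<longleftrightarrow> \<omega> \<in> A"
proof -
  define G where "G = (\<Union>j. {(\<lambda>\<omega>. \<beta> j u \<omega> - \<beta> j 0 \<omega>) -` B \<inter> space M | u B. u \<in> {0..s} \<and> B \<in> sets borel})"
  define N where "N = sigma (space M) G"
  have G: "G \<subseteq> Pow (space M)" by (auto simp: G_def)
  have N: "space N = space M" "sets N = past s"
    unfolding N_def past_def G_def[symmetric] by (rule space_measure_of[OF G], rule sets_measure_of[OF G])
  have m: "(\<lambda>\<omega>. \<beta> j u \<omega> - \<beta> j 0 \<omega>) \<in> borel_measurable N" for j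
  proof (rule measurableI)
    fix A :: "real set" assume "A \<in> sets borel"
    moreover have "u \<in> {0..s}" using u by simp
    ultimately have "(\<lambda>\<omega>. \<beta> j u \<omega> - \<beta> j 0 \<omega>) -` A \<inter> space M \<in> G" unfolding G_def by blast
    then show "(\<lambda>\<omega>. \<beta> j u \<omega> - \<beta> j 0 \<omega>) -` A \<inter> space N \<in> sets N"
      unfolding N(1) unfolding N(2) past_def G_def[symmetric] by (rule sigma_sets.Basic)
  qed simp
  define g where "g \<omega> = (\<Sum>j. (sqrt (q j) * (\<beta> j u \<omega> - \<beta> j 0 \<omega>)) *\<^sub>R e j)" for \<omega>
  have "g \<in> borel_measurable N" unfolding g_def using m by measurable
  then have "g -` B \<inter> space M \<in> past s" using measurable_sets[of g N borel B] B N by simp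
  moreover have "AE \<omega> in M. g \<omega> = W u \<omega> - W 0 \<omega>"
  proof -
    have "AE \<omega> in M. \<forall>j. (W u \<omega> - W 0 \<omega>) \<bullet> e j = sqrt (q j) * (\<beta> j u \<omega> - \<beta> j 0 \<omega>)"
      using u by (intro W_increment_coordinate) auto
    then show ?thesis
    proof (elim AE_mp, intro AE_I2 impI)
    fix \<omega> assume "\<forall>j. (W u \<omega> - W 0 \<omega>) \<bullet> e j = sqrt (q j) * (\<beta> j u \<omega> - \<beta> j 0 \<omega>)"
    then show "g \<omega> = W u \<omega> - W 0 \<omega>"
      using sums_unique[OF sums_expansion[of "W u \<omega> - W 0 \<omega>"]] by (simp add: g_def)
  qed
  qed
  then have "AE \<omega> in M. \<omega> \<in> W u -` B \<inter> space M \<longleftrightarrow> \<omega> \<in> g -` B \<inter> space M"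
    using W_0 by eventually_elim simp
  ultimately show ?thesis by blast
qed

text \<open>The direction from \<open>W\<close> back to its coordinates: since
  \<open>q j > 0\<close>, an increment of \<open>\<beta> j\<close> is a coordinate of an increment
  of \<open>W\<close> divided by \<open>sqrt (q j)\<close>. This is needed because the independence
  of \<open>\<eta>\<close> is stated for the trajectory of \<open>W\<close> and not for the
  \<open>\<beta> j\<close>.\<close>

lemma trajectory_AE:
  assumes A: "A \<in> past s \<or> (0 \<le> s \<and> s \<le> r \<and> A \<in> future s r)"
  shows "\<exists>S\<in>sets trajectory_space. AE \<omega> in M. \<omega> \<in> A \<longleftrightarrow> \<omega> \<in> trajectory W -` S \<inter> space M"
proof -
  let ?V = "vimage_algebra (space M) (trajectory W) trajectory_space"
  have sp: "trajectory W \<in> space M \<rightarrow> space trajectory_space"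
    by (auto simp: trajectory_def space_PiM)
  have V: "sets ?V = {trajectory W -` S \<inter> space M | S. S \<in> sets trajectory_space}"
    by (rule sets_vimage_algebra2[OF sp])
  have gen: "\<exists>S\<in>sigma_sets (space M) (sets ?V). AE \<omega> in M. \<omega> \<in> (\<lambda>\<omega>. \<beta> j u \<omega> - \<beta> j v \<omega>) -` B \<inter> space M \<longleftrightarrow> \<omega> \<in> S"
    if uv: "0 \<le> u" "0 \<le> v" and B: "B \<in> sets borel" for j u v B
  proof -
    define f where "f x = (x u \<bullet> e j - x v \<bullet> e j) / sqrt (q j)" for x
    have f: "f \<in> borel_measurable trajectory_space"
      unfolding f_def using uv
      by (intro borel_measurable_divide borel_measurable_diff borel_measurable_inner borel_measurable_const measurable_component_singleton) auto
    then have S: "f -` B \<inter> space trajectory_space \<in> sets trajectory_space" using B by (rule measurable_sets)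
    have "AE \<omega> in M. \<omega> \<in> (\<lambda>\<omega>. \<beta> j u \<omega> - \<beta> j v \<omega>) -` B \<inter> space M
      \<longleftrightarrow> \<omega> \<in> trajectory W -` (f -` B \<inter> space trajectory_space) \<inter> space M"
      using W_increment_coordinate[OF uv(2,1)] AE_space
    proof eventually_elim
      case (elim \<omega>)
      have "f (trajectory W \<omega>) = \<beta> j u \<omega> - \<beta> j v \<omega>"
        using elim q_pos[of j] uv by (simp add: f_def trajectory_def inner_diff_left[symmetric])
      moreover have "trajectory W \<omega> \<in> space trajectory_space" using sp elim by blast
      ultimately show ?case by simp
    qed
    moreover have "trajectory W -` (f -` B \<inter> space trajectory_space) \<inter> space M \<in> sets ?V"
      unfolding V using S by blast
    ultimately show ?thesis by (meson sigma_sets.Basic)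
  qed
  have "\<exists>S\<in>sigma_sets (space M) (sets ?V). AE \<omega> in M. \<omega> \<in> A \<longleftrightarrow> \<omega> \<in> S"
    using A
  proof (elim disjE conjE)
    assume "A \<in> past s"
    then show ?thesis unfolding past_def
      by (rule sigma_sets_AE_eq[rotated]) (use gen in force)
  next
    assume "A \<in> future s r" "0 \<le> s" "s \<le> r"
    then show ?thesis unfolding future_def
      by (elim sigma_sets_AE_eq[rotated]) (use gen in force)
  qed
  then obtain S where S: "S \<in> sets ?V" "AE \<omega> in M. \<omega> \<in> A \<longleftrightarrow> \<omega> \<in> S"
    using sets.sigma_sets_eq[of ?V] by auto
  from S(1) obtain R where R: "R \<in> sets trajectory_space" "S = trajectory W -` R \<inter> space M" unfolding V by blast
  show ?thesis using S(2) unfolding R(2) by (intro bexI[OF _ R(1)])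
qed

end

section \<open>Integrals of functions of two independent variables\<close>

context prob_space
begin

lemma distr_pair_indep:
  assumes X: "X \<in> measurable M N" and Y: "Y \<in> measurable M K"
    and indep: "indep_set {X -` A \<inter> space M | A. A \<in> sets N} {Y -` B \<inter> space M | B. B \<in> sets K}"
  shows "distr M N X \<Otimes>\<^sub>M distr M K Y = distr M (N \<Otimes>\<^sub>M K) (\<lambda>\<omega>. (X \<omega>, Y \<omega>))"
proof -
  interpret X: prob_space "distr M N X" by (rule prob_space_distr[OF X])
  interpret Y: prob_space "distr M K Y" by (rule prob_space_distr[OF Y])
  show ?thesis
  proof (rule pair_measure_eqI)
    show "sets (distr M N X \<Otimes>\<^sub>M distr M K Y) = sets (distr M (N \<Otimes>\<^sub>M K) (\<lambda>\<omega>. (X \<omega>, Y \<omega>)))"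
      by simp
    fix A B assume A: "A \<in> sets (distr M N X)" and B: "B \<in> sets (distr M K Y)"
    have "prob ((X -` A \<inter> space M) \<inter> (Y -` B \<inter> space M)) = prob (X -` A \<inter> space M) * prob (Y -` B \<inter> space M)"
      using A B by (intro indep_setD[OF indep]) auto
    moreover have "(\<lambda>\<omega>. (X \<omega>, Y \<omega>)) -` (A \<times> B) \<inter> space M = (X -` A \<inter> space M) \<inter> (Y -` B \<inter> space M)" by auto
    ultimately show "emeasure (distr M N X) A * emeasure (distr M K Y) B = emeasure (distr M (N \<Otimes>\<^sub>M K) (\<lambda>\<omega>. (X \<omega>, Y \<omega>))) (A \<times> B)"
      using A B X Y by (simp add: emeasure_distr emeasure_eq_measure ennreal_mult'' measure_nonneg)
  qed unfold_locales
qed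

text \<open>The law of the pair is a product measure, so one argument may be frozen while the other
  is integrated out. This takes the place of conditional expectations throughout.\<close>

lemma nn_integral_indep:
  assumes X: "X \<in> measurable M N" and Y: "Y \<in> measurable M K"
    and indep: "indep_set {X -` A \<inter> space M | A. A \<in> sets N} {Y -` B \<inter> space M | B. B \<in> sets K}"
    and f: "f \<in> borel_measurable (N \<Otimes>\<^sub>M K)"
  shows "(\<integral>\<^sup>+\<omega>. f (X \<omega>, Y \<omega>) \<partial>M) = (\<integral>\<^sup>+\<omega>. (\<integral>\<^sup>+\<omega>'. f (X \<omega>, Y \<omega>') \<partial>M) \<partial>M)"
proof -
  interpret Y: prob_space "distr M K Y" by (rule prob_space_distr[OF Y])
  have f': "f \<in> borel_measurable (distr M N X \<Otimes>\<^sub>M distr M K Y)" using f by simp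
  have "(\<integral>\<^sup>+\<omega>. f (X \<omega>, Y \<omega>) \<partial>M) = (\<integral>\<^sup>+z. f z \<partial>distr M (N \<Otimes>\<^sub>M K) (\<lambda>\<omega>. (X \<omega>, Y \<omega>)))"
    using X Y f by (subst nn_integral_distr) auto
  also have "\<dots> = (\<integral>\<^sup>+x. (\<integral>\<^sup>+y. f (x, y) \<partial>distr M K Y) \<partial>distr M N X)"
    unfolding distr_pair_indep[OF X Y indep, symmetric] by (rule Y.nn_integral_fst[OF f', symmetric])
  also have "\<dots> = (\<integral>\<^sup>+x. (\<integral>\<^sup>+\<omega>'. f (x, Y \<omega>') \<partial>M) \<partial>distr M N X)"
    using Y f by (intro nn_integral_cong nn_integral_distr) auto
  also have "\<dots> = (\<integral>\<^sup>+\<omega>. (\<integral>\<^sup>+\<omega>'. f (X \<omega>, Y \<omega>') \<partial>M) \<partial>M)"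
  proof (rule nn_integral_distr[OF X], unfold measurable_distr_eq1)
    show "(\<lambda>x. \<integral>\<^sup>+\<omega>'. f (x, Y \<omega>') \<partial>M) \<in> borel_measurable N"
    proof (rule sigma_finite_measure.borel_measurable_nn_integral[OF sigma_finite_measure_axioms, unfolded case_prod_beta])
      have "(\<lambda>p. (fst p, Y (snd p))) \<in> measurable (N \<Otimes>\<^sub>M M) (N \<Otimes>\<^sub>M K)" using Y by measurable
      from measurable_compose[OF this f] show "(\<lambda>p. f (fst p, Y (snd p))) \<in> borel_measurable (N \<Otimes>\<^sub>M M)" .
    qed
  qed
  finally show ?thesis .
qed

lemma integral_indep:
  fixes f :: "_ \<Rightarrow> 'b::{banach, second_countable_topology}"
  assumes X: "X \<in> measurable M N" and Y: "Y \<in> measurable M K"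
    and indep: "indep_set {X -` A \<inter> space M | A. A \<in> sets N} {Y -` B \<inter> space M | B. B \<in> sets K}"
    and f: "f \<in> borel_measurable (N \<Otimes>\<^sub>M K)" and int: "integrable M (\<lambda>\<omega>. f (X \<omega>, Y \<omega>))"
  shows "(\<integral>\<omega>. f (X \<omega>, Y \<omega>) \<partial>M) = (\<integral>\<omega>. (\<integral>\<omega>'. f (X \<omega>, Y \<omega>') \<partial>M) \<partial>M)"
proof -
  interpret X: prob_space "distr M N X" by (rule prob_space_distr[OF X])
  interpret Y: prob_space "distr M K Y" by (rule prob_space_distr[OF Y])
  interpret P: pair_sigma_finite "distr M N X" "distr M K Y" ..
  have f': "integrable (distr M N X \<Otimes>\<^sub>M distr M K Y) f"
    unfolding distr_pair_indep[OF X Y indep] using X Y f int by (subst integrable_distr_eq) auto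
  have "(\<integral>\<omega>. f (X \<omega>, Y \<omega>) \<partial>M) = (\<integral>z. f z \<partial>distr M (N \<Otimes>\<^sub>M K) (\<lambda>\<omega>. (X \<omega>, Y \<omega>)))"
    using X Y f by (subst integral_distr) auto
  also have "\<dots> = (\<integral>x. (\<integral>y. f (x, y) \<partial>distr M K Y) \<partial>distr M N X)"
    unfolding distr_pair_indep[OF X Y indep, symmetric] by (rule P.integral_fst'[OF f', symmetric])
  also have "\<dots> = (\<integral>x. (\<integral>\<omega>'. f (x, Y \<omega>') \<partial>M) \<partial>distr M N X)"
    using Y f by (intro Bochner_Integration.integral_cong refl integral_distr) auto
  also have "\<dots> = (\<integral>\<omega>. (\<integral>\<omega>'. f (X \<omega>, Y \<omega>') \<partial>M) \<partial>M)"
  proof (rule integral_distr[OF X])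
    show "(\<lambda>x. \<integral>\<omega>'. f (x, Y \<omega>') \<partial>M) \<in> borel_measurable N"
    proof (rule sigma_finite_measure.borel_measurable_lebesgue_integral[OF sigma_finite_measure_axioms, unfolded case_prod_beta])
      have "(\<lambda>p. (fst p, Y (snd p))) \<in> measurable (N \<Otimes>\<^sub>M M) (N \<Otimes>\<^sub>M K)" using Y by measurable
      from measurable_compose[OF this f] show "(\<lambda>p. f (fst p, Y (snd p))) \<in> borel_measurable (N \<Otimes>\<^sub>M M)" .
    qed
  qed
  finally show ?thesis .
qed

end

section \<open>The filtration and its independence of later increments\<close>

locale hilbert_wiener_initial = hilbert_wiener M e q W \<beta>
  for M :: "'w measure" and e :: "nat \<Rightarrow> 'a::{real_inner, banach, second_countable_topology}" and q W \<beta> +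
  fixes \<eta> :: "'w \<Rightarrow> 'a"
  assumes \<eta>_measurable: "\<eta> \<in> borel_measurable M"
    and \<eta>_indep: "indep_set {\<eta> -` U \<inter> space M | U. U \<in> sets borel}
           {trajectory W -` U \<inter> space M | U. U \<in> sets trajectory_space}"
begin

abbreviation Filt :: "real \<Rightarrow> 'w measure" where "Filt \<equiv> filtration M \<eta> W"

lemma filtration_generator_subset:
  "{\<eta> -` U \<inter> space M | U. U \<in> sets borel} \<union>
      {W s -` U \<inter> space M | s U. 0 \<le> s \<and> s \<le> t \<and> U \<in> sets borel} \<union> null_sets M \<subseteq> events"
proof (intro Un_least subsetI)
  show "A \<in> events" if "A \<in> {\<eta> -` U \<inter> space M | U. U \<in> sets borel}" for A
    using that measurable_sets[OF \<eta>_measurable] by blast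
  fix A assume "A \<in> {W s -` U \<inter> space M | s U. 0 \<le> s \<and> s \<le> t \<and> U \<in> sets borel}"
  then obtain s U where "0 \<le> s" "U \<in> sets borel" "A = W s -` U \<inter> space M" by blast
  then show "A \<in> events" using measurable_sets[OF W_measurable] by simp
qed auto

lemma space_filtration [simp]: "space (Filt t) = space M"
  unfolding filtration_def
  by (rule space_measure_of[OF order_trans[OF filtration_generator_subset sets.space_closed]])

lemma sets_filtration: "sets (Filt t) = sigma_sets (space M) ({\<eta> -` U \<inter> space M | U. U \<in> sets borel} \<union>
      {W s -` U \<inter> space M | s U. 0 \<le> s \<and> s \<le> t \<and> U \<in> sets borel} \<union> null_sets M)"
  unfolding filtration_def
  by (rule sets_measure_of[OF order_trans[OF filtration_generator_subset sets.space_closed]])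

lemma filtration_subset: "sets (Filt t) \<subseteq> events"
  unfolding sets_filtration by (rule sets.sigma_sets_subset[OF filtration_generator_subset])

lemma filtration_measurable: "f \<in> measurable (Filt t) N \<Longrightarrow> f \<in> measurable M N"
proof (rule measurableI)
  assume f: "f \<in> measurable (Filt t) N"
  show "f x \<in> space N" if "x \<in> space M" for x using measurable_space[OF f] that by simp
  show "f -` A \<inter> space M \<in> events" if "A \<in> sets N" for A
    using subsetD[OF filtration_subset measurable_sets[OF f that]] by simp
qed

lemma filtration_mono: "s \<le> t \<Longrightarrow> sets (Filt s) \<subseteq> sets (Filt t)"
  unfolding sets_filtration
proof (rule sigma_sets_mono', intro Un_mono order_refl subsetI)
  fix A assume st: "s \<le> t" and "A \<in> {W s' -` U \<inter> space M | s' U. 0 \<le> s' \<and> s' \<le> s \<and> U \<in> sets borel}"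
  then obtain u U where "0 \<le> u" "u \<le> s" "U \<in> sets borel" "A = W u -` U \<inter> space M" by blast
  moreover have "u \<le> t" using st calculation by simp
  ultimately show "A \<in> {W s' -` U \<inter> space M | s' U. 0 \<le> s' \<and> s' \<le> t \<and> U \<in> sets borel}" by blast
qed

lemma W_adapted: "0 \<le> s \<Longrightarrow> s \<le> t \<Longrightarrow> W s \<in> borel_measurable (Filt t)"
proof (rule measurableI)
  fix A :: "'a set" assume "0 \<le> s" "s \<le> t" "A \<in> sets borel"
  then have "W s -` A \<inter> space M \<in> {W s -` U \<inter> space M | s U. 0 \<le> s \<and> s \<le> t \<and> U \<in> sets borel}" by blast
  then show "W s -` A \<inter> space (Filt t) \<in> sets (Filt t)"
    unfolding sets_filtration space_filtration by (intro sigma_sets.Basic) blast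
qed simp

text \<open>\<open>\<eta>\<close> is independent of all that \<open>W\<close> determines, hence of
  past and future jointly, so that \<open>P(U A b) = P(U) P(A) P(b) = P(U A) P(b)\<close> for
  \<open>U\<close> from \<open>\<eta>\<close>, \<open>A\<close> from the past and \<open>b\<close>
  from the future. The sets \<open>U \<inter> A\<close> are intersection-stable, and each generator
  of the filtration agrees almost everywhere with one of them or with the empty set.\<close>

lemma filtration_increment_indep:
  assumes sr: "0 \<le> s" "s \<le> r"
  shows "indep_set (sets (Filt s)) {(\<lambda>\<omega>. W r \<omega> - W s \<omega>) -` B \<inter> space M | B. B \<in> sets borel}"
proof -
  let ?E = "{\<eta> -` U \<inter> space M | U. U \<in> sets borel}"
  let ?T = "{trajectory W -` U \<inter> space M | U. U \<in> sets trajectory_space}"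
  let ?G = "{U \<inter> A | U A. U \<in> ?E \<and> A \<in> past s}"
  have pf: "past s \<subseteq> events" "future s r \<subseteq> events"
    using past_future_indep[OF sr] by (auto simp: indep_sets2_eq)
  have E_ev: "?E \<subseteq> events" and T_ev: "?T \<subseteq> events" using \<eta>_indep unfolding indep_sets2_eq by blast+
  have past_sa: "sigma_algebra (space M) (past s)" "sigma_algebra (space M) (future s r)"
    unfolding past_def future_def by (rule sigma_algebra_sigma_sets, blast)+
  have indep1: "indep_set ?G (future s r)"
    unfolding indep_sets2_eq
  proof (intro conjI ballI)
    show "?G \<subseteq> events"
    proof
      fix x assume "x \<in> ?G"
      then obtain U A where "U \<in> ?E" "A \<in> past s" "x = U \<inter> A" by blast
      then show "x \<in> events" using subsetD[OF E_ev] subsetD[OF pf(1)] by (simp only: sets.Int)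
    qed
    show "future s r \<subseteq> events" by (rule pf)
    \<comment> \<open>Independence of \<open>\<eta>\<close> is carried over to any event that agrees
      almost everywhere with one of the trajectory of \<open>W\<close>; it is used both for
      \<open>A\<close> and for \<open>A \<inter> b\<close>.\<close>
    have tr: "prob (U \<inter> A) = prob U * prob A"
      if U: "U \<in> ?E" and A: "A \<in> events" "S \<in> sets trajectory_space" "AE \<omega> in M. \<omega> \<in> A \<longleftrightarrow> \<omega> \<in> trajectory W -` S \<inter> space M"
      for U A S
    proof -
      have T: "trajectory W -` S \<inter> space M \<in> ?T" using A(2) by blast
      have "prob (U \<inter> A) = prob (U \<inter> (trajectory W -` S \<inter> space M))"
      proof (rule finite_measure_eq_AE)
        show "AE x in M. (x \<in> U \<inter> A) = (x \<in> U \<inter> (trajectory W -` S \<inter> space M))"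
          using A(3) by eventually_elim blast
      qed (use A(1) subsetD[OF E_ev U] subsetD[OF T_ev T] in \<open>simp_all only: sets.Int\<close>)
      also have "\<dots> = prob U * prob (trajectory W -` S \<inter> space M)" by (rule indep_setD[OF \<eta>_indep U T])
      also have "prob (trajectory W -` S \<inter> space M) = prob A"
      proof (rule finite_measure_eq_AE)
        show "AE x in M. (x \<in> trajectory W -` S \<inter> space M) = (x \<in> A)"
          using A(3) by eventually_elim blast
      qed (use A(1) subsetD[OF T_ev T] in \<open>simp_all only:\<close>)
      finally show ?thesis .
    qed
    fix a b assume a: "a \<in> ?G" and b: "b \<in> future s r"
    then obtain U A where UA: "U \<in> ?E" "A \<in> past s" "a = U \<inter> A" by blast
    obtain S where S: "S \<in> sets trajectory_space" "AE \<omega> in M. \<omega> \<in> A \<longleftrightarrow> \<omega> \<in> trajectory W -` S \<inter> space M"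
      using trajectory_AE[of A s] UA(2) by blast
    obtain R where R: "R \<in> sets trajectory_space" "AE \<omega> in M. \<omega> \<in> b \<longleftrightarrow> \<omega> \<in> trajectory W -` R \<inter> space M"
      using trajectory_AE[of b s r] b sr by blast
    have "prob (U \<inter> (A \<inter> b)) = prob U * prob (A \<inter> b)"
    proof (rule tr[OF UA(1)])
      show "A \<inter> b \<in> events" using UA(2) b pf by (intro sets.Int) auto
      show "S \<inter> R \<in> sets trajectory_space" using S R by (intro sets.Int)
      show "AE \<omega> in M. \<omega> \<in> A \<inter> b \<longleftrightarrow> \<omega> \<in> trajectory W -` (S \<inter> R) \<inter> space M"
        using S(2) R(2) by eventually_elim blast
    qed
    also have "prob (A \<inter> b) = prob A * prob b" by (rule indep_setD[OF past_future_indep[OF sr] UA(2) b])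
    also have "prob U * (prob A * prob b) = prob (U \<inter> A) * prob b"
      using tr[OF UA(1) _ S] UA(2) pf by (simp add: subset_iff)
    finally show "prob (a \<inter> b) = prob a * prob b" unfolding UA(3) by (simp add: Int_assoc)
  qed
  have "Int_stable ?G" unfolding Int_stable_def
  proof (intro ballI)
    fix a b assume "a \<in> ?G" "b \<in> ?G"
    then obtain U A U' A' where *: "U \<in> sets borel" "A \<in> past s" "a = (\<eta> -` U \<inter> space M) \<inter> A"
      "U' \<in> sets borel" "A' \<in> past s" "b = (\<eta> -` U' \<inter> space M) \<inter> A'" by blast
    interpret sigma_algebra "space M" "past s" by (rule past_sa)
    have "a \<inter> b = (\<eta> -` (U \<inter> U') \<inter> space M) \<inter> (A \<inter> A')" unfolding * by blast
    moreover have "U \<inter> U' \<in> sets borel" "A \<inter> A' \<in> past s" using * by auto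
    ultimately show "a \<inter> b \<in> ?G" by blast
  qed
  moreover have "Int_stable (future s r)" unfolding Int_stable_def
  proof (intro ballI)
    interpret sigma_algebra "space M" "future s r" by (rule past_sa)
    show "a \<inter> b \<in> future s r" if "a \<in> future s r" "b \<in> future s r" for a b using that by (rule Int)
  qed
  ultimately have indep2: "indep_set (sigma_sets (space M) ?G) (sigma_sets (space M) (future s r))"
    by (rule indep_set_sigma_sets[OF indep1])
  have space_E: "space M \<in> ?E" by (intro CollectI exI[of _ UNIV]) simp
  have space_P: "space M \<in> past s" unfolding past_def by (rule sigma_sets_top)
  show ?thesis
  proof (rule indep_set_AE_eq[OF indep2])
    show "sets (Filt s) \<subseteq> events" by (rule filtration_subset)
    note dW = W_increment_measurable[OF sr]
    show "{(\<lambda>\<omega>. W r \<omega> - W s \<omega>) -` B \<inter> space M | B. B \<in> sets borel} \<subseteq> events"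
      using measurable_sets[OF dW] by blast
    show "\<exists>b\<in>sigma_sets (space M) ?G. AE \<omega> in M. \<omega> \<in> a \<longleftrightarrow> \<omega> \<in> b" if "a \<in> sets (Filt s)" for a
      using that unfolding sets_filtration
    proof (rule sigma_sets_AE_eq[rotated])
      fix A assume "A \<in> ?E \<union> {W s' -` U \<inter> space M | s' U. 0 \<le> s' \<and> s' \<le> s \<and> U \<in> sets borel} \<union> null_sets M"
      then show "\<exists>B\<in>sigma_sets (space M) ?G. AE \<omega> in M. \<omega> \<in> A \<longleftrightarrow> \<omega> \<in> B"
      proof (elim UnE)
        assume A: "A \<in> ?E"
        then have "A = A \<inter> space M" by blast
        then have "A \<in> ?G" using A space_P by blast
        then show ?thesis by (intro bexI[of _ A] sigma_sets.Basic) auto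
      next
        assume "A \<in> {W s' -` U \<inter> space M | s' U. 0 \<le> s' \<and> s' \<le> s \<and> U \<in> sets borel}"
        then obtain u U where U: "0 \<le> u" "u \<le> s" "U \<in> sets borel" "A = W u -` U \<inter> space M" by blast
        obtain B where B: "B \<in> past s" "AE \<omega> in M. \<omega> \<in> A \<longleftrightarrow> \<omega> \<in> B"
          using past_AE[OF U(1,2,3)] unfolding U(4) by blast
        have "B = space M \<inter> B" using sets.sets_into_space subsetD[OF pf(1) B(1)] by blast
        then have "B \<in> ?G" using B(1) space_E by blast
        then show ?thesis using B(2) by (intro bexI[of _ B] sigma_sets.Basic)
      next
        assume "A \<in> null_sets M"
        then have "AE \<omega> in M. \<omega> \<in> A \<longleftrightarrow> \<omega> \<in> {}" using AE_not_in by auto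
        then show ?thesis by (intro bexI[of _ "{}"] sigma_sets.Empty)
      qed
    qed
    show "\<exists>b\<in>sigma_sets (space M) (future s r). AE \<omega> in M. \<omega> \<in> a \<longleftrightarrow> \<omega> \<in> b"
      if a: "a \<in> {(\<lambda>\<omega>. W r \<omega> - W s \<omega>) -` B \<inter> space M | B. B \<in> sets borel}" for a
    proof -
      obtain B where B: "B \<in> sets borel" "a = (\<lambda>\<omega>. W r \<omega> - W s \<omega>) -` B \<inter> space M" using a by blast
      obtain A where A: "A \<in> future s r" "AE \<omega> in M. \<omega> \<in> a \<longleftrightarrow> \<omega> \<in> A"
        using future_AE[OF sr B(1)] unfolding B(2) by blast
      have "A \<in> sigma_sets (space M) (future s r)" using A(1) by (rule sigma_sets.Basic)
      with A(2) show ?thesis by (rule bexI[where x = A])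
    qed
  qed
qed

lemma filtration_indep_vars:
  assumes "0 \<le> s" "s \<le> r" and Z: "Z \<in> measurable (Filt s) N"
  shows "indep_set {Z -` A \<inter> space M | A. A \<in> sets N} {(\<lambda>\<omega>. W r \<omega> - W s \<omega>) -` B \<inter> space M | B. B \<in> sets borel}"
proof -
  have sub: "{Z -` A \<inter> space M | A. A \<in> sets N} \<subseteq> sets (Filt s)" using measurable_sets[OF Z] by auto
  show ?thesis
    using filtration_increment_indep[OF assms(1,2)] unfolding indep_set_def
    by (rule indep_sets_mono_sets) (use sub in \<open>simp split: bool.split\<close>)
qed

lemma nn_integral_filtration:
  assumes sr: "0 \<le> s" "s \<le> r" and Z: "Z \<in> measurable (Filt s) N" and f: "f \<in> borel_measurable (N \<Otimes>\<^sub>M borel)"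
  shows "(\<integral>\<^sup>+\<omega>. f (Z \<omega>, W r \<omega> - W s \<omega>) \<partial>M) = (\<integral>\<^sup>+\<omega>. (\<integral>\<^sup>+\<omega>'. f (Z \<omega>, W r \<omega>' - W s \<omega>') \<partial>M) \<partial>M)"
  by (rule nn_integral_indep[OF filtration_measurable[OF Z] W_increment_measurable[OF sr] filtration_indep_vars[OF sr Z] f])

lemma integral_filtration:
  fixes f :: "_ \<Rightarrow> 'b::{banach, second_countable_topology}"
  assumes sr: "0 \<le> s" "s \<le> r" and Z: "Z \<in> measurable (Filt s) N" and f: "f \<in> borel_measurable (N \<Otimes>\<^sub>M borel)"
    and int: "integrable M (\<lambda>\<omega>. f (Z \<omega>, W r \<omega> - W s \<omega>))"
  shows "(\<integral>\<omega>. f (Z \<omega>, W r \<omega> - W s \<omega>) \<partial>M) = (\<integral>\<omega>. (\<integral>\<omega>'. f (Z \<omega>, W r \<omega>' - W s \<omega>') \<partial>M) \<partial>M)"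
  by (rule integral_indep[OF filtration_measurable[OF Z] W_increment_measurable[OF sr] filtration_indep_vars[OF sr Z] f int])

end

section \<open>Exponential weights of Wiener increments\<close>

text \<open>Completing the square. This is the Gaussian core of Girsanov's theorem: the normalised
  exponential weight moves the mean from 0 to \<open>\<kappa> * \<sigma>\<^sup>2\<close> and keeps
  the variance, so that weighted moments are ordinary moments of a shifted Gaussian.\<close>

lemma normal_density_tilt:
  assumes "\<sigma> > 0"
  shows "normal_density 0 \<sigma> x * exp (\<kappa> * x - \<kappa>\<^sup>2 * \<sigma>\<^sup>2 / 2) = normal_density (\<kappa> * \<sigma>\<^sup>2) \<sigma> x"
proof -
  have "- (x - 0)\<^sup>2 / (2 * \<sigma>\<^sup>2) + (\<kappa> * x - \<kappa>\<^sup>2 * \<sigma>\<^sup>2 / 2) = - (x - \<kappa> * \<sigma>\<^sup>2)\<^sup>2 / (2 * \<sigma>\<^sup>2)"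
    using assms by (simp add: field_simps power2_eq_square)
  then show ?thesis unfolding normal_density_def by (simp add: exp_add[symmetric])
qed

context hilbert_wiener
begin

lemma increment_measurable: "0 \<le> s \<Longrightarrow> s \<le> r \<Longrightarrow> (\<lambda>\<omega>. \<beta> j r \<omega> - \<beta> j s \<omega>) \<in> borel_measurable M"
  by (intro borel_measurable_diff \<beta>_measurable) auto

lemma increment_distributed:
  "0 \<le> s \<Longrightarrow> s < r \<Longrightarrow> distributed M lborel (\<lambda>\<omega>. \<beta> j r \<omega> - \<beta> j s \<omega>) (normal_density 0 (sqrt (r - s)))"
  using \<beta>_wiener[of j] unfolding standard_wiener_process_def by blast

lemma increment_indep:
  assumes "0 \<le> s" "s \<le> r"
  shows "indep_vars (\<lambda>_. borel) (\<lambda>j \<omega>. \<beta> j r \<omega> - \<beta> j s \<omega>) UNIV"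
proof -
  have "indep_vars (\<lambda>_. borel) (\<lambda>j \<omega>. (\<lambda>x. x r - x s :: real) (trajectory (\<beta> j) \<omega>)) UNIV"
  proof (rule indep_vars_compose2[OF \<beta>_indep])
    show "(\<lambda>x. x r - x s) \<in> measurable trajectory_space (borel :: real measure)"
      using assms by (intro borel_measurable_diff measurable_component_singleton) auto
  qed
  moreover have "(\<lambda>j \<omega>. (\<lambda>x. x r - x s :: real) (trajectory (\<beta> j) \<omega>)) = (\<lambda>j \<omega>. \<beta> j r \<omega> - \<beta> j s \<omega>)"
    using assms by (simp add: trajectory_def fun_eq_iff)
  ultimately show ?thesis by simp
qed

lemma increment_expectation:
  fixes f :: "real \<Rightarrow> real"
  assumes sr: "0 \<le> s" "s < r" and f: "f \<in> borel_measurable borel"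
    and h: "has_bochner_integral lborel (\<lambda>x. normal_density 0 (sqrt (r - s)) x * f x) I"
  shows "integrable M (\<lambda>\<omega>. f (\<beta> j r \<omega> - \<beta> j s \<omega>))" "expectation (\<lambda>\<omega>. f (\<beta> j r \<omega> - \<beta> j s \<omega>)) = I"
proof -
  have f': "f \<in> borel_measurable lborel" using f by simp
  have nn: "\<And>x. x \<in> space lborel \<Longrightarrow> 0 \<le> normal_density 0 (sqrt (r - s)) x" by simp
  show "integrable M (\<lambda>\<omega>. f (\<beta> j r \<omega> - \<beta> j s \<omega>))"
    using distributed_integrable[OF increment_distributed[OF sr] f' nn, of j] h
    by (auto dest: integrable.intros)
  show "expectation (\<lambda>\<omega>. f (\<beta> j r \<omega> - \<beta> j s \<omega>)) = I"
    using distributed_integral[OF increment_distributed[OF sr] f' nn, of j] h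
    by (simp add: has_bochner_integral_integral_eq)
qed

lemma increment_moments:
  assumes sr: "0 \<le> s" "s < r"
  shows "integrable M (\<lambda>\<omega>. \<beta> j r \<omega> - \<beta> j s \<omega>)" "expectation (\<lambda>\<omega>. \<beta> j r \<omega> - \<beta> j s \<omega>) = 0"
    "integrable M (\<lambda>\<omega>. (\<beta> j r \<omega> - \<beta> j s \<omega>)\<^sup>2)" "expectation (\<lambda>\<omega>. (\<beta> j r \<omega> - \<beta> j s \<omega>)\<^sup>2) = r - s"
    "integrable M (\<lambda>\<omega>. \<bar>\<beta> j r \<omega> - \<beta> j s \<omega>\<bar> ^ 3)"
    "expectation (\<lambda>\<omega>. \<bar>\<beta> j r \<omega> - \<beta> j s \<omega>\<bar> ^ 3) \<le> 2 * ((r - s) * sqrt (r - s))"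
proof -
  have \<sigma>: "sqrt (r - s) > 0" using sr by simp
  have 1: "has_bochner_integral lborel (\<lambda>x. normal_density 0 (sqrt (r - s)) x * x) 0"
    using normal_moment_nz_1[OF \<sigma>, of 0] by simp
  show "integrable M (\<lambda>\<omega>. \<beta> j r \<omega> - \<beta> j s \<omega>)" "expectation (\<lambda>\<omega>. \<beta> j r \<omega> - \<beta> j s \<omega>) = 0"
    using increment_expectation[OF sr _ 1, of j] by auto
  have 2: "has_bochner_integral lborel (\<lambda>x. normal_density 0 (sqrt (r - s)) x * x\<^sup>2) (r - s)"
  proof -
    have "fact (2 * 1) / ((2 / (sqrt (r - s))\<^sup>2) ^ 1 * fact 1) = r - s" using sr by (simp add: fact_2)
    from normal_moment_even[OF \<sigma>, of 0 1, unfolded this] show ?thesis by simp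
  qed
  show "integrable M (\<lambda>\<omega>. (\<beta> j r \<omega> - \<beta> j s \<omega>)\<^sup>2)" "expectation (\<lambda>\<omega>. (\<beta> j r \<omega> - \<beta> j s \<omega>)\<^sup>2) = r - s"
    using increment_expectation[OF sr _ 2, of j] by auto
  have 3: "has_bochner_integral lborel (\<lambda>x. normal_density 0 (sqrt (r - s)) x * \<bar>x\<bar> ^ 3) (2 * sqrt (r - s) ^ 3 * sqrt (2 / pi))"
    using normal_moment_abs_odd[OF \<sigma>, of 0 1] by (simp add: numeral_3_eq_3)
  \<comment> \<open>The third absolute moment is \<open>2 * sqrt (2 / pi)\<close> times the cube of
    the deviation; the root is given away, which leaves the 2 in
    \<open>heat_constant\<close>.\<close>
  have "sqrt (2 / pi) \<le> 1" using pi_gt3 by simp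
  then have "2 * sqrt (r - s) ^ 3 * sqrt (2 / pi) \<le> 2 * sqrt (r - s) ^ 3 * 1" using \<sigma> by (intro mult_left_mono) auto
  also have "\<dots> = 2 * ((r - s) * sqrt (r - s))" using sr by (simp add: power3_eq_cube)
  finally show "integrable M (\<lambda>\<omega>. \<bar>\<beta> j r \<omega> - \<beta> j s \<omega>\<bar> ^ 3)"
    "expectation (\<lambda>\<omega>. \<bar>\<beta> j r \<omega> - \<beta> j s \<omega>\<bar> ^ 3) \<le> 2 * ((r - s) * sqrt (r - s))"
    using increment_expectation[OF sr _ 3, of j] by auto
qed

lemma increment_exp_moments:
  fixes \<kappa> :: real
  assumes sr: "0 \<le> s" "s < r"
  defines "D \<equiv> \<lambda>x. exp (\<kappa> * x - \<kappa>\<^sup>2 * (r - s) / 2)"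
  shows "integrable M (\<lambda>\<omega>. D (\<beta> j r \<omega> - \<beta> j s \<omega>))" "expectation (\<lambda>\<omega>. D (\<beta> j r \<omega> - \<beta> j s \<omega>)) = 1"
    "integrable M (\<lambda>\<omega>. (D (\<beta> j r \<omega> - \<beta> j s \<omega>))\<^sup>2)" "expectation (\<lambda>\<omega>. (D (\<beta> j r \<omega> - \<beta> j s \<omega>))\<^sup>2) = exp (\<kappa>\<^sup>2 * (r - s))"
    "integrable M (\<lambda>\<omega>. D (\<beta> j r \<omega> - \<beta> j s \<omega>) * (\<beta> j r \<omega> - \<beta> j s \<omega> - \<kappa> * (r - s)))"
    "expectation (\<lambda>\<omega>. D (\<beta> j r \<omega> - \<beta> j s \<omega>) * (\<beta> j r \<omega> - \<beta> j s \<omega> - \<kappa> * (r - s))) = 0"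
    "integrable M (\<lambda>\<omega>. D (\<beta> j r \<omega> - \<beta> j s \<omega>) * (\<beta> j r \<omega> - \<beta> j s \<omega> - \<kappa> * (r - s))\<^sup>2)"
    "expectation (\<lambda>\<omega>. D (\<beta> j r \<omega> - \<beta> j s \<omega>) * (\<beta> j r \<omega> - \<beta> j s \<omega> - \<kappa> * (r - s))\<^sup>2) = r - s"
proof -
  have \<sigma>: "sqrt (r - s) > 0" using sr by simp
  have sq: "(sqrt (r - s))\<^sup>2 = r - s" using sr by simp
  have nd: "normal_density 0 (sqrt (r - s)) x * exp (k * x - k\<^sup>2 * (r - s) / 2) = normal_density (k * (r - s)) (sqrt (r - s)) x" for x k
    using normal_density_tilt[OF \<sigma>, of x k] unfolding sq .
  have m0: "has_bochner_integral lborel (normal_density \<mu> (sqrt (r - s))) 1" for \<mu>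
    using normal_moment_even[OF \<sigma>, of \<mu> 0] by simp
  have Dm: "D \<in> borel_measurable borel" unfolding D_def by measurable
  have 0: "has_bochner_integral lborel (\<lambda>x. normal_density 0 (sqrt (r - s)) x * D x) 1"
    unfolding D_def nd by (rule m0)
  show "integrable M (\<lambda>\<omega>. D (\<beta> j r \<omega> - \<beta> j s \<omega>))" "expectation (\<lambda>\<omega>. D (\<beta> j r \<omega> - \<beta> j s \<omega>)) = 1"
    using increment_expectation[OF sr Dm 0, of j] by auto
  \<comment> \<open>The square of the weight is \<open>exp (\<kappa>\<^sup>2 * (r - s))\<close>
    times the weight with parameter \<open>2 * \<kappa>\<close>, which again has mean one.\<close>
  have D2: "(D x)\<^sup>2 = exp (\<kappa>\<^sup>2 * (r - s)) * exp ((2 * \<kappa>) * x - (2 * \<kappa>)\<^sup>2 * (r - s) / 2)" for x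
  proof -
    have "(D x)\<^sup>2 = exp ((\<kappa> * x - \<kappa>\<^sup>2 * (r - s) / 2) + (\<kappa> * x - \<kappa>\<^sup>2 * (r - s) / 2))"
      unfolding D_def power2_eq_square by (rule exp_add[symmetric])
    also have "(\<kappa> * x - \<kappa>\<^sup>2 * (r - s) / 2) + (\<kappa> * x - \<kappa>\<^sup>2 * (r - s) / 2)
       = \<kappa>\<^sup>2 * (r - s) + ((2 * \<kappa>) * x - (2 * \<kappa>)\<^sup>2 * (r - s) / 2)"
      by (simp add: power2_eq_square field_simps)
    finally show ?thesis by (simp only: exp_add)
  qed
  have 1: "has_bochner_integral lborel (\<lambda>x. normal_density 0 (sqrt (r - s)) x * (D x)\<^sup>2) (exp (\<kappa>\<^sup>2 * (r - s)) * 1)"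
  proof -
    have "normal_density 0 (sqrt (r - s)) x * (D x)\<^sup>2 = exp (\<kappa>\<^sup>2 * (r - s)) * normal_density ((2 * \<kappa>) * (r - s)) (sqrt (r - s)) x" for x
      unfolding D2 nd[symmetric] by simp
    then show ?thesis by (simp only:) (intro has_bochner_integral_mult_right m0)
  qed
  show "integrable M (\<lambda>\<omega>. (D (\<beta> j r \<omega> - \<beta> j s \<omega>))\<^sup>2)" "expectation (\<lambda>\<omega>. (D (\<beta> j r \<omega> - \<beta> j s \<omega>))\<^sup>2) = exp (\<kappa>\<^sup>2 * (r - s))"
    using increment_expectation[OF sr _ 1, of j] Dm by auto
  have 2: "has_bochner_integral lborel (\<lambda>x. normal_density 0 (sqrt (r - s)) x * (D x * (x - \<kappa> * (r - s)))) 0"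
    using normal_moment_odd[OF \<sigma>, of "\<kappa> * (r - s)" 0] unfolding D_def by (simp add: nd mult.assoc[symmetric])
  show "integrable M (\<lambda>\<omega>. D (\<beta> j r \<omega> - \<beta> j s \<omega>) * (\<beta> j r \<omega> - \<beta> j s \<omega> - \<kappa> * (r - s)))"
    "expectation (\<lambda>\<omega>. D (\<beta> j r \<omega> - \<beta> j s \<omega>) * (\<beta> j r \<omega> - \<beta> j s \<omega> - \<kappa> * (r - s))) = 0"
    using increment_expectation[OF sr _ 2, of j] Dm by auto
  have 3: "has_bochner_integral lborel (\<lambda>x. normal_density 0 (sqrt (r - s)) x * (D x * (x - \<kappa> * (r - s))\<^sup>2)) (r - s)"
  proof -
    have "fact (2 * 1) / ((2 / (sqrt (r - s))\<^sup>2) ^ 1 * fact 1) = r - s" using sr by (simp add: fact_2)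
    from normal_moment_even[OF \<sigma>, of "\<kappa> * (r - s)" 1, unfolded this] show ?thesis
      unfolding D_def by (simp add: nd mult.assoc[symmetric])
  qed
  show "integrable M (\<lambda>\<omega>. D (\<beta> j r \<omega> - \<beta> j s \<omega>) * (\<beta> j r \<omega> - \<beta> j s \<omega> - \<kappa> * (r - s))\<^sup>2)"
    "expectation (\<lambda>\<omega>. D (\<beta> j r \<omega> - \<beta> j s \<omega>) * (\<beta> j r \<omega> - \<beta> j s \<omega> - \<kappa> * (r - s))\<^sup>2) = r - s"
    using increment_expectation[OF sr _ 3, of j] Dm by auto
qed

lemma increment_product:
  fixes f g :: "real \<Rightarrow> real"
  assumes sr: "0 \<le> s" "s \<le> r" and ij: "i \<noteq> j" and m: "f \<in> borel_measurable borel" "g \<in> borel_measurable borel"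
    and int: "integrable M (\<lambda>\<omega>. f (\<beta> i r \<omega> - \<beta> i s \<omega>))" "integrable M (\<lambda>\<omega>. g (\<beta> j r \<omega> - \<beta> j s \<omega>))"
  shows "integrable M (\<lambda>\<omega>. f (\<beta> i r \<omega> - \<beta> i s \<omega>) * g (\<beta> j r \<omega> - \<beta> j s \<omega>))"
    "expectation (\<lambda>\<omega>. f (\<beta> i r \<omega> - \<beta> i s \<omega>) * g (\<beta> j r \<omega> - \<beta> j s \<omega>))
      = expectation (\<lambda>\<omega>. f (\<beta> i r \<omega> - \<beta> i s \<omega>)) * expectation (\<lambda>\<omega>. g (\<beta> j r \<omega> - \<beta> j s \<omega>))"
proof -
  define X where "X k \<omega> = (if k = i then f else g) (\<beta> k r \<omega> - \<beta> k s \<omega>)" for k \<omega>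
  have "indep_vars (\<lambda>_. borel) X UNIV"
    unfolding X_def by (rule indep_vars_compose2[OF increment_indep[OF sr]]) (use m in auto)
  then have ind: "indep_vars (\<lambda>_. borel) X {i, j}" by (rule indep_vars_subset) simp
  have intX: "integrable M (X k)" if "k \<in> {i, j}" for k
    using that int ij unfolding X_def by auto
  have prod: "(\<Prod>k\<in>{i, j}. X k \<omega>) = f (\<beta> i r \<omega> - \<beta> i s \<omega>) * g (\<beta> j r \<omega> - \<beta> j s \<omega>)" for \<omega>
    using ij by (simp add: X_def)
  show "integrable M (\<lambda>\<omega>. f (\<beta> i r \<omega> - \<beta> i s \<omega>) * g (\<beta> j r \<omega> - \<beta> j s \<omega>))"
    using indep_vars_integrable[OF _ ind intX] unfolding prod by simp
  show "expectation (\<lambda>\<omega>. f (\<beta> i r \<omega> - \<beta> i s \<omega>) * g (\<beta> j r \<omega> - \<beta> j s \<omega>))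
      = expectation (\<lambda>\<omega>. f (\<beta> i r \<omega> - \<beta> i s \<omega>)) * expectation (\<lambda>\<omega>. g (\<beta> j r \<omega> - \<beta> j s \<omega>))"
    using indep_vars_lebesgue_integral[OF _ ind intX] ij unfolding prod by (simp add: X_def)
qed

text \<open>The Girsanov density for a shift in direction \<open>e j\<close> during the time
  \<open>h\<close>. For an increment \<open>v\<close> of \<open>W\<close>,
  \<open>v \<bullet> e j / sqrt (q j)\<close> is almost surely the increment of the standard process
  \<open>\<beta> j\<close>; expressed through \<open>W\<close> the density is adapted to the
  filtration.\<close>

definition weight :: "nat \<Rightarrow> real \<Rightarrow> real \<Rightarrow> 'a \<Rightarrow> real" where
  "weight j \<kappa> h v = exp (\<kappa> * (v \<bullet> e j / sqrt (q j)) - \<kappa>\<^sup>2 * h / 2)"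

text \<open>\<open>sqrt (q j) * \<kappa> * h\<close> is the mean that the coordinate
  \<open>j\<close> of an increment over time \<open>h\<close> has under the weight.\<close>

definition recentred :: "nat \<Rightarrow> real \<Rightarrow> real \<Rightarrow> 'a \<Rightarrow> 'a" where
  "recentred j \<kappa> h v = v - (sqrt (q j) * \<kappa> * h) *\<^sub>R e j"

lemma weight_measurable [measurable]: "weight j \<kappa> h \<in> borel_measurable borel"
  unfolding weight_def by measurable

lemma recentred_measurable [measurable]: "recentred j \<kappa> h \<in> borel_measurable borel"
  unfolding recentred_def by measurable

lemma weight_pos: "weight j \<kappa> h v > 0" by (simp add: weight_def)

text \<open>Under the weight the coordinate \<open>j\<close> of the recentred increment is a centred
  Gaussian with its old variance, and the other coordinates, being independent of the weight, keep
  their law. Parseval's identity adds the variances up to the trace.\<close>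

lemma weighted_increment:
  fixes \<kappa> :: real and j :: nat
  assumes sr: "0 \<le> s" "s < r"
  defines "w \<equiv> \<lambda>\<omega>. weight j \<kappa> (r - s) (W r \<omega> - W s \<omega>)" and "N \<equiv> \<lambda>\<omega>. recentred j \<kappa> (r - s) (W r \<omega> - W s \<omega>)"
  shows "integrable M w" "expectation w = 1"
    "integrable M (\<lambda>\<omega>. (w \<omega>)\<^sup>2)" "expectation (\<lambda>\<omega>. (w \<omega>)\<^sup>2) = exp (\<kappa>\<^sup>2 * (r - s))"
    "integrable M (\<lambda>\<omega>. w \<omega> * (norm (N \<omega>))\<^sup>2)" "expectation (\<lambda>\<omega>. w \<omega> * (norm (N \<omega>))\<^sup>2) = (r - s) * suminf q"
    "integrable M (\<lambda>\<omega>. w \<omega> *\<^sub>R N \<omega>)" "expectation (\<lambda>\<omega>. w \<omega> *\<^sub>R N \<omega>) = 0"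
proof -
  have [measurable]: "(\<lambda>\<omega>. W r \<omega> - W s \<omega>) \<in> borel_measurable M" using sr by (intro W_increment_measurable) auto
  have [measurable]: "w \<in> borel_measurable M" "N \<in> borel_measurable M" unfolding w_def N_def by measurable
  define D where "D x = exp (\<kappa> * x - \<kappa>\<^sup>2 * (r - s) / 2)" for x
  have Dm: "D \<in> borel_measurable borel" unfolding D_def by measurable
  define g where "g i \<omega> = \<beta> i r \<omega> - \<beta> i s \<omega>" for i \<omega>
  have [measurable]: "g i \<in> borel_measurable M" for i unfolding g_def using sr by (intro increment_measurable) auto
  note em = increment_exp_moments[OF sr, where \<kappa> = \<kappa>, folded D_def g_def]
  note mo = increment_moments[OF sr, folded g_def]
  note pr = increment_product[OF sr(1) less_imp_le[OF sr(2)], folded g_def]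
  have co: "AE \<omega> in M. \<forall>i. (W r \<omega> - W s \<omega>) \<bullet> e i = sqrt (q i) * g i \<omega>"
    unfolding g_def using sr by (intro W_increment_coordinate) auto
  have wD: "AE \<omega> in M. w \<omega> = D (g j \<omega>)"
    using co by eventually_elim (use q_pos[of j] in \<open>simp add: w_def weight_def D_def\<close>)
  have Nc: "AE \<omega> in M. \<forall>i. N \<omega> \<bullet> e i = sqrt (q i) * (g i \<omega> - (if i = j then \<kappa> * (r - s) else 0))"
    using co by eventually_elim (simp add: N_def recentred_def inner_diff_left orthonormal algebra_simps)
  have w0: "w \<omega> > 0" for \<omega> unfolding w_def by (rule weight_pos)
  show "integrable M w" using em(1)[of j] by (subst integrable_cong_AE[OF _ _ wD]) (use Dm in auto)
  show "expectation w = 1" using em(2)[of j] by (subst integral_cong_AE[OF _ _ wD]) (use Dm in auto)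
  have wD2: "AE \<omega> in M. (w \<omega>)\<^sup>2 = (D (g j \<omega>))\<^sup>2" using wD by eventually_elim simp
  show "integrable M (\<lambda>\<omega>. (w \<omega>)\<^sup>2)" using em(3)[of j] by (subst integrable_cong_AE[OF _ _ wD2]) (use Dm in auto)
  show "expectation (\<lambda>\<omega>. (w \<omega>)\<^sup>2) = exp (\<kappa>\<^sup>2 * (r - s))" using em(4)[of j] by (subst integral_cong_AE[OF _ _ wD2]) (use Dm in auto)
  have one: "integrable M (\<lambda>\<omega>. w \<omega> * (N \<omega> \<bullet> e i)) \<and> expectation (\<lambda>\<omega>. w \<omega> * (N \<omega> \<bullet> e i)) = 0
    \<and> integrable M (\<lambda>\<omega>. w \<omega> * (N \<omega> \<bullet> e i)\<^sup>2) \<and> expectation (\<lambda>\<omega>. w \<omega> * (N \<omega> \<bullet> e i)\<^sup>2) = (r - s) * q i" for i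
  proof -
    define m where "m = (if i = j then \<kappa> * (r - s) else 0)"
    have c: "integrable M (\<lambda>\<omega>. D (g j \<omega>) * (g i \<omega> - m))" "expectation (\<lambda>\<omega>. D (g j \<omega>) * (g i \<omega> - m)) = 0"
      "integrable M (\<lambda>\<omega>. D (g j \<omega>) * (g i \<omega> - m)\<^sup>2)" "expectation (\<lambda>\<omega>. D (g j \<omega>) * (g i \<omega> - m)\<^sup>2) = r - s"
    proof -
      show "integrable M (\<lambda>\<omega>. D (g j \<omega>) * (g i \<omega> - m))"
        using em(5)[of j] pr(1)[of j i D "\<lambda>x. x"] em(1)[of j] mo(1)[of i] Dm by (cases "i = j") (auto simp: m_def)
      show "expectation (\<lambda>\<omega>. D (g j \<omega>) * (g i \<omega> - m)) = 0"
        using em(6)[of j] pr(2)[of j i D "\<lambda>x. x"] em(1)[of j] mo(1,2)[of i] Dm by (cases "i = j") (auto simp: m_def)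
      show "integrable M (\<lambda>\<omega>. D (g j \<omega>) * (g i \<omega> - m)\<^sup>2)"
        using em(7)[of j] pr(1)[of j i D "\<lambda>x. x\<^sup>2"] em(1)[of j] mo(3)[of i] Dm by (cases "i = j") (auto simp: m_def)
      show "expectation (\<lambda>\<omega>. D (g j \<omega>) * (g i \<omega> - m)\<^sup>2) = r - s"
        using em(8)[of j] pr(2)[of j i D "\<lambda>x. x\<^sup>2"] em(1,2)[of j] mo(3,4)[of i] Dm by (cases "i = j") (auto simp: m_def)
    qed
    have ae1: "AE \<omega> in M. w \<omega> * (N \<omega> \<bullet> e i) = sqrt (q i) * (D (g j \<omega>) * (g i \<omega> - m))"
      using wD Nc by eventually_elim (simp add: m_def)
    have ae2: "AE \<omega> in M. w \<omega> * (N \<omega> \<bullet> e i)\<^sup>2 = q i * (D (g j \<omega>) * (g i \<omega> - m)\<^sup>2)"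
      using wD Nc by eventually_elim (use q_pos[of i] in \<open>simp add: m_def power_mult_distrib\<close>)
    have meas: "(\<lambda>\<omega>. w \<omega> * (N \<omega> \<bullet> e i)) \<in> borel_measurable M" "(\<lambda>\<omega>. w \<omega> * (N \<omega> \<bullet> e i)\<^sup>2) \<in> borel_measurable M"
      "(\<lambda>\<omega>. sqrt (q i) * (D (g j \<omega>) * (g i \<omega> - m))) \<in> borel_measurable M"
      "(\<lambda>\<omega>. q i * (D (g j \<omega>) * (g i \<omega> - m)\<^sup>2)) \<in> borel_measurable M" using Dm by measurable
    show ?thesis
      unfolding integrable_cong_AE[OF meas(1,3) ae1] integral_cong_AE[OF meas(1,3) ae1]
        integrable_cong_AE[OF meas(2,4) ae2] integral_cong_AE[OF meas(2,4) ae2]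
      using c by simp
  qed
  have q0: "0 \<le> (r - s) * q i" for i using sr q_pos[of i] by simp
  \<comment> \<open>Sum and expectation are interchanged by monotone convergence, before
    integrability of the squared norm is known.\<close>
  have nn: "(\<integral>\<^sup>+\<omega>. ennreal (w \<omega> * (norm (N \<omega>))\<^sup>2) \<partial>M) = ennreal ((r - s) * suminf q)"
  proof -
    have "(\<integral>\<^sup>+\<omega>. ennreal (w \<omega> * (norm (N \<omega>))\<^sup>2) \<partial>M) = (\<integral>\<^sup>+\<omega>. (\<Sum>i. ennreal (w \<omega> * (N \<omega> \<bullet> e i)\<^sup>2)) \<partial>M)"
    proof (rule nn_integral_cong)
      fix \<omega>
      have "(\<lambda>i. w \<omega> * (N \<omega> \<bullet> e i)\<^sup>2) sums (w \<omega> * (norm (N \<omega>))\<^sup>2)" by (intro sums_mult parseval)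
      then show "ennreal (w \<omega> * (norm (N \<omega>))\<^sup>2) = (\<Sum>i. ennreal (w \<omega> * (N \<omega> \<bullet> e i)\<^sup>2))"
        using w0[of \<omega>] by (subst suminf_ennreal2) (auto simp: sums_iff intro!: mult_nonneg_nonneg less_imp_le)
    qed
    also have "\<dots> = (\<Sum>i. \<integral>\<^sup>+\<omega>. ennreal (w \<omega> * (N \<omega> \<bullet> e i)\<^sup>2) \<partial>M)"
      by (rule nn_integral_suminf) measurable
    also have "\<dots> = (\<Sum>i. ennreal ((r - s) * q i))"
    proof (rule arg_cong[where f = suminf], rule ext)
      fix i
      show "(\<integral>\<^sup>+\<omega>. ennreal (w \<omega> * (N \<omega> \<bullet> e i)\<^sup>2) \<partial>M) = ennreal ((r - s) * q i)"
        using one[of i] by (subst nn_integral_eq_integral) (auto intro!: AE_I2 mult_nonneg_nonneg less_imp_le[OF w0])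
    qed
    also have "\<dots> = ennreal ((r - s) * suminf q)"
      using q0 q_summable by (subst suminf_ennreal2) (auto simp: suminf_mult intro: summable_mult)
    finally show ?thesis .
  qed
  have wN2: "0 \<le> w \<omega> * (norm (N \<omega>))\<^sup>2" for \<omega> using w0[of \<omega>] by (simp add: less_imp_le)
  show int2: "integrable M (\<lambda>\<omega>. w \<omega> * (norm (N \<omega>))\<^sup>2)"
    by (rule integrableI_nonneg) (use nn wN2 in auto)
  have "0 \<le> (r - s) * suminf q" using sr suminf_nonneg[OF q_summable] q_pos by (intro mult_nonneg_nonneg) (auto intro: less_imp_le)
  then show "expectation (\<lambda>\<omega>. w \<omega> * (norm (N \<omega>))\<^sup>2) = (r - s) * suminf q"
    using nn wN2 by (subst integral_eq_nn_integral) auto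
  show intN: "integrable M (\<lambda>\<omega>. w \<omega> *\<^sub>R N \<omega>)"
  proof (rule Bochner_Integration.integrable_bound)
    show "integrable M (\<lambda>\<omega>. w \<omega> + w \<omega> * (norm (N \<omega>))\<^sup>2)" using int2 \<open>integrable M w\<close> by simp
    show "AE \<omega> in M. norm (w \<omega> *\<^sub>R N \<omega>) \<le> norm (w \<omega> + w \<omega> * (norm (N \<omega>))\<^sup>2)"
    proof (intro AE_I2)
      fix \<omega>
      have "norm (N \<omega>) \<le> 1 + (norm (N \<omega>))\<^sup>2" using zero_le_power2[of "norm (N \<omega>) - 1/2"] by (simp add: power2_eq_square algebra_simps)
      then have "w \<omega> * norm (N \<omega>) \<le> w \<omega> * (1 + (norm (N \<omega>))\<^sup>2)" using w0[of \<omega>] by (intro mult_left_mono) auto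
      then show "norm (w \<omega> *\<^sub>R N \<omega>) \<le> norm (w \<omega> + w \<omega> * (norm (N \<omega>))\<^sup>2)"
        using w0[of \<omega>] by (simp add: algebra_simps abs_if not_less)
    qed
  qed measurable
  show "expectation (\<lambda>\<omega>. w \<omega> *\<^sub>R N \<omega>) = 0"
  proof (rule eq_if_coordinates_eq)
    fix i
    have "expectation (\<lambda>\<omega>. w \<omega> *\<^sub>R N \<omega>) \<bullet> e i = expectation (\<lambda>\<omega>. (w \<omega> *\<^sub>R N \<omega>) \<bullet> e i)"
      using intN by (intro integral_inner_left[symmetric]) auto
    then show "expectation (\<lambda>\<omega>. w \<omega> *\<^sub>R N \<omega>) \<bullet> e i = 0 \<bullet> e i" using one[of i] by simp
  qed
qed

text \<open>In the expansion of the square, symmetry moves \<open>G\<close> from the increment to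
  \<open>x\<close> in the cross term, whose weighted mean is then 0; in the quadratic term
  \<open>G\<close> is dropped as a contraction, which leaves the trace.\<close>

lemma weighted_increment_energy:
  assumes sr: "0 \<le> s" "s < r" and G: "linear G" "\<And>x. norm (G x) \<le> norm x" "\<And>x y. G x \<bullet> y = x \<bullet> G y"
  shows "(\<integral>\<^sup>+\<omega>. ennreal (weight j \<kappa> (r - s) (W r \<omega> - W s \<omega>) * (norm (x + G (recentred j \<kappa> (r - s) (W r \<omega> - W s \<omega>))))\<^sup>2) \<partial>M)
     \<le> ennreal ((norm x)\<^sup>2 + (r - s) * suminf q)"
proof -
  define w where "w = (\<lambda>\<omega>. weight j \<kappa> (r - s) (W r \<omega> - W s \<omega>))"
  define N where "N = (\<lambda>\<omega>. recentred j \<kappa> (r - s) (W r \<omega> - W s \<omega>))"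
  have wN: "weight j \<kappa> (r - s) (W r \<omega> - W s \<omega>) = w \<omega>" "recentred j \<kappa> (r - s) (W r \<omega> - W s \<omega>) = N \<omega>" for \<omega>
    by (simp_all add: w_def N_def)
  note f = weighted_increment[OF sr, of j \<kappa>, unfolded wN]
  have w0: "0 \<le> w \<omega>" for \<omega> unfolding w_def using weight_pos less_imp_le by blast
  define U where "U \<omega> = w \<omega> * (norm x)\<^sup>2 + 2 * (G x \<bullet> (w \<omega> *\<^sub>R N \<omega>)) + w \<omega> * (norm (N \<omega>))\<^sup>2" for \<omega>
  have "w \<omega> * (norm (x + G (N \<omega>)))\<^sup>2 \<le> U \<omega>" for \<omega>
  proof -
    have "(norm (x + G (N \<omega>)))\<^sup>2 = (norm x)\<^sup>2 + 2 * (G x \<bullet> N \<omega>) + (norm (G (N \<omega>)))\<^sup>2"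
      using G(3)[of x "N \<omega>"] unfolding power2_norm_eq_inner by (simp add: inner_add_left inner_add_right inner_commute)
    also have "\<dots> \<le> (norm x)\<^sup>2 + 2 * (G x \<bullet> N \<omega>) + (norm (N \<omega>))\<^sup>2"
      using power_mono[OF G(2)[of "N \<omega>"], of 2] by simp
    finally have "w \<omega> * (norm (x + G (N \<omega>)))\<^sup>2 \<le> w \<omega> * ((norm x)\<^sup>2 + 2 * (G x \<bullet> N \<omega>) + (norm (N \<omega>))\<^sup>2)"
      using w0 by (intro mult_left_mono)
    also have "\<dots> = U \<omega>" by (simp add: U_def algebra_simps)
    finally show ?thesis .
  qed
  then have "(\<integral>\<^sup>+\<omega>. ennreal (w \<omega> * (norm (x + G (N \<omega>)))\<^sup>2) \<partial>M) \<le> (\<integral>\<^sup>+\<omega>. ennreal (U \<omega>) \<partial>M)"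
    by (intro nn_integral_mono ennreal_leI)
  also have "\<dots> = ennreal (expectation U)"
  proof (rule nn_integral_eq_integral)
    show "integrable M U" unfolding U_def using f by (intro Bochner_Integration.integrable_add integrable_mult_left integrable_mult_right integrable_inner_right) auto
    have "0 \<le> U \<omega>" for \<omega>
    proof -
      have "0 \<le> w \<omega> * (norm (x + G (N \<omega>)))\<^sup>2" using w0 by simp
      also have "\<dots> \<le> U \<omega>" by fact
      finally show ?thesis .
    qed
    then show "AE \<omega> in M. 0 \<le> U \<omega>" by simp
  qed
  also have "expectation U = (norm x)\<^sup>2 + (r - s) * suminf q"
  proof -
    have i1: "integrable M (\<lambda>\<omega>. w \<omega> * (norm x)\<^sup>2)" and i2: "integrable M (\<lambda>\<omega>. 2 * (G x \<bullet> (w \<omega> *\<^sub>R N \<omega>)))"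
      using f by (auto intro!: integrable_mult_left integrable_mult_right integrable_inner_right simp del: inner_scaleR_right)
    have "expectation U = expectation (\<lambda>\<omega>. w \<omega> * (norm x)\<^sup>2) + expectation (\<lambda>\<omega>. 2 * (G x \<bullet> (w \<omega> *\<^sub>R N \<omega>))) + expectation (\<lambda>\<omega>. w \<omega> * (norm (N \<omega>))\<^sup>2)"
      unfolding U_def Bochner_Integration.integral_add[OF Bochner_Integration.integrable_add[OF i1 i2] f(5)]
        Bochner_Integration.integral_add[OF i1 i2] ..
    also have "expectation (\<lambda>\<omega>. 2 * (G x \<bullet> (w \<omega> *\<^sub>R N \<omega>))) = 2 * (G x \<bullet> expectation (\<lambda>\<omega>. w \<omega> *\<^sub>R N \<omega>))"
      using f by (subst integral_mult_right_zero, subst integral_inner_right) auto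
    finally show ?thesis using f by simp
  qed
  finally show ?thesis unfolding w_def N_def .
qed

end

section \<open>Paths of the variational solution\<close>

text \<open>The process is the pointwise limit of its values at the grid times
  \<open>floor ((n + 1) t) / (n + 1)\<close>, and each approximation is pieced together from
  countably many random variables.\<close>

lemma continuous_process_jointly_measurable:
  fixes Z :: "real \<Rightarrow> 'w \<Rightarrow> 'b::metric_space"
  assumes m: "\<And>t. Z t \<in> borel_measurable M" and c: "\<And>\<omega>. \<omega> \<in> space M \<Longrightarrow> continuous_on UNIV (\<lambda>t. Z t \<omega>)"
  shows "(\<lambda>p. Z (fst p) (snd p)) \<in> borel_measurable (borel \<Otimes>\<^sub>M M)"
proof (rule borel_measurable_LIMSEQ_metric)
  fix n :: nat
  show "(\<lambda>p. Z (real_of_int \<lfloor>real (Suc n) * fst p\<rfloor> / real (Suc n)) (snd p)) \<in> borel_measurable (borel \<Otimes>\<^sub>M M)"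
  proof (rule measurable_compose_countable[where f = "\<lambda>i p. Z (real_of_int i / real (Suc n)) (snd p)" and g = "\<lambda>p. \<lfloor>real (Suc n) * fst p\<rfloor>"])
    show "(\<lambda>p. Z (real_of_int i / real (Suc n)) (snd p)) \<in> borel_measurable (borel \<Otimes>\<^sub>M M)" for i
      by (rule measurable_compose[OF measurable_snd m])
    show "(\<lambda>p. \<lfloor>real (Suc n) * fst p\<rfloor>) \<in> measurable (borel \<Otimes>\<^sub>M M) (count_space UNIV)" by measurable
  qed
next
  fix p :: "real \<times> 'w" assume "p \<in> space (borel \<Otimes>\<^sub>M M)"
  then have \<omega>: "snd p \<in> space M" by (auto simp: space_pair_measure)
  have *: "\<bar>real_of_int \<lfloor>real (Suc n) * x\<rfloor> / real (Suc n) - x\<bar> \<le> 1 / real (Suc n)" for n x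
  proof -
    have "\<bar>real_of_int \<lfloor>real (Suc n) * x\<rfloor> - real (Suc n) * x\<bar> \<le> 1" by linarith
    then have "\<bar>(real_of_int \<lfloor>real (Suc n) * x\<rfloor> - real (Suc n) * x) / real (Suc n)\<bar> \<le> 1 / real (Suc n)"
      unfolding abs_divide by (simp add: divide_right_mono)
    then show ?thesis by (simp add: diff_divide_distrib)
  qed
  have "(\<lambda>n. real_of_int \<lfloor>real (Suc n) * fst p\<rfloor> / real (Suc n) - fst p) \<longlonglongrightarrow> 0"
    by (rule Lim_null_comparison[OF _ LIMSEQ_Suc[OF lim_1_over_n]]) (use * in auto)
  then have "(\<lambda>n. real_of_int \<lfloor>real (Suc n) * fst p\<rfloor> / real (Suc n)) \<longlonglongrightarrow> fst p" by (rule LIM_zero_cancel)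
  moreover have "isCont (\<lambda>t. Z t (snd p)) (fst p)" using c[OF \<omega>] by (simp add: continuous_on_eq_continuous_at)
  ultimately show "(\<lambda>n. Z (real_of_int \<lfloor>real (Suc n) * fst p\<rfloor> / real (Suc n)) (snd p)) \<longlonglongrightarrow> Z (fst p) (snd p)"
    by (rule isCont_tendsto_compose[rotated])
qed

lemma abs_set_integral_le_AE:
  fixes f g :: "real \<Rightarrow> real"
  assumes f: "set_integrable lborel A f" and g: "set_integrable lborel A g"
    and le: "AE x in lborel. x \<in> A \<longrightarrow> \<bar>f x\<bar> \<le> g x"
  shows "\<bar>LINT x:A|lborel. f x\<bar> \<le> (LINT x:A|lborel. g x)"
proof -
  have "(LINT x:A|lborel. f x) \<le> (LINT x:A|lborel. g x)"
    unfolding set_lebesgue_integral_def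
  proof (rule integral_mono_AE)
    show "AE x in lborel. indicator A x *\<^sub>R f x \<le> indicator A x *\<^sub>R g x"
      using le by eventually_elim (auto simp: indicator_def)
  qed (use f g in \<open>auto simp: set_integrable_def\<close>)
  moreover have "(LINT x:A|lborel. - g x) \<le> (LINT x:A|lborel. f x)"
    unfolding set_lebesgue_integral_def
  proof (rule integral_mono_AE)
    show "AE x in lborel. indicator A x *\<^sub>R (- g x) \<le> indicator A x *\<^sub>R f x"
      using le by eventually_elim (auto simp: indicator_def)
  qed (use f g in \<open>auto simp: set_integrable_def\<close>)
  ultimately show ?thesis by (simp add: set_lebesgue_integral_def)
qed

locale spde = hilbert_wiener_initial M e q W \<beta> \<eta>
  for M :: "'w measure" and e :: "nat \<Rightarrow> 'a::{real_inner, banach, second_countable_topology}" and q W \<beta> \<eta> +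
  fixes DA V :: "'a set" and A S F :: "'a \<Rightarrow> 'a" and T C K :: real and X Y :: "real \<Rightarrow> 'w \<Rightarrow> 'a"
  assumes T_pos: "T > 0"
    and F_bound: "norm (F x) \<le> C"
    and A_selfadjoint: "selfadjoint_operator DA A"
    and A_nonpos: "x \<in> DA \<Longrightarrow> A x \<bullet> x \<le> 0"
    and S_sqrt: "sqrt_of_minus DA A V S"
    and e_in_V: "e i \<in> V"
    and X_continuous: "\<omega> \<in> space M \<Longrightarrow> continuous_on {0..T} (\<lambda>t. X t \<omega>)"
    and X_adapted: "t \<in> {0..T} \<Longrightarrow> X t \<in> borel_measurable (filtration M \<eta> W t)"
    and Y_version: "V_version M (filtration M \<eta> W) V S T X Y"
    and equation: "AE \<omega> in M. \<forall>t\<in>{0..T}. \<forall>v\<in>V. set_integrable lborel {0..t} (\<lambda>s. drift S F (Y s \<omega>) v) \<and>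
           X t \<omega> \<bullet> v = \<eta> \<omega> \<bullet> v + W t \<omega> \<bullet> v + (LINT s:{0..t}|lborel. drift S F (Y s \<omega>) v)"
    and X_moment: "t \<in> {0..T} \<Longrightarrow> (\<integral>\<^sup>+\<omega>. ennreal ((norm (X t \<omega>))\<^sup>2) \<partial>M) \<le> ennreal K"
    and K_nonneg: "K \<ge> 0"
begin

lemma C_nonneg: "C \<ge> 0" using F_bound[of 0] norm_ge_zero order_trans by blast

lemma A_linear: "subspace DA" "x \<in> DA \<Longrightarrow> y \<in> DA \<Longrightarrow> A (x + y) = A x + A y" "x \<in> DA \<Longrightarrow> A (c *\<^sub>R x) = c *\<^sub>R A x"
  and A_dense: "closure DA = UNIV" and A_symmetric: "x \<in> DA \<Longrightarrow> y \<in> DA \<Longrightarrow> A x \<bullet> y = x \<bullet> A y"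
  using A_selfadjoint unfolding selfadjoint_operator_def linear_operator_def by auto

lemma S_selfadjoint: "selfadjoint_operator V S" and DA_eq: "DA = {x \<in> V. S x \<in> V}"
  and S_S: "x \<in> DA \<Longrightarrow> S (S x) = - A x"
  using S_sqrt unfolding sqrt_of_minus_def by auto

lemma S_symmetric: "x \<in> V \<Longrightarrow> y \<in> V \<Longrightarrow> S x \<bullet> y = x \<bullet> S y"
  using S_selfadjoint unfolding selfadjoint_operator_def by auto

lemma V_borel: "V \<in> sets borel"
  by (rule selfadjoint_domain_borel[OF S_selfadjoint e_in_V])

lemma X_measurable: "t \<in> {0..T} \<Longrightarrow> X t \<in> borel_measurable M"
  using X_adapted filtration_measurable by blast

text \<open>The process is frozen outside \<open>{0..T}\<close>, so that it is continuous and
  jointly measurable on the whole time line.\<close>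

definition XT :: "real \<Rightarrow> 'w \<Rightarrow> 'a" where "XT t = X (max 0 (min T t))"

lemma XT_eq: "t \<in> {0..T} \<Longrightarrow> XT t = X t" by (simp add: XT_def)

lemma XT_jointly_measurable: "(\<lambda>p. XT (fst p) (snd p)) \<in> borel_measurable (borel \<Otimes>\<^sub>M M)"
proof (rule continuous_process_jointly_measurable)
  show "XT t \<in> borel_measurable M" for t unfolding XT_def using T_pos by (intro X_measurable) auto
  show "continuous_on UNIV (\<lambda>t. XT t \<omega>)" if "\<omega> \<in> space M" for \<omega>
    unfolding XT_def using T_pos
    by (intro continuous_on_compose2[OF X_continuous[OF that]] continuous_intros) auto
qed

lemma XT_measurable: "XT t \<in> borel_measurable M"
  unfolding XT_def using T_pos by (intro X_measurable) auto

lemma XT_moment: "(\<integral>\<^sup>+\<omega>. ennreal ((norm (XT t \<omega>))\<^sup>2) \<partial>M) \<le> ennreal K"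
  unfolding XT_def using T_pos by (intro X_moment) auto

lemma X_integrable: "0 \<le> s \<Longrightarrow> r \<le> T \<Longrightarrow> \<omega> \<in> space M \<Longrightarrow> continuous_on {s..r} (\<lambda>\<sigma>. X \<sigma> \<omega>)"
  by (rule continuous_on_subset[OF X_continuous]) auto

lemma sigma_finite_time: "sigma_finite_measure (restrict_space lborel {0..T})"
  by (rule sigma_finite_measure_restrict_space) (auto simp: sigma_finite_lborel)

text \<open>Fubini's theorem with the path as outer variable: the exceptional null set of the
  product has null time sections for almost every path.\<close>

lemma Y_AE: "AE \<omega> in M. AE s in lborel. s \<in> {0..T} \<longrightarrow> Y s \<omega> = X s \<omega>"
proof -
  interpret I: sigma_finite_measure "restrict_space lborel {0..T}" by (rule sigma_finite_time)
  interpret P: pair_sigma_finite "restrict_space lborel {0..T}" M ..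
  have "AE p in restrict_space lborel {0..T} \<Otimes>\<^sub>M M. Y (fst p) (snd p) = X (fst p) (snd p)"
    using Y_version unfolding V_version_def by (simp add: case_prod_beta)
  then obtain N where N: "N \<in> null_sets (restrict_space lborel {0..T} \<Otimes>\<^sub>M M)"
    "{p \<in> space (restrict_space lborel {0..T} \<Otimes>\<^sub>M M). \<not> (Y (fst p) (snd p) = X (fst p) (snd p))} \<subseteq> N"
    unfolding eventually_ae_filter by blast
  have set: "{x \<in> space (restrict_space lborel {0..T} \<Otimes>\<^sub>M M). (fst x, snd x) \<notin> N} \<in> sets (restrict_space lborel {0..T} \<Otimes>\<^sub>M M)"
    using N(1) by (auto simp: set_diff_eq[symmetric] intro!: sets.Diff)
  have "AE p in restrict_space lborel {0..T} \<Otimes>\<^sub>M M. (fst p, snd p) \<notin> N" using AE_not_in[OF N(1)] by simp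
  then have "AE s in restrict_space lborel {0..T}. AE \<omega> in M. (s, \<omega>) \<notin> N"
    using P.AE_pair_iff[OF set] by simp
  then have "AE \<omega> in M. AE s in restrict_space lborel {0..T}. (s, \<omega>) \<notin> N"
    using P.AE_commute[OF set] by simp
  with AE_space show ?thesis
  proof eventually_elim
    case (elim \<omega>)
    from elim(2) have "AE s in lborel. s \<in> {0..T} \<longrightarrow> (s, \<omega>) \<notin> N" by (subst (asm) AE_restrict_space_iff) auto
    then show ?case
    proof eventually_elim
      case (elim s)
      show ?case
      proof
        assume "s \<in> {0..T}"
        then have "(s, \<omega>) \<in> space (restrict_space lborel {0..T} \<Otimes>\<^sub>M M)" "(s, \<omega>) \<notin> N"
          using \<open>\<omega> \<in> space M\<close> elim by (auto simp: space_pair_measure space_restrict_space)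
        then show "Y s \<omega> = X s \<omega>" using N(2) by auto
      qed
    qed
  qed
qed

lemma Y_in_V: "t \<in> {0..T} \<Longrightarrow> \<omega> \<in> space M \<Longrightarrow> Y t \<omega> \<in> V"
  using Y_version unfolding V_version_def by blast

lemma equation_increment:
  "AE \<omega> in M. \<forall>s r. 0 \<le> s \<longrightarrow> s \<le> r \<longrightarrow> r \<le> T \<longrightarrow> (\<forall>v\<in>V.
    set_integrable lborel {s..r} (\<lambda>\<sigma>. drift S F (Y \<sigma> \<omega>) v) \<and>
    (X r \<omega> - X s \<omega>) \<bullet> v = (W r \<omega> - W s \<omega>) \<bullet> v + (LINT \<sigma>:{s..r}|lborel. drift S F (Y \<sigma> \<omega>) v))"
  using equation
proof eventually_elim
  case (elim \<omega>)
  show ?case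
  proof (intro allI impI ballI)
    fix s r v assume sr: "0 \<le> s" "s \<le> r" "r \<le> T" and v: "v \<in> V"
    have i: "set_integrable lborel {0..r} (\<lambda>\<sigma>. drift S F (Y \<sigma> \<omega>) v)"
      and er: "X r \<omega> \<bullet> v = \<eta> \<omega> \<bullet> v + W r \<omega> \<bullet> v + (LINT s:{0..r}|lborel. drift S F (Y s \<omega>) v)"
      and es: "X s \<omega> \<bullet> v = \<eta> \<omega> \<bullet> v + W s \<omega> \<bullet> v + (LINT s:{0..s}|lborel. drift S F (Y s \<omega>) v)"
      using elim sr v by auto
    have i0: "set_integrable lborel {0..s} (\<lambda>\<sigma>. drift S F (Y \<sigma> \<omega>) v)"
      and ir: "set_integrable lborel {s..r} (\<lambda>\<sigma>. drift S F (Y \<sigma> \<omega>) v)"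
      using sr by (auto intro!: set_integrable_subset[OF i])
    have "(LINT \<sigma>:{0..s} \<union> {s..r}|lborel. drift S F (Y \<sigma> \<omega>) v)
      = (LINT \<sigma>:{0..s}|lborel. drift S F (Y \<sigma> \<omega>) v) + (LINT \<sigma>:{s..r}|lborel. drift S F (Y \<sigma> \<omega>) v)"
    proof (rule set_integral_Un_AE[OF _ _ _ i0 ir])
      show "AE x in lborel. \<not> (x \<in> {0..s} \<and> x \<in> {s..r})"
        using AE_lborel_singleton[of s] by eventually_elim auto
    qed auto
    moreover have "{0..s} \<union> {s..r} = {0..r}" using sr by auto
    ultimately show "set_integrable lborel {s..r} (\<lambda>\<sigma>. drift S F (Y \<sigma> \<omega>) v) \<and>
      (X r \<omega> - X s \<omega>) \<bullet> v = (W r \<omega> - W s \<omega>) \<bullet> v + (LINT \<sigma>:{s..r}|lborel. drift S F (Y \<sigma> \<omega>) v)"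
      using ir er es by (simp add: inner_diff_left)
  qed
qed

text \<open>For \<open>v\<close> in \<open>DA\<close> both square roots move onto \<open>v\<close>,
  as \<open>S (Y \<sigma> \<omega>) \<bullet> S v = - (X \<sigma> \<omega> \<bullet> A v)\<close>.
  The version \<open>Y\<close> and the values of \<open>F\<close> leave the estimate; what remains
  is the continuous path of \<open>X\<close> and the bound \<open>C\<close>. One null event serves
  all times and all \<open>v\<close>.\<close>

lemma equation_domain:
  "AE \<omega> in M. \<forall>s r. 0 \<le> s \<longrightarrow> s \<le> r \<longrightarrow> r \<le> T \<longrightarrow> (\<forall>v\<in>DA.
    \<bar>(X r \<omega> - X s \<omega>) \<bullet> v - (W r \<omega> - W s \<omega>) \<bullet> v - (LINT \<sigma>:{s..r}|lborel. X \<sigma> \<omega> \<bullet> A v)\<bar> \<le> C * norm v * (r - s))"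
  using equation_increment Y_AE AE_space
proof eventually_elim
  case (elim \<omega>)
  show ?case
  proof (intro allI impI ballI)
    fix s r v assume sr: "0 \<le> s" "s \<le> r" "r \<le> T" and v: "v \<in> DA"
    then have vV: "v \<in> V" "S v \<in> V" using DA_eq by auto
    have i: "set_integrable lborel {s..r} (\<lambda>\<sigma>. drift S F (Y \<sigma> \<omega>) v)"
      and eq: "(X r \<omega> - X s \<omega>) \<bullet> v = (W r \<omega> - W s \<omega>) \<bullet> v + (LINT \<sigma>:{s..r}|lborel. drift S F (Y \<sigma> \<omega>) v)"
      using elim(1) sr vV(1) by blast+
    have iX: "set_integrable lborel {s..r} (\<lambda>\<sigma>. X \<sigma> \<omega> \<bullet> A v)"
      using sr elim(3) by (intro borel_integrable_atLeastAtMost' continuous_intros X_integrable) auto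
    have ic: "set_integrable lborel {s..r} (\<lambda>\<sigma>. C * norm v)"
      by (intro borel_integrable_atLeastAtMost' continuous_intros)
    have "\<bar>LINT \<sigma>:{s..r}|lborel. drift S F (Y \<sigma> \<omega>) v - X \<sigma> \<omega> \<bullet> A v\<bar> \<le> (LINT \<sigma>:{s..r}|lborel. C * norm v)"
    proof (rule abs_set_integral_le_AE[OF set_integral_diff(1)[OF i iX] ic])
      show "AE \<sigma> in lborel. \<sigma> \<in> {s..r} \<longrightarrow> \<bar>drift S F (Y \<sigma> \<omega>) v - X \<sigma> \<omega> \<bullet> A v\<bar> \<le> C * norm v"
        using elim(2)
      proof eventually_elim
        case (elim \<sigma>)
        show ?case
        proof
          assume "\<sigma> \<in> {s..r}"
          then have \<sigma>: "\<sigma> \<in> {0..T}" using sr by auto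
          have Y: "Y \<sigma> \<omega> \<in> V" "Y \<sigma> \<omega> = X \<sigma> \<omega>" using Y_in_V[OF \<sigma> \<open>\<omega> \<in> space M\<close>] elim \<sigma> by auto
          have "S (Y \<sigma> \<omega>) \<bullet> S v = Y \<sigma> \<omega> \<bullet> S (S v)" by (rule S_symmetric[OF Y(1) vV(2)])
          also have "\<dots> = - (X \<sigma> \<omega> \<bullet> A v)" using S_S[OF v] Y(2) by simp
          finally have "drift S F (Y \<sigma> \<omega>) v - X \<sigma> \<omega> \<bullet> A v = F (Y \<sigma> \<omega>) \<bullet> v" by (simp add: drift_def)
          moreover have "\<bar>F (Y \<sigma> \<omega>) \<bullet> v\<bar> \<le> norm (F (Y \<sigma> \<omega>)) * norm v" by (rule Cauchy_Schwarz_ineq2)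
          moreover have "norm (F (Y \<sigma> \<omega>)) * norm v \<le> C * norm v" using F_bound by (intro mult_right_mono) auto
          ultimately show "\<bar>drift S F (Y \<sigma> \<omega>) v - X \<sigma> \<omega> \<bullet> A v\<bar> \<le> C * norm v" by simp
        qed
      qed
    qed
    also have "(LINT \<sigma>:{s..r}|lborel. C * norm v) = C * norm v * (r - s)"
      using sr by (simp add: set_lebesgue_integral_def)
    finally show "\<bar>(X r \<omega> - X s \<omega>) \<bullet> v - (W r \<omega> - W s \<omega>) \<bullet> v - (LINT \<sigma>:{s..r}|lborel. X \<sigma> \<omega> \<bullet> A v)\<bar> \<le> C * norm v * (r - s)"
      using set_integral_diff(2)[OF i iX] eq by simp
  qed
qed

end

section \<open>The energy estimate under a weight\<close>

text \<open>This is where the truncation pays: the drift error \<open>a * u\<close> contains the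
  unknown \<open>u\<close>, but after truncation at 1 it costs only \<open>2 * a\<close>, whatever
  the size of \<open>u\<close>.\<close>

lemma min_square_one_le:
  fixes u g a :: real
  assumes "u\<^sup>2 \<le> g * u + a * u" "u \<ge> 0" "a \<ge> 0"
  shows "min (u\<^sup>2) 1 \<le> g\<^sup>2 + 2 * a"
proof -
  have "g * u \<le> (g\<^sup>2 + u\<^sup>2) / 2" using zero_le_power2[of "g - u"] by (simp add: power2_eq_square algebra_simps)
  then have *: "u\<^sup>2 \<le> g\<^sup>2 + 2 * (a * u)" using assms(1) by (simp add: field_simps)
  show ?thesis
  proof (cases "u \<le> 1")
    case True
    then have "a * u \<le> a" using assms(3) mult_left_mono[of u 1 a] by simp
    then show ?thesis using * by simp
  next
    case False
    show ?thesis
    proof (cases "a \<ge> 1")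
      case True
      then show ?thesis using zero_le_power2[of g] by linarith
    next
      case False
      \<comment> \<open>For \<open>u > 1\<close> and \<open>a < 1\<close> both factors are
        nonnegative. Expanded, this is \<open>1 - 2 * a \<le> u\<^sup>2 - 2 * (a * u)\<close>, and
        the right-hand side is at most \<open>g\<^sup>2\<close>.\<close>
      have "0 \<le> (u - 1) * (u + 1 - 2 * a)" using False \<open>\<not> u \<le> 1\<close> by (intro mult_nonneg_nonneg) auto
      then have "1 - 2 * a \<le> u\<^sup>2 - 2 * (a * u)" by (simp add: power2_eq_square algebra_simps)
      then show ?thesis using * by linarith
    qed
  qed
qed

lemma ennreal_set_integral:
  fixes g :: "real \<Rightarrow> real"
  assumes "set_integrable lborel A g" "\<And>x. x \<in> A \<Longrightarrow> 0 \<le> g x"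
  shows "ennreal (LINT x:A|lborel. g x) = (\<integral>\<^sup>+x. ennreal (g x) * indicator A x \<partial>lborel)"
proof -
  have "ennreal (LINT x:A|lborel. g x) = (\<integral>\<^sup>+x. ennreal (indicator A x *\<^sub>R g x) \<partial>lborel)"
    unfolding set_lebesgue_integral_def
    by (rule nn_integral_eq_integral[symmetric]) (use assms in \<open>auto simp: set_integrable_def indicator_def\<close>)
  also have "\<dots> = (\<integral>\<^sup>+x. ennreal (g x) * indicator A x \<partial>lborel)"
    by (intro nn_integral_cong) (auto simp: indicator_def)
  finally show ?thesis .
qed

lemma (in prob_space) nn_integral_time_average:
  fixes f :: "real \<Rightarrow> 'a \<Rightarrow> real" and L :: "'a \<Rightarrow> real"
  assumes f: "(\<lambda>p. f (fst p) (snd p)) \<in> borel_measurable (borel \<Otimes>\<^sub>M M)" and L: "L \<in> borel_measurable M"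
    and L0: "\<And>\<omega>. 0 \<le> L \<omega>" and f0: "\<And>\<tau> \<omega>. 0 \<le> f \<tau> \<omega>" and sr: "s \<le> r" and c0: "0 \<le> c"
    and bd: "\<And>\<tau>. \<tau> \<in> {s..r} \<Longrightarrow> (\<integral>\<^sup>+\<omega>. ennreal (L \<omega> * f \<tau> \<omega>) \<partial>M) \<le> ennreal c"
  shows "(\<integral>\<^sup>+\<omega>. ennreal (L \<omega>) * (\<integral>\<^sup>+\<tau>. ennreal (f \<tau> \<omega>) * indicator {s..r} \<tau> \<partial>lborel) \<partial>M) \<le> ennreal (c * (r - s))"
proof -
  interpret P: pair_sigma_finite lborel M ..
  have f': "(\<lambda>p. f (fst p) (snd p)) \<in> borel_measurable (lborel \<Otimes>\<^sub>M M)" using f by simp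
  have m1: "(\<lambda>\<tau>. f \<tau> \<omega>) \<in> borel_measurable lborel" if "\<omega> \<in> space M" for \<omega>
    using measurable_compose[OF measurable_Pair[OF measurable_ident_sets[OF refl] measurable_const[OF that]] f'] by simp
  have "(\<integral>\<^sup>+\<omega>. ennreal (L \<omega>) * (\<integral>\<^sup>+\<tau>. ennreal (f \<tau> \<omega>) * indicator {s..r} \<tau> \<partial>lborel) \<partial>M)
     = (\<integral>\<^sup>+\<omega>. (\<integral>\<^sup>+\<tau>. ennreal (L \<omega> * f \<tau> \<omega>) * indicator {s..r} \<tau> \<partial>lborel) \<partial>M)"
  proof (rule nn_integral_cong)
    fix \<omega> assume \<omega>: "\<omega> \<in> space M"
    note [measurable] = m1[OF \<omega>]
    have "(\<integral>\<^sup>+\<tau>. ennreal (L \<omega> * f \<tau> \<omega>) * indicator {s..r} \<tau> \<partial>lborel) = (\<integral>\<^sup>+\<tau>. ennreal (L \<omega>) * (ennreal (f \<tau> \<omega>) * indicator {s..r} \<tau>) \<partial>lborel)"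
      by (intro nn_integral_cong) (use L0 f0 in \<open>simp add: ennreal_mult' mult.assoc\<close>)
    also have "\<dots> = ennreal (L \<omega>) * (\<integral>\<^sup>+\<tau>. ennreal (f \<tau> \<omega>) * indicator {s..r} \<tau> \<partial>lborel)"
      by (rule nn_integral_cmult) measurable
    finally show "ennreal (L \<omega>) * (\<integral>\<^sup>+\<tau>. ennreal (f \<tau> \<omega>) * indicator {s..r} \<tau> \<partial>lborel)
      = (\<integral>\<^sup>+\<tau>. ennreal (L \<omega> * f \<tau> \<omega>) * indicator {s..r} \<tau> \<partial>lborel)" by simp
  qed
  also have "\<dots> = (\<integral>\<^sup>+\<tau>. (\<integral>\<^sup>+\<omega>. ennreal (L \<omega> * f \<tau> \<omega>) * indicator {s..r} \<tau> \<partial>M) \<partial>lborel)"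
  proof (rule P.Fubini')
    have [measurable]: "(\<lambda>p. L (snd p)) \<in> borel_measurable (lborel \<Otimes>\<^sub>M M)" by (rule measurable_compose[OF measurable_snd L])
    note [measurable] = f'
    show "(\<lambda>(\<tau>, \<omega>). ennreal (L \<omega> * f \<tau> \<omega>) * indicator {s..r} \<tau>) \<in> borel_measurable (lborel \<Otimes>\<^sub>M M)"
      unfolding case_prod_beta by measurable
  qed
  also have "\<dots> \<le> (\<integral>\<^sup>+\<tau>. ennreal c * indicator {s..r} \<tau> \<partial>lborel)"
  proof (rule nn_integral_mono)
    fix \<tau> :: real
    show "(\<integral>\<^sup>+\<omega>. ennreal (L \<omega> * f \<tau> \<omega>) * indicator {s..r} \<tau> \<partial>M) \<le> ennreal c * indicator {s..r} \<tau>"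
      using bd[of \<tau>] by (cases "\<tau> \<in> {s..r}") auto
  qed
  also have "\<dots> = ennreal c * ennreal (r - s)"
    using sr by (subst nn_integral_cmult_indicator) auto
  also have "\<dots> = ennreal (c * (r - s))" using c0 sr by (simp add: ennreal_mult')
  finally show ?thesis .
qed

text \<open>Young's inequality at the scale \<open>\<rho>\<close> replaces Cauchy-Schwarz.
  \<open>\<rho>\<close> is the size of \<open>g\<close> in mean square, later
  \<open>sqrt (r - s)\<close> for the noise and 1 for the drift.\<close>

lemma (in prob_space) nn_integral_product_le:
  fixes f g :: "'a \<Rightarrow> real"
  assumes m: "f \<in> borel_measurable M" "g \<in> borel_measurable M"
    and f: "(\<integral>\<^sup>+\<omega>. ennreal ((f \<omega>)\<^sup>2) \<partial>M) \<le> ennreal a" and g: "(\<integral>\<^sup>+\<omega>. ennreal ((g \<omega>)\<^sup>2) \<partial>M) \<le> ennreal (b * \<rho>\<^sup>2)"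
    and \<rho>: "\<rho> > 0" "0 \<le> a" "0 \<le> b"
  shows "(\<integral>\<^sup>+\<omega>. ennreal (f \<omega> * g \<omega>) \<partial>M) \<le> ennreal ((a + b) / 2 * \<rho>)"
proof -
  have "(\<integral>\<^sup>+\<omega>. ennreal (f \<omega> * g \<omega>) \<partial>M) \<le> (\<integral>\<^sup>+\<omega>. ennreal (\<rho> / 2) * ennreal ((f \<omega>)\<^sup>2) + ennreal (1 / (2 * \<rho>)) * ennreal ((g \<omega>)\<^sup>2) \<partial>M)"
  proof (rule nn_integral_mono)
    fix \<omega>
    have "0 \<le> (\<rho> * f \<omega> - g \<omega>)\<^sup>2 / (2 * \<rho>)" using \<rho> by simp
    then have "f \<omega> * g \<omega> \<le> \<rho> / 2 * (f \<omega>)\<^sup>2 + 1 / (2 * \<rho>) * (g \<omega>)\<^sup>2"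
      using \<rho> by (simp add: power2_eq_square field_simps)
    then have "ennreal (f \<omega> * g \<omega>) \<le> ennreal (\<rho> / 2 * (f \<omega>)\<^sup>2 + 1 / (2 * \<rho>) * (g \<omega>)\<^sup>2)" by (rule ennreal_leI)
    also have "\<dots> = ennreal (\<rho> / 2) * ennreal ((f \<omega>)\<^sup>2) + ennreal (1 / (2 * \<rho>)) * ennreal ((g \<omega>)\<^sup>2)"
      using \<rho> by (subst ennreal_plus) (auto simp: ennreal_mult'[symmetric])
    finally show "ennreal (f \<omega> * g \<omega>) \<le> ennreal (\<rho> / 2) * ennreal ((f \<omega>)\<^sup>2) + ennreal (1 / (2 * \<rho>)) * ennreal ((g \<omega>)\<^sup>2)" .
  qed
  also have "\<dots> = ennreal (\<rho> / 2) * (\<integral>\<^sup>+\<omega>. ennreal ((f \<omega>)\<^sup>2) \<partial>M) + ennreal (1 / (2 * \<rho>)) * (\<integral>\<^sup>+\<omega>. ennreal ((g \<omega>)\<^sup>2) \<partial>M)"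
  proof -
    note [measurable] = m
    show ?thesis by (subst nn_integral_add; (measurable)?) (subst nn_integral_cmult, measurable)+
  qed
  also have "\<dots> \<le> ennreal (\<rho> / 2) * ennreal a + ennreal (1 / (2 * \<rho>)) * ennreal (b * \<rho>\<^sup>2)"
    using f g by (intro add_mono mult_left_mono) auto
  also have "\<dots> = ennreal (\<rho> / 2 * a + 1 / (2 * \<rho>) * (b * \<rho>\<^sup>2))"
    using \<rho> by (subst ennreal_plus) (auto simp: ennreal_mult'[symmetric])
  also have "\<rho> / 2 * a + 1 / (2 * \<rho>) * (b * \<rho>\<^sup>2) = (a + b) / 2 * \<rho>"
    using \<rho> by (simp add: power2_eq_square field_simps)
  finally show ?thesis .
qed

context hilbert_wiener
begin

lemma W_increment_second_moment:
  assumes "0 \<le> s" "s \<le> r"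
  shows "(\<integral>\<^sup>+\<omega>. ennreal ((norm (W r \<omega> - W s \<omega>))\<^sup>2) \<partial>M) = ennreal ((r - s) * suminf q)"
proof (cases "s = r")
  case True then show ?thesis by simp
next
  case False
  then have sr: "0 \<le> s" "s < r" using assms by auto
  \<comment> \<open>For \<open>\<kappa> = 0\<close> the weight is 1 and nothing is recentred, so the
    weighted moments specialise to the plain ones.\<close>
  have 1: "weight j 0 h v = 1" "recentred j 0 h v = v" for j h v by (simp_all add: weight_def recentred_def)
  from weighted_increment(5,6)[OF sr, of 0 0] show ?thesis unfolding 1
    by (subst nn_integral_eq_integral) auto
qed

lemma trace_nonneg: "0 \<le> suminf q"
  using suminf_nonneg[OF q_summable] q_pos less_imp_le by blast

lemma weight_second_moment:
  assumes "0 \<le> s" "s \<le> r" "r - s \<le> T"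
  shows "(\<integral>\<^sup>+\<omega>. ennreal ((weight j \<kappa> (r - s) (W r \<omega> - W s \<omega>))\<^sup>2) \<partial>M) \<le> ennreal (exp (\<kappa>\<^sup>2 * T))"
proof (cases "s = r")
  case True
  have "1 \<le> exp (\<kappa>\<^sup>2 * T)" using assms True by simp
  then have "ennreal 1 \<le> ennreal (exp (\<kappa>\<^sup>2 * T))" by (rule ennreal_leI)
  then show ?thesis using True by (simp add: weight_def emeasure_space_1)
next
  case False
  then have sr: "0 \<le> s" "s < r" using assms by auto
  from weighted_increment(3,4)[OF sr, of j \<kappa>]
  have "(\<integral>\<^sup>+\<omega>. ennreal ((weight j \<kappa> (r - s) (W r \<omega> - W s \<omega>))\<^sup>2) \<partial>M) = ennreal (exp (\<kappa>\<^sup>2 * (r - s)))"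
    by (subst nn_integral_eq_integral) auto
  also have "\<dots> \<le> ennreal (exp (\<kappa>\<^sup>2 * T))" using assms(3) by (intro ennreal_leI) (simp add: mult_left_mono)
  finally show ?thesis .
qed

text \<open>Multiplicativity in time separates, at an intermediate time \<open>s\<close>, a factor
  that is known at \<open>s\<close> from one that is independent of the past.\<close>

lemma weight_mult:
  "weight j \<kappa> (s - r0) (W s \<omega> - W r0 \<omega>) * weight j \<kappa> (r - s) (W r \<omega> - W s \<omega>) = weight j \<kappa> (r - r0) (W r \<omega> - W r0 \<omega>)"
  unfolding weight_def exp_add[symmetric] inner_diff_left
  by (rule arg_cong[where f = exp]) (simp add: diff_divide_distrib algebra_simps)

end

section \<open>The resolvent-regularised process\<close>

locale spde_resolvent = spde M e q W \<beta> \<eta> DA V A S F T C K X Y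
  for M :: "'w measure" and e :: "nat \<Rightarrow> 'a::{real_inner, banach, second_countable_topology}"
    and q W \<beta> \<eta> DA V A S F T C K X Y +
  fixes J :: "'a \<Rightarrow> 'a" and l :: real
  assumes l_pos: "l > 0" and J_linear: "linear J" and J_domain: "J x \<in> DA" and J_inverse: "J x - l *\<^sub>R A (J x) = x"
    and J_contraction: "norm (J x) \<le> norm x" and J_symmetric: "J x \<bullet> y = x \<bullet> J y"
begin

text \<open>Two resolvents are taken because \<open>A (G x) = J (A (J x))\<close>: the inner one
  makes \<open>A\<close> bounded by \<open>2 / l\<close>, and the outer one can be moved onto an
  increment of \<open>X\<close>, where it provides smallness in time.\<close>

definition G :: "'a \<Rightarrow> 'a" where "G x = J (J x)"

lemma J_bounded_linear: "bounded_linear J"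
proof (rule bounded_linear_intro[of J 1])
  show "J (x + y) = J x + J y" "J (c *\<^sub>R x) = c *\<^sub>R J x" for x y c
    using J_linear by (simp_all add: linear_add linear_scale)
  show "norm (J x) \<le> norm x * 1" for x using J_contraction by simp
qed

lemma J_measurable [measurable]: "J \<in> borel_measurable borel"
  by (intro borel_measurable_continuous_onI linear_continuous_on J_bounded_linear)

lemma G_measurable [measurable]: "G \<in> borel_measurable borel"
  unfolding G_def by measurable

lemma J_diff: "J (x - y) = J x - J y" and J_scale: "J (c *\<^sub>R x) = c *\<^sub>R J x"
  using J_linear by (simp_all add: linear_diff linear_scale)

lemma G_linear: "linear G" unfolding G_def by (rule linear_compose[OF J_linear J_linear, unfolded comp_def])

lemma G_contraction: "norm (G x) \<le> norm x"
  unfolding G_def using J_contraction order_trans by blast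

lemma G_symmetric: "G x \<bullet> y = x \<bullet> G y" unfolding G_def by (simp add: J_symmetric)

lemma A_J: "A (J x) = (1 / l) *\<^sub>R (J x - x)"
proof -
  have "J x - x = l *\<^sub>R A (J x)" using arg_cong[OF J_inverse[of x], of "\<lambda>v. J x - v"] by simp
  then show ?thesis using l_pos by simp
qed

lemma A_J_bound: "norm (A (J u)) \<le> 2 / l * norm u"
proof -
  have "norm (J u - u) \<le> 2 * norm u" using norm_triangle_ineq4[of "J u" u] J_contraction[of u] by linarith
  then show ?thesis unfolding A_J using l_pos by (simp add: divide_right_mono)
qed

lemma A_G: "A (G u) = J (A (J u))"
  by (simp only: G_def A_J J_scale J_diff)

text \<open>Symmetry distributes the powers of \<open>J\<close> evenly: with \<open>p = J x\<close>
  the expression equals \<open>A (J p) \<bullet> J p\<close>, and \<open>J p\<close> lies in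
  \<open>DA\<close>.\<close>

lemma A_G_nonpos: "x \<bullet> A (G (G x)) \<le> 0"
proof -
  define p where "p = J x"
  have "x \<bullet> A (G (G x)) = (1 / l) * (J p \<bullet> (J p - p))"
    unfolding A_G A_J G_def J_scale J_diff p_def
    by (simp add: inner_diff_right J_symmetric[symmetric])
  also have "J p - p = l *\<^sub>R A (J p)" unfolding A_J using l_pos by simp
  also have "(1 / l) * (J p \<bullet> (l *\<^sub>R A (J p))) = A (J p) \<bullet> J p" using l_pos by (simp add: inner_commute)
  also have "\<dots> \<le> 0" by (rule A_nonpos[OF J_domain])
  finally show ?thesis .
qed

text \<open>With \<open>u\<close> the vector on the left, the equation is tested against
  \<open>J u\<close>. As \<open>A (J u)\<close> is at most \<open>2 / l * norm u\<close>, one factor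
  \<open>norm u\<close> cancels. The result is a quantitative modulus of continuity for
  \<open>J X\<close>; for \<open>X\<close> itself only continuity is known.\<close>

lemma J_increment:
  "AE \<omega> in M. \<forall>s r. 0 \<le> s \<longrightarrow> s \<le> r \<longrightarrow> r \<le> T \<longrightarrow>
    ennreal (norm (J (X r \<omega> - X s \<omega>))) \<le> ennreal (norm (W r \<omega> - W s \<omega>))
      + (\<integral>\<^sup>+\<tau>. ennreal (2 / l * norm (XT \<tau> \<omega>) + C) * indicator {s..r} \<tau> \<partial>lborel)"
  using equation_domain AE_space
proof eventually_elim
  case (elim \<omega>)
  show ?case
  proof (intro allI impI)
    fix s r assume sr: "0 \<le> s" "s \<le> r" "r \<le> T"
    define u where "u = J (X r \<omega> - X s \<omega>)"
    define I where "I = (LINT \<tau>:{s..r}|lborel. 2 / l * norm (X \<tau> \<omega>) + C)"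
    have cX: "continuous_on {s..r} (\<lambda>\<sigma>. X \<sigma> \<omega>)" using sr elim by (intro X_integrable) auto
    have iI: "set_integrable lborel {s..r} (\<lambda>\<tau>. 2 / l * norm (X \<tau> \<omega>) + C)"
      by (intro borel_integrable_atLeastAtMost' continuous_intros cX)
    have i1: "set_integrable lborel {s..r} (\<lambda>\<tau>. 2 / l * norm (X \<tau> \<omega>))"
      by (intro borel_integrable_atLeastAtMost' continuous_intros cX)
    have i2: "set_integrable lborel {s..r} (\<lambda>\<tau>. C)" by (intro borel_integrable_atLeastAtMost' continuous_intros)
    have I_eq: "I = (LINT \<tau>:{s..r}|lborel. 2 / l * norm (X \<tau> \<omega>)) + C * (r - s)"
      unfolding I_def set_integral_add(2)[OF i1 i2] using sr by (simp add: set_lebesgue_integral_def)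
    have "(norm u)\<^sup>2 = (X r \<omega> - X s \<omega>) \<bullet> J u" unfolding power2_norm_eq_inner u_def by (simp add: J_symmetric)
    also have "\<dots> \<le> (W r \<omega> - W s \<omega>) \<bullet> J u + (LINT \<sigma>:{s..r}|lborel. X \<sigma> \<omega> \<bullet> A (J u)) + C * norm (J u) * (r - s)"
    proof -
      have "\<bar>(X r \<omega> - X s \<omega>) \<bullet> J u - (W r \<omega> - W s \<omega>) \<bullet> J u - (LINT \<sigma>:{s..r}|lborel. X \<sigma> \<omega> \<bullet> A (J u))\<bar> \<le> C * norm (J u) * (r - s)"
        using elim(1) sr J_domain by blast
      then show ?thesis by linarith
    qed
    also have "(W r \<omega> - W s \<omega>) \<bullet> J u \<le> norm (W r \<omega> - W s \<omega>) * norm u"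
      using norm_cauchy_schwarz[of "W r \<omega> - W s \<omega>" "J u"] mult_left_mono[OF J_contraction[of u], of "norm (W r \<omega> - W s \<omega>)"] by simp
    also have "(LINT \<sigma>:{s..r}|lborel. X \<sigma> \<omega> \<bullet> A (J u)) \<le> (LINT \<tau>:{s..r}|lborel. (2 / l * norm (X \<tau> \<omega>)) * norm u)"
    proof (rule set_integral_mono)
      show "set_integrable lborel {s..r} (\<lambda>\<sigma>. X \<sigma> \<omega> \<bullet> A (J u))" "set_integrable lborel {s..r} (\<lambda>\<tau>. (2 / l * norm (X \<tau> \<omega>)) * norm u)"
        by (intro borel_integrable_atLeastAtMost' continuous_intros cX)+
      fix \<tau>
      have "X \<tau> \<omega> \<bullet> A (J u) \<le> norm (X \<tau> \<omega>) * norm (A (J u))" by (rule norm_cauchy_schwarz)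
      also have "\<dots> \<le> norm (X \<tau> \<omega>) * (2 / l * norm u)" by (intro mult_left_mono A_J_bound) auto
      finally show "X \<tau> \<omega> \<bullet> A (J u) \<le> (2 / l * norm (X \<tau> \<omega>)) * norm u" by (simp add: mult_ac)
    qed
    also have "(LINT \<tau>:{s..r}|lborel. (2 / l * norm (X \<tau> \<omega>)) * norm u) = (LINT \<tau>:{s..r}|lborel. 2 / l * norm (X \<tau> \<omega>)) * norm u"
      by (rule set_integral_mult_left)
    also have "C * norm (J u) * (r - s) \<le> C * norm u * (r - s)"
      using J_contraction C_nonneg sr by (intro mult_right_mono mult_left_mono) auto
    finally have "norm u * norm u \<le> (norm (W r \<omega> - W s \<omega>) + I) * norm u"
      unfolding I_eq power2_eq_square by (simp add: algebra_simps)
    moreover have "0 \<le> I" unfolding I_def set_lebesgue_integral_def using l_pos C_nonneg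
      by (intro Bochner_Integration.integral_nonneg) (auto simp: indicator_def)
    ultimately have "norm u \<le> norm (W r \<omega> - W s \<omega>) + I" by (cases "norm u = 0") auto
    then have "ennreal (norm u) \<le> ennreal (norm (W r \<omega> - W s \<omega>) + I)" by (rule ennreal_leI)
    also have "\<dots> = ennreal (norm (W r \<omega> - W s \<omega>)) + ennreal I"
      using \<open>0 \<le> I\<close> by (intro ennreal_plus) auto
    also have "ennreal I = (\<integral>\<^sup>+\<tau>. ennreal (2 / l * norm (X \<tau> \<omega>) + C) * indicator {s..r} \<tau> \<partial>lborel)"
      unfolding I_def using l_pos C_nonneg by (intro ennreal_set_integral iI) auto
    also have "\<dots> = (\<integral>\<^sup>+\<tau>. ennreal (2 / l * norm (XT \<tau> \<omega>) + C) * indicator {s..r} \<tau> \<partial>lborel)"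
      by (intro nn_integral_cong) (use sr in \<open>auto simp: indicator_def XT_eq\<close>)
    finally show "ennreal (norm (J (X r \<omega> - X s \<omega>))) \<le> ennreal (norm (W r \<omega> - W s \<omega>))
      + (\<integral>\<^sup>+\<tau>. ennreal (2 / l * norm (XT \<tau> \<omega>) + C) * indicator {s..r} \<tau> \<partial>lborel)" unfolding u_def .
  qed
qed

text \<open>The test vector is \<open>G u\<close> with \<open>u = G (X r - y')\<close>, where
  \<open>y'\<close> is the end point of the segment. In the drift integral \<open>X \<sigma>\<close>
  is compared with \<open>X r\<close>, as in an implicit scheme: the part at time \<open>r\<close>
  is dissipative, \<open>y'\<close> lies in \<open>DA\<close>, and \<open>X r - X \<sigma>\<close>
  gives the last term. \<open>z\<close> is the velocity of the segment; \<open>w\<close> will be the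
  drift that \<open>W\<close> gains under the weight.\<close>

lemma energy_pathwise:
  "AE \<omega> in M. \<forall>s r y z w. 0 \<le> s \<longrightarrow> s \<le> r \<longrightarrow> r \<le> T \<longrightarrow> y + (r - s) *\<^sub>R z \<in> DA \<longrightarrow>
    ennreal (min ((norm (G (X r \<omega> - (y + (r - s) *\<^sub>R z))))\<^sup>2) 1)
    \<le> ennreal ((norm (G (X s \<omega> - y) + G (W r \<omega> - W s \<omega> - (r - s) *\<^sub>R w)))\<^sup>2)
      + ennreal (2 * ((r - s) * (C + norm (A (y + (r - s) *\<^sub>R z)) + norm (w - z))))
      + ennreal (4 / l) * (\<integral>\<^sup>+\<sigma>. ennreal (norm (J (X r \<omega> - XT \<sigma> \<omega>))) * indicator {s..r} \<sigma> \<partial>lborel)"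
  using equation_domain AE_space
proof eventually_elim
  case (elim \<omega>)
  show ?case
  proof (intro allI impI)
    fix s r y z w assume sr: "0 \<le> s" "s \<le> r" "r \<le> T" and yD: "y + (r - s) *\<^sub>R z \<in> DA"
    define y' where "y' = y + (r - s) *\<^sub>R z"
    define u where "u = G (X r \<omega> - y')"
    define g where "g = G (X s \<omega> - y) + G (W r \<omega> - W s \<omega> - (r - s) *\<^sub>R w)"
    define I where "I = (LINT \<sigma>:{s..r}|lborel. norm (J (X r \<omega> - X \<sigma> \<omega>)))"
    define c where "c = (r - s) * (C + norm (A y') + norm (w - z))"
    have cX: "continuous_on {s..r} (\<lambda>\<sigma>. X \<sigma> \<omega>)" using sr elim by (intro X_integrable) auto
    note blJ = J_bounded_linear
    have iI: "set_integrable lborel {s..r} (\<lambda>\<sigma>. norm (J (X r \<omega> - X \<sigma> \<omega>)))"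
      by (intro borel_integrable_atLeastAtMost' continuous_intros cX bounded_linear.continuous_on[OF blJ])
    have GuD: "G u \<in> DA" unfolding G_def by (rule J_domain)
    have "(norm u)\<^sup>2 = (X r \<omega> - y') \<bullet> G u" unfolding power2_norm_eq_inner u_def by (simp add: G_symmetric)
    also have "\<dots> = (X s \<omega> - y) \<bullet> G u + (X r \<omega> - X s \<omega>) \<bullet> G u - (r - s) * (z \<bullet> G u)"
      by (simp add: y'_def inner_diff_left inner_add_left)
    also have "(X r \<omega> - X s \<omega>) \<bullet> G u \<le> (W r \<omega> - W s \<omega>) \<bullet> G u + (LINT \<sigma>:{s..r}|lborel. X \<sigma> \<omega> \<bullet> A (G u)) + C * norm (G u) * (r - s)"
    proof -
      have "\<bar>(X r \<omega> - X s \<omega>) \<bullet> G u - (W r \<omega> - W s \<omega>) \<bullet> G u - (LINT \<sigma>:{s..r}|lborel. X \<sigma> \<omega> \<bullet> A (G u))\<bar> \<le> C * norm (G u) * (r - s)"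
        using elim(1) sr GuD by blast
      then show ?thesis by linarith
    qed
    also have "(LINT \<sigma>:{s..r}|lborel. X \<sigma> \<omega> \<bullet> A (G u)) \<le> (LINT \<sigma>:{s..r}|lborel. norm (J (X r \<omega> - X \<sigma> \<omega>)) * (2 / l * norm u) + norm (A y') * norm u)"
    proof (rule set_integral_mono)
      show "set_integrable lborel {s..r} (\<lambda>\<sigma>. X \<sigma> \<omega> \<bullet> A (G u))"
        by (intro borel_integrable_atLeastAtMost' continuous_intros cX)
      show "set_integrable lborel {s..r} (\<lambda>\<sigma>. norm (J (X r \<omega> - X \<sigma> \<omega>)) * (2 / l * norm u) + norm (A y') * norm u)"
        by (intro borel_integrable_atLeastAtMost' continuous_intros cX bounded_linear.continuous_on[OF blJ])
      fix \<sigma>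
      \<comment> \<open>Splitting at the end time \<open>r\<close> makes the dissipative term carry
        exactly the vector whose norm is estimated.\<close>
      have "X \<sigma> \<omega> \<bullet> A (G u) = (X r \<omega> - y') \<bullet> A (G u) + y' \<bullet> A (G u) + (X \<sigma> \<omega> - X r \<omega>) \<bullet> A (G u)"
        by (simp add: inner_diff_left)
      also have "(X r \<omega> - y') \<bullet> A (G u) \<le> 0" unfolding u_def by (rule A_G_nonpos)
      also have "y' \<bullet> A (G u) \<le> norm (A y') * norm u"
      proof -
        have "y' \<bullet> A (G u) = A y' \<bullet> G u" using A_symmetric[OF yD GuD] by (simp add: y'_def)
        also have "\<dots> \<le> norm (A y') * norm (G u)" by (rule norm_cauchy_schwarz)
        also have "\<dots> \<le> norm (A y') * norm u" by (intro mult_left_mono G_contraction) auto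
        finally show ?thesis .
      qed
      also have "(X \<sigma> \<omega> - X r \<omega>) \<bullet> A (G u) \<le> norm (J (X r \<omega> - X \<sigma> \<omega>)) * (2 / l * norm u)"
      proof -
        have "(X \<sigma> \<omega> - X r \<omega>) \<bullet> A (G u) = J (X \<sigma> \<omega> - X r \<omega>) \<bullet> A (J u)" unfolding A_G by (simp add: J_symmetric)
        also have "\<dots> \<le> norm (J (X \<sigma> \<omega> - X r \<omega>)) * norm (A (J u))" by (rule norm_cauchy_schwarz)
        also have "\<dots> \<le> norm (J (X \<sigma> \<omega> - X r \<omega>)) * (2 / l * norm u)" by (intro mult_left_mono A_J_bound) auto
        also have "norm (J (X \<sigma> \<omega> - X r \<omega>)) = norm (J (X r \<omega> - X \<sigma> \<omega>))" unfolding J_diff by (rule norm_minus_commute)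
        finally show ?thesis .
      qed
      finally show "X \<sigma> \<omega> \<bullet> A (G u) \<le> norm (J (X r \<omega> - X \<sigma> \<omega>)) * (2 / l * norm u) + norm (A y') * norm u" by simp
    qed
    also have "\<dots> = I * (2 / l * norm u) + norm (A y') * norm u * (r - s)"
    proof -
      have i1: "set_integrable lborel {s..r} (\<lambda>\<sigma>. norm (J (X r \<omega> - X \<sigma> \<omega>)) * (2 / l * norm u))"
        and i2: "set_integrable lborel {s..r} (\<lambda>\<sigma>. norm (A y') * norm u)"
        by (intro borel_integrable_atLeastAtMost' continuous_intros cX bounded_linear.continuous_on[OF blJ])+
      show ?thesis unfolding set_integral_add(2)[OF i1 i2] I_def set_integral_mult_left
        using sr by (simp add: set_lebesgue_integral_def)
    qed
    also have "C * norm (G u) * (r - s) \<le> C * norm u * (r - s)"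
      using G_contraction C_nonneg sr by (intro mult_right_mono mult_left_mono) auto
    finally have le: "(norm u)\<^sup>2 \<le> (X s \<omega> - y) \<bullet> G u + ((W r \<omega> - W s \<omega>) \<bullet> G u + (I * (2 / l * norm u) + norm (A y') * norm u * (r - s)) + C * norm u * (r - s))
       - (r - s) * (z \<bullet> G u)" by simp
    \<comment> \<open>The velocity \<open>z\<close> of the segment is exchanged for
      \<open>w\<close>; the difference costs \<open>norm (w - z)\<close> per unit of time.\<close>
    have "g \<bullet> u = (X s \<omega> - y) \<bullet> G u + (W r \<omega> - W s \<omega>) \<bullet> G u - (r - s) * (w \<bullet> G u)"
      by (simp add: g_def inner_add_left G_symmetric inner_diff_left)
    moreover have "g \<bullet> u \<le> norm g * norm u" by (rule norm_cauchy_schwarz)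
    moreover have "(r - s) * ((w - z) \<bullet> G u) \<le> (r - s) * (norm (w - z) * norm u)"
    proof -
      have "(w - z) \<bullet> G u \<le> norm (w - z) * norm (G u)" by (rule norm_cauchy_schwarz)
      also have "\<dots> \<le> norm (w - z) * norm u" by (intro mult_left_mono G_contraction) auto
      finally show ?thesis using sr by (intro mult_left_mono) auto
    qed
    ultimately have "(norm u)\<^sup>2 \<le> norm g * norm u + (c + 2 / l * I) * norm u"
      using le unfolding c_def by (simp add: algebra_simps)
    moreover have I0: "0 \<le> I" unfolding I_def set_lebesgue_integral_def
      by (intro Bochner_Integration.integral_nonneg) (auto simp: indicator_def)
    moreover have c0: "0 \<le> c" unfolding c_def using sr C_nonneg by simp
    ultimately have "min ((norm u)\<^sup>2) 1 \<le> (norm g)\<^sup>2 + 2 * (c + 2 / l * I)"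
      using l_pos by (intro min_square_one_le) auto
    also have "\<dots> = (norm g)\<^sup>2 + 2 * c + 4 / l * I" by (simp add: algebra_simps)
    finally have "ennreal (min ((norm u)\<^sup>2) 1) \<le> ennreal ((norm g)\<^sup>2 + 2 * c + 4 / l * I)" by (rule ennreal_leI)
    also have "\<dots> = ennreal ((norm g)\<^sup>2) + ennreal (2 * c) + ennreal (4 / l) * ennreal I"
      using l_pos I0 c0 by (simp add: ennreal_plus ennreal_mult'[symmetric] del: ennreal_plus[symmetric])
    also have "ennreal I = (\<integral>\<^sup>+\<sigma>. ennreal (norm (J (X r \<omega> - X \<sigma> \<omega>))) * indicator {s..r} \<sigma> \<partial>lborel)"
      unfolding I_def by (intro ennreal_set_integral iI) auto
    also have "\<dots> = (\<integral>\<^sup>+\<sigma>. ennreal (norm (J (X r \<omega> - XT \<sigma> \<omega>))) * indicator {s..r} \<sigma> \<partial>lborel)"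
      by (intro nn_integral_cong) (use sr in \<open>auto simp: indicator_def XT_eq\<close>)
    finally show "ennreal (min ((norm (G (X r \<omega> - (y + (r - s) *\<^sub>R z))))\<^sup>2) 1)
      \<le> ennreal ((norm (G (X s \<omega> - y) + G (W r \<omega> - W s \<omega> - (r - s) *\<^sub>R w)))\<^sup>2)
      + ennreal (2 * ((r - s) * (C + norm (A (y + (r - s) *\<^sub>R z)) + norm (w - z))))
      + ennreal (4 / l) * (\<integral>\<^sup>+\<sigma>. ennreal (norm (J (X r \<omega> - XT \<sigma> \<omega>))) * indicator {s..r} \<sigma> \<partial>lborel)"
      unfolding g_def u_def c_def y'_def .
  qed
qed

end

text \<open>
  On a partition into \<open>n\<close> equal parts the errors add up to $O(n^{-1/2})$.
\<close>

lemma increment_le_of_superlinear_error: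
  fixes h \<Psi> :: "real \<Rightarrow> real"
  assumes step: "\<And>s r. a \<le> s \<Longrightarrow> s < r \<Longrightarrow> r \<le> b \<Longrightarrow> h r - h s \<le> k * (r - s) + c * ((\<Psi> r - \<Psi> s) * sqrt (r - s))"
    and ab: "a \<le> b"
  shows "h b - h a \<le> k * (b - a)"
proof (cases "a = b")
  case False
  then have ab': "a < b" using ab by simp
  have bound: "h b - h a \<le> k * (b - a) + c * ((\<Psi> b - \<Psi> a) * sqrt ((b - a) / real (Suc n)))" for n
  proof -
    define d where "d = (b - a) / real (Suc n)"
    have d0: "d > 0" using ab' by (simp add: d_def)
    have nd: "real (Suc n) * d = b - a" by (simp add: d_def)
    define x where "x i = a + real i * d" for i
    have x: "x 0 = a" "x (Suc n) = b" using nd by (auto simp: x_def)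
    have "h b - h a = (\<Sum>i<Suc n. h (x (Suc i)) - h (x i))"
      using sum_lessThan_telescope[of "\<lambda>i. h (x i)" "Suc n"] x by simp
    also have "\<dots> \<le> (\<Sum>i<Suc n. k * d + (\<Psi> (x (Suc i)) - \<Psi> (x i)) * (c * sqrt d))"
    proof (rule sum_mono)
      fix i assume i: "i \<in> {..<Suc n}"
      have diff: "x (Suc i) - x i = d" by (simp add: x_def algebra_simps)
      have "real (Suc i) * d \<le> real (Suc n) * d" using i d0 by (intro mult_right_mono) auto
      then have "x (Suc i) \<le> b" using nd by (simp add: x_def)
      moreover have "a \<le> x i" using d0 by (simp add: x_def)
      ultimately show "h (x (Suc i)) - h (x i) \<le> k * d + (\<Psi> (x (Suc i)) - \<Psi> (x i)) * (c * sqrt d)"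
        using step[of "x i" "x (Suc i)"] d0 diff by (simp add: mult_ac)
    qed
    also have "\<dots> = k * (real (Suc n) * d) + (\<Sum>i<Suc n. \<Psi> (x (Suc i)) - \<Psi> (x i)) * (c * sqrt d)"
      unfolding sum.distrib sum_distrib_right[symmetric] by (simp only: sum_constant card_lessThan mult_ac)
    \<comment> \<open>The increments of \<open>\<Psi>\<close> telescope, so the whole interval pays
      the factor \<open>sqrt d\<close> once and not \<open>n + 1\<close> times.\<close>
    also have "(\<Sum>i<Suc n. \<Psi> (x (Suc i)) - \<Psi> (x i)) = \<Psi> b - \<Psi> a"
      using sum_lessThan_telescope[of "\<lambda>i. \<Psi> (x i)" "Suc n"] x by simp
    finally show ?thesis unfolding nd by (simp add: d_def mult_ac)
  qed
  have "(\<lambda>n. (b - a) * (1 / real (Suc n))) \<longlonglongrightarrow> (b - a) * 0" by (intro tendsto_intros LIMSEQ_Suc[OF lim_1_over_n])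
  then have "(\<lambda>n. (b - a) / real (Suc n)) \<longlonglongrightarrow> 0" by simp
  note sq = tendsto_real_sqrt[OF this]
  have "(\<lambda>n. k * (b - a) + c * ((\<Psi> b - \<Psi> a) * sqrt ((b - a) / real (Suc n)))) \<longlonglongrightarrow> k * (b - a) + c * ((\<Psi> b - \<Psi> a) * sqrt 0)"
    by (intro tendsto_add tendsto_mult tendsto_const sq)
  then have "(\<lambda>n. k * (b - a) + c * ((\<Psi> b - \<Psi> a) * sqrt ((b - a) / real (Suc n)))) \<longlonglongrightarrow> k * (b - a)"
    by (simp only: real_sqrt_zero mult_zero_right add_0_right)
  then show ?thesis by (rule LIMSEQ_le_const) (use bound in auto)
qed simp

lemma increment_eq_of_superlinear_error:
  fixes h \<Psi> :: "real \<Rightarrow> real"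
  assumes step: "\<And>s r. a \<le> s \<Longrightarrow> s < r \<Longrightarrow> r \<le> b \<Longrightarrow> \<bar>h r - h s\<bar> \<le> c * ((\<Psi> r - \<Psi> s) * sqrt (r - s))"
    and ab: "a \<le> b"
  shows "h b = h a"
proof (rule antisym)
  have "h r - h s \<le> 0 * (r - s) + c * ((\<Psi> r - \<Psi> s) * sqrt (r - s))" if "a \<le> s" "s < r" "r \<le> b" for r s
    using step[OF that] by linarith
  from increment_le_of_superlinear_error[of a b h 0 c \<Psi>, OF this ab] show "h b \<le> h a" by simp
  have "- h r - - h s \<le> 0 * (r - s) + c * ((\<Psi> r - \<Psi> s) * sqrt (r - s))" if "a \<le> s" "s < r" "r \<le> b" for r s
    using step[OF that] by linarith
  from increment_le_of_superlinear_error[of a b "\<lambda>x. - h x" 0 c \<Psi>, OF this ab] show "h a \<le> h b" by simp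
qed

context hilbert_wiener_initial
begin

lemma weight_adapted: "0 \<le> r0 \<Longrightarrow> r0 \<le> s \<Longrightarrow> (\<lambda>\<omega>. weight j \<kappa> (s - r0) (W s \<omega> - W r0 \<omega>)) \<in> borel_measurable (Filt s)"
  by (rule measurable_compose[OF _ weight_measurable]) (intro borel_measurable_diff W_adapted; simp)

lemma weight_step_expectation:
  assumes "0 \<le> s" "s < r"
  shows "(\<integral>\<^sup>+\<omega>. ennreal (weight j \<kappa> (r - s) (W r \<omega> - W s \<omega>)) \<partial>M) = 1"
proof -
  have "AE \<omega> in M. 0 \<le> weight j \<kappa> (r - s) (W r \<omega> - W s \<omega>)" by (intro AE_I2 less_imp_le[OF weight_pos])
  from nn_integral_eq_integral[OF weighted_increment(1)[OF assms] this] show ?thesis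
    unfolding weighted_increment(2)[OF assms] by simp
qed

text \<open>The weight of the time after \<open>r0\<close> is independent of the events known at
  \<open>r0\<close> and has mean one, so weighting leaves their probability unchanged.\<close>

lemma weight_expectation:
  assumes r: "0 \<le> r0" "r0 \<le> t" and B: "B \<in> sets (Filt r0)"
  shows "(\<integral>\<^sup>+\<omega>. ennreal (weight j \<kappa> (t - r0) (W t \<omega> - W r0 \<omega>)) * indicator B \<omega> \<partial>M) = emeasure M B"
proof (cases "r0 = t")
  case True
  have "B \<in> events" using B filtration_subset by blast
  then show ?thesis using True by (simp add: weight_def)
next
  case False
  then have rt: "r0 < t" using r by simp
  have BM: "B \<in> events" using B filtration_subset by blast
  define f where "f = (\<lambda>p :: ennreal \<times> 'a. fst p * ennreal (weight j \<kappa> (t - r0) (snd p)))"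
  have f: "f \<in> borel_measurable (borel \<Otimes>\<^sub>M borel)" unfolding f_def by measurable
  have Z: "(\<lambda>\<omega>. indicator B \<omega> :: ennreal) \<in> borel_measurable (Filt r0)" using B by measurable
  have "(\<integral>\<^sup>+\<omega>. ennreal (weight j \<kappa> (t - r0) (W t \<omega> - W r0 \<omega>)) * indicator B \<omega> \<partial>M) = (\<integral>\<^sup>+\<omega>. f (indicator B \<omega>, W t \<omega> - W r0 \<omega>) \<partial>M)"
    by (simp add: f_def mult.commute)
  also have "\<dots> = (\<integral>\<^sup>+\<omega>. (\<integral>\<^sup>+\<omega>'. f (indicator B \<omega>, W t \<omega>' - W r0 \<omega>') \<partial>M) \<partial>M)"
    by (rule nn_integral_filtration[OF r Z f])
  also have "\<dots> = (\<integral>\<^sup>+\<omega>. indicator B \<omega> \<partial>M)"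
  proof (rule nn_integral_cong)
    fix \<omega>
    have m: "(\<lambda>\<omega>'. ennreal (weight j \<kappa> (t - r0) (W t \<omega>' - W r0 \<omega>'))) \<in> borel_measurable M"
      using measurable_compose[OF W_increment_measurable[OF r] weight_measurable] by simp
    show "(\<integral>\<^sup>+\<omega>'. f (indicator B \<omega>, W t \<omega>' - W r0 \<omega>') \<partial>M) = indicator B \<omega>"
      unfolding f_def fst_conv snd_conv using weight_step_expectation[OF r(1) rt]
      by (subst nn_integral_cmult[OF m]) simp
  qed
  finally show ?thesis using BM by simp
qed

end

context spde_resolvent
begin

text \<open>\<open>a\<close> is a bound for the second moment of the weight. The first summand is
  the share of the noise, the second that of the drift, where
  \<open>8 / l\<^sup>2 * K + 2 * C\<^sup>2\<close> bounds the second moment of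
  \<open>2 / l * norm X + C\<close> and \<open>sqrt T\<close> converts \<open>r - s\<close> into
  \<open>sqrt (r - s)\<close>.\<close>

definition increment_constant :: "real \<Rightarrow> real" where
  "increment_constant a = (a + suminf q) / 2 + sqrt T * ((a + (8 / l\<^sup>2 * K + 2 * C\<^sup>2)) / 2)"

lemma increment_constant_nonneg: "0 \<le> a \<Longrightarrow> 0 \<le> increment_constant a"
  unfolding increment_constant_def using trace_nonneg K_nonneg T_pos less_imp_le[OF T_pos]
  by (intro add_nonneg_nonneg mult_nonneg_nonneg divide_nonneg_nonneg) simp_all

text \<open>Both terms of \<open>J_increment\<close> are products of \<open>L\<close> with square
  integrable quantities. The noise is of size \<open>sqrt (r - s)\<close> in mean square, the time
  integral even of size \<open>r - s\<close>.\<close>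

lemma J_increment_expectation:
  assumes sr: "0 \<le> s" "s \<le> r" "r \<le> T" and L: "L \<in> borel_measurable M" "\<And>\<omega>. 0 \<le> L \<omega>"
    and L2: "(\<integral>\<^sup>+\<omega>. ennreal ((L \<omega>)\<^sup>2) \<partial>M) \<le> ennreal a" and a: "0 \<le> a"
  shows "(\<integral>\<^sup>+\<omega>. ennreal (L \<omega> * norm (J (X r \<omega> - XT s \<omega>))) \<partial>M) \<le> ennreal (increment_constant a * sqrt (r - s))"
proof (cases "s = r")
  case True
  have J0: "J 0 = 0" using J_scale[of 0 0] by simp
  have "X r = XT s" using True sr by (simp add: XT_eq)
  then show ?thesis using True J0 by simp
next
  case False
  then have rs: "0 < r - s" using sr by simp
  define b where "b = 8 / l\<^sup>2 * K + 2 * C\<^sup>2"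
  have b0: "0 \<le> b" unfolding b_def using K_nonneg by simp
  define f where "f \<tau> \<omega> = 2 / l * norm (XT \<tau> \<omega>) + C" for \<tau> \<omega>
  have f0: "0 \<le> f \<tau> \<omega>" for \<tau> \<omega> unfolding f_def using l_pos C_nonneg by simp
  note [measurable] = L(1) XT_jointly_measurable XT_measurable
  have [measurable]: "W r \<in> borel_measurable M" "W s \<in> borel_measurable M" using sr by (auto intro!: W_measurable)
  have fm: "(\<lambda>p. f (fst p) (snd p)) \<in> borel_measurable (borel \<Otimes>\<^sub>M M)" unfolding f_def by measurable
  have [measurable]: "f \<tau> \<in> borel_measurable M" for \<tau> unfolding f_def by measurable
  have Im: "(\<lambda>\<omega>. \<integral>\<^sup>+\<tau>. ennreal (f \<tau> \<omega>) * indicator {s..r} \<tau> \<partial>lborel) \<in> borel_measurable M"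
  proof -
    have sw: "(\<lambda>p. (snd p, fst p)) \<in> measurable (M \<Otimes>\<^sub>M lborel) (borel \<Otimes>\<^sub>M M)" by measurable
    have [measurable]: "(\<lambda>p. f (snd p) (fst p)) \<in> borel_measurable (M \<Otimes>\<^sub>M lborel)"
      using measurable_compose[OF sw fm] by simp
    show ?thesis by measurable
  qed
  have f2: "(\<integral>\<^sup>+\<omega>. ennreal ((f \<tau> \<omega>)\<^sup>2) \<partial>M) \<le> ennreal (b * 1\<^sup>2)" for \<tau>
  proof -
    have "(f \<tau> \<omega>)\<^sup>2 \<le> 8 / l\<^sup>2 * (norm (XT \<tau> \<omega>))\<^sup>2 + 2 * C\<^sup>2" for \<omega>
      using zero_le_power2[of "2 / l * norm (XT \<tau> \<omega>) - C"] unfolding f_def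
      by (simp add: power2_sum power2_diff power_divide power_mult_distrib)
    then have "(\<integral>\<^sup>+\<omega>. ennreal ((f \<tau> \<omega>)\<^sup>2) \<partial>M) \<le> (\<integral>\<^sup>+\<omega>. ennreal (8 / l\<^sup>2) * ennreal ((norm (XT \<tau> \<omega>))\<^sup>2) + ennreal (2 * C\<^sup>2) \<partial>M)"
      by (intro nn_integral_mono) (simp add: ennreal_mult'[symmetric] ennreal_plus[symmetric] ennreal_leI del: ennreal_plus)
    also have "\<dots> = ennreal (8 / l\<^sup>2) * (\<integral>\<^sup>+\<omega>. ennreal ((norm (XT \<tau> \<omega>))\<^sup>2) \<partial>M) + ennreal (2 * C\<^sup>2)"
      by (subst nn_integral_add, measurable) (subst nn_integral_cmult, measurable, simp add: emeasure_space_1)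
    also have "\<dots> \<le> ennreal (8 / l\<^sup>2) * ennreal K + ennreal (2 * C\<^sup>2)"
      by (intro add_mono mult_left_mono XT_moment) auto
    also have "\<dots> = ennreal (b * 1\<^sup>2)" unfolding b_def using K_nonneg
      by (simp add: ennreal_mult'[symmetric] ennreal_plus[symmetric] del: ennreal_plus)
    finally show ?thesis .
  qed
  have "(\<integral>\<^sup>+\<omega>. ennreal (L \<omega> * norm (J (X r \<omega> - XT s \<omega>))) \<partial>M)
     \<le> (\<integral>\<^sup>+\<omega>. ennreal (L \<omega> * norm (W r \<omega> - W s \<omega>)) + ennreal (L \<omega>) * (\<integral>\<^sup>+\<tau>. ennreal (f \<tau> \<omega>) * indicator {s..r} \<tau> \<partial>lborel) \<partial>M)"
  proof (rule nn_integral_mono_AE)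
    show "AE \<omega> in M. ennreal (L \<omega> * norm (J (X r \<omega> - XT s \<omega>)))
       \<le> ennreal (L \<omega> * norm (W r \<omega> - W s \<omega>)) + ennreal (L \<omega>) * (\<integral>\<^sup>+\<tau>. ennreal (f \<tau> \<omega>) * indicator {s..r} \<tau> \<partial>lborel)"
      using J_increment
    proof eventually_elim
      case (elim \<omega>)
      have "ennreal (norm (J (X r \<omega> - X s \<omega>))) \<le> ennreal (norm (W r \<omega> - W s \<omega>)) + (\<integral>\<^sup>+\<tau>. ennreal (f \<tau> \<omega>) * indicator {s..r} \<tau> \<partial>lborel)"
        unfolding f_def using elim sr by blast
      from mult_left_mono[OF this, of "ennreal (L \<omega>)"] show ?case
        using sr L(2)[of \<omega>] by (simp add: XT_eq ennreal_mult' distrib_left)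
    qed
  qed
  also have "\<dots> = (\<integral>\<^sup>+\<omega>. ennreal (L \<omega> * norm (W r \<omega> - W s \<omega>)) \<partial>M) + (\<integral>\<^sup>+\<omega>. ennreal (L \<omega>) * (\<integral>\<^sup>+\<tau>. ennreal (f \<tau> \<omega>) * indicator {s..r} \<tau> \<partial>lborel) \<partial>M)"
  proof (rule nn_integral_add)
    show "(\<lambda>\<omega>. ennreal (L \<omega> * norm (W r \<omega> - W s \<omega>))) \<in> borel_measurable M" by measurable
    show "(\<lambda>\<omega>. ennreal (L \<omega>) * (\<integral>\<^sup>+\<tau>. ennreal (f \<tau> \<omega>) * indicator {s..r} \<tau> \<partial>lborel)) \<in> borel_measurable M"
      by (intro borel_measurable_times_ennreal Im) measurable
  qed
  also have "\<dots> \<le> ennreal ((a + suminf q) / 2 * sqrt (r - s)) + ennreal ((a + b) / 2 * 1 * (r - s))"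
  proof (rule add_mono)
    show "(\<integral>\<^sup>+\<omega>. ennreal (L \<omega> * norm (W r \<omega> - W s \<omega>)) \<partial>M) \<le> ennreal ((a + suminf q) / 2 * sqrt (r - s))"
    proof (rule nn_integral_product_le[OF _ _ L2])
      show "(\<integral>\<^sup>+\<omega>. ennreal ((norm (W r \<omega> - W s \<omega>))\<^sup>2) \<partial>M) \<le> ennreal (suminf q * (sqrt (r - s))\<^sup>2)"
        using W_increment_second_moment[OF sr(1,2)] rs by (simp add: mult.commute)
    qed (use rs a trace_nonneg in \<open>measurable, auto\<close>)
    show "(\<integral>\<^sup>+\<omega>. ennreal (L \<omega>) * (\<integral>\<^sup>+\<tau>. ennreal (f \<tau> \<omega>) * indicator {s..r} \<tau> \<partial>lborel) \<partial>M) \<le> ennreal ((a + b) / 2 * 1 * (r - s))"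
    proof (rule nn_integral_time_average[OF fm L(1) L(2) f0 sr(2)])
      show "0 \<le> (a + b) / 2 * 1" using a b0 by simp
      show "(\<integral>\<^sup>+\<omega>. ennreal (L \<omega> * f \<tau> \<omega>) \<partial>M) \<le> ennreal ((a + b) / 2 * 1)" for \<tau>
      proof (rule nn_integral_product_le[OF L(1) _ L2 f2])
        show "f \<tau> \<in> borel_measurable M" by measurable
      qed (use a b0 in auto)
    qed
  qed
  also have "\<dots> = ennreal ((a + suminf q) / 2 * sqrt (r - s) + (a + b) / 2 * 1 * (r - s))"
    using a b0 trace_nonneg rs by (intro ennreal_plus[symmetric]) auto
  also have "\<dots> \<le> ennreal (increment_constant a * sqrt (r - s))"
  proof (rule ennreal_leI)
    have "sqrt (r - s) * sqrt (r - s) \<le> sqrt T * sqrt (r - s)"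
      using sr rs by (intro mult_right_mono) auto
    then have "r - s \<le> sqrt T * sqrt (r - s)" using rs by simp
    then have "(a + b) / 2 * (r - s) \<le> (a + b) / 2 * (sqrt T * sqrt (r - s))" using a b0 by (intro mult_left_mono) auto
    then show "(a + suminf q) / 2 * sqrt (r - s) + (a + b) / 2 * 1 * (r - s) \<le> increment_constant a * sqrt (r - s)"
      unfolding increment_constant_def b_def[symmetric] by (simp add: algebra_simps)
  qed
  finally show ?thesis .
qed

text \<open>Values in \<open>ennreal\<close> postpone all questions of integrability. Because of the
  truncation, the energy is at most the probability of \<open>B\<close> when \<open>B\<close> is
  known at time \<open>r0\<close>.\<close>

definition energy :: "nat \<Rightarrow> real \<Rightarrow> real \<Rightarrow> 'w set \<Rightarrow> real \<Rightarrow> 'a \<Rightarrow> ennreal" where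
  "energy j \<kappa> r0 B t y = (\<integral>\<^sup>+\<omega>. ennreal (weight j \<kappa> (t - r0) (W t \<omega> - W r0 \<omega>)) * indicator B \<omega>
     * ennreal (min ((norm (G (X t \<omega> - y)))\<^sup>2) 1) \<partial>M)"

text \<open>The truncation has to be decided by the past, hence the alternative on
  \<open>norm (G (X s \<omega> - y)) < 1\<close> instead of a minimum after the step. In the first
  case the increment adds at most the trace in weighted mean; in the second the energy is 1 already
  and the weight has mean one.\<close>

lemma energy_martingale_step:
  assumes t: "0 \<le> r0" "r0 \<le> s" "s < r" "r \<le> T" and B: "B \<in> sets (Filt r0)"
  shows "(\<integral>\<^sup>+\<omega>. ennreal (weight j \<kappa> (r - r0) (W r \<omega> - W r0 \<omega>)) * indicator B \<omega> *
      ennreal (if norm (G (X s \<omega> - y)) < 1 then (norm (G (X s \<omega> - y) + G (recentred j \<kappa> (r - s) (W r \<omega> - W s \<omega>))))\<^sup>2 else 1) \<partial>M)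
    \<le> energy j \<kappa> r0 B s y + ennreal ((r - s) * suminf q) * emeasure M B"
proof -
  have s0: "0 \<le> s" "s \<le> r" using t by auto
  \<comment> \<open>All that is known at time \<open>s\<close>; only the increment of
    \<open>W\<close> from \<open>s\<close> to \<open>r\<close> is integrated out.\<close>
  define Z where "Z \<omega> = (ennreal (weight j \<kappa> (s - r0) (W s \<omega> - W r0 \<omega>)) * indicator B \<omega>, G (X s \<omega> - y))" for \<omega>
  define f where "f = (\<lambda>p :: (ennreal \<times> 'a) \<times> 'a. fst (fst p) * ennreal (weight j \<kappa> (r - s) (snd p) *
     (if norm (snd (fst p)) < 1 then (norm (snd (fst p) + G (recentred j \<kappa> (r - s) (snd p))))\<^sup>2 else 1)))"
  have f: "f \<in> borel_measurable ((borel \<Otimes>\<^sub>M borel) \<Otimes>\<^sub>M borel)" unfolding f_def by measurable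
  have Bs: "B \<in> sets (Filt s)" using B filtration_mono[of r0 s] t by auto
  have Z: "Z \<in> measurable (Filt s) (borel \<Otimes>\<^sub>M borel)"
  proof -
    note [measurable] = weight_adapted[OF t(1,2), of j \<kappa>] Bs
    have [measurable]: "X s \<in> borel_measurable (Filt s)" using t by (intro X_adapted) auto
    show ?thesis unfolding Z_def by measurable
  qed
  have "(\<integral>\<^sup>+\<omega>. ennreal (weight j \<kappa> (r - r0) (W r \<omega> - W r0 \<omega>)) * indicator B \<omega> *
      ennreal (if norm (G (X s \<omega> - y)) < 1 then (norm (G (X s \<omega> - y) + G (recentred j \<kappa> (r - s) (W r \<omega> - W s \<omega>))))\<^sup>2 else 1) \<partial>M)
     = (\<integral>\<^sup>+\<omega>. f (Z \<omega>, W r \<omega> - W s \<omega>) \<partial>M)"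
    unfolding weight_mult[of j \<kappa> s r0 _ r, symmetric] f_def Z_def fst_conv snd_conv
    by (intro nn_integral_cong) (simp add: ennreal_mult' less_imp_le[OF weight_pos] mult_ac)
  also have "\<dots> = (\<integral>\<^sup>+\<omega>. (\<integral>\<^sup>+\<omega>'. f (Z \<omega>, W r \<omega>' - W s \<omega>') \<partial>M) \<partial>M)"
    by (rule nn_integral_filtration[OF s0 Z f])
  also have "\<dots> \<le> (\<integral>\<^sup>+\<omega>. fst (Z \<omega>) * (ennreal (min ((norm (snd (Z \<omega>)))\<^sup>2) 1) + ennreal ((r - s) * suminf q)) \<partial>M)"
  proof (rule nn_integral_mono)
    fix \<omega>
    define x where "x = snd (Z \<omega>)"
    define g where "g \<omega>' = weight j \<kappa> (r - s) (W r \<omega>' - W s \<omega>') *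
       (if norm x < 1 then (norm (x + G (recentred j \<kappa> (r - s) (W r \<omega>' - W s \<omega>'))))\<^sup>2 else 1)" for \<omega>'
    note [measurable] = W_increment_measurable[OF s0]
    have gm: "(\<lambda>\<omega>'. ennreal (g \<omega>')) \<in> borel_measurable M" unfolding g_def by measurable
    have "(\<integral>\<^sup>+\<omega>'. f (Z \<omega>, W r \<omega>' - W s \<omega>') \<partial>M) = fst (Z \<omega>) * (\<integral>\<^sup>+\<omega>'. ennreal (g \<omega>') \<partial>M)"
      unfolding nn_integral_cmult[OF gm, symmetric] by (simp only: f_def g_def x_def fst_conv snd_conv)
    also have "(\<integral>\<^sup>+\<omega>'. ennreal (g \<omega>') \<partial>M) \<le> ennreal (min ((norm x)\<^sup>2) 1) + ennreal ((r - s) * suminf q)"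
    proof (cases "norm x < 1")
      case True
      have "(\<integral>\<^sup>+\<omega>'. ennreal (g \<omega>') \<partial>M) \<le> ennreal ((norm x)\<^sup>2 + (r - s) * suminf q)"
        unfolding g_def using True weighted_increment_energy[OF s0(1) t(3) G_linear G_contraction G_symmetric, of j \<kappa> x] by simp
      also have "\<dots> = ennreal (min ((norm x)\<^sup>2) 1) + ennreal ((r - s) * suminf q)"
      proof -
        have "(norm x)\<^sup>2 \<le> 1" using True by (simp add: power_le_one)
        then show ?thesis using t(3) trace_nonneg by (simp add: ennreal_plus min_def)
      qed
      finally show ?thesis .
    next
      case False
      then have "1 \<le> (norm x)\<^sup>2" by (simp add: one_le_power)
      then have "ennreal (min ((norm x)\<^sup>2) 1) = 1" by (simp add: min_def)
      then show ?thesis unfolding g_def using False weight_step_expectation[OF s0(1) t(3), of j \<kappa>] by simp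
    qed
    finally show "(\<integral>\<^sup>+\<omega>'. f (Z \<omega>, W r \<omega>' - W s \<omega>') \<partial>M) \<le> fst (Z \<omega>) * (ennreal (min ((norm (snd (Z \<omega>)))\<^sup>2) 1) + ennreal ((r - s) * suminf q))"
      unfolding x_def by (simp add: mult_left_mono)
  qed
  also have "\<dots> = (\<integral>\<^sup>+\<omega>. fst (Z \<omega>) * ennreal (min ((norm (snd (Z \<omega>)))\<^sup>2) 1) \<partial>M) + (\<integral>\<^sup>+\<omega>. fst (Z \<omega>) \<partial>M) * ennreal ((r - s) * suminf q)"
  proof -
    have [measurable]: "Z \<in> measurable M (borel \<Otimes>\<^sub>M borel)" by (rule filtration_measurable[OF Z])
    show ?thesis unfolding distrib_left
      by (subst nn_integral_add; (measurable)?) (subst nn_integral_multc, measurable)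
  qed
  also have "(\<integral>\<^sup>+\<omega>. fst (Z \<omega>) \<partial>M) = emeasure M B"
    unfolding Z_def fst_conv by (rule weight_expectation[OF t(1,2) B])
  also have "(\<integral>\<^sup>+\<omega>. fst (Z \<omega>) * ennreal (min ((norm (snd (Z \<omega>)))\<^sup>2) 1) \<partial>M) = energy j \<kappa> r0 B s y"
    unfolding energy_def Z_def by simp
  finally show ?thesis by (simp add: mult.commute)
qed

text \<open>The pathwise estimate is integrated against the weight. The terms linear in
  \<open>r - s\<close> keep the probability of \<open>B\<close> as a factor. In the last term the
  indicator of \<open>B\<close> is dropped: this term is superlinear and vanishes under subdivision.
  \<open>w\<close> is the drift per unit of time that \<open>W\<close> gains under the
  weight.\<close>

lemma energy_step:
  fixes \<kappa> :: real and j :: nat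
  assumes t: "0 \<le> r0" "r0 \<le> s" "s < r" "r \<le> T" and B: "B \<in> sets (Filt r0)" and yD: "y + (r - s) *\<^sub>R z \<in> DA"
  defines "c \<equiv> 4 / l * increment_constant (exp (\<kappa>\<^sup>2 * T))" and "w \<equiv> (sqrt (q j) * \<kappa>) *\<^sub>R e j"
  shows "energy j \<kappa> r0 B r (y + (r - s) *\<^sub>R z) \<le> energy j \<kappa> r0 B s y
    + ennreal ((r - s) * (suminf q + 2 * (C + norm (A (y + (r - s) *\<^sub>R z)) + norm (w - z)))) * emeasure M B
    + ennreal (c * ((r - s) * sqrt (r - s)))"
proof -
  have s0: "0 \<le> s" "s \<le> r" "0 \<le> r" "r0 \<le> r" using t by auto
  define L where "L \<omega> = weight j \<kappa> (r - r0) (W r \<omega> - W r0 \<omega>)" for \<omega>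
  define b where "b = 2 * ((r - s) * (C + norm (A (y + (r - s) *\<^sub>R z)) + norm (w - z)))"
  have b0: "0 \<le> b" unfolding b_def using s0 C_nonneg by simp
  have BM: "B \<in> events" using B filtration_subset by blast
  note [measurable] = BM W_increment_measurable[OF t(1) s0(4)] W_increment_measurable[OF s0(1,2)] XT_jointly_measurable
  have [measurable]: "X s \<in> borel_measurable M" "X r \<in> borel_measurable M" using t by (auto intro!: X_measurable)
  have Lm [measurable]: "L \<in> borel_measurable M" unfolding L_def by measurable
  have L0: "0 \<le> L \<omega>" for \<omega> unfolding L_def by (rule less_imp_le[OF weight_pos])
  have jm: "(\<lambda>p. norm (J (X r (snd p) - XT (fst p) (snd p)))) \<in> borel_measurable (borel \<Otimes>\<^sub>M M)" by measurable
  define g where "g \<omega> = (if norm (G (X s \<omega> - y)) < 1 then (norm (G (X s \<omega> - y) + G (recentred j \<kappa> (r - s) (W r \<omega> - W s \<omega>))))\<^sup>2 else 1)" for \<omega>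
  define I where "I \<omega> = (\<integral>\<^sup>+\<sigma>. ennreal (norm (J (X r \<omega> - XT \<sigma> \<omega>))) * indicator {s..r} \<sigma> \<partial>lborel)" for \<omega>
  have Im [measurable]: "I \<in> borel_measurable M"
  proof -
    have sw: "(\<lambda>p. (snd p, fst p)) \<in> measurable (M \<Otimes>\<^sub>M lborel) (borel \<Otimes>\<^sub>M M)" by measurable
    have [measurable]: "(\<lambda>p. norm (J (X r (fst p) - XT (snd p) (fst p)))) \<in> borel_measurable (M \<Otimes>\<^sub>M lborel)"
      using measurable_compose[OF sw jm] by simp
    show ?thesis unfolding I_def by measurable
  qed
  have gm [measurable]: "g \<in> borel_measurable M" unfolding g_def by measurable
  have rec: "recentred j \<kappa> (r - s) v = v - (r - s) *\<^sub>R w" for v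
    by (simp add: recentred_def w_def mult.commute)
  have "energy j \<kappa> r0 B r (y + (r - s) *\<^sub>R z) \<le> (\<integral>\<^sup>+\<omega>. ennreal (L \<omega>) * indicator B \<omega> * ennreal (g \<omega>)
      + (ennreal (L \<omega>) * indicator B \<omega> * ennreal b + ennreal (4 / l) * (ennreal (L \<omega>) * I \<omega>)) \<partial>M)"
    unfolding energy_def L_def[symmetric]
  proof (rule nn_integral_mono_AE)
    show "AE \<omega> in M. ennreal (L \<omega>) * indicator B \<omega> * ennreal (min ((norm (G (X r \<omega> - (y + (r - s) *\<^sub>R z))))\<^sup>2) 1)
      \<le> ennreal (L \<omega>) * indicator B \<omega> * ennreal (g \<omega>)
      + (ennreal (L \<omega>) * indicator B \<omega> * ennreal b + ennreal (4 / l) * (ennreal (L \<omega>) * I \<omega>))"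
      using energy_pathwise
    proof eventually_elim
      case (elim \<omega>)
      let ?m = "ennreal (min ((norm (G (X r \<omega> - (y + (r - s) *\<^sub>R z))))\<^sup>2) 1)"
      have "?m \<le> ennreal (g \<omega>) + ennreal b + ennreal (4 / l) * I \<omega>"
      proof (cases "norm (G (X s \<omega> - y)) < 1")
        case True
        have "?m \<le> ennreal ((norm (G (X s \<omega> - y) + G (W r \<omega> - W s \<omega> - (r - s) *\<^sub>R w)))\<^sup>2) + ennreal b + ennreal (4 / l) * I \<omega>"
          unfolding b_def I_def using elim s0 t(4) yD by blast
        then show ?thesis unfolding g_def rec using True by simp
      next
        case False
        \<comment> \<open>The truncated energy never exceeds 1, which is the value of
          \<open>g\<close> in this case.\<close>
        have "?m \<le> ennreal 1" by (intro ennreal_leI) simp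
        also have "\<dots> \<le> ennreal (g \<omega>) + (ennreal b + ennreal (4 / l) * I \<omega>)" using False by (simp add: g_def)
        finally show ?thesis by (simp add: add.assoc)
      qed
      from mult_left_mono[OF this, of "ennreal (L \<omega>) * indicator B \<omega>"]
      show ?case by (cases "\<omega> \<in> B") (auto simp: distrib_left mult_ac add_ac)
    qed
  qed
  also have "\<dots> = (\<integral>\<^sup>+\<omega>. ennreal (L \<omega>) * indicator B \<omega> * ennreal (g \<omega>) \<partial>M)
     + ((\<integral>\<^sup>+\<omega>. ennreal (L \<omega>) * indicator B \<omega> \<partial>M) * ennreal b + ennreal (4 / l) * (\<integral>\<^sup>+\<omega>. ennreal (L \<omega>) * I \<omega> \<partial>M))"
  proof -
    have m1: "(\<lambda>\<omega>. ennreal (L \<omega>) * indicator B \<omega> * ennreal (g \<omega>)) \<in> borel_measurable M"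
      and m2: "(\<lambda>\<omega>. ennreal (L \<omega>) * indicator B \<omega> * ennreal b) \<in> borel_measurable M"
      and m3: "(\<lambda>\<omega>. ennreal (4 / l) * (ennreal (L \<omega>) * I \<omega>)) \<in> borel_measurable M"
      and m4: "(\<lambda>\<omega>. ennreal (L \<omega>) * indicator B \<omega> :: ennreal) \<in> borel_measurable M"
      and m5: "(\<lambda>\<omega>. ennreal (L \<omega>) * I \<omega>) \<in> borel_measurable M" by measurable
    show ?thesis
      unfolding nn_integral_add[OF m1 borel_measurable_add[OF m2 m3]] nn_integral_add[OF m2 m3]
        nn_integral_multc[OF m4] nn_integral_cmult[OF m5] ..
  qed
  also have "(\<integral>\<^sup>+\<omega>. ennreal (L \<omega>) * indicator B \<omega> \<partial>M) = emeasure M B"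
    unfolding L_def by (rule weight_expectation[OF t(1) s0(4) B])
  also have "(\<integral>\<^sup>+\<omega>. ennreal (L \<omega>) * indicator B \<omega> * ennreal (g \<omega>) \<partial>M) \<le> energy j \<kappa> r0 B s y + ennreal ((r - s) * suminf q) * emeasure M B"
    unfolding L_def g_def by (rule energy_martingale_step[OF t B])
  also have "(\<integral>\<^sup>+\<omega>. ennreal (L \<omega>) * I \<omega> \<partial>M) \<le> ennreal (increment_constant (exp (\<kappa>\<^sup>2 * T)) * sqrt (r - s) * (r - s))"
    unfolding I_def
  proof (rule nn_integral_time_average[OF jm Lm L0 _ s0(2)])
    show "0 \<le> increment_constant (exp (\<kappa>\<^sup>2 * T)) * sqrt (r - s)" using s0 by (intro mult_nonneg_nonneg increment_constant_nonneg) auto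
    fix \<tau> assume \<tau>: "\<tau> \<in> {s..r}"
    have "(\<integral>\<^sup>+\<omega>. ennreal (L \<omega> * norm (J (X r \<omega> - XT \<tau> \<omega>))) \<partial>M) \<le> ennreal (increment_constant (exp (\<kappa>\<^sup>2 * T)) * sqrt (r - \<tau>))"
    proof (rule J_increment_expectation[OF _ _ t(4) Lm L0])
      show "(\<integral>\<^sup>+\<omega>. ennreal ((L \<omega>)\<^sup>2) \<partial>M) \<le> ennreal (exp (\<kappa>\<^sup>2 * T))"
        unfolding L_def using t by (intro weight_second_moment) auto
    qed (use \<tau> s0 in auto)
    also have "\<dots> \<le> ennreal (increment_constant (exp (\<kappa>\<^sup>2 * T)) * sqrt (r - s))"
      using \<tau> by (intro ennreal_leI mult_left_mono increment_constant_nonneg) auto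
    finally show "(\<integral>\<^sup>+\<omega>. ennreal (L \<omega> * norm (J (X r \<omega> - XT \<tau> \<omega>))) \<partial>M) \<le> ennreal (increment_constant (exp (\<kappa>\<^sup>2 * T)) * sqrt (r - s))" .
  qed simp
  also have "ennreal (4 / l) * ennreal (increment_constant (exp (\<kappa>\<^sup>2 * T)) * sqrt (r - s) * (r - s)) = ennreal (c * ((r - s) * sqrt (r - s)))"
    unfolding c_def using l_pos by (simp add: ennreal_mult'[symmetric] mult_ac)
  finally have "energy j \<kappa> r0 B r (y + (r - s) *\<^sub>R z) \<le> energy j \<kappa> r0 B s y + ennreal ((r - s) * suminf q) * emeasure M B
     + (emeasure M B * ennreal b + ennreal (c * ((r - s) * sqrt (r - s))))"
    by (simp add: add_mono mult_left_mono)
  also have "\<dots> = energy j \<kappa> r0 B s y + (ennreal ((r - s) * suminf q) + ennreal b) * emeasure M B + ennreal (c * ((r - s) * sqrt (r - s)))"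
    unfolding distrib_right mult.commute[of "emeasure M B" "ennreal b"] by (simp only: add.assoc)
  also have "ennreal ((r - s) * suminf q) + ennreal b = ennreal ((r - s) * (suminf q + 2 * (C + norm (A (y + (r - s) *\<^sub>R z)) + norm (w - z))))"
  proof -
    have "0 \<le> (r - s) * suminf q" using s0 trace_nonneg by simp
    then have "ennreal ((r - s) * suminf q) + ennreal b = ennreal ((r - s) * suminf q + b)" using b0 by (rule ennreal_plus[symmetric])
    also have "(r - s) * suminf q + b = (r - s) * (suminf q + 2 * (C + norm (A (y + (r - s) *\<^sub>R z)) + norm (w - z)))"
      unfolding b_def by (simp add: algebra_simps)
    finally show ?thesis .
  qed
  finally show ?thesis .
qed

text \<open>The constant \<open>c\<close> of a step depends on \<open>l\<close>, but it multiplies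
  the superlinear error only and does not enter \<open>k\<close>. The bound is therefore uniform in
  the resolvent parameter.\<close>

lemma energy_bound:
  fixes \<kappa> :: real and j :: nat
  assumes t: "0 \<le> r0" "r0 \<le> t" "t \<le> T" and B: "B \<in> sets (Filt r0)" and y: "y \<in> DA" "z \<in> DA"
  defines "w \<equiv> (sqrt (q j) * \<kappa>) *\<^sub>R e j"
  defines "k \<equiv> (suminf q + 2 * (C + (norm (A y) + (t - r0) * norm (A z)) + norm (w - z))) * prob B"
  shows "energy j \<kappa> r0 B t (y + (t - r0) *\<^sub>R z) \<le> energy j \<kappa> r0 B r0 y + ennreal (k * (t - r0))"
proof -
  define E where "E r = energy j \<kappa> r0 B r (y + (r - r0) *\<^sub>R z)" for r
  define h where "h r = enn2real (E r)" for r
  define c where "c = 4 / l * increment_constant (exp (\<kappa>\<^sup>2 * T))"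
  have c0: "0 \<le> c" unfolding c_def using l_pos by (intro mult_nonneg_nonneg increment_constant_nonneg) auto
  \<comment> \<open>The summation over a partition needs real numbers; finiteness comes from the
    truncation and the mean one of the weight.\<close>
  have fin: "E r = ennreal (h r)" if r: "r0 \<le> r" "r \<le> t" for r
  proof -
    have "E r \<le> (\<integral>\<^sup>+\<omega>. ennreal (weight j \<kappa> (r - r0) (W r \<omega> - W r0 \<omega>)) * indicator B \<omega> \<partial>M)"
      unfolding E_def energy_def
    proof (rule nn_integral_mono)
      fix \<omega>
      have "ennreal (min ((norm (G (X r \<omega> - (y + (r - r0) *\<^sub>R z))))\<^sup>2) 1) \<le> ennreal 1" by (intro ennreal_leI) simp
      from mult_left_mono[OF this, of "ennreal (weight j \<kappa> (r - r0) (W r \<omega> - W r0 \<omega>)) * indicator B \<omega>"]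
      show "ennreal (weight j \<kappa> (r - r0) (W r \<omega> - W r0 \<omega>)) * indicator B \<omega> * ennreal (min ((norm (G (X r \<omega> - (y + (r - r0) *\<^sub>R z))))\<^sup>2) 1)
         \<le> ennreal (weight j \<kappa> (r - r0) (W r \<omega> - W r0 \<omega>)) * indicator B \<omega>" by simp
    qed
    also have "\<dots> = emeasure M B" by (rule weight_expectation[OF t(1) r(1) B])
    also have "\<dots> < \<infinity>" by (simp add: emeasure_eq_measure)
    finally show ?thesis unfolding h_def by (simp add: less_top)
  qed
  have "h t - h r0 \<le> k * (t - r0)"
  proof (rule increment_le_of_superlinear_error[where c = c and \<Psi> = "\<lambda>x. x"])
    fix s r assume sr: "r0 \<le> s" "s < r" "r \<le> t"
    have yD: "y + (r' - r0) *\<^sub>R z \<in> DA" for r' using y A_linear(1) by (intro subspace_add subspace_scale)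
    have eq: "(y + (s - r0) *\<^sub>R z) + (r - s) *\<^sub>R z = y + (r - r0) *\<^sub>R z" by (simp add: algebra_simps)
    have "E r \<le> E s + ennreal ((r - s) * (suminf q + 2 * (C + norm (A (y + (r - r0) *\<^sub>R z)) + norm (w - z)))) * emeasure M B
      + ennreal (c * ((r - s) * sqrt (r - s)))"
      using energy_step[OF t(1) sr(1,2) _ B, of "y + (s - r0) *\<^sub>R z" z j \<kappa>] sr t yD unfolding eq E_def c_def w_def by simp
    also have "\<dots> \<le> E s + ennreal (k * (r - s)) + ennreal (c * ((r - s) * sqrt (r - s)))"
    proof (intro add_right_mono add_left_mono)
      have "norm (A (y + (r - r0) *\<^sub>R z)) \<le> norm (A y) + (r - r0) * norm (A z)"
      proof -
        have zD: "(r - r0) *\<^sub>R z \<in> DA" by (rule subspace_scale[OF A_linear(1) y(2)])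
        have "A (y + (r - r0) *\<^sub>R z) = A y + (r - r0) *\<^sub>R A z" unfolding A_linear(2)[OF y(1) zD] A_linear(3)[OF y(2)] ..
        then show ?thesis using norm_triangle_ineq[of "A y" "(r - r0) *\<^sub>R A z"] sr by simp
      qed
      also have "\<dots> \<le> norm (A y) + (t - r0) * norm (A z)" using sr by (intro add_left_mono mult_right_mono) auto
      finally have le: "suminf q + 2 * (C + norm (A (y + (r - r0) *\<^sub>R z)) + norm (w - z))
        \<le> suminf q + 2 * (C + (norm (A y) + (t - r0) * norm (A z)) + norm (w - z))" by simp
      have "ennreal ((r - s) * (suminf q + 2 * (C + norm (A (y + (r - r0) *\<^sub>R z)) + norm (w - z)))) * emeasure M B
        = ennreal ((r - s) * (suminf q + 2 * (C + norm (A (y + (r - r0) *\<^sub>R z)) + norm (w - z))) * prob B)"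
        by (simp add: emeasure_eq_measure ennreal_mult'')
      also have "\<dots> \<le> ennreal (k * (r - s))"
      proof (rule ennreal_leI)
        have "(r - s) * (suminf q + 2 * (C + norm (A (y + (r - r0) *\<^sub>R z)) + norm (w - z))) * prob B
          \<le> (r - s) * (suminf q + 2 * (C + (norm (A y) + (t - r0) * norm (A z)) + norm (w - z))) * prob B"
          using le sr by (intro mult_right_mono mult_left_mono) auto
        then show "(r - s) * (suminf q + 2 * (C + norm (A (y + (r - r0) *\<^sub>R z)) + norm (w - z))) * prob B \<le> k * (r - s)"
          unfolding k_def by (simp add: mult_ac)
      qed
      finally show "ennreal ((r - s) * (suminf q + 2 * (C + norm (A (y + (r - r0) *\<^sub>R z)) + norm (w - z)))) * emeasure M B \<le> ennreal (k * (r - s))" .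
    qed
    finally have "ennreal (h r) \<le> ennreal (h s) + ennreal (k * (r - s)) + ennreal (c * ((r - s) * sqrt (r - s)))"
      using fin[of r] fin[of s] sr by simp
    moreover have k0: "0 \<le> k" unfolding k_def using trace_nonneg C_nonneg t by (intro mult_nonneg_nonneg add_nonneg_nonneg) auto
    moreover have h0: "0 \<le> h s" by (simp add: h_def)
    moreover have p: "0 \<le> k * (r - s)" "0 \<le> c * ((r - s) * sqrt (r - s))" using k0 c0 sr by auto
    ultimately have "ennreal (h r) \<le> ennreal (h s + k * (r - s) + c * ((r - s) * sqrt (r - s)))"
      by (simp only: ennreal_plus[OF add_nonneg_nonneg[OF h0 p(1)] p(2)] ennreal_plus[OF h0 p(1)])
    then have "h r \<le> h s + k * (r - s) + c * ((r - s) * sqrt (r - s))"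
      by (subst (asm) ennreal_le_iff) (use h0 p in linarith)+
    then show "h r - h s \<le> k * (r - s) + c * ((r - s) * sqrt (r - s))" by simp
  qed (rule t(2))
  then have "ennreal (h t) \<le> ennreal (h r0 + k * (t - r0))" by (intro ennreal_leI) simp
  also have "\<dots> = ennreal (h r0) + ennreal (k * (t - r0))"
    using trace_nonneg C_nonneg t unfolding k_def h_def by (intro ennreal_plus mult_nonneg_nonneg add_nonneg_nonneg) auto
  finally show ?thesis using fin[of t] fin[of r0] t by (simp add: E_def)
qed

end

section \<open>The support of the law\<close>

context spde
begin

text \<open>As \<open>k\<close> does not involve \<open>l\<close>, the parameter may tend to 0: the
  resolvents converge strongly to the identity, and Fatou's lemma transfers the bound to the process
  itself. At time \<open>r0\<close> contractivity removes the resolvents.\<close>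

lemma shifted_energy_bound:
  fixes \<kappa> :: real and j :: nat
  assumes t: "0 \<le> r0" "r0 \<le> t" "t \<le> T" and B: "B \<in> sets (Filt r0)" and y: "y \<in> DA" "z \<in> DA"
  defines "w \<equiv> (sqrt (q j) * \<kappa>) *\<^sub>R e j"
  defines "k \<equiv> (suminf q + 2 * (C + (norm (A y) + (t - r0) * norm (A z)) + norm (w - z))) * prob B"
  shows "(\<integral>\<^sup>+\<omega>. ennreal (weight j \<kappa> (t - r0) (W t \<omega> - W r0 \<omega>) * indicat_real B \<omega> * min ((norm (X t \<omega> - (y + (t - r0) *\<^sub>R z)))\<^sup>2) 1) \<partial>M)
    \<le> (\<integral>\<^sup>+\<omega>. ennreal (indicat_real B \<omega> * min ((norm (X r0 \<omega> - y))\<^sup>2) 1) \<partial>M) + ennreal (k * (t - r0))"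
proof -
  define l where "l n = 1 / real (Suc n)" for n
  have l: "l n > 0" for n by (simp add: l_def)
  have "\<exists>J. linear J \<and> (\<forall>x. J x \<in> DA) \<and> (\<forall>x. J x - l n *\<^sub>R A (J x) = x) \<and> (\<forall>x\<in>DA. J (x - l n *\<^sub>R A x) = x)
    \<and> (\<forall>x. norm (J x) \<le> norm x) \<and> (\<forall>x y. J x \<bullet> y = x \<bullet> J y)" for n
    by (rule selfadjoint_resolvent[OF A_selfadjoint A_nonpos l[of n]]) blast+
  then obtain J where J: "\<And>n. linear (J n)" "\<And>n x. J n x \<in> DA" "\<And>n x. J n x - l n *\<^sub>R A (J n x) = x"
    "\<And>n x. x \<in> DA \<Longrightarrow> J n (x - l n *\<^sub>R A x) = x" "\<And>n x. norm (J n x) \<le> norm x" "\<And>n x y. J n x \<bullet> y = x \<bullet> J n y"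
    by metis
  have R: "spde_resolvent M e q W \<beta> \<eta> DA V A S F T C K X Y (J n) (l n)" for n
    by (intro spde_resolvent.intro spde_axioms spde_resolvent_axioms.intro l J)
  have "l \<longlonglongrightarrow> 0" unfolding l_def by (rule LIMSEQ_Suc[OF lim_1_over_n])
  then have Jlim: "(\<lambda>n. J n x) \<longlonglongrightarrow> x" for x
    by (intro selfadjoint_resolvent_convergence[OF A_dense J(1,3,4,5) l])
  have Glim: "(\<lambda>n. J n (J n x)) \<longlonglongrightarrow> x" for x
  proof -
    have "(\<lambda>n. norm (J n x - x)) \<longlonglongrightarrow> norm (x - x)" by (intro tendsto_intros Jlim)
    then have 0: "(\<lambda>n. norm (J n x - x)) \<longlonglongrightarrow> 0" by simp
    \<comment> \<open>The outer resolvent acts on a null sequence and is a contraction, so strong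
      convergence of \<open>J n\<close> passes to its square.\<close>
    have "(\<lambda>n. J n (J n x - x)) \<longlonglongrightarrow> 0"
      by (rule Lim_null_comparison[OF _ 0]) (intro always_eventually allI J(5))
    from tendsto_add[OF this Jlim[of x]] show ?thesis by (simp add: linear_diff[OF J(1)])
  qed
  define L where "L \<omega> = weight j \<kappa> (t - r0) (W t \<omega> - W r0 \<omega>)" for \<omega>
  have L0: "0 \<le> L \<omega>" for \<omega> unfolding L_def by (rule less_imp_le[OF weight_pos])
  define v where "v \<omega> = X t \<omega> - (y + (t - r0) *\<^sub>R z)" for \<omega>
  define RHS where "RHS = (\<integral>\<^sup>+\<omega>. ennreal (indicat_real B \<omega> * min ((norm (X r0 \<omega> - y))\<^sup>2) 1) \<partial>M) + ennreal (k * (t - r0))"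
  have BM: "B \<in> events" using B filtration_subset by blast
  have bound: "(\<integral>\<^sup>+\<omega>. ennreal (L \<omega> * indicat_real B \<omega> * min ((norm (J n (J n (v \<omega>))))\<^sup>2) 1) \<partial>M) \<le> RHS" for n
  proof -
    note E = spde_resolvent.energy_def[OF R[of n]] and G = spde_resolvent.G_def[OF R[of n]]
    have "(\<integral>\<^sup>+\<omega>. ennreal (L \<omega> * indicat_real B \<omega> * min ((norm (J n (J n (v \<omega>))))\<^sup>2) 1) \<partial>M)
      = (\<integral>\<^sup>+\<omega>. ennreal (L \<omega>) * indicator B \<omega> * ennreal (min ((norm (J n (J n (v \<omega>))))\<^sup>2) 1) \<partial>M)"
      by (intro nn_integral_cong) (simp add: ennreal_mult' L0 ennreal_indicator)
    also have "\<dots> \<le> (\<integral>\<^sup>+\<omega>. ennreal (weight j \<kappa> (r0 - r0) (W r0 \<omega> - W r0 \<omega>)) * indicator B \<omega> * ennreal (min ((norm (J n (J n (X r0 \<omega> - y))))\<^sup>2) 1) \<partial>M)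
        + ennreal (k * (t - r0))"
      using spde_resolvent.energy_bound[OF R[of n] t B y, of j \<kappa>] unfolding E G L_def v_def k_def w_def .
    also have "\<dots> \<le> RHS"
      unfolding RHS_def
    proof (intro add_right_mono nn_integral_mono)
      fix \<omega>
      have "norm (J n (J n (X r0 \<omega> - y))) \<le> norm (X r0 \<omega> - y)" using J(5)[of n "J n (X r0 \<omega> - y)"] J(5)[of n "X r0 \<omega> - y"] by linarith
      then have "min ((norm (J n (J n (X r0 \<omega> - y))))\<^sup>2) 1 \<le> min ((norm (X r0 \<omega> - y))\<^sup>2) 1"
        by (intro min.mono power_mono) auto
      then show "ennreal (weight j \<kappa> (r0 - r0) (W r0 \<omega> - W r0 \<omega>)) * indicator B \<omega> * ennreal (min ((norm (J n (J n (X r0 \<omega> - y))))\<^sup>2) 1)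
         \<le> ennreal (indicat_real B \<omega> * min ((norm (X r0 \<omega> - y))\<^sup>2) 1)"
        by (cases "\<omega> \<in> B") (auto simp: weight_def intro: ennreal_leI)
    qed
    finally show ?thesis .
  qed
  have [measurable]: "W t \<in> borel_measurable M" "W r0 \<in> borel_measurable M" "X t \<in> borel_measurable M"
    using t by (auto intro!: W_measurable X_measurable)
  have [measurable]: "J n \<in> borel_measurable borel" for n by (rule spde_resolvent.J_measurable[OF R[of n]])
  note [measurable] = BM
  have "(\<integral>\<^sup>+\<omega>. ennreal (L \<omega> * indicat_real B \<omega> * min ((norm (v \<omega>))\<^sup>2) 1) \<partial>M)
     = (\<integral>\<^sup>+\<omega>. liminf (\<lambda>n. ennreal (L \<omega> * indicat_real B \<omega> * min ((norm (J n (J n (v \<omega>))))\<^sup>2) 1)) \<partial>M)"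
  proof (intro nn_integral_cong lim_imp_Liminf[symmetric])
    fix \<omega>
    show "(\<lambda>n. ennreal (L \<omega> * indicat_real B \<omega> * min ((norm (J n (J n (v \<omega>))))\<^sup>2) 1)) \<longlonglongrightarrow> ennreal (L \<omega> * indicat_real B \<omega> * min ((norm (v \<omega>))\<^sup>2) 1)"
      by (intro tendsto_ennrealI tendsto_intros tendsto_min Glim)
  qed simp
  also have "\<dots> \<le> liminf (\<lambda>n. \<integral>\<^sup>+\<omega>. ennreal (L \<omega> * indicat_real B \<omega> * min ((norm (J n (J n (v \<omega>))))\<^sup>2) 1) \<partial>M)"
    by (rule nn_integral_liminf) (unfold L_def v_def, measurable)
  also have "\<dots> \<le> liminf (\<lambda>n. RHS)" by (intro Liminf_mono always_eventually allI bound)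
  also have "\<dots> = RHS" by (rule Liminf_const) simp
  finally show ?thesis unfolding L_def v_def RHS_def .
qed

definition support :: "real \<Rightarrow> 'a set" where
  "support t = {x. \<forall>\<rho>>0. 0 < prob {\<omega> \<in> space M. norm (X t \<omega> - x) < \<rho>}}"

lemma ball_event: "t \<in> {0..T} \<Longrightarrow> {\<omega> \<in> space M. norm (X t \<omega> - x) < \<rho>} \<in> events"
  using X_measurable[of t] by measurable

text \<open>
  The event \<open>B\<close> of the proof is that \<open>X\<close> is close to \<open>x\<close> at time $t - \delta$. Its weighted probability is its
  probability, and the weighted energy at time \<open>t\<close> on \<open>B\<close> is a small fraction of that, so the energy
  cannot be bounded below almost surely.
\<close>

lemma support_shift:
  assumes t: "0 < t" "t \<le> T" and x: "x \<in> support t"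
  shows "x + c *\<^sub>R e j \<in> support t"
  unfolding support_def
proof (intro CollectI allI impI)
  fix \<epsilon>0 :: real assume \<epsilon>0: "0 < \<epsilon>0"
  define \<epsilon> where "\<epsilon> = min \<epsilon>0 1"
  have \<epsilon>: "0 < \<epsilon>" "\<epsilon> \<le> 1" "\<epsilon> \<le> \<epsilon>0" using \<epsilon>0 by (auto simp: \<epsilon>_def)
  \<comment> \<open>With \<open>4 * \<rho> = \<epsilon>\<^sup>2 / 8\<close> the final upper bound is
    \<open>\<epsilon>\<^sup>2 / 8 + \<epsilon>\<^sup>2 / 16\<close>, below the lower bound
    \<open>\<epsilon>\<^sup>2 / 4\<close>. The consequence
    \<open>4 * \<rho> \<le> \<epsilon>\<close> keeps the two approximation errors together below
    \<open>\<epsilon> / 2\<close>.\<close>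
  define \<rho> where "\<rho> = \<epsilon>\<^sup>2 / 32"
  have \<epsilon>2: "0 < \<epsilon>\<^sup>2" "\<epsilon>\<^sup>2 \<le> \<epsilon>" "\<epsilon>\<^sup>2 \<le> 1" using \<epsilon> by (auto simp: power2_eq_square mult_le_one mult_left_le)
  have \<rho>: "0 < \<rho>" "\<rho> \<le> 1/32" "4 * \<rho> \<le> \<epsilon>" using \<epsilon> \<epsilon>2 unfolding \<rho>_def by linarith+
  obtain y where y: "y \<in> DA" "dist y x < \<rho>" using A_dense \<rho>(1) closure_approachable[of x DA] by auto
  obtain z where z: "z \<in> DA" "dist z (c *\<^sub>R e j) < \<rho>" using A_dense \<rho>(1) closure_approachable[of "c *\<^sub>R e j" DA] by auto
  \<comment> \<open>The part of the growth rate that does not depend on the length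
    \<open>\<delta>\<close> of the last interval. The velocity of the segment is
    \<open>z / \<delta>\<close>, but \<open>norm (A z')\<close> appears in the rate with the factor
    \<open>\<delta>\<close>.\<close>
  define D where "D = suminf q + 2 * C + 2 * norm (A y) + 2 * norm (A z)"
  have D0: "0 \<le> D" unfolding D_def using trace_nonneg C_nonneg by simp
  \<comment> \<open>\<open>N\<close> is large enough for
    \<open>\<delta> n * D \<le> \<epsilon>\<^sup>2 / 16\<close> for every \<open>n\<close>, while
    \<open>n\<close> itself lets \<open>\<delta> n\<close> tend to 0.\<close>
  obtain N :: nat where N: "16 * (D * t) / \<epsilon>\<^sup>2 < real N" using reals_Archimedean2 by blast
  define \<delta> where "\<delta> n = t / real (N + n + 2)" for n
  have \<delta>: "0 < \<delta> n" "\<delta> n \<le> t" "\<delta> n * D \<le> \<epsilon>\<^sup>2 / 16" for n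
  proof -
    show "0 < \<delta> n" "\<delta> n \<le> t" using t unfolding \<delta>_def by (auto simp: field_simps)
    have "16 * (D * t) < real N * \<epsilon>\<^sup>2" using N \<epsilon>2 by (simp add: field_simps)
    also have "\<dots> \<le> real (N + n + 2) * \<epsilon>\<^sup>2" using \<epsilon>2 by (intro mult_right_mono) auto
    finally have "16 * (D * t) \<le> \<epsilon>\<^sup>2 * real (N + n + 2)" by (simp add: mult.commute)
    then have "16 * (D * t) / real (N + n + 2) \<le> \<epsilon>\<^sup>2" by (subst pos_divide_le_eq) auto
    then show "\<delta> n * D \<le> \<epsilon>\<^sup>2 / 16" unfolding \<delta>_def by (simp add: mult_ac)
  qed
  define Bn where "Bn n = {\<omega> \<in> space M. norm (X (t - \<delta> n) \<omega> - x) < \<rho>}" for n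
  have tn: "t - \<delta> n \<in> {0..T}" for n using \<delta>[of n] t by auto
  have Bn_ev: "Bn n \<in> events" for n unfolding Bn_def by (rule ball_event[OF tn])
  \<comment> \<open>By continuity of paths, the event that \<open>X t\<close> is near
    \<open>x\<close> is covered by the events \<open>Bn n\<close>; if all of these were null,
    \<open>x\<close> would not be in the support.\<close>
  have "\<exists>n. 0 < prob (Bn n)"
  proof (rule ccontr)
    assume "\<not> (\<exists>n. 0 < prob (Bn n))"
    then have "prob (Bn n) = 0" for n by (metis measure_nonneg order_antisym_conv not_less)
    then have "Bn n \<in> null_sets M" for n using Bn_ev by (auto simp: null_sets_def emeasure_eq_measure)
    then have null: "(\<Union>n. Bn n) \<in> null_sets M" by (intro null_sets_UN')  auto
    have "{\<omega> \<in> space M. norm (X t \<omega> - x) < \<rho>} \<subseteq> (\<Union>n. Bn n)"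
    proof
      fix \<omega> assume "\<omega> \<in> {\<omega> \<in> space M. norm (X t \<omega> - x) < \<rho>}"
      then have \<omega>: "\<omega> \<in> space M" "norm (X t \<omega> - x) < \<rho>" by auto
      have "(\<lambda>n. t * (1 / real (n + (N + 2)))) \<longlonglongrightarrow> t * 0" by (intro tendsto_intros LIMSEQ_ignore_initial_segment[OF lim_1_over_n])
      then have "\<delta> \<longlonglongrightarrow> 0" unfolding \<delta>_def by (simp add: add_ac)
      then have "(\<lambda>n. t - \<delta> n) \<longlonglongrightarrow> t - 0" by (intro tendsto_intros)
      then have "(\<lambda>n. X (t - \<delta> n) \<omega>) \<longlonglongrightarrow> X t \<omega>"
        using continuous_on_tendsto_compose[OF X_continuous[OF \<omega>(1)], of "\<lambda>n. t - \<delta> n" t sequentially] tn t by auto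
      then have "(\<lambda>n. norm (X (t - \<delta> n) \<omega> - x)) \<longlonglongrightarrow> norm (X t \<omega> - x)" by (intro tendsto_intros)
      then have "\<forall>\<^sub>F n in sequentially. norm (X (t - \<delta> n) \<omega> - x) < \<rho>" using \<omega>(2) by (rule order_tendstoD(2))
      then obtain n where "norm (X (t - \<delta> n) \<omega> - x) < \<rho>" unfolding eventually_sequentially by blast
      then show "\<omega> \<in> (\<Union>n. Bn n)" using \<omega>(1) by (auto simp: Bn_def)
    qed
    then have "prob {\<omega> \<in> space M. norm (X t \<omega> - x) < \<rho>} \<le> prob (\<Union>n. Bn n)"
      using Bn_ev by (intro finite_measure_mono) auto
    also have "\<dots> = 0" using null by (simp add: measure_eq_0_null_sets)
    finally show False using x \<rho>(1) unfolding support_def by fastforce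
  qed
  then obtain n where pos: "0 < prob (Bn n)" by blast
  define r0 where "r0 = t - \<delta> n"
  define B where "B = Bn n"
  have r0: "0 \<le> r0" "r0 \<le> t" "t - r0 = \<delta> n" "r0 \<in> {0..T}" using \<delta>[of n] tn[of n] by (auto simp: r0_def)
  have B: "B \<in> sets (Filt r0)"
  proof -
    have "X r0 \<in> borel_measurable (Filt r0)" using r0(4) by (rule X_adapted)
    then have "{\<omega> \<in> space (Filt r0). norm (X r0 \<omega> - x) < \<rho>} \<in> sets (Filt r0)" by measurable
    then show ?thesis unfolding B_def Bn_def r0_def[symmetric] by simp
  qed
  have BM: "B \<in> events" using B filtration_subset by blast
  \<comment> \<open>Chosen so that the drift gained by \<open>W\<close> amounts to exactly
    \<open>c *\<^sub>R e j\<close> over the time \<open>\<delta> n\<close>.\<close>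
  define \<kappa> where "\<kappa> = c / (sqrt (q j) * \<delta> n)"
  have w: "(sqrt (q j) * \<kappa>) *\<^sub>R e j = (1 / \<delta> n) *\<^sub>R (c *\<^sub>R e j)"
    using q_pos[of j] by (simp add: \<kappa>_def)
  define z' where "z' = (1 / \<delta> n) *\<^sub>R z"
  have z': "z' \<in> DA" unfolding z'_def by (rule subspace_scale[OF A_linear(1) z(1)])
  have dz: "(t - r0) *\<^sub>R z' = z" unfolding r0(3) z'_def using \<delta>(1)[of n] by simp
  define p where "p = prob B"
  have p: "0 < p" using pos by (simp add: p_def B_def)
  define L where "L \<omega> = weight j \<kappa> (t - r0) (W t \<omega> - W r0 \<omega>)" for \<omega>
  have L0: "0 \<le> L \<omega>" for \<omega> unfolding L_def by (rule less_imp_le[OF weight_pos])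
  have [measurable]: "W t \<in> borel_measurable M" "W r0 \<in> borel_measurable M" "X t \<in> borel_measurable M"
    using t r0 by (auto intro!: W_measurable X_measurable)
  note [measurable] = BM
  have Lm [measurable]: "L \<in> borel_measurable M" unfolding L_def by measurable
  define k where "k = (suminf q + 2 * (C + (norm (A y) + (t - r0) * norm (A z')) + norm ((sqrt (q j) * \<kappa>) *\<^sub>R e j - z'))) * prob B"
  have kd: "k * (t - r0) \<le> p * (\<epsilon>\<^sup>2 / 16 + 2 * \<rho>)"
  proof -
    have Az: "\<delta> n * norm (A z') = norm (A z)"
      unfolding z'_def A_linear(3)[OF z(1)] using \<delta>(1)[of n] by simp
    have wz: "norm ((sqrt (q j) * \<kappa>) *\<^sub>R e j - z') * \<delta> n = norm (c *\<^sub>R e j - z)"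
      unfolding w z'_def scaleR_diff_right[symmetric] using \<delta>(1)[of n] by simp
    have "k * (t - r0) = p * (\<delta> n * (suminf q + 2 * C + 2 * norm (A y) + 2 * norm (A z)) + 2 * (norm ((sqrt (q j) * \<kappa>) *\<^sub>R e j - z') * \<delta> n))"
      unfolding k_def r0(3) Az p_def by (simp add: algebra_simps)
    also have "\<dots> = p * (\<delta> n * D + 2 * norm (c *\<^sub>R e j - z))" unfolding wz D_def ..
    also have "\<dots> \<le> p * (\<epsilon>\<^sup>2 / 16 + 2 * \<rho>)"
      using p \<delta>(3)[of n] z(2) by (intro mult_left_mono) (auto simp: dist_norm norm_minus_commute)
    finally show ?thesis .
  qed
  have first: "(\<integral>\<^sup>+\<omega>. ennreal (indicat_real B \<omega> * min ((norm (X r0 \<omega> - y))\<^sup>2) 1) \<partial>M) \<le> ennreal ((2 * \<rho>)\<^sup>2) * emeasure M B"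
  proof -
    have "(\<integral>\<^sup>+\<omega>. ennreal (indicat_real B \<omega> * min ((norm (X r0 \<omega> - y))\<^sup>2) 1) \<partial>M) \<le> (\<integral>\<^sup>+\<omega>. ennreal ((2 * \<rho>)\<^sup>2) * indicator B \<omega> \<partial>M)"
    proof (rule nn_integral_mono)
      fix \<omega>
      show "ennreal (indicat_real B \<omega> * min ((norm (X r0 \<omega> - y))\<^sup>2) 1) \<le> ennreal ((2 * \<rho>)\<^sup>2) * indicator B \<omega>"
      proof (cases "\<omega> \<in> B")
        case True
        then have "norm (X r0 \<omega> - x) < \<rho>" by (simp add: B_def Bn_def r0_def)
        then have "norm (X r0 \<omega> - y) \<le> 2 * \<rho>"
          using y(2) norm_triangle_ineq[of "X r0 \<omega> - x" "x - y"] by (simp add: dist_norm norm_minus_commute)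
        then have "(norm (X r0 \<omega> - y))\<^sup>2 \<le> (2 * \<rho>)\<^sup>2" by (intro power_mono) auto
        then show ?thesis using True by (auto intro!: ennreal_leI)
      qed simp
    qed
    also have "\<dots> = ennreal ((2 * \<rho>)\<^sup>2) * emeasure M B" by (rule nn_integral_cmult_indicator[OF BM])
    finally show ?thesis .
  qed
  show "0 < prob {\<omega> \<in> space M. norm (X t \<omega> - (x + c *\<^sub>R e j)) < \<epsilon>0}"
  proof (rule ccontr)
    assume "\<not> 0 < prob {\<omega> \<in> space M. norm (X t \<omega> - (x + c *\<^sub>R e j)) < \<epsilon>0}"
    then have "prob {\<omega> \<in> space M. norm (X t \<omega> - (x + c *\<^sub>R e j)) < \<epsilon>0} = 0" by (simp add: not_less measure_le_0_iff)
    then have "{\<omega> \<in> space M. norm (X t \<omega> - (x + c *\<^sub>R e j)) < \<epsilon>0} \<in> null_sets M"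
      using ball_event[of t] t by (auto simp: null_sets_def emeasure_eq_measure)
    then have ae: "AE \<omega> in M. \<not> norm (X t \<omega> - (x + c *\<^sub>R e j)) < \<epsilon>0"
      using AE_not_in AE_space by fastforce
    \<comment> \<open>If the target ball were missed almost surely, the truncated energy would be at
      least \<open>(\<epsilon> / 2)\<^sup>2\<close> on \<open>B\<close>, and so would be its
      weighted mean relative to \<open>p\<close>; the energy bound is smaller.\<close>
    have "ennreal ((\<epsilon> / 2)\<^sup>2) * emeasure M B = ennreal ((\<epsilon> / 2)\<^sup>2) * (\<integral>\<^sup>+\<omega>. ennreal (L \<omega>) * indicator B \<omega> \<partial>M)"
      unfolding L_def weight_expectation[OF r0(1,2) B] ..
    also have "\<dots> = (\<integral>\<^sup>+\<omega>. ennreal ((\<epsilon> / 2)\<^sup>2) * (ennreal (L \<omega>) * indicator B \<omega>) \<partial>M)"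
      by (rule nn_integral_cmult[symmetric]) measurable
    also have "\<dots> \<le> (\<integral>\<^sup>+\<omega>. ennreal (L \<omega> * indicat_real B \<omega> * min ((norm (X t \<omega> - (y + (t - r0) *\<^sub>R z')))\<^sup>2) 1) \<partial>M)"
    proof (rule nn_integral_mono_AE)
      show "AE \<omega> in M. ennreal ((\<epsilon> / 2)\<^sup>2) * (ennreal (L \<omega>) * indicator B \<omega>)
         \<le> ennreal (L \<omega> * indicat_real B \<omega> * min ((norm (X t \<omega> - (y + (t - r0) *\<^sub>R z')))\<^sup>2) 1)"
        using ae
      proof eventually_elim
        case (elim \<omega>)
        have eq: "X t \<omega> - (x + c *\<^sub>R e j) = (X t \<omega> - (y + z)) + ((y - x) + (z - c *\<^sub>R e j))" by simp
        have "norm (X t \<omega> - (x + c *\<^sub>R e j)) \<le> norm (X t \<omega> - (y + z)) + (norm (y - x) + norm (z - c *\<^sub>R e j))"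
          unfolding eq using norm_triangle_ineq[of "X t \<omega> - (y + z)" "(y - x) + (z - c *\<^sub>R e j)"] norm_triangle_ineq[of "y - x" "z - c *\<^sub>R e j"]
          by linarith
        then have "\<epsilon> / 2 \<le> norm (X t \<omega> - (y + z))"
          using elim \<epsilon>(3) y(2) z(2) \<rho>(3) by (simp add: dist_norm)
        then have "(\<epsilon> / 2)\<^sup>2 \<le> (norm (X t \<omega> - (y + z)))\<^sup>2" using \<epsilon> by (intro power_mono) auto
        moreover have "(\<epsilon> / 2)\<^sup>2 \<le> 1" using \<epsilon> by (intro power_le_one) auto
        ultimately have "(\<epsilon> / 2)\<^sup>2 \<le> min ((norm (X t \<omega> - (y + (t - r0) *\<^sub>R z')))\<^sup>2) 1" unfolding dz by simp
        from mult_left_mono[OF this L0[of \<omega>]]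
        have "ennreal ((\<epsilon> / 2)\<^sup>2 * L \<omega>) \<le> ennreal (L \<omega> * min ((norm (X t \<omega> - (y + (t - r0) *\<^sub>R z')))\<^sup>2) 1)"
          by (intro ennreal_leI) (simp add: mult.commute)
        then show ?case using L0[of \<omega>] by (cases "\<omega> \<in> B") (auto simp: ennreal_mult'[symmetric] mult.commute)
      qed
    qed
    also have "\<dots> \<le> (\<integral>\<^sup>+\<omega>. ennreal (indicat_real B \<omega> * min ((norm (X r0 \<omega> - y))\<^sup>2) 1) \<partial>M) + ennreal (k * (t - r0))"
      unfolding L_def k_def by (rule shifted_energy_bound[OF r0(1,2) t(2) B y(1) z'])
    also have "\<dots> \<le> ennreal ((2 * \<rho>)\<^sup>2) * emeasure M B + ennreal (p * (\<epsilon>\<^sup>2 / 16 + 2 * \<rho>))"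
      by (intro add_mono first ennreal_leI kd)
    also have "\<dots> = ennreal ((2 * \<rho>)\<^sup>2 * p + p * (\<epsilon>\<^sup>2 / 16 + 2 * \<rho>))"
    proof -
      have "ennreal ((2 * \<rho>)\<^sup>2) * emeasure M B = ennreal ((2 * \<rho>)\<^sup>2 * p)"
        unfolding p_def emeasure_eq_measure by (simp add: ennreal_mult'')
      moreover have "ennreal ((2 * \<rho>)\<^sup>2 * p) + ennreal (p * (\<epsilon>\<^sup>2 / 16 + 2 * \<rho>)) = ennreal ((2 * \<rho>)\<^sup>2 * p + p * (\<epsilon>\<^sup>2 / 16 + 2 * \<rho>))"
        using p \<rho>(1) by (intro ennreal_plus[symmetric]) auto
      ultimately show ?thesis by simp
    qed
    finally have "ennreal ((\<epsilon> / 2)\<^sup>2 * p) \<le> ennreal ((2 * \<rho>)\<^sup>2 * p + p * (\<epsilon>\<^sup>2 / 16 + 2 * \<rho>))"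
      unfolding p_def emeasure_eq_measure by (simp add: ennreal_mult'')
    then have "(\<epsilon> / 2)\<^sup>2 * p \<le> (2 * \<rho>)\<^sup>2 * p + p * (\<epsilon>\<^sup>2 / 16 + 2 * \<rho>)"
      using p \<rho>(1) by (subst (asm) ennreal_le_iff) auto
    then have "p * ((\<epsilon> / 2)\<^sup>2) \<le> p * ((2 * \<rho>)\<^sup>2 + (\<epsilon>\<^sup>2 / 16 + 2 * \<rho>))" by (simp add: algebra_simps)
    then have "(\<epsilon> / 2)\<^sup>2 \<le> (2 * \<rho>)\<^sup>2 + (\<epsilon>\<^sup>2 / 16 + 2 * \<rho>)" using p by simp
    moreover have "(2 * \<rho>)\<^sup>2 \<le> 2 * \<rho> * 1" unfolding power2_eq_square using \<rho> by (intro mult_left_mono) auto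
    ultimately have "\<epsilon>\<^sup>2 / 4 \<le> 4 * \<rho> + \<epsilon>\<^sup>2 / 16" by (simp add: power_divide)
    also have "\<dots> = \<epsilon>\<^sup>2 / 8 + \<epsilon>\<^sup>2 / 16" by (simp add: \<rho>_def)
    finally show False using \<epsilon>2(1) by simp
  qed
qed

text \<open>Otherwise every point has a ball of probability 0 around it, and by Lindelof's theorem
  countably many such balls cover the space.\<close>

lemma support_nonempty:
  assumes "t \<in> {0..T}"
  shows "support t \<noteq> {}"
proof
  assume "support t = {}"
  then have "\<forall>x. \<exists>\<rho>>0. \<not> 0 < prob {\<omega> \<in> space M. norm (X t \<omega> - x) < \<rho>}" unfolding support_def by blast
  then obtain \<rho> where \<rho>: "\<And>x. \<rho> x > 0" "\<And>x. \<not> 0 < prob {\<omega> \<in> space M. norm (X t \<omega> - x) < \<rho> x}" by metis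
  obtain \<F> where \<F>: "\<F> \<subseteq> range (\<lambda>x. ball x (\<rho> x))" "countable \<F>" "\<Union>\<F> = \<Union>(range (\<lambda>x. ball x (\<rho> x)))"
    by (rule Lindelof[of "range (\<lambda>x. ball x (\<rho> x))"]) auto
  have null: "X t -` U \<inter> space M \<in> null_sets M" if U_in: "U \<in> \<F>" for U
  proof -
    obtain x where U: "U = ball x (\<rho> x)" using U_in \<F>(1) by blast
    have eq: "X t -` U \<inter> space M = {\<omega> \<in> space M. norm (X t \<omega> - x) < \<rho> x}"
      unfolding U by (auto simp: dist_norm norm_minus_commute)
    have "prob {\<omega> \<in> space M. norm (X t \<omega> - x) < \<rho> x} = 0" using \<rho>(2)[of x] by (simp add: not_less measure_le_0_iff)
    then show ?thesis unfolding eq using ball_event[OF assms] by (auto simp: null_sets_def emeasure_eq_measure)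
  qed
  have "(\<Union>U\<in>\<F>. X t -` U \<inter> space M) \<in> null_sets M" by (intro null_sets_UN' \<F>(2) null)
  moreover have "(\<Union>U\<in>\<F>. X t -` U \<inter> space M) = space M"
  proof -
    have "\<Union>\<F> = UNIV" unfolding \<F>(3) using \<rho>(1) by (auto intro!: bexI)
    then show ?thesis by blast
  qed
  ultimately show False using emeasure_space_1 by (simp add: null_sets_def)
qed

theorem ball_probability_positive:
  assumes t: "0 < t" "t \<le> T" and \<rho>: "\<rho> > 0"
  shows "0 < prob {\<omega> \<in> space M. norm (X t \<omega> - a) < \<rho>}"
proof -
  have tT: "t \<in> {0..T}" using t by simp
  obtain x0 where x0: "x0 \<in> support t" using support_nonempty[OF tT] by blast
  have shift: "\<forall>x\<in>support t. x + s \<in> support t" if "s \<in> span (range e)" for s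
    using that
  proof (induction rule: span_induct_alt)
    case base
    show ?case by simp
  next
    case (step c b s)
    then obtain j where b: "b = e j" by blast
    show ?case
    proof
      fix x assume "x \<in> support t"
      then have "x + c *\<^sub>R e j \<in> support t" by (rule support_shift[OF t])
      then have "(x + c *\<^sub>R e j) + s \<in> support t" using step by blast
      then show "x + (c *\<^sub>R b + s) \<in> support t" by (simp add: b add.assoc)
    qed
  qed
  have "a - x0 \<in> closure (span (range e))" using complete_span by simp
  then obtain s where s: "s \<in> span (range e)" "dist s (a - x0) < \<rho> / 2"
    using \<rho> unfolding closure_approachable by (meson half_gt_zero)
  have "x0 + s \<in> support t" using shift[OF s(1)] x0 by blast
  then have "0 < prob {\<omega> \<in> space M. norm (X t \<omega> - (x0 + s)) < \<rho> / 2}" using half_gt_zero[OF \<rho>] unfolding support_def by blast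
  also have "\<dots> \<le> prob {\<omega> \<in> space M. norm (X t \<omega> - a) < \<rho>}"
  proof (rule finite_measure_mono[OF _ ball_event[OF tT]])
    show "{\<omega> \<in> space M. norm (X t \<omega> - (x0 + s)) < \<rho> / 2} \<subseteq> {\<omega> \<in> space M. norm (X t \<omega> - a) < \<rho>}"
    proof
      fix \<omega> assume "\<omega> \<in> {\<omega> \<in> space M. norm (X t \<omega> - (x0 + s)) < \<rho> / 2}"
      moreover have "norm (X t \<omega> - a) \<le> norm (X t \<omega> - (x0 + s)) + norm (s - (a - x0))"
        using norm_triangle_ineq[of "X t \<omega> - (x0 + s)" "s - (a - x0)"] by (simp add: algebra_simps)
      ultimately show "\<omega> \<in> {\<omega> \<in> space M. norm (X t \<omega> - a) < \<rho>}" using s(2) by (simp add: dist_norm)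
    qed
  qed
  finally show ?thesis .
qed

end

section \<open>Smooth cylindrical functions\<close>

lemma partial_depends:
  assumes "\<forall>x y. (\<forall>i<m. x i = y i) \<longrightarrow> f x = f y"
  shows "\<forall>x y. (\<forall>i<m. x i = y i) \<longrightarrow> partial k f x = partial k f y"
proof (intro allI impI)
  fix x y :: "nat \<Rightarrow> real" assume xy: "\<forall>i<m. x i = y i"
  show "partial k f x = partial k f y"
  proof (cases "k < m")
    case True
    have "(\<lambda>t. f (x(k := t))) = (\<lambda>t. f (y(k := t)))" using assms xy by (auto simp: fun_eq_iff)
    then show ?thesis using xy True by (simp add: partial_def)
  next
    case False
    have "(\<lambda>t. f (x(k := t))) = (\<lambda>t. f x)" "(\<lambda>t. f (y(k := t))) = (\<lambda>t. f y)"
      using False by (intro ext assms[rule_format]; auto)+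
    then show ?thesis by (simp add: partial_def)
  qed
qed

lemma partial_eq_0:
  assumes "\<forall>x y. (\<forall>i<m. x i = y i) \<longrightarrow> f x = f y" and "m \<le> k"
  shows "partial k f x = 0"
proof -
  have "(\<lambda>t. f (x(k := t))) = (\<lambda>t. f x)"
    using assms(2) by (intro ext assms(1)[rule_format]) auto
  then show ?thesis by (simp add: partial_def)
qed

lemma smooth_compact_support_partial:
  assumes f: "smooth_compact_support m f" and k: "k < m"
  shows "smooth_compact_support m (partial k f)"
  unfolding smooth_compact_support_def
proof (intro conjI)
  show "\<forall>x y. (\<forall>i<m. x i = y i) \<longrightarrow> partial k f x = partial k f y"
    using f by (intro partial_depends) (simp add: smooth_compact_support_def)
  obtain r where r: "\<And>x i. i < m \<Longrightarrow> \<bar>x i\<bar> > r \<Longrightarrow> f x = 0"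
    using f unfolding smooth_compact_support_def by blast
  have "partial k f x = 0" if i: "i < m" "\<bar>x i\<bar> > r" for x i
  proof (cases "i = k")
    case False
    have "f (x(k := t)) = 0" for t by (rule r[of i]) (use i False in auto)
    then show ?thesis by (simp add: partial_def)
  next
    case True
    \<comment> \<open>When the large coordinate is the one that is differentiated, vanishing at the
      point is not enough. The condition is strict, so \<open>f\<close> vanishes on a neighbourhood
      in that coordinate.\<close>
    have "open {t::real. \<bar>t\<bar> > r}" by (intro open_Collect_less continuous_intros)
    then have "\<forall>\<^sub>F t in nhds (x k). f (x(k := t)) = 0"
      unfolding eventually_nhds using i True r[of k] k
      by (intro exI[of _ "{t. \<bar>t\<bar> > r}"]) auto
    then have "deriv (\<lambda>t. f (x(k := t))) (x k) = deriv (\<lambda>t. 0) (x k)" by (intro deriv_cong_ev) auto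
    then show ?thesis by (simp add: partial_def)
  qed
  then show "\<exists>r. \<forall>x. (\<exists>i<m. \<bar>x i\<bar> > r) \<longrightarrow> partial k f x = 0" by blast
  have *: "foldr partial is (partial k f) = foldr partial (is @ [k]) f" for "is" by simp
  have "is @ [k] \<in> lists {..<m}" if "is \<in> lists {..<m}" for "is" using that k by auto
  then show "\<forall>is\<in>lists {..<m}. continuous_on UNIV (foldr partial is (partial k f)) \<and>
      (\<forall>i<m. \<forall>x. (\<lambda>t. foldr partial is (partial k f) (x(i := t))) differentiable at (x i))"
    using f unfolding * smooth_compact_support_def by blast
qed

lemma
  assumes f: "smooth_compact_support m f"
  shows smooth_compact_support_continuous: "continuous_on UNIV f"
    and smooth_compact_support_differentiable: "k < m \<Longrightarrow> (\<lambda>t. f (x(k := t))) differentiable at (x k)"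
  using bspec[OF conjunct2[OF conjunct2[OF f[unfolded smooth_compact_support_def]]], of "[]"] by simp_all

lemma smooth_compact_support_depends:
  assumes "smooth_compact_support m f" "\<And>i. i < m \<Longrightarrow> x i = y i"
  shows "f x = f y"
  using conjunct1[OF assms(1)[unfolded smooth_compact_support_def]] assms(2) by blast

lemma smooth_compact_support_DERIV:
  assumes f: "smooth_compact_support m f" and k: "k < m"
  shows "((\<lambda>t. f (x(k := t))) has_real_derivative partial k f (x(k := t0))) (at t0)"
proof -
  have "(\<lambda>t. f (x(k := t))) differentiable at t0"
    using smooth_compact_support_differentiable[OF f k, of "x(k := t0)"] by simp
  then have "DERIV (\<lambda>t. f (x(k := t))) t0 :> deriv (\<lambda>t. f (x(k := t))) t0"
    by (simp only: DERIV_deriv_iff_real_differentiable)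
  then show ?thesis by (simp add: partial_def)
qed

text \<open>\<open>f\<close> depends on \<open>m\<close> entries only, so the remaining entries may
  be set to 0. The box that is left is compact in the product topology, and \<open>f\<close>
  vanishes where an entry with index below \<open>m\<close> leaves it.\<close>

lemma smooth_compact_support_bounded:
  assumes f: "smooth_compact_support m f"
  shows "\<exists>C. \<forall>x. \<bar>f x\<bar> \<le> C"
proof -
  obtain r where r: "\<And>x i. i < m \<Longrightarrow> \<bar>x i\<bar> > r \<Longrightarrow> f x = 0"
    using f unfolding smooth_compact_support_def by blast
  define K where "K = PiE UNIV (\<lambda>i. if i < m then {- \<bar>r\<bar>..\<bar>r\<bar>} else {0::real})"
  have "compactin (product_topology (\<lambda>i. euclidean) UNIV) K"
    unfolding K_def compactin_PiE by auto
  then have "compact K" by (simp add: euclidean_product_topology)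
  then have "compact (f ` K)"
    using continuous_on_subset[OF smooth_compact_support_continuous[OF f]] by (intro compact_continuous_image) auto
  then have "bounded (f ` K)" by (rule compact_imp_bounded)
  then obtain C where C: "\<And>y. y \<in> f ` K \<Longrightarrow> \<bar>y\<bar> \<le> C" unfolding bounded_real by blast
  have "\<bar>f x\<bar> \<le> max C 0" for x
  proof (cases "\<exists>i<m. \<bar>x i\<bar> > r")
    case True
    then have "f x = 0" using r by blast
    then show ?thesis by simp
  next
    case False
    define x' where "x' i = (if i < m then x i else 0)" for i
    have "x' i \<in> (if i < m then {- \<bar>r\<bar>..\<bar>r\<bar>} else {0})" for i
    proof (cases "i < m")
      case True
      moreover have "\<not> (i < m \<and> \<bar>x i\<bar> > r)" using False by blast
      ultimately have "\<bar>x i\<bar> \<le> r" by simp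
      then show ?thesis using True by (simp add: x'_def abs_le_iff)
    qed (simp add: x'_def)
    then have "x' \<in> K" unfolding K_def by (intro PiE_I) simp_all
    then have "\<bar>f x'\<bar> \<le> C" by (intro C imageI)
    moreover have "f x = f x'" by (rule smooth_compact_support_depends[OF f]) (simp add: x'_def)
    ultimately show ?thesis by simp
  qed
  then show ?thesis by blast
qed

lemma smooth_compact_support_foldr:
  "smooth_compact_support m f \<Longrightarrow> is \<in> lists {..<m} \<Longrightarrow> smooth_compact_support m (foldr partial is f)"
proof (induction "is")
  case (Cons i "is")
  then have "smooth_compact_support m (foldr partial is f)" "i < m" by simp_all
  then show ?case unfolding foldr_Cons comp_def by (rule smooth_compact_support_partial)
qed simp

text \<open>Derivatives up to the third order occur, the third in the Taylor remainder and as
  Lipschitz constant of the second. There are finitely many index lists, so one constant serves all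
  of them.\<close>

lemma smooth_compact_support_bounds:
  assumes f: "smooth_compact_support m f"
  obtains C where "C \<ge> 0" "\<And>is x. set is \<subseteq> {..<m} \<Longrightarrow> length is \<le> 3 \<Longrightarrow> \<bar>foldr partial is f x\<bar> \<le> C"
proof -
  define I where "I = {is. set is \<subseteq> {..<m} \<and> length is \<le> 3}"
  have fin: "finite I" unfolding I_def by (rule finite_lists_length_le) simp
  have "\<forall>is\<in>I. \<exists>C. \<forall>x. \<bar>foldr partial is f x\<bar> \<le> C"
    unfolding I_def by (intro ballI smooth_compact_support_bounded[where m = m] smooth_compact_support_foldr[OF f]) auto
  then obtain B where B: "\<And>is x. is \<in> I \<Longrightarrow> \<bar>foldr partial is f x\<bar> \<le> B is" by metis
  have B0: "0 \<le> B is" if "is \<in> I" for "is" using B[OF that, of undefined] by (rule order_trans[OF abs_ge_zero])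
  show thesis
  proof (rule that[of "sum B I"])
    show "0 \<le> sum B I" using B0 by (rule sum_nonneg)
    fix "is" x assume "set is \<subseteq> {..<m}" "length is \<le> 3"
    then have i: "is \<in> I" by (simp add: I_def)
    have "B is \<le> sum B I" using i B0 fin by (intro member_le_sum) auto
    then show "\<bar>foldr partial is f x\<bar> \<le> sum B I" using B[OF i, of x] by linarith
  qed
qed

text \<open>The intermediate points of Lindeberg's replacement method. Changing one entry at a time
  keeps the calculus one-dimensional, and the point with index \<open>k\<close> does not involve the
  entry \<open>y k\<close>; for random \<open>y\<close> with independent entries it is independent
  of the next change.\<close>

definition hybrid :: "nat \<Rightarrow> (nat \<Rightarrow> real) \<Rightarrow> (nat \<Rightarrow> real) \<Rightarrow> nat \<Rightarrow> real" where
  "hybrid k x y i = (if i < k then y i else x i)"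

lemma hybrid_0: "hybrid 0 x y = x" by (simp add: hybrid_def fun_eq_iff)

lemma hybrid_Suc: "hybrid (Suc k) x y = (hybrid k x y)(k := y k)"
  by (auto simp: hybrid_def fun_eq_iff less_Suc_eq)

lemma hybrid_diag: "hybrid k x y k = x k" by (simp add: hybrid_def)

lemma hybrid_telescope:
  assumes f: "smooth_compact_support m f"
  shows "f y - f x = (\<Sum>k<m. f ((hybrid k x y)(k := y k)) - f (hybrid k x y))"
proof -
  have "f y = f (hybrid m x y)" by (rule smooth_compact_support_depends[OF f]) (simp add: hybrid_def)
  then show ?thesis
    using sum_lessThan_telescope[of "\<lambda>k. f (hybrid k x y)" m] by (simp add: hybrid_0 hybrid_Suc)
qed

lemma smooth_compact_support_MVT:
  assumes f: "smooth_compact_support m f" and k: "k < m"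
  shows "\<exists>\<xi>. \<bar>\<xi> - x k\<bar> \<le> \<bar>t - x k\<bar> \<and> f (x(k := t)) - f x = (t - x k) * partial k f (x(k := \<xi>))"
proof -
  note D = smooth_compact_support_DERIV[OF f k, of x]
  consider "t = x k" | "x k < t" | "t < x k" by linarith
  then show ?thesis
  proof cases
    case 1
    then show ?thesis by (intro exI[of _ "x k"]) simp
  next
    case 2
    obtain \<xi> where "\<xi> > x k" "\<xi> < t" "f (x(k := t)) - f (x(k := x k)) = (t - x k) * partial k f (x(k := \<xi>))"
      using MVT2[OF 2 D] by blast
    then show ?thesis by (intro exI[of _ \<xi>]) auto
  next
    case 3
    obtain \<xi> where "\<xi> > t" "\<xi> < x k" "f (x(k := x k)) - f (x(k := t)) = (x k - t) * partial k f (x(k := \<xi>))"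
      using MVT2[OF 3 D] by blast
    then show ?thesis by (intro exI[of _ \<xi>]) (auto simp: algebra_simps)
  qed
qed

lemma smooth_compact_support_Lipschitz:
  assumes f: "smooth_compact_support m f" and C: "\<And>k x. k < m \<Longrightarrow> \<bar>partial k f x\<bar> \<le> C"
  shows "\<bar>f y - f x\<bar> \<le> C * (\<Sum>k<m. \<bar>y k - x k\<bar>)"
proof -
  have "\<bar>f y - f x\<bar> \<le> (\<Sum>k<m. \<bar>f ((hybrid k x y)(k := y k)) - f (hybrid k x y)\<bar>)"
    by (subst hybrid_telescope[OF f, of y x]) (rule sum_abs)
  also have "\<dots> \<le> (\<Sum>k<m. C * \<bar>y k - x k\<bar>)"
  proof (rule sum_mono)
    fix k assume "k \<in> {..<m}"
    then have k: "k < m" by simp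
    obtain \<xi> where "f ((hybrid k x y)(k := y k)) - f (hybrid k x y) = (y k - hybrid k x y k) * partial k f ((hybrid k x y)(k := \<xi>))"
      using smooth_compact_support_MVT[OF f k] by blast
    then have "\<bar>f ((hybrid k x y)(k := y k)) - f (hybrid k x y)\<bar> = \<bar>y k - x k\<bar> * \<bar>partial k f ((hybrid k x y)(k := \<xi>))\<bar>"
      by (simp add: hybrid_diag abs_mult)
    also have "\<dots> \<le> \<bar>y k - x k\<bar> * C" by (intro mult_left_mono C k) simp
    finally show "\<bar>f ((hybrid k x y)(k := y k)) - f (hybrid k x y)\<bar> \<le> C * \<bar>y k - x k\<bar>" by (simp add: mult.commute)
  qed
  finally show ?thesis by (simp add: sum_distrib_left)
qed

text \<open>Each replacement is treated by the mean value theorem, and the intermediate derivative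
  is compared with the one at \<open>x\<close> by its Lipschitz bound; this costs a product of two
  displacements.\<close>

lemma smooth_compact_support_first_order:
  assumes f: "smooth_compact_support m f" and C: "\<And>i k x. i < m \<Longrightarrow> k < m \<Longrightarrow> \<bar>partial i (partial k f) x\<bar> \<le> C" "0 \<le> C"
  shows "\<bar>f y - f x - (\<Sum>k<m. (y k - x k) * partial k f x)\<bar> \<le> C * (\<Sum>k<m. \<bar>y k - x k\<bar>)\<^sup>2"
proof -
  define S where "S = (\<Sum>k<m. \<bar>y k - x k\<bar>)"
  have eq: "f y - f x - (\<Sum>k<m. (y k - x k) * partial k f x)
    = (\<Sum>k<m. f ((hybrid k x y)(k := y k)) - f (hybrid k x y) - (y k - x k) * partial k f x)"
    by (subst hybrid_telescope[OF f, of y x]) (rule sum_subtractf[symmetric])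
  have "\<bar>f y - f x - (\<Sum>k<m. (y k - x k) * partial k f x)\<bar>
    \<le> (\<Sum>k<m. \<bar>f ((hybrid k x y)(k := y k)) - f (hybrid k x y) - (y k - x k) * partial k f x\<bar>)"
    unfolding eq by (rule sum_abs)
  also have "\<dots> \<le> (\<Sum>k<m. \<bar>y k - x k\<bar> * (C * S))"
  proof (rule sum_mono)
    fix k assume "k \<in> {..<m}"
    then have k: "k < m" by simp
    obtain \<xi> where \<xi>: "\<bar>\<xi> - hybrid k x y k\<bar> \<le> \<bar>y k - hybrid k x y k\<bar>"
      "f ((hybrid k x y)(k := y k)) - f (hybrid k x y) = (y k - hybrid k x y k) * partial k f ((hybrid k x y)(k := \<xi>))"
      using smooth_compact_support_MVT[OF f k] by blast
    have "\<bar>partial k f ((hybrid k x y)(k := \<xi>)) - partial k f x\<bar> \<le> C * (\<Sum>i<m. \<bar>((hybrid k x y)(k := \<xi>)) i - x i\<bar>)"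
      by (rule smooth_compact_support_Lipschitz[OF smooth_compact_support_partial[OF f k]]) (use C k in auto)
    also have "\<dots> \<le> C * S" unfolding S_def
      using \<xi>(1) C(2) by (intro mult_left_mono sum_mono) (auto simp: hybrid_def)
    finally have le: "\<bar>partial k f ((hybrid k x y)(k := \<xi>)) - partial k f x\<bar> \<le> C * S" .
    have "f ((hybrid k x y)(k := y k)) - f (hybrid k x y) - (y k - x k) * partial k f x
       = (y k - x k) * (partial k f ((hybrid k x y)(k := \<xi>)) - partial k f x)"
      unfolding \<xi>(2) by (simp add: hybrid_diag algebra_simps)
    then show "\<bar>f ((hybrid k x y)(k := y k)) - f (hybrid k x y) - (y k - x k) * partial k f x\<bar> \<le> \<bar>y k - x k\<bar> * (C * S)"
      using mult_left_mono[OF le, of "\<bar>y k - x k\<bar>"] by (simp add: abs_mult)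
  qed
  also have "\<dots> = C * S\<^sup>2" by (simp add: sum_distrib_right[symmetric] S_def[symmetric] power2_eq_square)
  finally show ?thesis unfolding S_def .
qed

text \<open>Maclaurin's formula of order three in a single coordinate; the factor 1/6 of the
  remainder is given away.\<close>

lemma smooth_compact_support_Taylor:
  assumes f: "smooth_compact_support m f" and k: "k < m" and C: "\<And>x. \<bar>partial k (partial k (partial k f)) x\<bar> \<le> C"
  shows "\<bar>f (x(k := x k + h)) - f x - h * partial k f x - h\<^sup>2 / 2 * partial k (partial k f) x\<bar> \<le> C * \<bar>h\<bar> ^ 3"
proof -
  define d where "d n t = (partial k ^^ n) f (x(k := x k + t))" for n t
  have smooth: "smooth_compact_support m ((partial k ^^ n) f)" for n
    by (induction n) (auto intro: f smooth_compact_support_partial[OF _ k])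
  have D: "DERIV (d n) t :> d (Suc n) t" for n t
  proof -
    have "((\<lambda>t. (partial k ^^ n) f (x(k := t))) has_real_derivative partial k ((partial k ^^ n) f) (x(k := t + x k))) (at (t + x k))"
      by (rule smooth_compact_support_DERIV[OF smooth k])
    then show ?thesis unfolding DERIV_shift d_def by (simp add: add.commute)
  qed
  obtain \<xi> where "d 0 h = (\<Sum>n<3. (d n 0 / fact n) * h ^ n) + (d 3 \<xi> / fact 3) * h ^ 3"
    using Maclaurin_all_le[of d "d 0" h 3] D by blast
  then have "f (x(k := x k + h)) - f x - h * partial k f x - h\<^sup>2 / 2 * partial k (partial k f) x
     = partial k (partial k (partial k f)) (x(k := x k + \<xi>)) / 6 * h ^ 3"
    by (simp add: d_def numeral_3_eq_3 lessThan_Suc fact_numeral power2_eq_square field_simps)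
  from arg_cong[OF this, of abs] have "\<bar>f (x(k := x k + h)) - f x - h * partial k f x - h\<^sup>2 / 2 * partial k (partial k f) x\<bar>
     = \<bar>partial k (partial k (partial k f)) (x(k := x k + \<xi>))\<bar> / 6 * \<bar>h\<bar> ^ 3"
    by (simp only: abs_mult abs_divide power_abs abs_numeral)
  also have "\<dots> \<le> C * \<bar>h\<bar> ^ 3"
  proof (rule mult_right_mono)
    show "\<bar>partial k (partial k (partial k f)) (x(k := x k + \<xi>))\<bar> / 6 \<le> C" using C[of "x(k := x k + \<xi>)"] by linarith
  qed simp
  finally show ?thesis .
qed

lemma smooth_compact_support_measurable: "smooth_compact_support m f \<Longrightarrow> f \<in> borel_measurable borel"
  by (rule borel_measurable_continuous_onI[OF smooth_compact_support_continuous])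

context orthonormal_basis
begin

abbreviation coordinates :: "'a \<Rightarrow> nat \<Rightarrow> real" where "coordinates x \<equiv> (\<lambda>j. x \<bullet> e j)"

lemma coordinates_measurable [measurable]: "coordinates \<in> borel_measurable borel"
  by (intro measurable_coordinatewise_then_product) measurable

lemma dir_deriv_coordinates: "dir_deriv (e i) (\<lambda>x. g (coordinates x)) = (\<lambda>x. partial i g (coordinates x))"
proof
  fix x
  have eq: "coordinates (x + t *\<^sub>R e i) = (coordinates x)(i := t + x \<bullet> e i)" for t
    by (auto simp: inner_add_left orthonormal fun_eq_iff)
  have "DERIV (\<lambda>t. g ((coordinates x)(i := t + x \<bullet> e i))) 0 :> D \<longleftrightarrow> DERIV (\<lambda>t. g ((coordinates x)(i := t))) (x \<bullet> e i) :> D" for D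
    using DERIV_shift[of "\<lambda>t. g ((coordinates x)(i := t))" D 0 "x \<bullet> e i"] by simp
  then show "dir_deriv (e i) (\<lambda>x. g (coordinates x)) x = partial i g (coordinates x)"
    unfolding dir_deriv_def eq partial_def deriv_def by simp
qed

text \<open>Derivatives in directions with index at least \<open>m\<close> vanish, which turns both
  series into finite sums.\<close>

lemma generator_eq:
  assumes f: "smooth_compact_support m f"
  shows "generator e q S F (\<lambda>x. f (coordinates x)) x =
    (\<Sum>i<m. 1/2 * q i * partial i (partial i f) (coordinates x)) + (\<Sum>i<m. drift S F x (e i) * partial i f (coordinates x))"
proof -
  have dep: "\<forall>x y. (\<forall>i<m. x i = y i) \<longrightarrow> f x = f y" using f by (simp add: smooth_compact_support_def)
  have 0: "partial i f z = 0" "partial i (partial i f) z = 0" if "i \<notin> {..<m}" for i z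
    using that partial_eq_0[OF dep] partial_eq_0[OF partial_depends[OF dep]] by auto
  show ?thesis unfolding generator_def dir_deriv_coordinates
    by (intro arg_cong2[where f = "(+)"] suminf_finite) (auto simp: 0)
qed

end

section \<open>Short-time expansion of the Wiener process\<close>

lemma Young_scaled:
  fixes x y :: real
  assumes "k > 0"
  shows "x * y \<le> (k * x\<^sup>2 + y\<^sup>2 / k) / 2"
proof -
  have "0 \<le> (k * x - y)\<^sup>2 / k" using assms by simp
  also have "\<dots> = k * x\<^sup>2 - 2 * (x * y) + y\<^sup>2 / k" using assms by (simp add: power2_eq_square field_simps)
  finally show ?thesis by simp
qed

lemma abs_le_Young:
  fixes t \<rho> :: real
  assumes "\<rho> > 0"
  shows "\<bar>t\<bar> \<le> \<rho> / 2 + t\<^sup>2 * (1 / (2 * \<rho>))"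
  using Young_scaled[OF assms, of 1 "\<bar>t\<bar>"] by (simp add: add_divide_distrib mult.commute)

context hilbert_wiener
begin

text \<open>The point \<open>p\<close> is built from increments with index below \<open>k\<close>,
  so it is independent of the increment number \<open>k\<close>.\<close>

lemma increment_factor:
  fixes u :: "(nat \<Rightarrow> real) \<Rightarrow> real" and v :: "real \<Rightarrow> real" and x :: "nat \<Rightarrow> real" and k :: nat
  assumes sr: "0 \<le> s" "s \<le> r" and u: "u \<in> borel_measurable borel" "\<And>z. \<bar>u z\<bar> \<le> D"
    and v: "v \<in> borel_measurable borel" "integrable M (\<lambda>\<omega>. v (\<beta> k r \<omega> - \<beta> k s \<omega>))"
  defines "p \<equiv> \<lambda>\<omega>. hybrid k x (\<lambda>i. x i + sqrt (q i) * (\<beta> i r \<omega> - \<beta> i s \<omega>))"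
  shows "integrable M (\<lambda>\<omega>. v (\<beta> k r \<omega> - \<beta> k s \<omega>) * u (p \<omega>))" "integrable M (\<lambda>\<omega>. u (p \<omega>))"
    "expectation (\<lambda>\<omega>. v (\<beta> k r \<omega> - \<beta> k s \<omega>) * u (p \<omega>)) = expectation (\<lambda>\<omega>. v (\<beta> k r \<omega> - \<beta> k s \<omega>)) * expectation (\<lambda>\<omega>. u (p \<omega>))"
proof -
  define g where "g i \<omega> = \<beta> i r \<omega> - \<beta> i s \<omega>" for i \<omega>
  have [measurable]: "g i \<in> borel_measurable M" for i unfolding g_def by (rule increment_measurable[OF sr])
  define Y1 where "Y1 z = v (z k)" for z :: "nat \<Rightarrow> real"
  define Y2 where "Y2 z = u (\<lambda>i. if i < k then x i + sqrt (q i) * z i else x i)" for z :: "nat \<Rightarrow> real"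
  have Y1m: "Y1 \<in> borel_measurable (PiM {k} (\<lambda>_. borel))"
  proof -
    have "(\<lambda>z. z k) \<in> borel_measurable (PiM {k} (\<lambda>_. borel :: real measure))" by (rule measurable_component_singleton) simp
    from measurable_compose[OF this v(1)] show ?thesis unfolding Y1_def .
  qed
  have Y2m: "Y2 \<in> borel_measurable (PiM {..<k} (\<lambda>_. borel))"
    unfolding Y2_def
  proof (rule measurable_compose[OF _ u(1)], rule measurable_coordinatewise_then_product)
    fix i
    show "(\<lambda>z. if i < k then x i + sqrt (q i) * z i else x i) \<in> borel_measurable (PiM {..<k} (\<lambda>_. borel))"
    proof (cases "i < k")
      case True
      then have "(\<lambda>z. z i) \<in> borel_measurable (PiM {..<k} (\<lambda>_. borel :: real measure))"
        by (intro measurable_component_singleton) simp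
      then show ?thesis using True by simp
    qed simp
  qed
  have "indep_var (PiM {k} (\<lambda>_. borel)) (\<lambda>\<omega>. restrict (\<lambda>i. g i \<omega>) {k}) (PiM {..<k} (\<lambda>_. borel)) (\<lambda>\<omega>. restrict (\<lambda>i. g i \<omega>) {..<k})"
    using increment_indep[OF sr] unfolding g_def by (rule indep_var_restrict) auto
  from indep_var_compose[OF this Y1m Y2m]
  have ind: "indep_var borel (\<lambda>\<omega>. v (g k \<omega>)) borel (\<lambda>\<omega>. u (p \<omega>))"
    unfolding comp_def Y1_def Y2_def p_def g_def[symmetric] hybrid_def by (simp cong: if_cong)
  have pm: "p \<in> borel_measurable M"
    unfolding p_def g_def[symmetric] hybrid_def by (intro measurable_coordinatewise_then_product) measurable
  have intu: "integrable M (\<lambda>\<omega>. u (p \<omega>))"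
    by (rule integrable_const_bound[where B = D]) (use u measurable_compose[OF pm u(1)] in auto)
  then show "integrable M (\<lambda>\<omega>. u (p \<omega>))" .
  have intv: "integrable M (\<lambda>\<omega>. v (g k \<omega>))" using v(2) unfolding g_def .
  show "integrable M (\<lambda>\<omega>. v (\<beta> k r \<omega> - \<beta> k s \<omega>) * u (p \<omega>))"
    "expectation (\<lambda>\<omega>. v (\<beta> k r \<omega> - \<beta> k s \<omega>) * u (p \<omega>)) = expectation (\<lambda>\<omega>. v (\<beta> k r \<omega> - \<beta> k s \<omega>)) * expectation (\<lambda>\<omega>. u (p \<omega>))"
    using indep_var_integrable[OF ind intv intu] indep_var_lebesgue_integral[OF ind intv intu] unfolding g_def by auto
qed

text \<open>Young's inequality at the scale \<open>sqrt (r - s)\<close> of the deviation; each of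
  its two halves contributes \<open>sqrt (r - s) / 2\<close>.\<close>

lemma increment_abs_moment:
  assumes sr: "0 \<le> s" "s < r"
  shows "integrable M (\<lambda>\<omega>. \<bar>\<beta> j r \<omega> - \<beta> j s \<omega>\<bar>)" "expectation (\<lambda>\<omega>. \<bar>\<beta> j r \<omega> - \<beta> j s \<omega>\<bar>) \<le> sqrt (r - s)"
proof -
  note mo = increment_moments[OF sr, of j]
  show i: "integrable M (\<lambda>\<omega>. \<bar>\<beta> j r \<omega> - \<beta> j s \<omega>\<bar>)" using mo(1) by (rule integrable_abs)
  have h: "sqrt (r - s) > 0" using sr by simp
  have "expectation (\<lambda>\<omega>. \<bar>\<beta> j r \<omega> - \<beta> j s \<omega>\<bar>) \<le> expectation (\<lambda>\<omega>. sqrt (r - s) / 2 + (\<beta> j r \<omega> - \<beta> j s \<omega>)\<^sup>2 * (1 / (2 * sqrt (r - s))))"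
  proof (rule integral_mono[OF i])
    show "integrable M (\<lambda>\<omega>. sqrt (r - s) / 2 + (\<beta> j r \<omega> - \<beta> j s \<omega>)\<^sup>2 * (1 / (2 * sqrt (r - s))))"
      using mo(3) by (intro Bochner_Integration.integrable_add integrable_mult_left) auto
    fix \<omega>
    show "\<bar>\<beta> j r \<omega> - \<beta> j s \<omega>\<bar> \<le> sqrt (r - s) / 2 + (\<beta> j r \<omega> - \<beta> j s \<omega>)\<^sup>2 * (1 / (2 * sqrt (r - s)))"
      by (rule abs_le_Young[OF h])
  qed
  also have "\<dots> = sqrt (r - s) / 2 + (r - s) * (1 / (2 * sqrt (r - s)))"
    using mo(3,4) by (subst Bochner_Integration.integral_add) (auto simp: prob_space)
  also have "(r - s) * (1 / (2 * sqrt (r - s))) = sqrt (r - s) / 2"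
    using real_sqrt_mult_self[of "r - s"] h sr by (simp add: field_simps)
  finally show "expectation (\<lambda>\<omega>. \<bar>\<beta> j r \<omega> - \<beta> j s \<omega>\<bar>) \<le> sqrt (r - s)" by simp
qed

text \<open>The two errors of a replacement: the first summand comes from moving the second
  derivative from the hybrid point back to \<open>x\<close>, the second from the Taylor remainder
  with the third absolute moment.\<close>

definition heat_constant :: "nat \<Rightarrow> real" where
  "heat_constant m = (\<Sum>k<m. q k * (\<Sum>i<m. sqrt (q i)) + 2 * (q k * sqrt (q k)))"

text \<open>Coordinates are replaced one at a time. Since the increment \<open>k\<close> is
  independent of the hybrid point \<open>p k\<close>, the first-order term has mean 0 and the
  second-order term has mean \<open>q k / 2 * h\<close> times the mean second derivative at
  \<open>p k\<close>.\<close>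

lemma heat_step:
  assumes sr: "0 \<le> s" "s < r" and f: "smooth_compact_support m f"
    and D: "0 \<le> D" "\<And>is x. set is \<subseteq> {..<m} \<Longrightarrow> length is \<le> 3 \<Longrightarrow> \<bar>foldr partial is f x\<bar> \<le> D"
  shows "\<bar>expectation (\<lambda>\<omega>. f (\<lambda>i. x i + sqrt (q i) * (\<beta> i r \<omega> - \<beta> i s \<omega>))) - f x
      - (r - s) * (\<Sum>i<m. 1/2 * q i * partial i (partial i f) x)\<bar> \<le> D * heat_constant m * ((r - s) * sqrt (r - s))"
proof -
  define h where "h = r - s"
  have h: "h > 0" using sr by (simp add: h_def)
  define g where "g i \<omega> = \<beta> i r \<omega> - \<beta> i s \<omega>" for i \<omega>
  have [measurable]: "g i \<in> borel_measurable M" for i unfolding g_def using sr by (intro increment_measurable) auto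
  define y where "y \<omega> i = x i + sqrt (q i) * g i \<omega>" for i \<omega>
  define p where "p k \<omega> = hybrid k x (y \<omega>)" for k \<omega>
  note mo = increment_moments[OF sr, folded g_def h_def] and am = increment_abs_moment[OF sr, folded g_def h_def]
  have sr': "0 \<le> s" "s \<le> r" using sr by auto
  note fac = increment_factor[OF sr', where x = x, folded g_def, folded y_def, folded p_def]
  have pm: "p k \<in> borel_measurable M" for k
    unfolding p_def y_def hybrid_def by (intro measurable_coordinatewise_then_product) measurable
  have ym: "y \<in> borel_measurable M"
    unfolding y_def by (intro measurable_coordinatewise_then_product) measurable
  define T where "T k \<omega> = f ((p k \<omega>)(k := y \<omega> k)) - f (p k \<omega>)" for k \<omega>
  have fm: "f \<in> borel_measurable borel" by (rule smooth_compact_support_measurable[OF f])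
  have fD: "\<bar>f z\<bar> \<le> D" for z using D(2)[of "[]" z] by simp
  have intT: "integrable M (T k)" for k
  proof -
    have "(p k \<omega>)(k := y \<omega> k) = p (Suc k) \<omega>" for \<omega> by (simp add: p_def hybrid_Suc)
    moreover have "integrable M (\<lambda>\<omega>. f (p k \<omega>))" for k
      by (rule integrable_const_bound[where B = D]) (use fD measurable_compose[OF pm fm] in auto)
    ultimately show ?thesis unfolding T_def by simp
  qed
  have est: "\<bar>expectation (T k) - h * (1/2 * q k * partial k (partial k f) x)\<bar>
     \<le> D * (q k * (\<Sum>i<m. sqrt (q i)) + 2 * (q k * sqrt (q k))) * (h * sqrt h)" if k: "k < m" for k
  proof -
    define f1 where "f1 = partial k f"
    define f2 where "f2 = partial k f1"
    have sf1: "smooth_compact_support m f1" unfolding f1_def by (rule smooth_compact_support_partial[OF f k])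
    have sf2: "smooth_compact_support m f2" unfolding f2_def by (rule smooth_compact_support_partial[OF sf1 k])
    have b1: "\<bar>f1 z\<bar> \<le> D" for z using D(2)[of "[k]" z] k by (simp add: f1_def)
    have b2: "\<bar>f2 z\<bar> \<le> D" for z using D(2)[of "[k, k]" z] k by (simp add: f1_def f2_def)
    have b3: "\<bar>partial i f2 z\<bar> \<le> D" if "i < m" for i z using D(2)[of "[i, k, k]" z] k that by (simp add: f1_def f2_def)
    have m1: "f1 \<in> borel_measurable borel" and m2: "f2 \<in> borel_measurable borel"
      using sf1 sf2 by (auto intro: smooth_compact_support_measurable)
    have int1: "integrable M (\<lambda>\<omega>. g k \<omega> * f1 (p k \<omega>))" "expectation (\<lambda>\<omega>. g k \<omega> * f1 (p k \<omega>)) = 0"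
      using fac(1,3)[OF m1 b1, of "\<lambda>t. t" k] mo(1,2)[of k] by auto
    have int2: "integrable M (\<lambda>\<omega>. (g k \<omega>)\<^sup>2 * f2 (p k \<omega>))" "expectation (\<lambda>\<omega>. (g k \<omega>)\<^sup>2 * f2 (p k \<omega>)) = h * expectation (\<lambda>\<omega>. f2 (p k \<omega>))"
      "integrable M (\<lambda>\<omega>. f2 (p k \<omega>))"
      using fac[OF m2 b2, of "\<lambda>t. t\<^sup>2" k] mo(3,4)[of k] by auto
    define R where "R \<omega> = T k \<omega> - sqrt (q k) * (g k \<omega> * f1 (p k \<omega>)) - q k / 2 * ((g k \<omega>)\<^sup>2 * f2 (p k \<omega>))" for \<omega>
    have Rle: "\<bar>R \<omega>\<bar> \<le> D * (q k * sqrt (q k)) * \<bar>g k \<omega>\<bar> ^ 3" for \<omega>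
    proof -
      have pk: "p k \<omega> k = x k" by (simp add: p_def hybrid_diag)
      have "\<bar>f ((p k \<omega>)(k := p k \<omega> k + sqrt (q k) * g k \<omega>)) - f (p k \<omega>) - (sqrt (q k) * g k \<omega>) * partial k f (p k \<omega>)
        - (sqrt (q k) * g k \<omega>)\<^sup>2 / 2 * partial k (partial k f) (p k \<omega>)\<bar> \<le> D * \<bar>sqrt (q k) * g k \<omega>\<bar> ^ 3"
      proof (rule smooth_compact_support_Taylor[OF f k])
        show "\<bar>partial k (partial k (partial k f)) z\<bar> \<le> D" for z using b3[OF k, of z] by (simp add: f1_def f2_def)
      qed
      moreover have "(sqrt (q k) * g k \<omega>)\<^sup>2 = q k * (g k \<omega>)\<^sup>2" using q_pos[of k] by (simp add: power_mult_distrib)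
      moreover have "\<bar>sqrt (q k) * g k \<omega>\<bar> ^ 3 = (q k * sqrt (q k)) * \<bar>g k \<omega>\<bar> ^ 3"
      proof -
        have "sqrt (q k) ^ 3 = q k * sqrt (q k)" using q_pos[of k] by (simp add: power3_eq_cube)
        then show ?thesis using q_pos[of k] by (simp add: abs_mult power_mult_distrib)
      qed
      ultimately show ?thesis unfolding R_def T_def pk f2_def f1_def y_def by (simp add: mult_ac)
    qed
    have intR: "integrable M R" unfolding R_def using intT int1(1) int2(1)
      by (intro Bochner_Integration.integrable_diff integrable_mult_right) auto
    have ER: "\<bar>expectation R\<bar> \<le> D * (q k * sqrt (q k)) * (2 * (h * sqrt h))"
    proof -
      have "\<bar>expectation R\<bar> \<le> expectation (\<lambda>\<omega>. \<bar>R \<omega>\<bar>)" by (rule integral_abs_bound)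
      also have "\<dots> \<le> expectation (\<lambda>\<omega>. D * (q k * sqrt (q k)) * \<bar>g k \<omega>\<bar> ^ 3)"
        by (rule integral_mono) (use intR Rle mo(5)[of k] in auto)
      also have "\<dots> = D * (q k * sqrt (q k)) * expectation (\<lambda>\<omega>. \<bar>g k \<omega>\<bar> ^ 3)" by simp
      also have "\<dots> \<le> D * (q k * sqrt (q k)) * (2 * (h * sqrt h))"
        using mo(6)[of k] D(1) q_pos[of k] by (intro mult_left_mono) auto
      finally show ?thesis .
    qed
    have ET: "expectation (T k) = expectation R + q k / 2 * (h * expectation (\<lambda>\<omega>. f2 (p k \<omega>)))"
    proof -
      have i1: "integrable M (\<lambda>\<omega>. sqrt (q k) * (g k \<omega> * f1 (p k \<omega>)))" and i2: "integrable M (\<lambda>\<omega>. q k / 2 * ((g k \<omega>)\<^sup>2 * f2 (p k \<omega>)))"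
        using int1(1) int2(1) by (auto intro!: integrable_mult_right)
      have "expectation R = expectation (T k) - expectation (\<lambda>\<omega>. sqrt (q k) * (g k \<omega> * f1 (p k \<omega>))) - expectation (\<lambda>\<omega>. q k / 2 * ((g k \<omega>)\<^sup>2 * f2 (p k \<omega>)))"
        unfolding R_def Bochner_Integration.integral_diff[OF Bochner_Integration.integrable_diff[OF intT i1] i2] Bochner_Integration.integral_diff[OF intT i1] ..
      then show ?thesis unfolding integral_mult_right_zero int1(2) int2(2) by simp
    qed
    \<comment> \<open>The second derivative is still taken at the random hybrid point. Bounded third
      derivatives and mean displacements of order \<open>sqrt h\<close> bring it back to
      \<open>x\<close>.\<close>
    have E2: "\<bar>expectation (\<lambda>\<omega>. f2 (p k \<omega>)) - f2 x\<bar> \<le> D * ((\<Sum>i<m. sqrt (q i)) * sqrt h)"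
    proof -
      have i: "integrable M (\<lambda>\<omega>. D * (\<Sum>i<m. sqrt (q i) * \<bar>g i \<omega>\<bar>))" using am(1) by (intro integrable_mult_right Bochner_Integration.integrable_sum) auto
      have "\<bar>expectation (\<lambda>\<omega>. f2 (p k \<omega>) - f2 x)\<bar> \<le> expectation (\<lambda>\<omega>. \<bar>f2 (p k \<omega>) - f2 x\<bar>)" by (rule integral_abs_bound)
      also have "\<dots> \<le> expectation (\<lambda>\<omega>. D * (\<Sum>i<m. sqrt (q i) * \<bar>g i \<omega>\<bar>))"
      proof (rule integral_mono[OF _ i])
        show "integrable M (\<lambda>\<omega>. \<bar>f2 (p k \<omega>) - f2 x\<bar>)" using int2(3) by auto
        fix \<omega>
        have "\<bar>f2 (p k \<omega>) - f2 x\<bar> \<le> D * (\<Sum>i<m. \<bar>p k \<omega> i - x i\<bar>)"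
          by (rule smooth_compact_support_Lipschitz[OF sf2 b3])
        also have "\<dots> \<le> D * (\<Sum>i<m. sqrt (q i) * \<bar>g i \<omega>\<bar>)"
          using D(1) less_imp_le[OF q_pos] by (intro mult_left_mono sum_mono) (auto simp: p_def hybrid_def y_def abs_mult)
        finally show "\<bar>f2 (p k \<omega>) - f2 x\<bar> \<le> D * (\<Sum>i<m. sqrt (q i) * \<bar>g i \<omega>\<bar>)" .
      qed
      also have "\<dots> = D * (\<Sum>i<m. sqrt (q i) * expectation (\<lambda>\<omega>. \<bar>g i \<omega>\<bar>))"
        using am(1) by (simp add: Bochner_Integration.integral_sum)
      also have "\<dots> \<le> D * (\<Sum>i<m. sqrt (q i) * sqrt h)"
        using D(1) am(2) less_imp_le[OF q_pos] by (intro mult_left_mono sum_mono) auto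
      finally show ?thesis using int2(3) by (simp add: prob_space sum_distrib_right)
    qed
    have "\<bar>expectation (T k) - h * (1/2 * q k * f2 x)\<bar> \<le> \<bar>expectation R\<bar> + \<bar>q k / 2 * h * (expectation (\<lambda>\<omega>. f2 (p k \<omega>)) - f2 x)\<bar>"
      unfolding ET by (simp add: algebra_simps)
    also have "\<bar>q k / 2 * h * (expectation (\<lambda>\<omega>. f2 (p k \<omega>)) - f2 x)\<bar> \<le> q k * h * (D * ((\<Sum>i<m. sqrt (q i)) * sqrt h))"
      unfolding abs_mult using E2 h q_pos[of k] by (intro mult_mono) auto
    finally show ?thesis using ER unfolding f2_def f1_def by (simp add: algebra_simps)
  qed
  have "expectation (\<lambda>\<omega>. f (y \<omega>)) - f x = (\<Sum>k<m. expectation (T k))"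
  proof -
    have "expectation (\<lambda>\<omega>. f (y \<omega>) - f x) = expectation (\<lambda>\<omega>. \<Sum>k<m. T k \<omega>)"
      by (subst hybrid_telescope[OF f]) (simp add: T_def p_def)
    moreover have "integrable M (\<lambda>\<omega>. f (y \<omega>))"
      by (rule integrable_const_bound[where B = D]) (use fD measurable_compose[OF ym fm] in auto)
    ultimately show ?thesis using intT by (simp add: Bochner_Integration.integral_sum prob_space)
  qed
  then have "\<bar>expectation (\<lambda>\<omega>. f (y \<omega>)) - f x - h * (\<Sum>i<m. 1/2 * q i * partial i (partial i f) x)\<bar>
     = \<bar>\<Sum>k<m. expectation (T k) - h * (1/2 * q k * partial k (partial k f) x)\<bar>"
    by (simp only: sum_subtractf sum_distrib_left)
  also have "\<dots> \<le> (\<Sum>k<m. \<bar>expectation (T k) - h * (1/2 * q k * partial k (partial k f) x)\<bar>)" by (rule sum_abs)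
  also have "\<dots> \<le> (\<Sum>k<m. D * (q k * (\<Sum>i<m. sqrt (q i)) + 2 * (q k * sqrt (q k))) * (h * sqrt h))"
    by (intro sum_mono est) simp
  also have "\<dots> = D * heat_constant m * (h * sqrt h)"
    unfolding heat_constant_def by (simp only: sum_distrib_left sum_distrib_right)
  finally show ?thesis unfolding h_def y_def g_def .
qed

end

section \<open>The formula of Ito for smooth cylindrical functions\<close>

lemma (in prob_space) nn_integral_time_Fubini:
  fixes f :: "real \<Rightarrow> 'a \<Rightarrow> real"
  assumes f: "(\<lambda>p. f (fst p) (snd p)) \<in> borel_measurable (borel \<Otimes>\<^sub>M M)" and A: "A \<in> sets borel"
  shows "(\<integral>\<^sup>+\<omega>. (\<integral>\<^sup>+\<tau>. ennreal (f \<tau> \<omega>) * indicator A \<tau> \<partial>lborel) \<partial>M) = (\<integral>\<^sup>+\<tau>. (\<integral>\<^sup>+\<omega>. ennreal (f \<tau> \<omega>) \<partial>M) * indicator A \<tau> \<partial>lborel)"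
proof -
  interpret P: pair_sigma_finite lborel M ..
  have [measurable]: "(\<lambda>p. f (fst p) (snd p)) \<in> borel_measurable (lborel \<Otimes>\<^sub>M M)" using f by simp
  note [measurable] = A
  have "(\<integral>\<^sup>+\<omega>. (\<integral>\<^sup>+\<tau>. ennreal (f \<tau> \<omega>) * indicator A \<tau> \<partial>lborel) \<partial>M) = (\<integral>\<^sup>+\<tau>. (\<integral>\<^sup>+\<omega>. ennreal (f \<tau> \<omega>) * indicator A \<tau> \<partial>M) \<partial>lborel)"
  proof (rule P.Fubini')
    show "(\<lambda>(\<tau>, \<omega>). ennreal (f \<tau> \<omega>) * indicator A \<tau>) \<in> borel_measurable (lborel \<Otimes>\<^sub>M M)"
      unfolding case_prod_beta by measurable
  qed
  also have "\<dots> = (\<integral>\<^sup>+\<tau>. (\<integral>\<^sup>+\<omega>. ennreal (f \<tau> \<omega>) \<partial>M) * indicator A \<tau> \<partial>lborel)"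
    by (intro nn_integral_cong) (simp add: indicator_def)
  finally show ?thesis .
qed

lemma (in prob_space) time_section_measurable:
  assumes f: "(\<lambda>p. f (fst p) (snd p)) \<in> borel_measurable (borel \<Otimes>\<^sub>M M)"
  shows "\<omega> \<in> space M \<Longrightarrow> (\<lambda>\<tau>. f \<tau> \<omega>) \<in> borel_measurable borel" "f \<tau> \<in> borel_measurable M"
proof -
  show "(\<lambda>\<tau>. f \<tau> \<omega>) \<in> borel_measurable borel" if "\<omega> \<in> space M"
    using measurable_compose[OF measurable_Pair[OF measurable_ident_sets[OF refl] measurable_const[OF that]] f] by simp
  have "(\<lambda>\<omega>. (\<tau>, \<omega>)) \<in> measurable M (borel \<Otimes>\<^sub>M M)" by measurable
  from measurable_compose[OF this f] show "f \<tau> \<in> borel_measurable M" by simp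
qed

lemma (in prob_space) set_integral_measurable:
  fixes f :: "real \<Rightarrow> 'a \<Rightarrow> real"
  assumes f: "(\<lambda>p. f (fst p) (snd p)) \<in> borel_measurable (borel \<Otimes>\<^sub>M M)" and A: "A \<in> sets borel"
  shows "(\<lambda>\<omega>. LINT \<tau>:A|lborel. f \<tau> \<omega>) \<in> borel_measurable M"
    and "(\<lambda>\<omega>. \<integral>\<^sup>+\<tau>. ennreal (f \<tau> \<omega>) * indicator A \<tau> \<partial>lborel) \<in> borel_measurable M"
    and "(\<lambda>\<tau>. \<integral>\<^sup>+\<omega>. ennreal (f \<tau> \<omega>) \<partial>M) \<in> borel_measurable borel"
proof -
  have sw: "(\<lambda>p. (snd p, fst p)) \<in> measurable (M \<Otimes>\<^sub>M lborel) (borel \<Otimes>\<^sub>M M)" by measurable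
  have [measurable]: "(\<lambda>p. f (snd p) (fst p)) \<in> borel_measurable (M \<Otimes>\<^sub>M lborel)"
    using measurable_compose[OF sw f] by simp
  note [measurable] = A f
  show "(\<lambda>\<omega>. LINT \<tau>:A|lborel. f \<tau> \<omega>) \<in> borel_measurable M"
    unfolding set_lebesgue_integral_def by measurable
  show "(\<lambda>\<omega>. \<integral>\<^sup>+\<tau>. ennreal (f \<tau> \<omega>) * indicator A \<tau> \<partial>lborel) \<in> borel_measurable M" by measurable
  show "(\<lambda>\<tau>. \<integral>\<^sup>+\<omega>. ennreal (f \<tau> \<omega>) \<partial>M) \<in> borel_measurable borel" by measurable
qed

text \<open>The squared deviation of \<open>n\<close> from its mean value \<open>c\<close> on the
  interval has a nonnegative integral; this is Cauchy-Schwarz against the constant 1.\<close>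

lemma set_integral_square_le:
  fixes n :: "real \<Rightarrow> real"
  assumes n: "set_integrable lborel {s..r} n" and n2: "set_integrable lborel {s..r} (\<lambda>\<sigma>. (n \<sigma>)\<^sup>2)" and sr: "s < r"
  shows "(LINT \<sigma>:{s..r}|lborel. n \<sigma>)\<^sup>2 \<le> (r - s) * (LINT \<sigma>:{s..r}|lborel. (n \<sigma>)\<^sup>2)"
proof -
  define A where "A = (LINT \<sigma>:{s..r}|lborel. n \<sigma>)"
  define c where "c = A / (r - s)"
  have ic: "set_integrable lborel {s..r} (\<lambda>\<sigma>. 2 * c * n \<sigma>)" using n by (rule set_integrable_mult_right)
  have ik: "set_integrable lborel {s..r} (\<lambda>\<sigma>. c\<^sup>2)" by (intro borel_integrable_atLeastAtMost' continuous_intros)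
  have "0 \<le> (LINT \<sigma>:{s..r}|lborel. (n \<sigma> - c)\<^sup>2)"
    unfolding set_lebesgue_integral_def by (intro Bochner_Integration.integral_nonneg) (auto simp: indicator_def)
  also have "\<dots> = (LINT \<sigma>:{s..r}|lborel. ((n \<sigma>)\<^sup>2 - 2 * c * n \<sigma>) + c\<^sup>2)"
  proof -
    have "(n \<sigma> - c)\<^sup>2 = ((n \<sigma>)\<^sup>2 - 2 * c * n \<sigma>) + c\<^sup>2" for \<sigma> by (simp add: power2_eq_square algebra_simps)
    then show ?thesis by (simp only:)
  qed
  also have "\<dots> = (LINT \<sigma>:{s..r}|lborel. (n \<sigma>)\<^sup>2) - 2 * c * A + c\<^sup>2 * (r - s)"
    using sr unfolding set_integral_add(2)[OF set_integral_diff(1)[OF n2 ic] ik] set_integral_diff(2)[OF n2 ic]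
      set_integral_mult_right A_def by (simp add: set_lebesgue_integral_def)
  also have "2 * c * A = 2 * (A\<^sup>2 / (r - s))" by (simp add: c_def power2_eq_square)
  also have "c\<^sup>2 * (r - s) = A\<^sup>2 / (r - s)" using sr by (simp add: c_def power2_eq_square)
  finally have "A\<^sup>2 / (r - s) \<le> (LINT \<sigma>:{s..r}|lborel. (n \<sigma>)\<^sup>2)" by simp
  then show ?thesis using sr unfolding A_def by (simp add: divide_le_eq mult.commute)
qed

context spde
begin

text \<open>Frozen outside \<open>{0..T}\<close> like \<open>XT\<close>, for joint measurability on
  the whole time line.\<close>

definition S_path :: "real \<Rightarrow> 'w \<Rightarrow> 'a" where "S_path t \<omega> = S (Y (max 0 (min T t)) \<omega>)"

text \<open>A common majorant for the drift coefficients. The summand 1 absorbs bounded quantities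
  and makes the increments of \<open>Psi\<close> dominate the length of time.\<close>

definition S_size :: "real \<Rightarrow> 'w \<Rightarrow> real" where "S_size t \<omega> = 1 + norm (S_path t \<omega>)"

lemma S_path_jointly_measurable: "(\<lambda>p. S_path (fst p) (snd p)) \<in> borel_measurable (borel \<Otimes>\<^sub>M M)"
proof -
  have Y: "(\<lambda>p. S (Y (fst p) (snd p))) \<in> borel_measurable (restrict_space lborel {0..T} \<Otimes>\<^sub>M M)"
  proof -
    have "(\<lambda>(t, \<omega>). S (Y t \<omega>)) \<in> borel_measurable (restrict_space lborel {0..T} \<Otimes>\<^sub>M M)"
      using Y_version unfolding V_version_def by blast
    then show ?thesis by (simp only: case_prod_beta')
  qed
  have "(\<lambda>p. max 0 (min T (fst p))) \<in> measurable (borel \<Otimes>\<^sub>M M) (restrict_space lborel {0..T})"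
    using T_pos by (intro measurable_restrict_space2) auto
  then have "(\<lambda>p. (max 0 (min T (fst p)), snd p)) \<in> measurable (borel \<Otimes>\<^sub>M M) (restrict_space lborel {0..T} \<Otimes>\<^sub>M M)"
    by (intro measurable_Pair) auto
  from measurable_compose[OF this Y] show ?thesis by (simp add: S_path_def)
qed

lemma S_size_jointly_measurable: "(\<lambda>p. S_size (fst p) (snd p)) \<in> borel_measurable (borel \<Otimes>\<^sub>M M)"
  unfolding S_size_def using S_path_jointly_measurable by measurable

lemma S_size_ge_1: "1 \<le> S_size t \<omega>" by (simp add: S_size_def)

lemma drift_bound:
  assumes "\<sigma> \<in> {0..T}"
  shows "\<bar>drift S F (Y \<sigma> \<omega>) (e i)\<bar> \<le> (C + norm (S (e i))) * S_size \<sigma> \<omega>"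
proof -
  have 1: "\<bar>S (Y \<sigma> \<omega>) \<bullet> S (e i)\<bar> \<le> norm (S (Y \<sigma> \<omega>)) * norm (S (e i))" by (rule Cauchy_Schwarz_ineq2)
  have "\<bar>F (Y \<sigma> \<omega>) \<bullet> e i\<bar> \<le> norm (F (Y \<sigma> \<omega>)) * norm (e i)" by (rule Cauchy_Schwarz_ineq2)
  then have 2: "\<bar>F (Y \<sigma> \<omega>) \<bullet> e i\<bar> \<le> C" using F_bound[of "Y \<sigma> \<omega>"] by simp
  have n: "S_size \<sigma> \<omega> = 1 + norm (S (Y \<sigma> \<omega>))" using assms by (simp add: S_size_def S_path_def)
  have "\<bar>drift S F (Y \<sigma> \<omega>) (e i)\<bar> \<le> norm (S (Y \<sigma> \<omega>)) * norm (S (e i)) + C"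
    unfolding drift_def using 1 2 by linarith
  also have "\<dots> \<le> (C + norm (S (e i))) * S_size \<sigma> \<omega>"
    unfolding n using C_nonneg by (simp add: algebra_simps)
  finally show ?thesis .
qed

end

locale spde_square_integrable = spde M e q W \<beta> \<eta> DA V A S F T C K X Y
  for M :: "'w measure" and e :: "nat \<Rightarrow> 'a::{real_inner, banach, second_countable_topology}"
    and q W \<beta> \<eta> DA V A S F T C K X Y +
  assumes S_size_moment: "(\<integral>\<^sup>+\<sigma>. (\<integral>\<^sup>+\<omega>. ennreal ((S_size \<sigma> \<omega>)\<^sup>2) \<partial>M) * indicator {0..T} \<sigma> \<partial>lborel) < \<infinity>"
begin

text \<open>\<open>S Y\<close> is only square integrable over time and probability, so its integral
  over a short interval has no rate in terms of the length. This function is the clock that takes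
  the place of the length in all error bounds.\<close>

definition Psi :: "real \<Rightarrow> real" where
  "Psi t = enn2real (\<integral>\<^sup>+\<sigma>. (\<integral>\<^sup>+\<omega>. ennreal ((S_size \<sigma> \<omega>)\<^sup>2) \<partial>M) * indicator {0..t} \<sigma> \<partial>lborel)"

lemma S_size_square_jointly_measurable: "(\<lambda>p. (S_size (fst p) (snd p))\<^sup>2) \<in> borel_measurable (borel \<Otimes>\<^sub>M M)"
  using S_size_jointly_measurable by measurable

lemma Psi_increment:
  assumes "0 \<le> s" "s \<le> r" "r \<le> T"
  shows "(\<integral>\<^sup>+\<sigma>. (\<integral>\<^sup>+\<omega>. ennreal ((S_size \<sigma> \<omega>)\<^sup>2) \<partial>M) * indicator {s..r} \<sigma> \<partial>lborel) = ennreal (Psi r - Psi s)"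
    and "r - s \<le> Psi r - Psi s"
proof -
  define \<psi> where "\<psi> \<sigma> = (\<integral>\<^sup>+\<omega>. ennreal ((S_size \<sigma> \<omega>)\<^sup>2) \<partial>M)" for \<sigma>
  have [measurable]: "\<psi> \<in> borel_measurable borel"
    unfolding \<psi>_def by (rule set_integral_measurable(3)[OF S_size_square_jointly_measurable, of "{}"]) simp
  define P where "P A = (\<integral>\<^sup>+\<sigma>. \<psi> \<sigma> * indicator A \<sigma> \<partial>lborel)" for A
  have fin: "P A < \<infinity>" if "A \<subseteq> {0..T}" for A
  proof -
    have "P A \<le> P {0..T}" unfolding P_def using that by (intro nn_integral_mono mult_left_mono) (auto simp: indicator_def)
    also have "\<dots> < \<infinity>" using S_size_moment unfolding P_def \<psi>_def .
    finally show ?thesis .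
  qed
  have Psi: "ennreal (Psi t) = P {0..t}" if "t \<le> T" for t
    using fin[of "{0..t}"] that unfolding Psi_def P_def \<psi>_def by (simp add: less_top)
  have "P {0..r} = (\<integral>\<^sup>+\<sigma>. \<psi> \<sigma> * indicator {0..s} \<sigma> + \<psi> \<sigma> * indicator {s..r} \<sigma> \<partial>lborel)"
    unfolding P_def
  proof (rule nn_integral_cong_AE)
    show "AE \<sigma> in lborel. \<psi> \<sigma> * indicator {0..r} \<sigma> = \<psi> \<sigma> * indicator {0..s} \<sigma> + \<psi> \<sigma> * indicator {s..r} \<sigma>"
      using AE_lborel_singleton[of s] by eventually_elim (use assms in \<open>auto simp: indicator_def\<close>)
  qed
  also have "\<dots> = P {0..s} + P {s..r}" unfolding P_def by (rule nn_integral_add) measurable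
  finally have sum: "P {0..r} = P {0..s} + P {s..r}" .
  define p where "p = enn2real (P {s..r})"
  have p: "P {s..r} = ennreal p" using fin[of "{s..r}"] assms by (simp add: p_def less_top)
  have p0: "0 \<le> p" by (simp add: p_def)
  have "ennreal (Psi r) = ennreal (Psi s) + ennreal p" using sum Psi[of r] Psi[of s] assms p by simp
  also have "\<dots> = ennreal (Psi s + p)" using p0 by (intro ennreal_plus[symmetric]) (auto simp: Psi_def)
  finally have "Psi r = Psi s + p" using p0 by (subst (asm) ennreal_inj) (auto simp: Psi_def)
  then have pe: "p = Psi r - Psi s" by simp
  show "(\<integral>\<^sup>+\<sigma>. (\<integral>\<^sup>+\<omega>. ennreal ((S_size \<sigma> \<omega>)\<^sup>2) \<partial>M) * indicator {s..r} \<sigma> \<partial>lborel) = ennreal (Psi r - Psi s)"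
    using p unfolding pe P_def \<psi>_def .
  have "ennreal (r - s) = (\<integral>\<^sup>+\<sigma>. 1 * indicator {s..r} \<sigma> \<partial>lborel)" using assms by simp
  also have "\<dots> \<le> P {s..r}"
    unfolding P_def
  proof (intro nn_integral_mono mult_right_mono)
    fix \<sigma> :: real
    have "(\<integral>\<^sup>+\<omega>. 1 \<partial>M) \<le> \<psi> \<sigma>" unfolding \<psi>_def
    proof (rule nn_integral_mono)
      fix \<omega>
      have "1 \<le> (S_size \<sigma> \<omega>)\<^sup>2" using S_size_ge_1 by (rule one_le_power)
      then show "1 \<le> ennreal ((S_size \<sigma> \<omega>)\<^sup>2)" by simp
    qed
    then show "1 \<le> \<psi> \<sigma>" by (simp add: emeasure_space_1)
  qed simp
  finally have "ennreal (r - s) \<le> ennreal (Psi r - Psi s)" unfolding p pe .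
  then show "r - s \<le> Psi r - Psi s" using p0 pe by (subst (asm) ennreal_le_iff) auto
qed

lemma S_size_set_integrable: "AE \<omega> in M. \<forall>s r. 0 \<le> s \<longrightarrow> r \<le> T \<longrightarrow>
    set_integrable lborel {s..r} (\<lambda>\<sigma>. S_size \<sigma> \<omega>) \<and> set_integrable lborel {s..r} (\<lambda>\<sigma>. (S_size \<sigma> \<omega>)\<^sup>2)"
proof -
  have "(\<integral>\<^sup>+\<omega>. (\<integral>\<^sup>+\<tau>. ennreal ((S_size \<tau> \<omega>)\<^sup>2) * indicator {0..T} \<tau> \<partial>lborel) \<partial>M) < \<infinity>"
    using S_size_moment nn_integral_time_Fubini[OF S_size_square_jointly_measurable, of "{0..T}"] by simp
  then have "AE \<omega> in M. (\<integral>\<^sup>+\<tau>. ennreal ((S_size \<tau> \<omega>)\<^sup>2) * indicator {0..T} \<tau> \<partial>lborel) \<noteq> \<infinity>"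
    by (intro nn_integral_PInf_AE set_integral_measurable(2)[OF S_size_square_jointly_measurable]) auto
  then show ?thesis using AE_space
  proof eventually_elim
    case (elim \<omega>)
    have m: "(\<lambda>\<sigma>. S_size \<sigma> \<omega>) \<in> borel_measurable borel" by (rule time_section_measurable(1)[OF S_size_jointly_measurable elim(2)])
    have i2: "set_integrable lborel {0..T} (\<lambda>\<sigma>. (S_size \<sigma> \<omega>)\<^sup>2)"
      unfolding set_integrable_def
    proof (rule integrableI_nonneg)
      show "(\<lambda>\<sigma>. indicator {0..T} \<sigma> *\<^sub>R (S_size \<sigma> \<omega>)\<^sup>2) \<in> borel_measurable lborel" using m by measurable
      have "(\<integral>\<^sup>+\<tau>. ennreal (indicator {0..T} \<tau> *\<^sub>R (S_size \<tau> \<omega>)\<^sup>2) \<partial>lborel) = (\<integral>\<^sup>+\<tau>. ennreal ((S_size \<tau> \<omega>)\<^sup>2) * indicator {0..T} \<tau> \<partial>lborel)"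
        by (intro nn_integral_cong) (simp add: indicator_def)
      then show "(\<integral>\<^sup>+\<tau>. ennreal (indicator {0..T} \<tau> *\<^sub>R (S_size \<tau> \<omega>)\<^sup>2) \<partial>lborel) < \<infinity>" using elim(1) by (simp add: less_top)
    qed (auto simp: indicator_def)
    have i1: "set_integrable lborel {0..T} (\<lambda>\<sigma>. S_size \<sigma> \<omega>)"
      unfolding set_integrable_def
    proof (rule Bochner_Integration.integrable_bound[OF i2[unfolded set_integrable_def]])
      show "(\<lambda>\<sigma>. indicator {0..T} \<sigma> *\<^sub>R S_size \<sigma> \<omega>) \<in> borel_measurable lborel" using m by measurable
      have "S_size \<sigma> \<omega> \<le> (S_size \<sigma> \<omega>)\<^sup>2" for \<sigma> using mult_right_mono[OF S_size_ge_1, of "S_size \<sigma> \<omega>" \<sigma> \<omega>] S_size_ge_1[of \<sigma> \<omega>] by (simp add: power2_eq_square)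
      moreover have "0 \<le> S_size \<sigma> \<omega>" for \<sigma> using S_size_ge_1[of \<sigma> \<omega>] by linarith
      ultimately show "AE \<sigma> in lborel. norm (indicator {0..T} \<sigma> *\<^sub>R S_size \<sigma> \<omega>) \<le> norm (indicator {0..T} \<sigma> *\<^sub>R (S_size \<sigma> \<omega>)\<^sup>2)"
        by (intro AE_I2) (simp add: indicator_def)
    qed
    show ?case
    proof (intro allI impI conjI)
      fix s r :: real assume "0 \<le> s" "r \<le> T"
      then have "{s..r} \<subseteq> {0..T}" by auto
      then show "set_integrable lborel {s..r} (\<lambda>\<sigma>. S_size \<sigma> \<omega>)" "set_integrable lborel {s..r} (\<lambda>\<sigma>. (S_size \<sigma> \<omega>)\<^sup>2)"
        using set_integrable_subset[OF i1] set_integrable_subset[OF i2] by auto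
    qed
  qed
qed

text \<open>The basis vectors lie in \<open>V\<close>, so the equation may be tested against them;
  the drift then pairs to at most a multiple of \<open>S_size\<close>.\<close>

lemma coordinate_increment:
  "AE \<omega> in M. \<forall>s r i. 0 \<le> s \<longrightarrow> s \<le> r \<longrightarrow> r \<le> T \<longrightarrow>
    \<bar>(X r \<omega> - X s \<omega>) \<bullet> e i - (W r \<omega> - W s \<omega>) \<bullet> e i\<bar> \<le> (C + norm (S (e i))) * (LINT \<sigma>:{s..r}|lborel. S_size \<sigma> \<omega>)"
  using equation_increment S_size_set_integrable
proof eventually_elim
  case (elim \<omega>)
  show ?case
  proof (intro allI impI)
    fix s r i assume sr: "0 \<le> s" "s \<le> r" "r \<le> T"
    have i: "set_integrable lborel {s..r} (\<lambda>\<sigma>. drift S F (Y \<sigma> \<omega>) (e i))"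
      and eq: "(X r \<omega> - X s \<omega>) \<bullet> e i = (W r \<omega> - W s \<omega>) \<bullet> e i + (LINT \<sigma>:{s..r}|lborel. drift S F (Y \<sigma> \<omega>) (e i))"
      using elim(1) sr e_in_V[of i] by blast+
    have n: "set_integrable lborel {s..r} (\<lambda>\<sigma>. (C + norm (S (e i))) * S_size \<sigma> \<omega>)"
      using elim(2) sr by (intro set_integrable_mult_right) auto
    have "\<bar>LINT \<sigma>:{s..r}|lborel. drift S F (Y \<sigma> \<omega>) (e i)\<bar> \<le> (LINT \<sigma>:{s..r}|lborel. (C + norm (S (e i))) * S_size \<sigma> \<omega>)"
      by (rule abs_set_integral_le_AE[OF i n]) (use sr in \<open>auto intro!: AE_I2 drift_bound\<close>)
    then show "\<bar>(X r \<omega> - X s \<omega>) \<bullet> e i - (W r \<omega> - W s \<omega>) \<bullet> e i\<bar> \<le> (C + norm (S (e i))) * (LINT \<sigma>:{s..r}|lborel. S_size \<sigma> \<omega>)"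
      using eq by simp
  qed
qed

definition gamma_bound :: "nat \<Rightarrow> real" where "gamma_bound m = (\<Sum>i<m. C + norm (S (e i)))"

lemma gamma_bound_nonneg: "0 \<le> gamma_bound m"
  unfolding gamma_bound_def using C_nonneg by (intro sum_nonneg) auto

definition dist_coord :: "nat \<Rightarrow> real \<Rightarrow> real \<Rightarrow> 'w \<Rightarrow> real" where
  "dist_coord m s \<sigma> \<omega> = (\<Sum>i<m. \<bar>(XT \<sigma> \<omega> - XT s \<omega>) \<bullet> e i\<bar>)"

lemma dist_coord_jointly_measurable: "(\<lambda>p. (dist_coord m s (fst p) (snd p))\<^sup>2) \<in> borel_measurable (borel \<Otimes>\<^sub>M M)"
proof -
  note [measurable] = XT_jointly_measurable XT_measurable
  show ?thesis unfolding dist_coord_def by measurable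
qed

text \<open>The noise has variance of order \<open>r - s\<close>, and the drift enters as the square
  of a time integral, which Cauchy-Schwarz bounds by \<open>r - s\<close> times an increment of
  \<open>Psi\<close>. Both parts thus carry the factor \<open>r - s\<close> that compensates a later
  division by \<open>sqrt (r - s)\<close>.\<close>

lemma dist_coord_second_moment:
  assumes sr: "0 \<le> s" "s < r" "r \<le> T" and \<sigma>: "\<sigma> \<in> {s..r}"
  shows "(\<integral>\<^sup>+\<omega>. ennreal ((dist_coord m s \<sigma> \<omega>)\<^sup>2) \<partial>M)
    \<le> ennreal ((r - s) * (2 * (real m)\<^sup>2 * suminf q + 2 * (gamma_bound m)\<^sup>2 * (Psi r - Psi s)))"
proof -
  note P = Psi_increment[of s r]
  \<comment> \<open>Twice the sum of squares bounds the square of the sum: \<open>m\<close>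
    coordinates of the noise, each at most its norm, give \<open>a\<close>; the drift with its
    factor \<open>gamma_bound m\<close> gives \<open>b\<close>.\<close>
  define a where "a = 2 * (real m)\<^sup>2"
  define b where "b = 2 * (gamma_bound m)\<^sup>2 * (r - s)"
  have ab: "0 \<le> a" "0 \<le> b" using sr by (auto simp: a_def b_def)
  have s\<sigma>: "0 \<le> s" "s \<le> \<sigma>" "\<sigma> \<le> T" using sr \<sigma> by auto
  have [measurable]: "W \<sigma> \<in> borel_measurable M" "W s \<in> borel_measurable M" using s\<sigma> by (auto intro!: W_measurable)
  have Nm: "(\<lambda>\<omega>. \<integral>\<^sup>+\<tau>. ennreal ((S_size \<tau> \<omega>)\<^sup>2) * indicator {s..r} \<tau> \<partial>lborel) \<in> borel_measurable M"
    by (rule set_integral_measurable(2)[OF S_size_square_jointly_measurable]) simp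
  have "(\<integral>\<^sup>+\<omega>. ennreal ((dist_coord m s \<sigma> \<omega>)\<^sup>2) \<partial>M)
     \<le> (\<integral>\<^sup>+\<omega>. ennreal a * ennreal ((norm (W \<sigma> \<omega> - W s \<omega>))\<^sup>2) + ennreal b * (\<integral>\<^sup>+\<tau>. ennreal ((S_size \<tau> \<omega>)\<^sup>2) * indicator {s..r} \<tau> \<partial>lborel) \<partial>M)"
  proof (rule nn_integral_mono_AE)
    show "AE \<omega> in M. ennreal ((dist_coord m s \<sigma> \<omega>)\<^sup>2)
      \<le> ennreal a * ennreal ((norm (W \<sigma> \<omega> - W s \<omega>))\<^sup>2) + ennreal b * (\<integral>\<^sup>+\<tau>. ennreal ((S_size \<tau> \<omega>)\<^sup>2) * indicator {s..r} \<tau> \<partial>lborel)"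
      using coordinate_increment S_size_set_integrable
    proof eventually_elim
      case (elim \<omega>)
      define A where "A = (LINT \<sigma>:{s..r}|lborel. S_size \<sigma> \<omega>)"
      define N where "N = (LINT \<sigma>:{s..r}|lborel. (S_size \<sigma> \<omega>)\<^sup>2)"
      have i: "set_integrable lborel {s..r} (\<lambda>\<sigma>. S_size \<sigma> \<omega>)" "set_integrable lborel {s..r} (\<lambda>\<sigma>. (S_size \<sigma> \<omega>)\<^sup>2)"
        and i': "set_integrable lborel {s..\<sigma>} (\<lambda>\<sigma>. S_size \<sigma> \<omega>)"
        using elim(2) sr s\<sigma> by auto
      have mono: "(LINT \<sigma>:{s..\<sigma>}|lborel. S_size \<sigma> \<omega>) \<le> A"
        unfolding A_def set_lebesgue_integral_def
      proof (rule integral_mono)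
        fix x
        have "0 \<le> S_size x \<omega>" using S_size_ge_1[of x \<omega>] by linarith
        then show "indicator {s..\<sigma>} x *\<^sub>R S_size x \<omega> \<le> indicator {s..r} x *\<^sub>R S_size x \<omega>" using \<sigma> by (auto simp: indicator_def)
      qed (use i(1) i' in \<open>auto simp: set_integrable_def\<close>)
      have "dist_coord m s \<sigma> \<omega> \<le> (\<Sum>i<m. norm (W \<sigma> \<omega> - W s \<omega>) + (C + norm (S (e i))) * A)"
        unfolding dist_coord_def
      proof (rule sum_mono)
        fix i
        have 1: "\<bar>(X \<sigma> \<omega> - X s \<omega>) \<bullet> e i - (W \<sigma> \<omega> - W s \<omega>) \<bullet> e i\<bar> \<le> (C + norm (S (e i))) * (LINT \<sigma>:{s..\<sigma>}|lborel. S_size \<sigma> \<omega>)"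
          using elim(1) s\<sigma> by blast
        have 2: "\<bar>(W \<sigma> \<omega> - W s \<omega>) \<bullet> e i\<bar> \<le> norm (W \<sigma> \<omega> - W s \<omega>)" using Cauchy_Schwarz_ineq2[of "W \<sigma> \<omega> - W s \<omega>" "e i"] by simp
        have 3: "(C + norm (S (e i))) * (LINT \<sigma>:{s..\<sigma>}|lborel. S_size \<sigma> \<omega>) \<le> (C + norm (S (e i))) * A"
          using C_nonneg by (intro mult_left_mono mono) auto
        have XT: "XT \<sigma> = X \<sigma>" "XT s = X s" using s\<sigma> by (simp_all add: XT_eq)
        show "\<bar>(XT \<sigma> \<omega> - XT s \<omega>) \<bullet> e i\<bar> \<le> norm (W \<sigma> \<omega> - W s \<omega>) + (C + norm (S (e i))) * A"
          unfolding XT using 1 2 3 by linarith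
      qed
      also have "\<dots> = real m * norm (W \<sigma> \<omega> - W s \<omega>) + gamma_bound m * A"
        unfolding gamma_bound_def sum_distrib_right by (subst sum.distrib) simp
      finally have "dist_coord m s \<sigma> \<omega> \<le> real m * norm (W \<sigma> \<omega> - W s \<omega>) + gamma_bound m * A" .
      moreover have "0 \<le> dist_coord m s \<sigma> \<omega>" unfolding dist_coord_def by (intro sum_nonneg) simp
      ultimately have "(dist_coord m s \<sigma> \<omega>)\<^sup>2 \<le> (real m * norm (W \<sigma> \<omega> - W s \<omega>) + gamma_bound m * A)\<^sup>2" by (intro power_mono)
      also have "\<dots> \<le> 2 * (real m * norm (W \<sigma> \<omega> - W s \<omega>))\<^sup>2 + 2 * (gamma_bound m * A)\<^sup>2"
        using zero_le_power2[of "real m * norm (W \<sigma> \<omega> - W s \<omega>) - gamma_bound m * A"] by (simp add: power2_sum power2_diff)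
      also have "\<dots> = a * (norm (W \<sigma> \<omega> - W s \<omega>))\<^sup>2 + 2 * (gamma_bound m)\<^sup>2 * A\<^sup>2" by (simp add: a_def power_mult_distrib)
      also have "\<dots> \<le> a * (norm (W \<sigma> \<omega> - W s \<omega>))\<^sup>2 + b * N"
        using mult_left_mono[OF set_integral_square_le[OF i sr(2)], of "2 * (gamma_bound m)\<^sup>2"] by (simp add: b_def A_def N_def mult_ac)
      finally have le: "(dist_coord m s \<sigma> \<omega>)\<^sup>2 \<le> a * (norm (W \<sigma> \<omega> - W s \<omega>))\<^sup>2 + b * N" .
      have N0: "0 \<le> N" unfolding N_def set_lebesgue_integral_def by (intro Bochner_Integration.integral_nonneg) (auto simp: indicator_def)
      have "ennreal ((dist_coord m s \<sigma> \<omega>)\<^sup>2) \<le> ennreal (a * (norm (W \<sigma> \<omega> - W s \<omega>))\<^sup>2 + b * N)" by (rule ennreal_leI[OF le])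
      also have "\<dots> = ennreal a * ennreal ((norm (W \<sigma> \<omega> - W s \<omega>))\<^sup>2) + ennreal b * ennreal N"
        using ab N0 by (subst ennreal_plus) (auto simp: ennreal_mult'[symmetric])
      also have "ennreal N = (\<integral>\<^sup>+\<tau>. ennreal ((S_size \<tau> \<omega>)\<^sup>2) * indicator {s..r} \<tau> \<partial>lborel)"
        unfolding N_def by (rule ennreal_set_integral[OF i(2)]) simp
      finally show ?case .
    qed
  qed
  also have "\<dots> = ennreal a * (\<integral>\<^sup>+\<omega>. ennreal ((norm (W \<sigma> \<omega> - W s \<omega>))\<^sup>2) \<partial>M)
     + ennreal b * (\<integral>\<^sup>+\<omega>. (\<integral>\<^sup>+\<tau>. ennreal ((S_size \<tau> \<omega>)\<^sup>2) * indicator {s..r} \<tau> \<partial>lborel) \<partial>M)"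
  proof -
    have m1: "(\<lambda>\<omega>. ennreal ((norm (W \<sigma> \<omega> - W s \<omega>))\<^sup>2)) \<in> borel_measurable M" by measurable
    show ?thesis
      unfolding nn_integral_cmult[OF m1, symmetric] nn_integral_cmult[OF Nm, symmetric]
      by (rule nn_integral_add) (use m1 Nm in \<open>measurable\<close>)
  qed
  also have "(\<integral>\<^sup>+\<omega>. (\<integral>\<^sup>+\<tau>. ennreal ((S_size \<tau> \<omega>)\<^sup>2) * indicator {s..r} \<tau> \<partial>lborel) \<partial>M) = ennreal (Psi r - Psi s)"
    using sr P(1) nn_integral_time_Fubini[OF S_size_square_jointly_measurable, of "{s..r}"] by simp
  also have "(\<integral>\<^sup>+\<omega>. ennreal ((norm (W \<sigma> \<omega> - W s \<omega>))\<^sup>2) \<partial>M) = ennreal ((\<sigma> - s) * suminf q)"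
    by (rule W_increment_second_moment[OF s\<sigma>(1,2)])
  also have "ennreal a * ennreal ((\<sigma> - s) * suminf q) + ennreal b * ennreal (Psi r - Psi s) = ennreal (a * ((\<sigma> - s) * suminf q) + b * (Psi r - Psi s))"
    using ab s\<sigma> sr trace_nonneg P(2) by (subst ennreal_plus) (auto simp: ennreal_mult'[symmetric])
  also have "\<dots> \<le> ennreal ((r - s) * (2 * (real m)\<^sup>2 * suminf q + 2 * (gamma_bound m)\<^sup>2 * (Psi r - Psi s)))"
  proof (rule ennreal_leI)
    have "(\<sigma> - s) * suminf q \<le> (r - s) * suminf q" using \<sigma> trace_nonneg by (intro mult_right_mono) auto
    from mult_left_mono[OF this ab(1)]
    show "a * ((\<sigma> - s) * suminf q) + b * (Psi r - Psi s) \<le> (r - s) * (2 * (real m)\<^sup>2 * suminf q + 2 * (gamma_bound m)\<^sup>2 * (Psi r - Psi s))"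
      unfolding a_def b_def by (simp add: algebra_simps)
  qed
  finally show ?thesis .
qed

end

section \<open>One-step expansion of a test function along the solution\<close>

locale spde_test_function = spde_square_integrable M e q W \<beta> \<eta> DA V A S F T C K X Y
  for M :: "'w measure" and e :: "nat \<Rightarrow> 'a::{real_inner, banach, second_countable_topology}"
    and q W \<beta> \<eta> DA V A S F T C K X Y +
  fixes f :: "(nat \<Rightarrow> real) \<Rightarrow> real" and m :: nat and D :: real
  assumes f_smooth: "smooth_compact_support m f" and D_nonneg: "0 \<le> D"
    and D_bound: "set is \<subseteq> {..<m} \<Longrightarrow> length is \<le> 3 \<Longrightarrow> \<bar>foldr partial is f x\<bar> \<le> D"
    and generator_measurable: "(\<lambda>x. indicator V x *\<^sub>R generator e q S F (\<lambda>x. f (coordinates x)) x) \<in> borel_measurable borel"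
begin

text \<open>The indicator discards the points outside \<open>V\<close>, where the drift coefficients
  have no meaning. Almost every path is in \<open>V\<close> at almost every time of
  \<open>{0..T}\<close>.\<close>

definition generator_path :: "real \<Rightarrow> 'w \<Rightarrow> real" where
  "generator_path \<sigma> \<omega> = indicator V (XT \<sigma> \<omega>) *\<^sub>R generator e q S F (\<lambda>x. f (coordinates x)) (XT \<sigma> \<omega>)"

definition heat :: "'a \<Rightarrow> real" where "heat x = (\<Sum>i<m. 1/2 * q i * partial i (partial i f) (coordinates x))"

definition generator_factor :: real where "generator_factor = gamma_bound m + (\<Sum>i<m. 1/2 * q i)"

lemma partial_bounds:
  "\<bar>f x\<bar> \<le> D" "i < m \<Longrightarrow> \<bar>partial i f x\<bar> \<le> D" "i < m \<Longrightarrow> j < m \<Longrightarrow> \<bar>partial i (partial j f) x\<bar> \<le> D"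
  "i < m \<Longrightarrow> j < m \<Longrightarrow> k < m \<Longrightarrow> \<bar>partial i (partial j (partial k f)) x\<bar> \<le> D"
  using D_bound[of "[]" x] D_bound[of "[i]" x] D_bound[of "[i, j]" x] D_bound[of "[i, j, k]" x] by auto

lemma Lipschitz:
  "\<bar>f y - f x\<bar> \<le> D * (\<Sum>k<m. \<bar>y k - x k\<bar>)"
  "i < m \<Longrightarrow> \<bar>partial i f y - partial i f x\<bar> \<le> D * (\<Sum>k<m. \<bar>y k - x k\<bar>)"
  "i < m \<Longrightarrow> \<bar>partial i (partial i f) y - partial i (partial i f) x\<bar> \<le> D * (\<Sum>k<m. \<bar>y k - x k\<bar>)"
  by (rule smooth_compact_support_Lipschitz[where m = m],
      auto intro!: smooth_compact_support_partial f_smooth partial_bounds)+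

lemma q_sum_nonneg: "0 \<le> (\<Sum>i<m. 1/2 * q i)"
  using q_pos by (intro sum_nonneg) (simp add: less_imp_le)

lemma generator_factor_nonneg: "0 \<le> generator_factor"
  unfolding generator_factor_def using gamma_bound_nonneg q_sum_nonneg by (rule add_nonneg_nonneg)

lemma f_coordinates_measurable: "(\<lambda>x. f (coordinates x)) \<in> borel_measurable borel"
  by (rule measurable_compose[OF coordinates_measurable smooth_compact_support_measurable[OF f_smooth]])

lemma heat_measurable: "heat \<in> borel_measurable borel"
proof -
  have "(\<lambda>x. partial i (partial i f) (coordinates x)) \<in> borel_measurable borel" if "i < m" for i
    by (rule measurable_compose[OF coordinates_measurable smooth_compact_support_measurable[OF
      smooth_compact_support_partial[OF smooth_compact_support_partial[OF f_smooth that] that]]])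
  then show ?thesis unfolding heat_def by (intro borel_measurable_sum borel_measurable_times borel_measurable_const) auto
qed

lemma heat_bound: "\<bar>heat x\<bar> \<le> D * (\<Sum>i<m. 1/2 * q i)"
proof -
  have "\<bar>heat x\<bar> \<le> (\<Sum>i<m. \<bar>1/2 * q i * partial i (partial i f) (coordinates x)\<bar>)" unfolding heat_def by (rule sum_abs)
  also have "\<dots> \<le> (\<Sum>i<m. D * (1/2 * q i))"
  proof (rule sum_mono)
    fix i assume "i \<in> {..<m}"
    then have "\<bar>partial i (partial i f) (coordinates x)\<bar> \<le> D" by (intro partial_bounds) auto
    from mult_left_mono[OF this, of "1/2 * q i"]
    show "\<bar>1/2 * q i * partial i (partial i f) (coordinates x)\<bar> \<le> D * (1/2 * q i)"
      using q_pos[of i] by (simp add: abs_mult mult_ac)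
  qed
  finally show ?thesis by (simp only: sum_distrib_left)
qed

lemma heat_Lipschitz: "\<bar>heat y - heat x\<bar> \<le> D * (\<Sum>i<m. 1/2 * q i) * (\<Sum>k<m. \<bar>(y - x) \<bullet> e k\<bar>)"
proof -
  have "\<bar>heat y - heat x\<bar> \<le> (\<Sum>i<m. \<bar>1/2 * q i * partial i (partial i f) (coordinates y) - 1/2 * q i * partial i (partial i f) (coordinates x)\<bar>)"
    unfolding heat_def sum_subtractf[symmetric] by (rule sum_abs)
  also have "\<dots> \<le> (\<Sum>i<m. (1/2 * q i) * (D * (\<Sum>k<m. \<bar>(y - x) \<bullet> e k\<bar>)))"
  proof (rule sum_mono)
    fix i assume "i \<in> {..<m}"
    then have "\<bar>partial i (partial i f) (coordinates y) - partial i (partial i f) (coordinates x)\<bar> \<le> D * (\<Sum>k<m. \<bar>(y - x) \<bullet> e k\<bar>)"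
      using Lipschitz(3)[of i "coordinates y" "coordinates x"] by (simp add: inner_diff_left)
    from mult_left_mono[OF this, of "\<bar>1/2 * q i\<bar>"]
    show "\<bar>1/2 * q i * partial i (partial i f) (coordinates y) - 1/2 * q i * partial i (partial i f) (coordinates x)\<bar> \<le> (1/2 * q i) * (D * (\<Sum>k<m. \<bar>(y - x) \<bullet> e k\<bar>))"
      using q_pos[of i] unfolding right_diff_distrib[symmetric] abs_mult by simp
  qed
  also have "\<dots> = D * (\<Sum>i<m. 1/2 * q i) * (\<Sum>k<m. \<bar>(y - x) \<bullet> e k\<bar>)" by (simp only: sum_distrib_right[symmetric]) (simp only: mult_ac)
  finally show ?thesis .
qed

lemma generator_path_jointly_measurable: "(\<lambda>p. generator_path (fst p) (snd p)) \<in> borel_measurable (borel \<Otimes>\<^sub>M M)"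
  unfolding generator_path_def by (rule measurable_compose[OF XT_jointly_measurable generator_measurable])

lemma generator_path_eq: "AE \<omega> in M. AE \<sigma> in lborel. \<sigma> \<in> {0..T} \<longrightarrow>
    generator_path \<sigma> \<omega> = heat (XT \<sigma> \<omega>) + (\<Sum>i<m. drift S F (Y \<sigma> \<omega>) (e i) * partial i f (coordinates (XT \<sigma> \<omega>)))"
  using Y_AE AE_space
proof eventually_elim
  case (elim \<omega>)
  from elim(1) show ?case
  proof eventually_elim
    case (elim \<sigma>)
    show ?case
    proof
      assume \<sigma>: "\<sigma> \<in> {0..T}"
      have Y: "Y \<sigma> \<omega> = XT \<sigma> \<omega>" using elim \<sigma> XT_eq[OF \<sigma>] by simp
      then have "XT \<sigma> \<omega> \<in> V" using Y_in_V[OF \<sigma> \<open>\<omega> \<in> space M\<close>] by simp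
      then show "generator_path \<sigma> \<omega> = heat (XT \<sigma> \<omega>) + (\<Sum>i<m. drift S F (Y \<sigma> \<omega>) (e i) * partial i f (coordinates (XT \<sigma> \<omega>)))"
        unfolding generator_path_def generator_eq[OF f_smooth] Y heat_def by simp
    qed
  qed
qed

lemma sum_drift_bound:
  assumes \<sigma>: "\<sigma> \<in> {0..T}" and p: "\<And>i. i < m \<Longrightarrow> \<bar>p i\<bar> \<le> B" and B: "0 \<le> B"
  shows "\<bar>\<Sum>i<m. drift S F (Y \<sigma> \<omega>) (e i) * p i\<bar> \<le> gamma_bound m * S_size \<sigma> \<omega> * B"
proof -
  have "\<bar>\<Sum>i<m. drift S F (Y \<sigma> \<omega>) (e i) * p i\<bar> \<le> (\<Sum>i<m. \<bar>drift S F (Y \<sigma> \<omega>) (e i) * p i\<bar>)" by (rule sum_abs)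
  also have "\<dots> \<le> (\<Sum>i<m. (C + norm (S (e i))) * (S_size \<sigma> \<omega> * B))"
  proof (rule sum_mono)
    fix i assume "i \<in> {..<m}"
    then have "\<bar>drift S F (Y \<sigma> \<omega>) (e i)\<bar> * \<bar>p i\<bar> \<le> ((C + norm (S (e i))) * S_size \<sigma> \<omega>) * B"
      using S_size_ge_1[of \<sigma> \<omega>] C_nonneg by (intro mult_mono drift_bound \<sigma> p) auto
    then show "\<bar>drift S F (Y \<sigma> \<omega>) (e i) * p i\<bar> \<le> (C + norm (S (e i))) * (S_size \<sigma> \<omega> * B)" by (simp add: abs_mult mult_ac)
  qed
  also have "\<dots> = gamma_bound m * (S_size \<sigma> \<omega> * B)" unfolding gamma_bound_def by (rule sum_distrib_right[symmetric])
  finally show ?thesis by (simp only: mult.assoc)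
qed

lemma generator_path_bound: "AE \<omega> in M. AE \<sigma> in lborel. \<sigma> \<in> {0..T} \<longrightarrow> \<bar>generator_path \<sigma> \<omega>\<bar> \<le> D * generator_factor * S_size \<sigma> \<omega>"
  using generator_path_eq
proof eventually_elim
  case (elim \<omega>)
  then show ?case
  proof eventually_elim
    case (elim \<sigma>)
    show ?case
    proof
      assume \<sigma>: "\<sigma> \<in> {0..T}"
      have 1: "\<bar>\<Sum>i<m. drift S F (Y \<sigma> \<omega>) (e i) * partial i f (coordinates (XT \<sigma> \<omega>))\<bar> \<le> gamma_bound m * S_size \<sigma> \<omega> * D"
        by (intro sum_drift_bound \<sigma> partial_bounds D_nonneg)
      have "D * (\<Sum>i<m. 1/2 * q i) * 1 \<le> D * (\<Sum>i<m. 1/2 * q i) * S_size \<sigma> \<omega>"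
        using D_nonneg q_sum_nonneg S_size_ge_1 by (intro mult_left_mono mult_nonneg_nonneg)
      then have "\<bar>heat (XT \<sigma> \<omega>)\<bar> \<le> D * (\<Sum>i<m. 1/2 * q i) * S_size \<sigma> \<omega>" using heat_bound[of "XT \<sigma> \<omega>"] by linarith
      with 1 have "\<bar>heat (XT \<sigma> \<omega>)\<bar> + \<bar>\<Sum>i<m. drift S F (Y \<sigma> \<omega>) (e i) * partial i f (coordinates (XT \<sigma> \<omega>))\<bar>
         \<le> D * (\<Sum>i<m. 1/2 * q i) * S_size \<sigma> \<omega> + gamma_bound m * S_size \<sigma> \<omega> * D" by linarith
      also have "\<dots> = D * generator_factor * S_size \<sigma> \<omega>" unfolding generator_factor_def by (simp only: distrib_left distrib_right mult_ac add_ac)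
      finally show "\<bar>generator_path \<sigma> \<omega>\<bar> \<le> D * generator_factor * S_size \<sigma> \<omega>" using elim \<sigma> by linarith
    qed
  qed
qed

lemma generator_path_set_integrable: "AE \<omega> in M. \<forall>s r. 0 \<le> s \<longrightarrow> r \<le> T \<longrightarrow> set_integrable lborel {s..r} (\<lambda>\<sigma>. generator_path \<sigma> \<omega>)"
  using generator_path_bound S_size_set_integrable AE_space
proof eventually_elim
  case (elim \<omega>)
  show ?case
  proof (intro allI impI)
    fix s r :: real assume sr: "0 \<le> s" "r \<le> T"
    have "set_integrable lborel {s..r} (\<lambda>\<sigma>. D * generator_factor * S_size \<sigma> \<omega>)"
      using elim(2) sr by (intro set_integrable_mult_right) auto
    then show "set_integrable lborel {s..r} (\<lambda>\<sigma>. generator_path \<sigma> \<omega>)" unfolding set_integrable_def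
    proof (rule Bochner_Integration.integrable_bound)
      show "(\<lambda>\<sigma>. indicator {s..r} \<sigma> *\<^sub>R generator_path \<sigma> \<omega>) \<in> borel_measurable lborel"
        using time_section_measurable(1)[OF generator_path_jointly_measurable elim(3)] by measurable
      show "AE \<sigma> in lborel. norm (indicator {s..r} \<sigma> *\<^sub>R generator_path \<sigma> \<omega>) \<le> norm (indicator {s..r} \<sigma> *\<^sub>R (D * generator_factor * S_size \<sigma> \<omega>))"
        using elim(1)
      proof eventually_elim
        case (elim \<sigma>)
        have "\<bar>generator_path \<sigma> \<omega>\<bar> \<le> \<bar>D * generator_factor * S_size \<sigma> \<omega>\<bar>" if "\<sigma> \<in> {s..r}" using elim that sr by fastforce
        then show ?case by (simp add: indicator_def)
      qed
    qed
  qed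
qed


text \<open>Only the derivatives of \<open>f\<close> are frozen at the left end point; the drift has
  no continuity in time and stays under the integral. The error is a multiple of
  \<open>S_size\<close> times \<open>dist_coord\<close>, split by Young's inequality at the scale
  \<open>sqrt (r - s)\<close> so that in mean both squares are of order \<open>sqrt (r - s)\<close>
  times an increment of \<open>Psi\<close>.\<close>

lemma generator_path_increment_bound:
  "AE \<omega> in M. \<forall>s r. 0 \<le> s \<longrightarrow> s < r \<longrightarrow> r \<le> T \<longrightarrow>
    set_integrable lborel {s..r} (\<lambda>\<sigma>. (dist_coord m s \<sigma> \<omega>)\<^sup>2) \<and>
    \<bar>(LINT \<sigma>:{s..r}|lborel. generator_path \<sigma> \<omega>) - (r - s) * heat (XT s \<omega>)
      - (\<Sum>k<m. (LINT \<sigma>:{s..r}|lborel. drift S F (Y \<sigma> \<omega>) (e k)) * partial k f (coordinates (XT s \<omega>)))\<bar>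
    \<le> D * generator_factor / 2 * (sqrt (r - s) * (LINT \<sigma>:{s..r}|lborel. (S_size \<sigma> \<omega>)\<^sup>2)
        + (LINT \<sigma>:{s..r}|lborel. (dist_coord m s \<sigma> \<omega>)\<^sup>2) / sqrt (r - s))"
  using equation_increment S_size_set_integrable generator_path_set_integrable generator_path_eq AE_space
proof eventually_elim
  case (elim \<omega>)
  show ?case
  proof (intro allI impI)
    fix s r :: real assume sr: "0 \<le> s" "s < r" "r \<le> T"
    define k where "k = sqrt (r - s)"
    have k: "k > 0" using sr by (simp add: k_def)
    define p where "p i = partial i f (coordinates (XT s \<omega>))" for i
    define g where "g \<sigma> = (\<Sum>i<m. drift S F (Y \<sigma> \<omega>) (e i) * p i)" for \<sigma>
    define d where "d \<sigma> = dist_coord m s \<sigma> \<omega>" for \<sigma>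
    have d0: "0 \<le> d \<sigma>" for \<sigma> unfolding d_def dist_coord_def by (intro sum_nonneg) simp
    have iG: "set_integrable lborel {s..r} (\<lambda>\<sigma>. generator_path \<sigma> \<omega>)" using elim(3) sr by simp
    have iD: "set_integrable lborel {s..r} (\<lambda>\<sigma>. drift S F (Y \<sigma> \<omega>) (e i))" for i
      using elim(1) sr e_in_V[of i] by simp
    have i2: "set_integrable lborel {s..r} (\<lambda>\<sigma>. (S_size \<sigma> \<omega>)\<^sup>2)" using elim(2) sr by simp
    have ih: "set_integrable lborel {s..r} (\<lambda>\<sigma>. heat (XT s \<omega>))" by (intro borel_integrable_atLeastAtMost' continuous_intros)
    have cont: "continuous_on {s..r} (\<lambda>\<sigma>. (d \<sigma>)\<^sup>2)"
    proof -
      have "continuous_on {s..r} (\<lambda>\<sigma>. X \<sigma> \<omega>)" using sr elim(5) by (intro X_integrable) auto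
      then have "continuous_on {s..r} (\<lambda>\<sigma>. XT \<sigma> \<omega>)"
        by (rule continuous_on_cong[THEN iffD1, rotated -1]) (use sr in \<open>auto simp: XT_eq\<close>)
      then show ?thesis unfolding d_def dist_coord_def by (intro continuous_intros)
    qed
    have id: "set_integrable lborel {s..r} (\<lambda>\<sigma>. (d \<sigma>)\<^sup>2)" by (rule borel_integrable_atLeastAtMost'[OF cont])
    have gi: "integrable lborel (\<lambda>\<sigma>. \<Sum>i<m. p i * (indicator {s..r} \<sigma> *\<^sub>R drift S F (Y \<sigma> \<omega>) (e i)))"
      using iD unfolding set_integrable_def by (intro Bochner_Integration.integrable_sum integrable_mult_right)
    have g_eq: "(\<lambda>\<sigma>. \<Sum>i<m. p i * (indicator {s..r} \<sigma> *\<^sub>R drift S F (Y \<sigma> \<omega>) (e i))) = (\<lambda>\<sigma>. indicator {s..r} \<sigma> *\<^sub>R g \<sigma>)"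
      unfolding g_def by (simp add: sum_distrib_left mult_ac)
    have ig: "set_integrable lborel {s..r} g" using gi unfolding g_eq set_integrable_def .
    have "(LINT \<sigma>:{s..r}|lborel. g \<sigma>) = (\<Sum>i<m. p i * (LINT \<sigma>:{s..r}|lborel. drift S F (Y \<sigma> \<omega>) (e i)))"
      unfolding set_lebesgue_integral_def g_eq[symmetric]
      by (subst Bochner_Integration.integral_sum) (use iD in \<open>auto simp: set_integrable_def\<close>)
    then have g_int: "(LINT \<sigma>:{s..r}|lborel. g \<sigma>) = (\<Sum>i<m. (LINT \<sigma>:{s..r}|lborel. drift S F (Y \<sigma> \<omega>) (e i)) * p i)"
      by (simp only: mult.commute)
    have h_int: "(LINT \<sigma>:{s..r}|lborel. heat (XT s \<omega>)) = (r - s) * heat (XT s \<omega>)" using sr by (simp add: set_lebesgue_integral_def)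
    have iR: "set_integrable lborel {s..r} (\<lambda>\<sigma>. D * generator_factor / 2 * (k * (S_size \<sigma> \<omega>)\<^sup>2 + (d \<sigma>)\<^sup>2 / k))"
      by (intro set_integrable_mult_right set_integral_add(1) set_integrable_divide i2 id)
    have R_int: "(LINT \<sigma>:{s..r}|lborel. D * generator_factor / 2 * (k * (S_size \<sigma> \<omega>)\<^sup>2 + (d \<sigma>)\<^sup>2 / k))
      = D * generator_factor / 2 * (k * (LINT \<sigma>:{s..r}|lborel. (S_size \<sigma> \<omega>)\<^sup>2) + (LINT \<sigma>:{s..r}|lborel. (d \<sigma>)\<^sup>2) / k)"
      unfolding set_integral_mult_right
      by (subst set_integral_add(2)) (auto intro!: set_integrable_mult_right set_integrable_divide i2 id)
    have bound: "\<bar>LINT \<sigma>:{s..r}|lborel. generator_path \<sigma> \<omega> - heat (XT s \<omega>) - g \<sigma>\<bar>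
      \<le> (LINT \<sigma>:{s..r}|lborel. D * generator_factor / 2 * (k * (S_size \<sigma> \<omega>)\<^sup>2 + (d \<sigma>)\<^sup>2 / k))"
    proof (rule abs_set_integral_le_AE[OF set_integral_diff(1)[OF set_integral_diff(1)[OF iG ih] ig] iR])
      show "AE \<sigma> in lborel. \<sigma> \<in> {s..r} \<longrightarrow> \<bar>generator_path \<sigma> \<omega> - heat (XT s \<omega>) - g \<sigma>\<bar> \<le> D * generator_factor / 2 * (k * (S_size \<sigma> \<omega>)\<^sup>2 + (d \<sigma>)\<^sup>2 / k)"
        using elim(4)
      proof eventually_elim
        case (elim \<sigma>)
        show ?case
        proof
          assume "\<sigma> \<in> {s..r}"
          then have \<sigma>: "\<sigma> \<in> {0..T}" using sr by auto
          have Ge: "generator_path \<sigma> \<omega> = heat (XT \<sigma> \<omega>) + (\<Sum>i<m. drift S F (Y \<sigma> \<omega>) (e i) * partial i f (coordinates (XT \<sigma> \<omega>)))"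
            using elim \<sigma> by blast
          have 1: "\<bar>heat (XT \<sigma> \<omega>) - heat (XT s \<omega>)\<bar> \<le> D * (\<Sum>i<m. 1/2 * q i) * d \<sigma>"
            unfolding d_def dist_coord_def by (rule heat_Lipschitz)
          have "\<bar>\<Sum>i<m. drift S F (Y \<sigma> \<omega>) (e i) * (partial i f (coordinates (XT \<sigma> \<omega>)) - p i)\<bar> \<le> gamma_bound m * S_size \<sigma> \<omega> * (D * d \<sigma>)"
          proof (rule sum_drift_bound[OF \<sigma>])
            show "\<bar>partial i f (coordinates (XT \<sigma> \<omega>)) - p i\<bar> \<le> D * d \<sigma>" if "i < m" for i
              using Lipschitz(2)[OF that, of "coordinates (XT \<sigma> \<omega>)" "coordinates (XT s \<omega>)"]
              unfolding p_def d_def dist_coord_def inner_diff_left .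
            show "0 \<le> D * d \<sigma>" using D_nonneg d0 by (rule mult_nonneg_nonneg)
          qed
          then have 2: "\<bar>(\<Sum>i<m. drift S F (Y \<sigma> \<omega>) (e i) * partial i f (coordinates (XT \<sigma> \<omega>))) - g \<sigma>\<bar> \<le> gamma_bound m * S_size \<sigma> \<omega> * (D * d \<sigma>)"
            unfolding g_def right_diff_distrib sum_subtractf .
          \<comment> \<open>The second-order part comes without \<open>S_size\<close>; this factor,
            which is at least 1, is inserted so that both parts have the same form.\<close>
          have 3: "D * (\<Sum>i<m. 1/2 * q i) * d \<sigma> * 1 \<le> D * (\<Sum>i<m. 1/2 * q i) * d \<sigma> * S_size \<sigma> \<omega>"
            by (intro mult_left_mono S_size_ge_1 mult_nonneg_nonneg D_nonneg q_sum_nonneg d0)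
          have "\<bar>generator_path \<sigma> \<omega> - heat (XT s \<omega>) - g \<sigma>\<bar> \<le> D * (\<Sum>i<m. 1/2 * q i) * d \<sigma> * S_size \<sigma> \<omega> + gamma_bound m * S_size \<sigma> \<omega> * (D * d \<sigma>)"
            unfolding Ge using 1 2 3 by linarith
          also have "\<dots> = D * generator_factor * (S_size \<sigma> \<omega> * d \<sigma>)" unfolding generator_factor_def by (simp only: distrib_left distrib_right mult_ac add_ac)
          also have "\<dots> \<le> D * generator_factor * ((k * (S_size \<sigma> \<omega>)\<^sup>2 + (d \<sigma>)\<^sup>2 / k) / 2)"
            by (intro mult_left_mono Young_scaled k mult_nonneg_nonneg D_nonneg generator_factor_nonneg)
          finally show "\<bar>generator_path \<sigma> \<omega> - heat (XT s \<omega>) - g \<sigma>\<bar> \<le> D * generator_factor / 2 * (k * (S_size \<sigma> \<omega>)\<^sup>2 + (d \<sigma>)\<^sup>2 / k)" by simp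
        qed
      qed
    qed
    have eq: "(LINT \<sigma>:{s..r}|lborel. generator_path \<sigma> \<omega> - heat (XT s \<omega>) - g \<sigma>) = (LINT \<sigma>:{s..r}|lborel. generator_path \<sigma> \<omega>)
       - (r - s) * heat (XT s \<omega>) - (\<Sum>i<m. (LINT \<sigma>:{s..r}|lborel. drift S F (Y \<sigma> \<omega>) (e i)) * p i)"
      unfolding set_integral_diff(2)[OF set_integral_diff(1)[OF iG ih] ig] set_integral_diff(2)[OF iG ih] g_int h_int ..
    from id bound[unfolded R_int eq] show "set_integrable lborel {s..r} (\<lambda>\<sigma>. (dist_coord m s \<sigma> \<omega>)\<^sup>2) \<and>
    \<bar>(LINT \<sigma>:{s..r}|lborel. generator_path \<sigma> \<omega>) - (r - s) * heat (XT s \<omega>)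
      - (\<Sum>k<m. (LINT \<sigma>:{s..r}|lborel. drift S F (Y \<sigma> \<omega>) (e k)) * partial k f (coordinates (XT s \<omega>)))\<bar>
    \<le> D * generator_factor / 2 * (sqrt (r - s) * (LINT \<sigma>:{s..r}|lborel. (S_size \<sigma> \<omega>)\<^sup>2)
        + (LINT \<sigma>:{s..r}|lborel. (dist_coord m s \<sigma> \<omega>)\<^sup>2) / sqrt (r - s))"
      unfolding k_def p_def d_def by (rule conjI)
  qed
qed

text \<open>\<open>X r\<close> is compared with \<open>X s\<close> plus the increment of
  \<open>W\<close>, a function of the past and an independent variable. The mean of \<open>f\<close>
  at the latter exceeds that at \<open>X s\<close> by \<open>r - s\<close> times the mean of
  \<open>heat\<close> up to a superlinear error, which is why the heat term is added here.\<close>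

definition Ito_error :: "real \<Rightarrow> real \<Rightarrow> 'w \<Rightarrow> real" where
  "Ito_error s r \<omega> = f (coordinates (XT r \<omega>)) - f (coordinates (XT s \<omega> + (W r \<omega> - W s \<omega>)))
     + (r - s) * heat (XT s \<omega>) - (LINT \<sigma>:{s..r}|lborel. generator_path \<sigma> \<omega>)"

text \<open>In this coefficient the first summand stems from the quadratic Taylor remainder, the
  second from the mixed term of drift and noise, the third from
  \<open>generator_path_increment_bound\<close>.\<close>

definition energy_factor :: real where "energy_factor = D * ((gamma_bound m)\<^sup>2 * sqrt T + gamma_bound m / 2 + generator_factor / 2)"
definition noise_factor :: real where "noise_factor = D * gamma_bound m / 2 * (real m)\<^sup>2"
definition distance_factor :: real where "distance_factor = D * generator_factor / 2"

text \<open>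
  The effect of the Wiener increment, which is independent of the past, is left to \<open>heat_step\<close>. What is
  estimated here is due to the drift alone, of which only square integrability of \<open>S Y\<close> is known.
\<close>

lemma Ito_error_bound:
  "AE \<omega> in M. \<forall>s r. 0 \<le> s \<longrightarrow> s < r \<longrightarrow> r \<le> T \<longrightarrow> \<bar>Ito_error s r \<omega>\<bar>
    \<le> energy_factor * sqrt (r - s) * (LINT \<sigma>:{s..r}|lborel. (S_size \<sigma> \<omega>)\<^sup>2) + noise_factor * sqrt (r - s) * (norm (W r \<omega> - W s \<omega>))\<^sup>2
      + distance_factor / sqrt (r - s) * (LINT \<sigma>:{s..r}|lborel. (dist_coord m s \<sigma> \<omega>)\<^sup>2)"
  using equation_increment S_size_set_integrable coordinate_increment generator_path_increment_bound
proof eventually_elim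
  case (elim \<omega>)
  show ?case
  proof (intro allI impI)
    fix s r :: real assume sr: "0 \<le> s" "s < r" "r \<le> T"
    define k where "k = sqrt (r - s)"
    have k: "k > 0" "k\<^sup>2 = r - s" using sr by (simp_all add: k_def)
    define w where "w = W r \<omega> - W s \<omega>"
    define \<delta> where "\<delta> i = (LINT \<sigma>:{s..r}|lborel. drift S F (Y \<sigma> \<omega>) (e i))" for i
    define A where "A = (LINT \<sigma>:{s..r}|lborel. S_size \<sigma> \<omega>)"
    define N where "N = (LINT \<sigma>:{s..r}|lborel. (S_size \<sigma> \<omega>)\<^sup>2)"
    define \<Delta> where "\<Delta> = (LINT \<sigma>:{s..r}|lborel. (dist_coord m s \<sigma> \<omega>)\<^sup>2)"
    define G where "G = (LINT \<sigma>:{s..r}|lborel. generator_path \<sigma> \<omega>)"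
    define \<gamma> where "\<gamma> = gamma_bound m"
    define b where "b = (\<Sum>i<m. \<bar>w \<bullet> e i\<bar>)"
    define u where "u = coordinates (XT r \<omega>)"
    define v where "v = coordinates (XT s \<omega> + w)"
    define x where "x = coordinates (XT s \<omega>)"
    have XT: "XT r = X r" "XT s = X s" using sr by (simp_all add: XT_eq)
    have g0: "0 \<le> \<gamma>" unfolding \<gamma>_def by (rule gamma_bound_nonneg)
    have A0: "0 \<le> A" unfolding A_def set_lebesgue_integral_def
    proof (rule Bochner_Integration.integral_nonneg)
      fix \<sigma>
      have "0 \<le> S_size \<sigma> \<omega>" using S_size_ge_1[of \<sigma> \<omega>] by linarith
      then show "0 \<le> indicator {s..r} \<sigma> *\<^sub>R S_size \<sigma> \<omega>" by simp
    qed
    have N0: "0 \<le> N" unfolding N_def set_lebesgue_integral_def by (intro Bochner_Integration.integral_nonneg) (auto simp: indicator_def)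
    have b0: "0 \<le> b" unfolding b_def by (intro sum_nonneg) simp
    have AN: "A\<^sup>2 \<le> k\<^sup>2 * N"
      unfolding A_def N_def k(2) by (rule set_integral_square_le) (use elim(2) sr in auto)
    have ue: "u i - v i = \<delta> i" for i
    proof -
      have "(X r \<omega> - X s \<omega>) \<bullet> e i = w \<bullet> e i + \<delta> i" using elim(1) sr e_in_V[of i] unfolding w_def \<delta>_def by simp
      then show ?thesis unfolding u_def v_def XT by (simp add: inner_add_left inner_diff_left)
    qed
    have \<delta>: "\<bar>\<delta> i\<bar> \<le> (C + norm (S (e i))) * A" for i
    proof -
      have "\<bar>(X r \<omega> - X s \<omega>) \<bullet> e i - w \<bullet> e i\<bar> \<le> (C + norm (S (e i))) * A" using elim(3) sr unfolding w_def A_def by simp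
      then show ?thesis unfolding ue[symmetric] u_def v_def XT by (simp add: inner_add_left inner_diff_left)
    qed
    have \<delta>s: "(\<Sum>i<m. \<bar>\<delta> i\<bar>) \<le> \<gamma> * A"
      unfolding \<gamma>_def gamma_bound_def sum_distrib_right by (intro sum_mono \<delta>)
    have \<delta>s0: "0 \<le> (\<Sum>i<m. \<bar>\<delta> i\<bar>)" by (intro sum_nonneg) simp
    \<comment> \<open>The drift displaces \<open>v\<close>, where only the noise has acted, to
      \<open>u\<close>; the remainder of the first-order formula at \<open>v\<close> is quadratic in
      the drift.\<close>
    have "\<bar>f u - f v - (\<Sum>i<m. (u i - v i) * partial i f v)\<bar> \<le> D * (\<Sum>i<m. \<bar>u i - v i\<bar>)\<^sup>2"
      by (rule smooth_compact_support_first_order[OF f_smooth]) (auto intro: partial_bounds D_nonneg)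
    also have "\<dots> \<le> D * (\<gamma> * A)\<^sup>2" unfolding ue by (intro mult_left_mono power_mono \<delta>s \<delta>s0 D_nonneg)
    finally have R1: "\<bar>f u - f v - (\<Sum>i<m. \<delta> i * partial i f v)\<bar> \<le> D * (\<gamma> * A)\<^sup>2" unfolding ue .
    \<comment> \<open>The gradient at \<open>v\<close> is replaced by the gradient at the starting
      point \<open>x\<close>, at the price of a product of drift and noise.\<close>
    have "\<bar>\<Sum>i<m. \<delta> i * (partial i f v - partial i f x)\<bar> \<le> (\<Sum>i<m. \<bar>\<delta> i * (partial i f v - partial i f x)\<bar>)" by (rule sum_abs)
    also have "\<dots> \<le> (\<Sum>i<m. \<bar>\<delta> i\<bar> * (D * b))"
    proof (rule sum_mono)
      fix i assume "i \<in> {..<m}"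
      then have "\<bar>partial i f v - partial i f x\<bar> \<le> D * (\<Sum>k<m. \<bar>v k - x k\<bar>)" by (intro Lipschitz(2)) simp
      also have "\<dots> = D * b" unfolding v_def x_def b_def inner_add_left by simp
      finally have "\<bar>partial i f v - partial i f x\<bar> \<le> D * b" .
      then show "\<bar>\<delta> i * (partial i f v - partial i f x)\<bar> \<le> \<bar>\<delta> i\<bar> * (D * b)" unfolding abs_mult by (intro mult_left_mono) auto
    qed
    also have "\<dots> = (\<Sum>i<m. \<bar>\<delta> i\<bar>) * (D * b)" by (rule sum_distrib_right[symmetric])
    also have "\<dots> \<le> \<gamma> * A * (D * b)" by (intro mult_right_mono \<delta>s mult_nonneg_nonneg D_nonneg b0)
    finally have R2: "\<bar>(\<Sum>i<m. \<delta> i * partial i f v) - (\<Sum>i<m. \<delta> i * partial i f x)\<bar> \<le> \<gamma> * A * (D * b)"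
      unfolding right_diff_distrib sum_subtractf .
    \<comment> \<open>The linear term in the drift, with the gradient at \<open>x\<close>, cancels
      against the drift part of the integrated generator.\<close>
    have R3: "\<bar>G - (r - s) * heat (XT s \<omega>) - (\<Sum>i<m. \<delta> i * partial i f x)\<bar> \<le> D * generator_factor / 2 * (k * N + \<Delta> / k)"
      using elim(4) sr unfolding G_def \<delta>_def x_def k_def N_def \<Delta>_def by simp
    have "\<bar>Ito_error s r \<omega>\<bar> \<le> D * (\<gamma> * A)\<^sup>2 + \<gamma> * A * (D * b) + D * generator_factor / 2 * (k * N + \<Delta> / k)"
      unfolding Ito_error_def w_def[symmetric] u_def[symmetric] v_def[symmetric] G_def[symmetric]
      using R1 R2 R3 by linarith
    also have "\<dots> = D * \<gamma>\<^sup>2 * A\<^sup>2 + D * \<gamma> * (b * A) + D * generator_factor / 2 * (k * N + \<Delta> / k)"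
      by (simp add: power_mult_distrib mult_ac)
    also have "\<dots> \<le> D * \<gamma>\<^sup>2 * (sqrt T * k * N) + D * \<gamma> * ((k * ((real m)\<^sup>2 * (norm w)\<^sup>2) + k * N) / 2) + D * generator_factor / 2 * (k * N + \<Delta> / k)"
    proof (intro add_mono mult_left_mono order_refl)
      \<comment> \<open>Of the two factors \<open>sqrt (r - s)\<close> in the quadratic remainder
        one is sacrificed for \<open>sqrt T\<close>; the other is all that the summation
        needs.\<close>
      have kT: "k \<le> sqrt T" unfolding k_def using sr by (intro real_sqrt_le_mono) simp
      have "k * (k * N) \<le> sqrt T * (k * N)" using k N0 by (intro mult_right_mono kT) simp
      with AN show "A\<^sup>2 \<le> sqrt T * k * N" by (simp add: power2_eq_square mult.assoc)
      have "b \<le> (\<Sum>i<m. norm w)" unfolding b_def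
      proof (rule sum_mono)
        fix i show "\<bar>w \<bullet> e i\<bar> \<le> norm w" using Cauchy_Schwarz_ineq2[of w "e i"] by simp
      qed
      then have "b\<^sup>2 \<le> (real m * norm w)\<^sup>2" using b0 by (intro power_mono) simp
      then have b2: "k * b\<^sup>2 \<le> k * ((real m)\<^sup>2 * (norm w)\<^sup>2)" using k by (simp add: power_mult_distrib)
      have "A\<^sup>2 / k \<le> k * N" using AN k(1) by (simp add: divide_le_eq power2_eq_square mult_ac)
      with b2 Young_scaled[OF k(1), of b A] show "b * A \<le> (k * ((real m)\<^sup>2 * (norm w)\<^sup>2) + k * N) / 2" by simp
    qed (use D_nonneg g0 k generator_factor_nonneg in auto)
    also have "\<dots> = energy_factor * k * N + noise_factor * k * (norm w)\<^sup>2 + distance_factor / k * \<Delta>"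
      unfolding energy_factor_def noise_factor_def distance_factor_def \<gamma>_def[symmetric] by (simp add: algebra_simps add_divide_distrib)
    finally show "\<bar>Ito_error s r \<omega>\<bar>
    \<le> energy_factor * sqrt (r - s) * (LINT \<sigma>:{s..r}|lborel. (S_size \<sigma> \<omega>)\<^sup>2) + noise_factor * sqrt (r - s) * (norm (W r \<omega> - W s \<omega>))\<^sup>2
      + distance_factor / sqrt (r - s) * (LINT \<sigma>:{s..r}|lborel. (dist_coord m s \<sigma> \<omega>)\<^sup>2)"
      unfolding k_def N_def w_def \<Delta>_def .
  qed
qed

end

lemma set_integral_singleton:
  fixes a :: real
  shows "(LINT \<sigma>:{a..a}|lborel. g \<sigma>) = (0::real)"
proof -
  have "AE \<sigma> in lborel. indicator {a..a} \<sigma> *\<^sub>R g \<sigma> = 0"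
    using AE_lborel_singleton[of a] by eventually_elim (simp add: indicator_def)
  then show ?thesis unfolding set_lebesgue_integral_def by (rule integral_eq_zero_AE)
qed

section \<open>Expectations of the one-step errors and their summation\<close>

context spde_test_function
begin

text \<open>The moment bound for \<open>dist_coord\<close> has a summand with an increment of
  \<open>Psi\<close>, where \<open>r - s\<close> is estimated by \<open>T\<close>, and one without,
  where \<open>r - s\<close> is estimated by the increment of \<open>Psi\<close>.\<close>

definition total_factor :: real where
  "total_factor = energy_factor + noise_factor * suminf q + distance_factor * (2 * (real m)\<^sup>2 * suminf q + 2 * (gamma_bound m)\<^sup>2 * T)"

lemma factor_nonneg: "0 \<le> energy_factor" "0 \<le> noise_factor" "0 \<le> distance_factor"
  unfolding energy_factor_def noise_factor_def distance_factor_def using D_nonneg generator_factor_nonneg gamma_bound_nonneg[of m] T_pos by auto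

lemma f_X_measurable: "(\<lambda>\<omega>. f (coordinates (XT t \<omega>))) \<in> borel_measurable M"
  by (rule measurable_compose[OF XT_measurable f_coordinates_measurable])

lemma heat_X_measurable: "(\<lambda>\<omega>. heat (XT t \<omega>)) \<in> borel_measurable M"
  by (rule measurable_compose[OF XT_measurable heat_measurable])

lemma f_shift_measurable:
  assumes "0 \<le> s" "s \<le> r"
  shows "(\<lambda>\<omega>. f (coordinates (XT s \<omega> + (W r \<omega> - W s \<omega>)))) \<in> borel_measurable M"
  by (rule measurable_compose[OF borel_measurable_add[OF XT_measurable W_increment_measurable[OF assms]] f_coordinates_measurable])

lemma generator_path_integral_measurable: "(\<lambda>\<omega>. LINT \<sigma>:{s..r}|lborel. generator_path \<sigma> \<omega>) \<in> borel_measurable M"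
  by (rule set_integral_measurable(1)[OF generator_path_jointly_measurable]) simp

lemma Ito_error_measurable: "0 \<le> s \<Longrightarrow> s \<le> r \<Longrightarrow> Ito_error s r \<in> borel_measurable M"
  unfolding Ito_error_def using f_X_measurable f_shift_measurable heat_X_measurable generator_path_integral_measurable
  by (intro borel_measurable_diff borel_measurable_add borel_measurable_times borel_measurable_const)

text \<open>In mean all three terms of \<open>Ito_error_bound\<close> are of order
  \<open>sqrt (r - s)\<close> times an increment of \<open>Psi\<close>. In the third, integration
  over time contributes another \<open>r - s\<close>, which outweighs the division by
  \<open>sqrt (r - s)\<close>.\<close>

lemma Ito_error_nn_integral:
  assumes sr: "0 \<le> s" "s < r" "r \<le> T"
  shows "(\<integral>\<^sup>+\<omega>. ennreal \<bar>Ito_error s r \<omega>\<bar> \<partial>M) \<le> ennreal (total_factor * ((Psi r - Psi s) * sqrt (r - s)))"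
proof -
  have gen: "ennreal (a * x + b * y + c * z) = ennreal a * ennreal x + ennreal b * ennreal y + ennreal c * ennreal z"
    if "0 \<le> a" "0 \<le> b" "0 \<le> c" "0 \<le> x" "0 \<le> y" "0 \<le> z" for a b c x y z
    using that by (simp add: ennreal_mult)
  have sr': "0 \<le> s" "s \<le> r" using sr by auto
  define h where "h = r - s"
  have h: "h > 0" "h \<le> T" using sr by (auto simp: h_def)
  define k where "k = sqrt h"
  have k: "k > 0" "k\<^sup>2 = h" using h by (simp_all add: k_def)
  define P where "P = Psi r - Psi s"
  have hP: "h \<le> P" unfolding h_def P_def using sr by (intro Psi_increment(2)) auto
  then have P0: "0 \<le> P" using h by linarith
  define \<tau> where "\<tau> = suminf q"
  have \<tau>0: "0 \<le> \<tau>" unfolding \<tau>_def by (rule trace_nonneg)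
  define N where "N \<omega> = (\<integral>\<^sup>+\<sigma>. ennreal ((S_size \<sigma> \<omega>)\<^sup>2) * indicator {s..r} \<sigma> \<partial>lborel)" for \<omega>
  define \<Delta> where "\<Delta> \<omega> = (\<integral>\<^sup>+\<sigma>. ennreal ((dist_coord m s \<sigma> \<omega>)\<^sup>2) * indicator {s..r} \<sigma> \<partial>lborel)" for \<omega>
  define U where "U \<omega> = ennreal ((norm (W r \<omega> - W s \<omega>))\<^sup>2)" for \<omega>
  have Nm: "N \<in> borel_measurable M" unfolding N_def by (rule set_integral_measurable(2)[OF S_size_square_jointly_measurable]) simp
  have \<Delta>m: "\<Delta> \<in> borel_measurable M" unfolding \<Delta>_def by (rule set_integral_measurable(2)[OF dist_coord_jointly_measurable]) simp
  have Um: "U \<in> borel_measurable M" unfolding U_def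
    using W_increment_measurable[OF sr'] by measurable
  have EN: "(\<integral>\<^sup>+\<omega>. N \<omega> \<partial>M) = ennreal P"
    unfolding N_def P_def using nn_integral_time_Fubini[OF S_size_square_jointly_measurable, of "{s..r}"] Psi_increment(1)[of s r] sr by simp
  have EU: "(\<integral>\<^sup>+\<omega>. U \<omega> \<partial>M) = ennreal (h * \<tau>)"
    unfolding U_def h_def \<tau>_def by (rule W_increment_second_moment[OF sr'])
  define B where "B = h * (2 * (real m)\<^sup>2 * \<tau> + 2 * (gamma_bound m)\<^sup>2 * P)"
  have B0: "0 \<le> B" unfolding B_def using h \<tau>0 P0 by (intro mult_nonneg_nonneg add_nonneg_nonneg) auto
  have "(\<integral>\<^sup>+\<omega>. \<Delta> \<omega> \<partial>M) = (\<integral>\<^sup>+\<sigma>. (\<integral>\<^sup>+\<omega>. ennreal ((dist_coord m s \<sigma> \<omega>)\<^sup>2) \<partial>M) * indicator {s..r} \<sigma> \<partial>lborel)"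
    unfolding \<Delta>_def by (rule nn_integral_time_Fubini[OF dist_coord_jointly_measurable]) simp
  also have "\<dots> \<le> (\<integral>\<^sup>+\<sigma>. ennreal B * indicator {s..r} \<sigma> \<partial>lborel)"
  proof (rule nn_integral_mono)
    fix \<sigma> :: real
    show "(\<integral>\<^sup>+\<omega>. ennreal ((dist_coord m s \<sigma> \<omega>)\<^sup>2) \<partial>M) * indicator {s..r} \<sigma> \<le> ennreal B * indicator {s..r} \<sigma>"
    proof (cases "\<sigma> \<in> {s..r}")
      case True
      then show ?thesis using dist_coord_second_moment[OF sr True, of m] by (simp add: B_def h_def \<tau>_def P_def)
    qed simp
  qed
  also have "\<dots> = ennreal (B * h)" using sr B0 by (simp add: nn_integral_cmult_indicator h_def ennreal_mult'')
  finally have E\<Delta>: "(\<integral>\<^sup>+\<omega>. \<Delta> \<omega> \<partial>M) \<le> ennreal (B * h)" .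
  have "(\<integral>\<^sup>+\<omega>. ennreal \<bar>Ito_error s r \<omega>\<bar> \<partial>M)
     \<le> (\<integral>\<^sup>+\<omega>. (ennreal (energy_factor * k) * N \<omega> + ennreal (noise_factor * k) * U \<omega>) + ennreal (distance_factor / k) * \<Delta> \<omega> \<partial>M)"
  proof (rule nn_integral_mono_AE)
    show "AE \<omega> in M. ennreal \<bar>Ito_error s r \<omega>\<bar> \<le> (ennreal (energy_factor * k) * N \<omega> + ennreal (noise_factor * k) * U \<omega>) + ennreal (distance_factor / k) * \<Delta> \<omega>"
      using Ito_error_bound S_size_set_integrable generator_path_increment_bound
    proof eventually_elim
      case (elim \<omega>)
      define n where "n = (LINT \<sigma>:{s..r}|lborel. (S_size \<sigma> \<omega>)\<^sup>2)"
      define d where "d = (LINT \<sigma>:{s..r}|lborel. (dist_coord m s \<sigma> \<omega>)\<^sup>2)"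
      define u where "u = (norm (W r \<omega> - W s \<omega>))\<^sup>2"
      have nd: "0 \<le> n" "0 \<le> d" "0 \<le> u" unfolding n_def d_def u_def set_lebesgue_integral_def
        by (auto intro!: Bochner_Integration.integral_nonneg simp: indicator_def)
      have n: "ennreal n = N \<omega>" unfolding n_def N_def by (rule ennreal_set_integral) (use elim(2) sr in auto)
      have d: "ennreal d = \<Delta> \<omega>" unfolding d_def \<Delta>_def by (rule ennreal_set_integral) (use elim(3) sr in auto)
      have "\<bar>Ito_error s r \<omega>\<bar> \<le> energy_factor * k * n + noise_factor * k * u + distance_factor / k * d"
        using elim(1) sr unfolding k_def h_def n_def u_def d_def by blast
      then have "ennreal \<bar>Ito_error s r \<omega>\<bar> \<le> ennreal (energy_factor * k * n + noise_factor * k * u + distance_factor / k * d)" by (rule ennreal_leI)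
      also have "\<dots> = ennreal (energy_factor * k) * ennreal n + ennreal (noise_factor * k) * ennreal u + ennreal (distance_factor / k) * ennreal d"
        by (rule gen) (use nd factor_nonneg k(1) in auto)
      finally show ?case unfolding n d u_def U_def .
    qed
  qed
  also have "\<dots> = (\<integral>\<^sup>+\<omega>. ennreal (energy_factor * k) * N \<omega> + ennreal (noise_factor * k) * U \<omega> \<partial>M) + (\<integral>\<^sup>+\<omega>. ennreal (distance_factor / k) * \<Delta> \<omega> \<partial>M)"
    using Nm Um \<Delta>m by (intro nn_integral_add; measurable)
  also have "(\<integral>\<^sup>+\<omega>. ennreal (energy_factor * k) * N \<omega> + ennreal (noise_factor * k) * U \<omega> \<partial>M) = (\<integral>\<^sup>+\<omega>. ennreal (energy_factor * k) * N \<omega> \<partial>M) + (\<integral>\<^sup>+\<omega>. ennreal (noise_factor * k) * U \<omega> \<partial>M)"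
    using Nm Um by (intro nn_integral_add; measurable)
  also have "(\<integral>\<^sup>+\<omega>. ennreal (energy_factor * k) * N \<omega> \<partial>M) + (\<integral>\<^sup>+\<omega>. ennreal (noise_factor * k) * U \<omega> \<partial>M) + (\<integral>\<^sup>+\<omega>. ennreal (distance_factor / k) * \<Delta> \<omega> \<partial>M)
     \<le> ennreal (energy_factor * k) * ennreal P + ennreal (noise_factor * k) * ennreal (h * \<tau>) + ennreal (distance_factor / k) * ennreal (B * h)"
    unfolding nn_integral_cmult[OF Nm] nn_integral_cmult[OF Um] nn_integral_cmult[OF \<Delta>m] EN EU
    by (intro add_mono mult_left_mono order_refl E\<Delta>) auto
  also have "\<dots> = ennreal (energy_factor * k * P + noise_factor * k * (h * \<tau>) + distance_factor / k * (B * h))"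
    by (rule gen[symmetric]) (use factor_nonneg k(1) P0 B0 h \<tau>0 in auto)
  also have "\<dots> \<le> ennreal (total_factor * (P * k))"
  proof (rule ennreal_leI)
    have "B \<le> P * (2 * (real m)\<^sup>2 * \<tau> + 2 * (gamma_bound m)\<^sup>2 * T)"
    proof -
      have 1: "h * (2 * (real m)\<^sup>2 * \<tau>) \<le> P * (2 * (real m)\<^sup>2 * \<tau>)" using \<tau>0 by (intro mult_right_mono hP) simp
      have "h * P \<le> T * P" using P0 h by (intro mult_right_mono) auto
      then have 2: "(2 * (gamma_bound m)\<^sup>2) * (h * P) \<le> (2 * (gamma_bound m)\<^sup>2) * (T * P)" by (intro mult_left_mono) auto
      have "B = h * (2 * (real m)\<^sup>2 * \<tau>) + (2 * (gamma_bound m)\<^sup>2) * (h * P)" unfolding B_def by (simp add: algebra_simps)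
      moreover have "P * (2 * (real m)\<^sup>2 * \<tau> + 2 * (gamma_bound m)\<^sup>2 * T) = P * (2 * (real m)\<^sup>2 * \<tau>) + (2 * (gamma_bound m)\<^sup>2) * (T * P)"
        by (simp add: algebra_simps)
      ultimately show ?thesis using 1 2 by linarith
    qed
    then have b: "(distance_factor * k) * B \<le> (distance_factor * k) * (P * (2 * (real m)\<^sup>2 * \<tau> + 2 * (gamma_bound m)\<^sup>2 * T))"
      using factor_nonneg k by (intro mult_left_mono) auto
    have "h * \<tau> \<le> P * \<tau>" by (intro mult_right_mono hP \<tau>0)
    then have a: "(noise_factor * k) * (h * \<tau>) \<le> (noise_factor * k) * (P * \<tau>)" using factor_nonneg k by (intro mult_left_mono) auto
    have "distance_factor / k * (B * h) = (distance_factor * k) * B" using k(1) unfolding k(2)[symmetric] by (simp add: power2_eq_square)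
    with a b have "energy_factor * k * P + noise_factor * k * (h * \<tau>) + distance_factor / k * (B * h)
      \<le> energy_factor * k * P + (noise_factor * k) * (P * \<tau>) + (distance_factor * k) * (P * (2 * (real m)\<^sup>2 * \<tau> + 2 * (gamma_bound m)\<^sup>2 * T))" by linarith
    also have "\<dots> = total_factor * (P * k)" unfolding total_factor_def \<tau>_def[symmetric] by (simp add: algebra_simps)
    finally show "energy_factor * k * P + noise_factor * k * (h * \<tau>) + distance_factor / k * (B * h) \<le> total_factor * (P * k)" .
  qed
  finally show ?thesis unfolding P_def k_def h_def .
qed

lemma Ito_error_expectation:
  assumes sr: "0 \<le> s" "s < r" "r \<le> T"
  shows "integrable M (Ito_error s r)" and "\<bar>expectation (Ito_error s r)\<bar> \<le> total_factor * ((Psi r - Psi s) * sqrt (r - s))"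
proof -
  note le = Ito_error_nn_integral[OF sr]
  show i: "integrable M (Ito_error s r)"
  proof (rule integrableI_bounded)
    show "Ito_error s r \<in> borel_measurable M" using sr by (intro Ito_error_measurable) auto
    show "(\<integral>\<^sup>+\<omega>. ennreal (norm (Ito_error s r \<omega>)) \<partial>M) < \<infinity>" using le by (simp add: order_le_less_trans)
  qed
  have "0 \<le> Psi r - Psi s" using Psi_increment(2)[of s r] sr by linarith
  moreover have "0 \<le> total_factor" unfolding total_factor_def using factor_nonneg trace_nonneg T_pos by (intro add_nonneg_nonneg mult_nonneg_nonneg) auto
  ultimately have 0: "0 \<le> total_factor * ((Psi r - Psi s) * sqrt (r - s))" using sr by (intro mult_nonneg_nonneg) auto
  have "ennreal \<bar>expectation (Ito_error s r)\<bar> \<le> (\<integral>\<^sup>+\<omega>. ennreal \<bar>Ito_error s r \<omega>\<bar> \<partial>M)"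
    using integral_norm_bound_ennreal[OF i] by simp
  also note le
  finally show "\<bar>expectation (Ito_error s r)\<bar> \<le> total_factor * ((Psi r - Psi s) * sqrt (r - s))" using 0 by (simp add: ennreal_le_iff)
qed

lemma heat_X_integrable: "integrable M (\<lambda>\<omega>. heat (XT t \<omega>))"
  by (rule integrable_const_bound[where B = "D * (\<Sum>i<m. 1/2 * q i)", OF AE_I2 heat_X_measurable]) (subst real_norm_def, rule heat_bound)

lemma f_X_integrable: "integrable M (\<lambda>\<omega>. f (coordinates (XT t \<omega>)))"
  by (rule integrable_const_bound[where B = D]) (auto intro: AE_I2 partial_bounds f_X_measurable)

lemma f_shift_integrable: "0 \<le> s \<Longrightarrow> s \<le> r \<Longrightarrow> integrable M (\<lambda>\<omega>. f (coordinates (XT s \<omega> + (W r \<omega> - W s \<omega>))))"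
  by (rule integrable_const_bound[where B = D]) (auto intro: AE_I2 partial_bounds f_shift_measurable)

text \<open>\<open>heat_step\<close> holds for a deterministic starting point with an error uniform
  in that point. Freezing \<open>XT s\<close>, which is known at time \<open>s\<close> and
  independent of the increment, turns it into a statement on the process.\<close>

lemma heat_expectation:
  assumes sr: "0 \<le> s" "s < r" "r \<le> T"
  shows "\<bar>expectation (\<lambda>\<omega>. f (coordinates (XT s \<omega> + (W r \<omega> - W s \<omega>)))) - expectation (\<lambda>\<omega>. f (coordinates (XT s \<omega>)))
    - (r - s) * expectation (\<lambda>\<omega>. heat (XT s \<omega>))\<bar> \<le> D * heat_constant m * ((r - s) * sqrt (r - s))"
proof -
  have sr': "0 \<le> s" "s \<le> r" using sr by auto
  define \<Phi> where "\<Phi> x = expectation (\<lambda>\<omega>. f (coordinates (x + (W r \<omega> - W s \<omega>))))" for x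
  have XT: "XT s \<in> borel_measurable (Filt s)" using X_adapted[of s] XT_eq[of s] sr by simp
  note [measurable] = f_coordinates_measurable W_increment_measurable[OF sr']
  have fm: "(\<lambda>p. f (coordinates (fst p + snd p))) \<in> borel_measurable (borel \<Otimes>\<^sub>M borel)"
    by (rule measurable_compose[OF _ f_coordinates_measurable]) measurable
  have "expectation (\<lambda>\<omega>. f (coordinates (XT s \<omega> + (W r \<omega> - W s \<omega>)))) = expectation (\<lambda>\<omega>. \<Phi> (XT s \<omega>))"
    using integral_filtration[OF sr' XT fm] f_shift_integrable[OF sr'] unfolding \<Phi>_def by simp
  moreover have \<Phi>_bound: "\<bar>\<Phi> x - f (coordinates x) - (r - s) * heat x\<bar> \<le> D * heat_constant m * ((r - s) * sqrt (r - s))" for x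
  proof -
    have "\<Phi> x = expectation (\<lambda>\<omega>. f (\<lambda>i. coordinates x i + sqrt (q i) * (\<beta> i r \<omega> - \<beta> i s \<omega>)))"
      unfolding \<Phi>_def
    proof (rule integral_cong_AE)
      show "AE \<omega> in M. f (coordinates (x + (W r \<omega> - W s \<omega>))) = f (\<lambda>i. coordinates x i + sqrt (q i) * (\<beta> i r \<omega> - \<beta> i s \<omega>))"
        using W_increment_coordinate[of s r] sr by (auto elim!: eventually_mono simp: inner_add_left)
      have "(\<lambda>\<omega>. coordinates x i + sqrt (q i) * (\<beta> i r \<omega> - \<beta> i s \<omega>)) \<in> borel_measurable M" for i
        using sr by (intro borel_measurable_add borel_measurable_times borel_measurable_diff borel_measurable_const \<beta>_measurable) auto
      then have "(\<lambda>\<omega> i. coordinates x i + sqrt (q i) * (\<beta> i r \<omega> - \<beta> i s \<omega>)) \<in> borel_measurable M"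
        by (rule measurable_coordinatewise_then_product)
      then show "(\<lambda>\<omega>. f (\<lambda>i. coordinates x i + sqrt (q i) * (\<beta> i r \<omega> - \<beta> i s \<omega>))) \<in> borel_measurable M"
        by (rule measurable_compose[OF _ smooth_compact_support_measurable[OF f_smooth]])
    qed measurable
    then show ?thesis
      using heat_step[OF sr(1,2) f_smooth D_nonneg D_bound, of "coordinates x"] unfolding heat_def by simp
  qed
  moreover have \<Phi>_int: "integrable M (\<lambda>\<omega>. \<Phi> (XT s \<omega>))"
  proof (rule integrable_const_bound[where B = D])
    have "\<Phi> \<in> borel_measurable borel" unfolding \<Phi>_def by measurable
    then show "(\<lambda>\<omega>. \<Phi> (XT s \<omega>)) \<in> borel_measurable M" by (rule measurable_compose[OF XT_measurable])
    have "\<bar>\<Phi> x\<bar> \<le> D" for x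
    proof -
      have "\<bar>\<Phi> x\<bar> \<le> expectation (\<lambda>\<omega>. \<bar>f (coordinates (x + (W r \<omega> - W s \<omega>)))\<bar>)"
        unfolding \<Phi>_def by (rule integral_abs_bound)
      also have "\<dots> \<le> expectation (\<lambda>\<omega>. D)"
        by (rule Bochner_Integration.integral_mono') (auto intro: partial_bounds D_nonneg)
      finally show ?thesis by (simp add: prob_space)
    qed
    then show "AE \<omega> in M. norm (\<Phi> (XT s \<omega>)) \<le> D" by (simp add: AE_I2)
  qed
  moreover have "\<bar>expectation (\<lambda>\<omega>. \<Phi> (XT s \<omega>) - f (coordinates (XT s \<omega>)) - (r - s) * heat (XT s \<omega>))\<bar>
      \<le> D * heat_constant m * ((r - s) * sqrt (r - s))"
  proof -
    have "\<bar>expectation (\<lambda>\<omega>. \<Phi> (XT s \<omega>) - f (coordinates (XT s \<omega>)) - (r - s) * heat (XT s \<omega>))\<bar>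
      \<le> expectation (\<lambda>\<omega>. \<bar>\<Phi> (XT s \<omega>) - f (coordinates (XT s \<omega>)) - (r - s) * heat (XT s \<omega>)\<bar>)"
      by (rule integral_abs_bound)
    also have "\<dots> \<le> expectation (\<lambda>\<omega>. D * heat_constant m * ((r - s) * sqrt (r - s)))"
      by (rule integral_mono) (auto intro!: \<Phi>_bound integrable_abs Bochner_Integration.integrable_diff \<Phi>_int f_X_integrable heat_X_integrable integrable_mult_right)
    finally show ?thesis by (simp add: prob_space)
  qed
  moreover have "expectation (\<lambda>\<omega>. \<Phi> (XT s \<omega>) - f (coordinates (XT s \<omega>)) - (r - s) * heat (XT s \<omega>))
    = expectation (\<lambda>\<omega>. \<Phi> (XT s \<omega>)) - expectation (\<lambda>\<omega>. f (coordinates (XT s \<omega>))) - (r - s) * expectation (\<lambda>\<omega>. heat (XT s \<omega>))"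
    by (simp add: \<Phi>_int f_X_integrable heat_X_integrable)
  ultimately show ?thesis by simp
qed

lemma generator_path_integral_integrable:
  assumes sr: "0 \<le> s" "s < r" "r \<le> T"
  shows "integrable M (\<lambda>\<omega>. LINT \<sigma>:{s..r}|lborel. generator_path \<sigma> \<omega>)"
proof -
  have eq: "(\<lambda>\<omega>. LINT \<sigma>:{s..r}|lborel. generator_path \<sigma> \<omega>) = (\<lambda>\<omega>. f (coordinates (XT r \<omega>)) - f (coordinates (XT s \<omega> + (W r \<omega> - W s \<omega>)))
     + (r - s) * heat (XT s \<omega>) - Ito_error s r \<omega>)" by (simp add: Ito_error_def)
  show ?thesis unfolding eq using sr
    by (intro Bochner_Integration.integrable_diff Bochner_Integration.integrable_add integrable_mult_right
        f_X_integrable f_shift_integrable heat_X_integrable Ito_error_expectation) auto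
qed

text \<open>The difference \<open>H\<close> of the two expectations has increments bounded by those
  of \<open>Psi\<close> times the root of the length, hence is constant. Expectations are taken in
  each single step, so that no martingale part ever has to be defined.\<close>

theorem Ito_formula:
  assumes t: "0 \<le> t" "t \<le> T"
  shows "expectation (\<lambda>\<omega>. f (coordinates (XT t \<omega>))) - expectation (\<lambda>\<omega>. f (coordinates (XT 0 \<omega>)))
    = expectation (\<lambda>\<omega>. LINT \<sigma>:{0..t}|lborel. generator_path \<sigma> \<omega>)"
proof -
  define H where "H t = expectation (\<lambda>\<omega>. f (coordinates (XT t \<omega>))) - expectation (\<lambda>\<omega>. LINT \<sigma>:{0..t}|lborel. generator_path \<sigma> \<omega>)" for t
  note zero = set_integral_singleton
  have int: "integrable M (\<lambda>\<omega>. LINT \<sigma>:{0..r}|lborel. generator_path \<sigma> \<omega>)" if "0 \<le> r" "r \<le> T" for r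
    using generator_path_integral_integrable[of 0 r] that by (cases "r = 0") (auto simp: zero[unfolded atLeastAtMost_singleton])
  have "H t = H 0"
  proof (rule increment_eq_of_superlinear_error[where h = H and a = 0 and b = t and c = "total_factor + D * heat_constant m" and \<Psi> = Psi])
    fix s r assume sr: "0 \<le> s" "s < r" "r \<le> t"
    then have sr: "0 \<le> s" "s < r" "r \<le> T" using t by auto
    have sr': "0 \<le> s" "s \<le> r" using sr by auto
    have split: "AE \<omega> in M. (LINT \<sigma>:{0..r}|lborel. generator_path \<sigma> \<omega>) = (LINT \<sigma>:{0..s}|lborel. generator_path \<sigma> \<omega>) + (LINT \<sigma>:{s..r}|lborel. generator_path \<sigma> \<omega>)"
      using generator_path_set_integrable
    proof eventually_elim
      case (elim \<omega>)
      have i: "set_integrable lborel {0..s} (\<lambda>\<sigma>. generator_path \<sigma> \<omega>)" "set_integrable lborel {s..r} (\<lambda>\<sigma>. generator_path \<sigma> \<omega>)" using elim sr by auto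
      have "(LINT \<sigma>:{0..s} \<union> {s..r}|lborel. generator_path \<sigma> \<omega>) = (LINT \<sigma>:{0..s}|lborel. generator_path \<sigma> \<omega>) + (LINT \<sigma>:{s..r}|lborel. generator_path \<sigma> \<omega>)"
      proof (rule set_integral_Un_AE[OF _ _ _ i])
        show "AE x in lborel. \<not> (x \<in> {0..s} \<and> x \<in> {s..r})" using AE_lborel_singleton[of s] by eventually_elim auto
      qed auto
      moreover have "{0..s} \<union> {s..r} = {0..r}" using sr by auto
      ultimately show ?case by simp
    qed
    have "expectation (\<lambda>\<omega>. LINT \<sigma>:{0..r}|lborel. generator_path \<sigma> \<omega>)
      = expectation (\<lambda>\<omega>. (LINT \<sigma>:{0..s}|lborel. generator_path \<sigma> \<omega>) + (LINT \<sigma>:{s..r}|lborel. generator_path \<sigma> \<omega>))"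
      by (rule integral_cong_AE[OF _ _ split]) (intro borel_measurable_add generator_path_integral_measurable)+
    also have "\<dots> = expectation (\<lambda>\<omega>. LINT \<sigma>:{0..s}|lborel. generator_path \<sigma> \<omega>) + expectation (\<lambda>\<omega>. LINT \<sigma>:{s..r}|lborel. generator_path \<sigma> \<omega>)"
      using sr by (intro Bochner_Integration.integral_add int generator_path_integral_integrable) auto
    finally have G: "expectation (\<lambda>\<omega>. LINT \<sigma>:{0..r}|lborel. generator_path \<sigma> \<omega>)
      = expectation (\<lambda>\<omega>. LINT \<sigma>:{0..s}|lborel. generator_path \<sigma> \<omega>) + expectation (\<lambda>\<omega>. LINT \<sigma>:{s..r}|lborel. generator_path \<sigma> \<omega>)" .
    have E: "expectation (Ito_error s r) = expectation (\<lambda>\<omega>. f (coordinates (XT r \<omega>))) - expectation (\<lambda>\<omega>. f (coordinates (XT s \<omega> + (W r \<omega> - W s \<omega>))))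
      + (r - s) * expectation (\<lambda>\<omega>. heat (XT s \<omega>)) - expectation (\<lambda>\<omega>. LINT \<sigma>:{s..r}|lborel. generator_path \<sigma> \<omega>)"
      unfolding Ito_error_def by (simp add: f_X_integrable f_shift_integrable[OF sr'] heat_X_integrable generator_path_integral_integrable[OF sr])
    have hc: "0 \<le> D * heat_constant m" unfolding heat_constant_def using D_nonneg q_pos
      by (intro mult_nonneg_nonneg sum_nonneg add_nonneg_nonneg) (auto simp: less_imp_le)
    \<comment> \<open>The error of the heat step is measured by the length, the other one by
      \<open>Psi\<close>; the increments of \<open>Psi\<close> dominate both.\<close>
    have "(r - s) * sqrt (r - s) \<le> (Psi r - Psi s) * sqrt (r - s)"
      using sr by (intro mult_right_mono Psi_increment(2)) auto
    from mult_left_mono[OF this hc] have "D * heat_constant m * ((r - s) * sqrt (r - s)) \<le> D * heat_constant m * ((Psi r - Psi s) * sqrt (r - s))" .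
    then have "\<bar>H r - H s\<bar> \<le> total_factor * ((Psi r - Psi s) * sqrt (r - s)) + D * heat_constant m * ((Psi r - Psi s) * sqrt (r - s))"
      using Ito_error_expectation(2)[OF sr] heat_expectation[OF sr] unfolding H_def G E by linarith
    then show "\<bar>H r - H s\<bar> \<le> (total_factor + D * heat_constant m) * ((Psi r - Psi s) * sqrt (r - s))" by (simp only: distrib_right)
  qed (use t in simp)
  then show ?thesis unfolding H_def zero by simp
qed

end

section \<open>The law solves the Cauchy problem\<close>

lemma (in spde) initial_value: "AE \<omega> in M. XT 0 \<omega> = \<eta> \<omega>"
  using equation W_0
proof eventually_elim
  case (elim \<omega>)
  show ?case
  proof (rule eq_if_coordinates_eq)
    fix i
    have "X 0 \<omega> \<bullet> e i = \<eta> \<omega> \<bullet> e i + W 0 \<omega> \<bullet> e i + (LINT s:{0..0}|lborel. drift S F (Y s \<omega>) (e i))"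
      using elim(1) T_pos e_in_V[of i] by simp
    then show "XT 0 \<omega> \<bullet> e i = \<eta> \<omega> \<bullet> e i"
      unfolding set_integral_singleton using elim(2) XT_eq[of 0] T_pos by simp
  qed
qed

text \<open>Integrability on the product permits the interchange of time and expectation. The
  generator is at most linear in \<open>S_size\<close>, which does not exceed its own square, and
  that has a finite integral.\<close>

lemma (in spde_test_function) generator_path_time_integrable:
  assumes t: "t \<in> {0..T}"
  shows "integrable (lborel \<Otimes>\<^sub>M M) (\<lambda>p. indicator {0..t} (fst p) * generator_path (fst p) (snd p))"
proof (rule integrableI_bounded)
  note [measurable] = generator_path_jointly_measurable
  interpret P: pair_sigma_finite lborel M ..
  have m: "(\<lambda>p. generator_path (fst p) (snd p)) \<in> borel_measurable (lborel \<Otimes>\<^sub>M M)" by measurable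
  then show m': "(\<lambda>p. indicator {0..t} (fst p) * generator_path (fst p) (snd p)) \<in> borel_measurable (lborel \<Otimes>\<^sub>M M)" by measurable
  have Dg: "0 \<le> D * generator_factor" using D_nonneg generator_factor_nonneg by (rule mult_nonneg_nonneg)
  have "(\<integral>\<^sup>+p. ennreal (norm (indicator {0..t} (fst p) * generator_path (fst p) (snd p))) \<partial>(lborel \<Otimes>\<^sub>M M))
    = (\<integral>\<^sup>+\<omega>. (\<integral>\<^sup>+\<sigma>. ennreal (norm (indicator {0..t} \<sigma> * generator_path \<sigma> \<omega>)) \<partial>lborel) \<partial>M)"
    using m' by (subst P.nn_integral_snd[symmetric]) (auto simp: case_prod_beta)
  also have "\<dots> \<le> (\<integral>\<^sup>+\<omega>. ennreal (D * generator_factor) * (\<integral>\<^sup>+\<sigma>. ennreal ((S_size \<sigma> \<omega>)\<^sup>2) * indicator {0..T} \<sigma> \<partial>lborel) \<partial>M)"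
  proof (rule nn_integral_mono_AE)
    show "AE \<omega> in M. (\<integral>\<^sup>+\<sigma>. ennreal (norm (indicator {0..t} \<sigma> * generator_path \<sigma> \<omega>)) \<partial>lborel)
      \<le> ennreal (D * generator_factor) * (\<integral>\<^sup>+\<sigma>. ennreal ((S_size \<sigma> \<omega>)\<^sup>2) * indicator {0..T} \<sigma> \<partial>lborel)"
      using generator_path_bound AE_space
    proof eventually_elim
      case (elim \<omega>)
      note [measurable] = time_section_measurable(1)[OF S_size_square_jointly_measurable elim(2)]
      have "(\<integral>\<^sup>+\<sigma>. ennreal (norm (indicator {0..t} \<sigma> * generator_path \<sigma> \<omega>)) \<partial>lborel) \<le> (\<integral>\<^sup>+\<sigma>. ennreal (D * generator_factor) * (ennreal ((S_size \<sigma> \<omega>)\<^sup>2) * indicator {0..T} \<sigma>) \<partial>lborel)"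
      proof (rule nn_integral_mono_AE)
        show "AE \<sigma> in lborel. ennreal (norm (indicator {0..t} \<sigma> * generator_path \<sigma> \<omega>)) \<le> ennreal (D * generator_factor) * (ennreal ((S_size \<sigma> \<omega>)\<^sup>2) * indicator {0..T} \<sigma>)"
          using elim(1)
        proof eventually_elim
          case (elim \<sigma>)
          show ?case
          proof (cases "\<sigma> \<in> {0..t}")
            case True
            then have \<sigma>: "\<sigma> \<in> {0..T}" using t by auto
            have "S_size \<sigma> \<omega> * 1 \<le> S_size \<sigma> \<omega> * S_size \<sigma> \<omega>" using S_size_ge_1[of \<sigma> \<omega>] by (intro mult_left_mono) auto
            then have "D * generator_factor * S_size \<sigma> \<omega> \<le> D * generator_factor * (S_size \<sigma> \<omega>)\<^sup>2" unfolding power2_eq_square by (intro mult_left_mono Dg) simp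
            then have "\<bar>generator_path \<sigma> \<omega>\<bar> \<le> D * generator_factor * (S_size \<sigma> \<omega>)\<^sup>2" using elim \<sigma> by linarith
            then have "ennreal \<bar>generator_path \<sigma> \<omega>\<bar> \<le> ennreal (D * generator_factor) * ennreal ((S_size \<sigma> \<omega>)\<^sup>2)"
              using Dg by (simp add: ennreal_mult[symmetric] ennreal_leI)
            then show ?thesis using True \<sigma> by simp
          qed simp
        qed
      qed
      also have "\<dots> = ennreal (D * generator_factor) * (\<integral>\<^sup>+\<sigma>. ennreal ((S_size \<sigma> \<omega>)\<^sup>2) * indicator {0..T} \<sigma> \<partial>lborel)"
        by (intro nn_integral_cmult) measurable
      finally show ?case .
    qed
  qed
  also have "\<dots> = ennreal (D * generator_factor) * (\<integral>\<^sup>+\<omega>. (\<integral>\<^sup>+\<sigma>. ennreal ((S_size \<sigma> \<omega>)\<^sup>2) * indicator {0..T} \<sigma> \<partial>lborel) \<partial>M)"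
    by (intro nn_integral_cmult set_integral_measurable(2)[OF S_size_square_jointly_measurable]) simp
  also have "\<dots> < \<infinity>"
    using S_size_moment nn_integral_time_Fubini[OF S_size_square_jointly_measurable, of "{0..T}"] by (simp add: ennreal_mult_less_top)
  finally show "(\<integral>\<^sup>+p. ennreal (norm (indicator {0..t} (fst p) * generator_path (fst p) (snd p))) \<partial>(lborel \<Otimes>\<^sub>M M)) < \<infinity>" .
qed

context spde_square_integrable
begin

abbreviation law :: "real \<Rightarrow> 'a measure" where "law t \<equiv> distr M borel (XT t)"

text \<open>On almost every path \<open>X\<close> is in \<open>V\<close> at almost every time;
  Fubini's theorem exchanges the two qualifications, for which \<open>V\<close> has to be a Borel
  set.\<close>

lemma law_on_V: "AE s in lborel. s \<in> {0..T} \<longrightarrow> (AE x in law s. x \<in> V)"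
proof -
  interpret P: pair_sigma_finite lborel M ..
  note [measurable] = XT_jointly_measurable V_borel
  have m: "(\<lambda>p. XT (fst p) (snd p)) \<in> borel_measurable (lborel \<Otimes>\<^sub>M M)" by measurable
  have set: "{p \<in> space (lborel \<Otimes>\<^sub>M M). fst p \<in> {0..T} \<longrightarrow> XT (fst p) (snd p) \<in> V} \<in> sets (lborel \<Otimes>\<^sub>M M)"
    using m by measurable
  have "AE \<omega> in M. AE s in lborel. s \<in> {0..T} \<longrightarrow> XT s \<omega> \<in> V"
    using Y_AE AE_space
  proof eventually_elim
    case (elim \<omega>)
    from elim(1) show ?case
    proof eventually_elim
      case (elim s)
      show ?case using elim Y_in_V[OF _ \<open>\<omega> \<in> space M\<close>, of s] XT_eq[of s] by auto
    qed
  qed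
  then have "AE s in lborel. AE \<omega> in M. s \<in> {0..T} \<longrightarrow> XT s \<omega> \<in> V"
    using P.AE_commute[where P = "\<lambda>s \<omega>. s \<in> {0..T} \<longrightarrow> XT s \<omega> \<in> V", OF set] by simp
  then show ?thesis
  proof eventually_elim
    case (elim s)
    show ?case
    proof
      assume "s \<in> {0..T}"
      then have "AE \<omega> in M. XT s \<omega> \<in> V" using elim by simp
      then show "AE x in law s. x \<in> V" using V_borel by (subst AE_distr_iff) (auto intro: XT_measurable)
    qed
  qed
qed

text \<open>Ito's formula after a change of variables to the law and an interchange of time and
  expectation. The measurability of the generator on \<open>V\<close> is assumed because none is
  known for \<open>F\<close>.\<close>

theorem law_cauchy_solution:
  assumes gm: "\<And>\<phi>. \<phi> \<in> FC0_infinity e \<Longrightarrow> (\<lambda>x. indicator V x *\<^sub>R generator e q S F \<phi> x) \<in> borel_measurable borel"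
  shows "cauchy_solution e q V S F {0..T} (distr M borel \<eta>) law"
  unfolding cauchy_solution_def
proof (intro conjI ballI allI)
  show "prob_space (law t)" for t by (rule prob_space_distr[OF XT_measurable])
  show "sets (law t) = sets borel" for t by simp
  show "e i \<in> V" for i by (rule e_in_V)
  show "AE s in lborel. s \<in> {0..T} \<longrightarrow> (AE x in law s. x \<in> V)" by (rule law_on_V)
next
  fix t \<phi> assume t: "t \<in> {0..T}" and \<phi>: "\<phi> \<in> FC0_infinity e"
  from \<phi> obtain m f where f: "smooth_compact_support m f" and \<phi>f: "\<phi> = (\<lambda>x. f (coordinates x))"
    unfolding FC0_infinity_def by auto
  obtain D where D: "D \<ge> 0" "\<And>is x. set is \<subseteq> {..<m} \<Longrightarrow> length is \<le> 3 \<Longrightarrow> \<bar>foldr partial is f x\<bar> \<le> D"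
    using smooth_compact_support_bounds[OF f] by blast
  interpret spde_test_function M e q W \<beta> \<eta> DA V A S F T C K X Y f m D
    by unfold_locales (use f D gm[OF \<phi>] in \<open>simp_all add: \<phi>f\<close>)
  interpret P: pair_sigma_finite lborel M ..
  define g where "g p = indicator {0..t} (fst p) * generator_path (fst p) (snd p)" for p
  have g: "integrable (lborel \<Otimes>\<^sub>M M) g" unfolding g_def by (rule generator_path_time_integrable[OF t])
  have generator_path: "generator_path s \<omega> = indicator V (XT s \<omega>) *\<^sub>R generator e q S F \<phi> (XT s \<omega>)" for s \<omega> unfolding generator_path_def \<phi>f ..
  have law: "(LINT x:V|law s. generator e q S F \<phi> x) = expectation (generator_path s)" for s
    unfolding set_lebesgue_integral_def generator_path by (rule integral_distr[OF XT_measurable gm[OF \<phi>]])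
  have gs: "(\<integral>\<omega>. g (s, \<omega>) \<partial>M) = indicator {0..t} s *\<^sub>R (LINT x:V|law s. generator e q S F \<phi> x)" for s
    unfolding law g_def by simp
  show "AE s in lborel. s \<in> {0..t} \<longrightarrow> set_integrable (law s) V (generator e q S F \<phi>)"
    using P.AE_integrable_fst'[OF g]
  proof eventually_elim
    case (elim s)
    show ?case
    proof
      assume "s \<in> {0..t}"
      then have "integrable M (generator_path s)" using elim by (simp add: g_def)
      then show "set_integrable (law s) V (generator e q S F \<phi>)"
        unfolding set_integrable_def integrable_distr_eq[OF XT_measurable gm[OF \<phi>]] generator_path .
    qed
  qed
  show "set_integrable lborel {0..t} (\<lambda>s. LINT x:V|law s. generator e q S F \<phi> x)"
    unfolding set_integrable_def using P.integrable_fst'[OF g] unfolding gs .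
  have "(LINT x|law t. \<phi> x) = expectation (\<lambda>\<omega>. f (coordinates (XT t \<omega>)))"
    unfolding \<phi>f by (rule integral_distr[OF XT_measurable f_coordinates_measurable])
  moreover have "(LINT x|distr M borel \<eta>. \<phi> x) = expectation (\<lambda>\<omega>. f (coordinates (XT 0 \<omega>)))"
  proof -
    have "(LINT x|distr M borel \<eta>. \<phi> x) = expectation (\<lambda>\<omega>. f (coordinates (\<eta> \<omega>)))"
      unfolding \<phi>f by (rule integral_distr[OF \<eta>_measurable f_coordinates_measurable])
    also have "\<dots> = expectation (\<lambda>\<omega>. f (coordinates (XT 0 \<omega>)))"
    proof (rule integral_cong_AE)
      show "AE \<omega> in M. f (coordinates (\<eta> \<omega>)) = f (coordinates (XT 0 \<omega>))" using initial_value by eventually_elim simp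
      show "(\<lambda>\<omega>. f (coordinates (\<eta> \<omega>))) \<in> borel_measurable M" by (rule measurable_compose[OF \<eta>_measurable f_coordinates_measurable])
    qed (rule f_X_measurable)
    finally show ?thesis .
  qed
  moreover have "expectation (\<lambda>\<omega>. LINT \<sigma>:{0..t}|lborel. generator_path \<sigma> \<omega>) = (LINT s:{0..t}|lborel. (LINT x:V|law s. generator e q S F \<phi> x))"
  proof -
    have "(LINT s:{0..t}|lborel. (LINT x:V|law s. generator e q S F \<phi> x)) = (\<integral>s. (\<integral>\<omega>. g (s, \<omega>) \<partial>M) \<partial>lborel)"
      unfolding set_lebesgue_integral_def[of lborel] gs ..
    also have "\<dots> = (\<integral>\<omega>. (\<integral>s. g (s, \<omega>) \<partial>lborel) \<partial>M)"
      by (rule P.Fubini_integral[symmetric]) (use g in simp)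
    also have "\<dots> = expectation (\<lambda>\<omega>. LINT \<sigma>:{0..t}|lborel. generator_path \<sigma> \<omega>)"
      unfolding set_lebesgue_integral_def g_def by simp
    finally show ?thesis by simp
  qed
  ultimately show "(LINT x|law t. \<phi> x) - (LINT x|distr M borel \<eta>. \<phi> x) = (LINT s:{0..t}|lborel. (LINT x:V|law s. generator e q S F \<phi> x))"
    using Ito_formula[of t] t by simp
qed

end

section \<open>Positivity on ellipsoids\<close>

text \<open>The inequality \<open>(1 + y)\<^sup>2 \<le> 2 + 2 * y\<^sup>2\<close> reduces the claim
  to the square integrability of the graph norm and the finiteness of \<open>T\<close>.\<close>

lemma (in spde) S_size_second_moment_finite:
  assumes int: "integrable (restrict_space lborel {0..T} \<Otimes>\<^sub>M M) (\<lambda>(t, \<omega>). (norm (Y t \<omega>))\<^sup>2 + (norm (S (Y t \<omega>)))\<^sup>2)"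
  shows "(\<integral>\<^sup>+\<sigma>. (\<integral>\<^sup>+\<omega>. ennreal ((S_size \<sigma> \<omega>)\<^sup>2) \<partial>M) * indicator {0..T} \<sigma> \<partial>lborel) < \<infinity>"
proof -
  define R where "R = restrict_space lborel {0..T}"
  interpret R: sigma_finite_measure R unfolding R_def by (rule sigma_finite_time)
  interpret P: pair_sigma_finite R M ..
  define g where "g p = (norm (Y (fst p) (snd p)))\<^sup>2 + (norm (S (Y (fst p) (snd p))))\<^sup>2" for p
  have g: "integrable (R \<Otimes>\<^sub>M M) g" using int unfolding R_def g_def case_prod_beta' .
  then have gm: "(\<lambda>p. ennreal (g p)) \<in> borel_measurable (R \<Otimes>\<^sub>M M)" by simp
  have gs: "(\<lambda>\<omega>. ennreal (g (\<sigma>, \<omega>))) \<in> borel_measurable M" if "\<sigma> \<in> space R" for \<sigma>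
    using measurable_compose[OF measurable_Pair1'[OF that] gm] by simp
  have g0: "0 \<le> g p" for p unfolding g_def by simp
  have gfin: "(\<integral>\<^sup>+p. ennreal (g p) \<partial>(R \<Otimes>\<^sub>M M)) < \<infinity>"
    using g g0 unfolding integrable_iff_bounded by simp
  have \<phi>m: "(\<lambda>\<sigma>. \<integral>\<^sup>+\<omega>. ennreal (g (\<sigma>, \<omega>)) \<partial>M) \<in> borel_measurable R"
    by (rule borel_measurable_nn_integral_fst[OF gm])
  have "(\<integral>\<^sup>+\<sigma>. (\<integral>\<^sup>+\<omega>. ennreal ((S_size \<sigma> \<omega>)\<^sup>2) \<partial>M) * indicator {0..T} \<sigma> \<partial>lborel) = (\<integral>\<^sup>+\<sigma>. (\<integral>\<^sup>+\<omega>. ennreal ((S_size \<sigma> \<omega>)\<^sup>2) \<partial>M) \<partial>R)"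
    unfolding R_def by (rule nn_integral_restrict_space[symmetric]) simp
  also have "\<dots> \<le> (\<integral>\<^sup>+\<sigma>. 2 + 2 * (\<integral>\<^sup>+\<omega>. ennreal (g (\<sigma>, \<omega>)) \<partial>M) \<partial>R)"
  proof (rule nn_integral_mono)
    fix \<sigma> assume \<sigma>: "\<sigma> \<in> space R"
    then have \<sigma>T: "\<sigma> \<in> {0..T}" by (simp add: R_def space_restrict_space)
    have "(\<integral>\<^sup>+\<omega>. ennreal ((S_size \<sigma> \<omega>)\<^sup>2) \<partial>M) \<le> (\<integral>\<^sup>+\<omega>. 2 + 2 * ennreal (g (\<sigma>, \<omega>)) \<partial>M)"
    proof (rule nn_integral_mono)
      fix \<omega>
      define y where "y = norm (S (Y \<sigma> \<omega>))"
      have "(S_size \<sigma> \<omega>)\<^sup>2 = (1 + y)\<^sup>2" using \<sigma>T by (simp add: S_size_def S_path_def y_def)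
      also have "\<dots> \<le> 2 + 2 * y\<^sup>2" using zero_le_power2[of "1 - y"] by (simp add: power2_eq_square algebra_simps)
      also have "\<dots> \<le> 2 + 2 * g (\<sigma>, \<omega>)" by (simp add: g_def y_def)
      finally have "ennreal ((S_size \<sigma> \<omega>)\<^sup>2) \<le> ennreal (2 + 2 * g (\<sigma>, \<omega>))" by (rule ennreal_leI)
      also have "\<dots> = 2 + 2 * ennreal (g (\<sigma>, \<omega>))" using g0[of "(\<sigma>, \<omega>)"] by (simp add: ennreal_mult)
      finally show "ennreal ((S_size \<sigma> \<omega>)\<^sup>2) \<le> 2 + 2 * ennreal (g (\<sigma>, \<omega>))" .
    qed
    also have "\<dots> = 2 + 2 * (\<integral>\<^sup>+\<omega>. ennreal (g (\<sigma>, \<omega>)) \<partial>M)"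
      using gs[OF \<sigma>] by (simp add: nn_integral_add nn_integral_cmult emeasure_space_1)
    finally show "(\<integral>\<^sup>+\<omega>. ennreal ((S_size \<sigma> \<omega>)\<^sup>2) \<partial>M) \<le> 2 + 2 * (\<integral>\<^sup>+\<omega>. ennreal (g (\<sigma>, \<omega>)) \<partial>M)" .
  qed
  also have "\<dots> = 2 * emeasure R (space R) + 2 * (\<integral>\<^sup>+\<sigma>. (\<integral>\<^sup>+\<omega>. ennreal (g (\<sigma>, \<omega>)) \<partial>M) \<partial>R)"
    using \<phi>m by (simp add: nn_integral_add nn_integral_cmult)
  also have "(\<integral>\<^sup>+\<sigma>. (\<integral>\<^sup>+\<omega>. ennreal (g (\<sigma>, \<omega>)) \<partial>M) \<partial>R) = (\<integral>\<^sup>+p. ennreal (g p) \<partial>(R \<Otimes>\<^sub>M M))" by (rule nn_integral_fst[OF gm])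
  also have "emeasure R (space R) = ennreal T"
    unfolding R_def using T_pos by (simp add: emeasure_restrict_space space_restrict_space)
  also have "2 * ennreal T + 2 * (\<integral>\<^sup>+p. ennreal (g p) \<partial>(R \<Otimes>\<^sub>M M)) < \<infinity>"
    using gfin by (simp add: ennreal_mult_less_top)
  finally show ?thesis .
qed

text \<open>Expanded in the eigenbasis, \<open>Q x \<bullet> x\<close> is a series with terms
  \<open>q i * (x \<bullet> e i)\<^sup>2\<close>, dominated termwise by Parseval's series.\<close>

lemma (in orthonormal_basis) Q_norm_le:
  assumes Q: "bounded_linear Q" "\<And>j. Q (e j) = q j *\<^sub>R e j" and q: "\<And>j. q j \<le> 1"
  shows "Q_norm Q x \<le> norm x"
proof -
  have "(\<lambda>i. Q ((x \<bullet> e i) *\<^sub>R e i) \<bullet> x) sums (Q x \<bullet> x)"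
    by (rule bounded_linear.sums[OF bounded_linear_inner_left bounded_linear.sums[OF Q(1) sums_expansion]])
  then have "Q x \<bullet> x \<le> (norm x)\<^sup>2"
  proof (rule sums_le[rotated, OF _ parseval])
    fix i
    have "q i * (x \<bullet> e i)\<^sup>2 \<le> 1 * (x \<bullet> e i)\<^sup>2" by (intro mult_right_mono q) simp
    then show "Q ((x \<bullet> e i) *\<^sub>R e i) \<bullet> x \<le> (x \<bullet> e i)\<^sup>2"
      by (simp add: linear_cmul[OF bounded_linear.linear[OF Q(1)]] Q(2) power2_eq_square inner_commute[of "e i"] mult_ac)
  qed
  then have "Q_norm Q x \<le> sqrt ((norm x)\<^sup>2)" unfolding Q_norm_def by (rule real_sqrt_le_mono)
  then show ?thesis by simp
qed

lemma ellipsoid_borel: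
  assumes "bounded_linear Q"
  shows "ellipsoid Q a R \<in> sets borel"
proof -
  have "continuous_on UNIV Q" using assms by (simp add: linear_continuous_on)
  then have "continuous_on UNIV (\<lambda>x. Q (x - a))"
    by (rule continuous_on_compose2) (auto intro: continuous_intros)
  then have "closed (ellipsoid Q a R)" unfolding ellipsoid_def Q_norm_def
    by (intro closed_Collect_le continuous_intros)
  then show ?thesis by simp
qed

text \<open>Integrability contains measurability, and \<open>\<mu> s\<close> lives on the Borel
  sets, so a single time \<open>s\<close> of integrability is enough; there is one because
  \<open>{0..T}\<close> has positive length. The given solution thus supplies the regularity of the
  coefficients.\<close>

lemma cauchy_solution_generator_measurable:
  assumes \<mu>: "cauchy_solution e q V S F {0..T} \<nu> \<mu>" and T: "T > 0" and \<phi>: "\<phi> \<in> FC0_infinity e"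
  shows "(\<lambda>x. indicator V x *\<^sub>R generator e q S F \<phi> x) \<in> borel_measurable borel"
proof -
  have sets: "sets (\<mu> t) = sets borel" if "t \<in> {0..T}" for t using \<mu> that unfolding cauchy_solution_def by blast
  have AE: "AE s in lborel. s \<in> {0..T} \<longrightarrow> set_integrable (\<mu> s) V (generator e q S F \<phi>)"
    using \<mu> T \<phi> unfolding cauchy_solution_def by auto
  have "\<exists>s\<in>{0..T}. set_integrable (\<mu> s) V (generator e q S F \<phi>)"
  proof (rule ccontr)
    assume "\<not> ?thesis"
    then have "AE s in lborel. s \<notin> {0..T}" using AE by (auto elim!: eventually_mono)
    then have "emeasure lborel {0..T} = 0" by (subst (asm) AE_iff_measurable[of "{0..T}"]) auto
    then show False using T by simp
  qed
  then obtain s where s: "s \<in> {0..T}" "set_integrable (\<mu> s) V (generator e q S F \<phi>)" by blast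
  from borel_measurable_integrable[OF s(2)[unfolded set_integrable_def]]
  show ?thesis unfolding measurable_cong_sets[OF sets[OF s(1)] refl] .
qed

theorem theorem3p1:
  fixes M :: "'w measure"
    and Q A S F :: "'a::{real_inner, banach, second_countable_topology} \<Rightarrow> 'a"
    and DA V :: "'a set"
    and e :: "nat \<Rightarrow> 'a" and q :: "nat \<Rightarrow> real"
    and W X :: "real \<Rightarrow> 'w \<Rightarrow> 'a" and \<eta> :: "'w \<Rightarrow> 'a"
    and \<mu> :: "real \<Rightarrow> 'a measure" and T :: real
  assumes "prob_space M"
    and "covariance_operator Q e q"
    and "wiener_process M e q W"
    and "T > 0"
    and "finite_moments M \<eta>"
    and "prob_space.indep_set M {\<eta> -` U \<inter> space M | U. U \<in> sets borel}
           {trajectory W -` U \<inter> space M | U. U \<in> sets trajectory_space}"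
    and "bdd_above (range (\<lambda>x. norm (F x)))"
    and "selfadjoint_operator DA A"
    and "\<exists>\<epsilon>>0. \<forall>x\<in>DA. A x \<bullet> x \<le> - \<epsilon> * (norm x)\<^sup>2"
    and "sqrt_of_minus DA A V S"
    and "unique_cauchy_solution e q V S F {0..T} (distr M borel \<eta>) \<mu>"
    and "variational_solution M \<eta> W V S F T X"
    and "(\<integral>\<^sup>+ \<omega>. (SUP t\<in>{0..T}. ennreal ((norm (X t \<omega>))\<^sup>2)) \<partial>M) < \<infinity>"
  shows "\<forall>t\<in>{0<..T}. \<forall>a. \<forall>R>0.
           measure (\<mu> t) (ellipsoid Q a R) > 0 \<and>
           measure M {\<omega> \<in> space M. X t \<omega> \<in> ellipsoid Q a R} > 0"
proof -
  interpret prob_space M by fact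
  have cov: "bounded_linear Q" "\<And>i j. e i \<bullet> e j = (if i = j then 1 else 0)" "closure (span (range e)) = UNIV"
    "\<And>j. Q (e j) = q j *\<^sub>R e j" "q 0 = 1" "decseq q" "\<And>j. 0 < q j" "summable q"
    using assms(2) unfolding covariance_operator_def by blast+
  obtain \<beta> :: "nat \<Rightarrow> real \<Rightarrow> 'w \<Rightarrow> real" where \<beta>: "\<And>j. standard_wiener_process M (\<beta> j)"
    "indep_vars (\<lambda>_. trajectory_space) (\<lambda>j. trajectory (\<beta> j)) UNIV"
    "\<And>t. 0 \<le> t \<Longrightarrow> AE \<omega> in M. (\<lambda>j. (sqrt (q j) * \<beta> j t \<omega>) *\<^sub>R e j) sums W t \<omega>"
    using assms(3) unfolding wiener_process_def by blast
  have Wm: "W t \<in> borel_measurable M" if "0 \<le> t" for t using assms(3) that unfolding wiener_process_def by blast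
  have \<eta>m: "\<eta> \<in> borel_measurable M" using assms(5) unfolding finite_moments_def by blast
  obtain C where C: "\<And>x. norm (F x) \<le> C" using assms(7) unfolding bdd_above_def by blast
  have A: "A x \<bullet> x \<le> 0" if "x \<in> DA" for x
  proof -
    obtain \<epsilon> where "\<epsilon> > 0" "A x \<bullet> x \<le> - \<epsilon> * (norm x)\<^sup>2" using assms(9) \<open>x \<in> DA\<close> by blast
    moreover have "0 \<le> \<epsilon> * (norm x)\<^sup>2" using \<open>\<epsilon> > 0\<close> by simp
    ultimately show ?thesis by linarith
  qed
  have \<mu>: "cauchy_solution e q V S F {0..T} (distr M borel \<eta>) \<mu>"
    and unique: "\<And>\<mu>'. cauchy_solution e q V S F {0..T} (distr M borel \<eta>) \<mu>' \<Longrightarrow> \<forall>t\<in>{0..T}. \<mu>' t = \<mu> t"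
    using assms(11) unfolding unique_cauchy_solution_def by blast+
  have eV: "e i \<in> V" for i using \<mu> unfolding cauchy_solution_def by blast
  obtain Y where Xc: "\<And>\<omega>. \<omega> \<in> space M \<Longrightarrow> continuous_on {0..T} (\<lambda>t. X t \<omega>)"
    and Xa: "\<And>t. t \<in> {0..T} \<Longrightarrow> X t \<in> borel_measurable (filtration M \<eta> W t)"
    and Y: "V_version M (filtration M \<eta> W) V S T X Y"
    and Yi: "integrable (restrict_space lborel {0..T} \<Otimes>\<^sub>M M) (\<lambda>(t, \<omega>). (norm (Y t \<omega>))\<^sup>2 + (norm (S (Y t \<omega>)))\<^sup>2)"
    and eq: "AE \<omega> in M. \<forall>t\<in>{0..T}. \<forall>v\<in>V. set_integrable lborel {0..t} (\<lambda>s. drift S F (Y s \<omega>) v) \<and>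
           X t \<omega> \<bullet> v = \<eta> \<omega> \<bullet> v + W t \<omega> \<bullet> v + (LINT s:{0..t}|lborel. drift S F (Y s \<omega>) v)"
    using assms(12) unfolding variational_solution_def by blast
  define K where "K = enn2real (\<integral>\<^sup>+ \<omega>. (SUP t\<in>{0..T}. ennreal ((norm (X t \<omega>))\<^sup>2)) \<partial>M)"
  have K: "(\<integral>\<^sup>+\<omega>. ennreal ((norm (X t \<omega>))\<^sup>2) \<partial>M) \<le> ennreal K" if "t \<in> {0..T}" for t
  proof -
    have "(\<integral>\<^sup>+\<omega>. ennreal ((norm (X t \<omega>))\<^sup>2) \<partial>M) \<le> (\<integral>\<^sup>+ \<omega>. (SUP t\<in>{0..T}. ennreal ((norm (X t \<omega>))\<^sup>2)) \<partial>M)"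
      by (intro nn_integral_mono SUP_upper that)
    also have "\<dots> = ennreal K" using assms(13) unfolding K_def by (simp add: less_top)
    finally show ?thesis .
  qed
  interpret spde M e q W \<beta> \<eta> DA V A S F T C K X Y
  proof
    show "0 \<le> K" by (simp add: K_def)
  qed (fact cov \<beta> Wm \<eta>m assms C A eV Xc Xa Y eq K)+
  interpret spde_square_integrable M e q W \<beta> \<eta> DA V A S F T C K X Y
    by unfold_locales (rule S_size_second_moment_finite[OF Yi])
  \<comment> \<open>The given solution \<open>\<mu>\<close> enters twice: it makes the generator
    measurable, and by uniqueness on the same time interval it coincides with the law obtained
    here.\<close>
  have "cauchy_solution e q V S F {0..T} (distr M borel \<eta>) law"
    by (rule law_cauchy_solution) (rule cauchy_solution_generator_measurable[OF \<mu> T_pos])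
  note law_eq = unique[OF this]
  have law: "\<mu> t = distr M borel (X t)" if "t \<in> {0..T}" for t
    unfolding bspec[OF law_eq that, symmetric] XT_eq[OF that] ..
  show ?thesis
  proof (intro ballI allI impI)
    fix t a and R :: real assume t: "t \<in> {0<..T}" and R: "R > 0"
    then have t0: "t \<in> {0..T}" by simp
    have q1: "q j \<le> 1" for j using decseqD[OF cov(6), of 0 j] cov(5) by simp
    have m: "{\<omega> \<in> space M. X t \<omega> \<in> ellipsoid Q a R} \<in> events"
      using measurable_sets[OF X_measurable[OF t0] ellipsoid_borel[OF cov(1), of a R]] by (simp add: vimage_def Int_def conj_commute)
    have "0 < prob {\<omega> \<in> space M. norm (X t \<omega> - a) < R}"
      using t R by (intro ball_probability_positive) auto
    also have "\<dots> \<le> prob {\<omega> \<in> space M. X t \<omega> \<in> ellipsoid Q a R}"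
    proof (rule finite_measure_mono[OF _ m])
      show "{\<omega> \<in> space M. norm (X t \<omega> - a) < R} \<subseteq> {\<omega> \<in> space M. X t \<omega> \<in> ellipsoid Q a R}"
        unfolding ellipsoid_def using order_trans[OF Q_norm_le[OF cov(1,4) q1] less_imp_le] by blast
    qed
    finally have p: "0 < prob {\<omega> \<in> space M. X t \<omega> \<in> ellipsoid Q a R}" .
    moreover have "measure (\<mu> t) (ellipsoid Q a R) = prob {\<omega> \<in> space M. X t \<omega> \<in> ellipsoid Q a R}"
      unfolding law[OF t0] measure_distr[OF X_measurable[OF t0] ellipsoid_borel[OF cov(1)]]
      by (rule arg_cong[where f = prob]) auto
    ultimately show "measure (\<mu> t) (ellipsoid Q a R) > 0 \<and> measure M {\<omega> \<in> space M. X t \<omega> \<in> ellipsoid Q a R} > 0" by simp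
  qed
qed

end
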